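(* Let $T$ be a hereditarily G-compact theory with monster model $\mathfrak C$, let $A\subseteq\mathfrak C$ be a small set, and let $G$ be a group definable in $\mathfrak C$ over $A$. Then $G^{00}_A=G^{000}_A$. In particular, if $T$ has NIP, then $G^{00}=G^{000}$.
   Context: Theories are complete first-order theories; structures may be many-sorted (possibly with infinitely many sorts). An interpreted structure $N$ may be many-sorted: each of its sorts is a definable set modulo a definable equivalence relation, and its basic relations and functions are definable in the interpreting structure, where parameters are allowed. Lascar distance: let $\mathfrak C$ be a monster model of a theory. For small (possibly infinite) tuples $a,b\in\mathfrak C$ write $d_L(a,b)\le n$ if there are tuples $a=a_0,a_1,\dots,a_n=b$ and small $M_1,\dots,M_n\preceq\mathfrak C$ such that $\operatorname{tp}(a_{i-1}/M_i)=\operatorname{tp}(a_i/M_i)$ for $i=1,\dots,n$. $d_L(a,b)$ is the least such $n$, or $\infty$ if there is none. A theory is G-compact if for every tuple $a$ there is an integer $n$ such that for all $b$, $d_L(a,b)<\infty$ implies $d_L(a,b)\le n$. A theory $T$ is hereditarily G-compact if for every model $M\models T$ and every structure $N$ interpreted by $M$ (with parameters), $\operatorname{Th}(N)$ is G-compact. Connected components: for $G$ definable over a small set $A$, identified with $G(\mathfrak C)$, $G^{000}_A$ is the smallest subgroup of $G$ which is invariant under $\operatorname{Aut}(\mathfrak C/A)$ and has small index in $G$ (i.e. index at most $2^{|T|+|A|}$); $G^{00}_A$ is the smallest subgroup of $G$ which is type-definable with parameters in $A$ and has small index. If $G^{000}_A$ (respectively $G^{00}_A$) does not depend on the choice of the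 small set $A$ over which $G$ is definable, it is denoted by $G^{000}$ (respectively $G^{00}$) and is said to exist. It is known that if $T$ has NIP, then $G^{00}$ and $G^{000}$ exist. *)

theory Defs
  imports "HOL-Algebra.Coset" "HOL-Library.Extended_Nat"
begin

unbundle cardinal_syntax

section \<open>Many-sorted first-order logic\<close>

record ('s, 'f, 'r) signature =
  Sorts :: "'s set"
  Funs :: "'f set"
  Rels :: "'r set"
  fun_dom :: "'f \<Rightarrow> 's list"
  fun_cod :: "'f \<Rightarrow> 's"
  rel_dom :: "'r \<Rightarrow> 's list"

definition wf_sig :: "('s, 'f, 'r) signature \<Rightarrow> bool" where
  "wf_sig L \<longleftrightarrow>
     (\<forall>f\<in>Funs L. set (fun_dom L f) \<subseteq> Sorts L \<and> fun_cod L f \<in> Sorts L) \<and>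
     (\<forall>r\<in>Rels L. set (rel_dom L r) \<subseteq> Sorts L)"

text \<open>The variable \<open>(n, s)\<close> is the \<open>n\<close>-th variable of sort \<open>s\<close>.\<close>

type_synonym 's var = "nat \<times> 's"

datatype ('s, 'f) tm = Var "'s var" | App 'f "('s, 'f) tm list"

datatype ('s, 'f, 'r) fm =
    Bot
  | Eq "('s, 'f) tm" "('s, 'f) tm"
  | Rel 'r "('s, 'f) tm list"
  | Imp "('s, 'f, 'r) fm" "('s, 'f, 'r) fm"
  | All "'s var" "('s, 'f, 'r) fm"

abbreviation Neg :: "('s, 'f, 'r) fm \<Rightarrow> ('s, 'f, 'r) fm" where
  "Neg \<phi> \<equiv> Imp \<phi> Bot"

fun tm_sort :: "('s, 'f, 'r) signature \<Rightarrow> ('s, 'f) tm \<Rightarrow> 's" where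
  "tm_sort L (Var v) = snd v"
| "tm_sort L (App f ts) = fun_cod L f"

fun wf_tm :: "('s, 'f, 'r) signature \<Rightarrow> ('s, 'f) tm \<Rightarrow> bool" where
  "wf_tm L (Var v) \<longleftrightarrow> snd v \<in> Sorts L"
| "wf_tm L (App f ts) \<longleftrightarrow>
     f \<in> Funs L \<and> map (tm_sort L) ts = fun_dom L f \<and> (\<forall>t\<in>set ts. wf_tm L t)"

primrec wf_fm :: "('s, 'f, 'r) signature \<Rightarrow> ('s, 'f, 'r) fm \<Rightarrow> bool" where
  "wf_fm L Bot \<longleftrightarrow> True"
| "wf_fm L (Eq t u) \<longleftrightarrow> wf_tm L t \<and> wf_tm L u \<and> tm_sort L t = tm_sort L u"
| "wf_fm L (Rel r ts) \<longleftrightarrow>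
     r \<in> Rels L \<and> map (tm_sort L) ts = rel_dom L r \<and> (\<forall>t\<in>set ts. wf_tm L t)"
| "wf_fm L (Imp \<phi> \<psi>) \<longleftrightarrow> wf_fm L \<phi> \<and> wf_fm L \<psi>"
| "wf_fm L (All v \<phi>) \<longleftrightarrow> snd v \<in> Sorts L \<and> wf_fm L \<phi>"

fun fv_tm :: "('s, 'f) tm \<Rightarrow> 's var set" where
  "fv_tm (Var v) = {v}"
| "fv_tm (App f ts) = (\<Union>t\<in>set ts. fv_tm t)"

primrec fv :: "('s, 'f, 'r) fm \<Rightarrow> 's var set" where
  "fv Bot = {}"
| "fv (Eq t u) = fv_tm t \<union> fv_tm u"
| "fv (Rel r ts) = (\<Union>t\<in>set ts. fv_tm t)"
| "fv (Imp \<phi> \<psi>) = fv \<phi> \<union> fv \<psi>"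
| "fv (All v \<phi>) = fv \<phi> - {v}"

definition formulas :: "('s, 'f, 'r) signature \<Rightarrow> ('s, 'f, 'r) fm set" where
  "formulas L = {\<phi>. wf_fm L \<phi>}"

definition sentences :: "('s, 'f, 'r) signature \<Rightarrow> ('s, 'f, 'r) fm set" where
  "sentences L = {\<phi> \<in> formulas L. fv \<phi> = {}}"

text \<open>Every element carries its sort, so different sorts are disjoint and a set of parameters
  is a plain set of elements. All sorts are nonempty.\<close>

record ('s, 'f, 'r, 'a) struct =
  univ :: "'a set"
  srt :: "'a \<Rightarrow> 's"
  fn :: "'f \<Rightarrow> 'a list \<Rightarrow> 'a"
  rl :: "'r \<Rightarrow> 'a list \<Rightarrow> bool"

definition elts :: "('s, 'f, 'r, 'a) struct \<Rightarrow> 's \<Rightarrow> 'a set" where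
  "elts M s = {x \<in> univ M. srt M x = s}"

definition tuples :: "('s, 'f, 'r, 'a) struct \<Rightarrow> 's list \<Rightarrow> 'a list set" where
  "tuples M ss = {xs. set xs \<subseteq> univ M \<and> map (srt M) xs = ss}"

definition is_struct :: "('s, 'f, 'r) signature \<Rightarrow> ('s, 'f, 'r, 'a) struct \<Rightarrow> bool" where
  "is_struct L M \<longleftrightarrow>
     srt M ` univ M = Sorts L \<and>
     (\<forall>f\<in>Funs L. \<forall>xs\<in>tuples M (fun_dom L f). fn M f xs \<in> elts M (fun_cod L f))"

fun val :: "('s, 'f, 'r, 'a) struct \<Rightarrow> ('s var \<Rightarrow> 'a) \<Rightarrow> ('s, 'f) tm \<Rightarrow> 'a" where
  "val M e (Var v) = e v"
| "val M e (App f ts) = fn M f (map (val M e) ts)"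

primrec sat :: "('s, 'f, 'r, 'a) struct \<Rightarrow> ('s var \<Rightarrow> 'a) \<Rightarrow> ('s, 'f, 'r) fm \<Rightarrow> bool" where
  "sat M e Bot \<longleftrightarrow> False"
| "sat M e (Eq t u) \<longleftrightarrow> val M e t = val M e u"
| "sat M e (Rel r ts) \<longleftrightarrow> rl M r (map (val M e) ts)"
| "sat M e (Imp \<phi> \<psi>) \<longleftrightarrow> (sat M e \<phi> \<longrightarrow> sat M e \<psi>)"
| "sat M e (All v \<phi>) \<longleftrightarrow> (\<forall>x\<in>elts M (snd v). sat M (e(v := x)) \<phi>)"

definition Th :: "('s, 'f, 'r) signature \<Rightarrow> ('s, 'f, 'r, 'a) struct \<Rightarrow> ('s, 'f, 'r) fm set" where
  "Th L M = {\<phi> \<in> sentences L. \<forall>e. sat M e \<phi>}"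

text \<open>Theories are deductively closed sets of sentences. Consistency is not part of this
  definition: it comes from the existence of a model.\<close>

definition complete_theory :: "('s, 'f, 'r) signature \<Rightarrow> ('s, 'f, 'r) fm set \<Rightarrow> bool" where
  "complete_theory L T \<longleftrightarrow>
     T \<subseteq> sentences L \<and> (\<forall>\<phi>\<in>sentences L. \<phi> \<in> T \<longleftrightarrow> Neg \<phi> \<notin> T)"

definition is_model ::
  "('s, 'f, 'r) signature \<Rightarrow> ('s, 'f, 'r) fm set \<Rightarrow> ('s, 'f, 'r, 'a) struct \<Rightarrow> bool" where
  "is_model L T M \<longleftrightarrow> is_struct L M \<and> T \<subseteq> Th L M"

definition elem_sub ::
  "('s, 'f, 'r) signature \<Rightarrow> 'a set \<Rightarrow> ('s, 'f, 'r, 'a) struct \<Rightarrow> bool" where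
  "elem_sub L B M \<longleftrightarrow>
     B \<subseteq> univ M \<and> is_struct L (M\<lparr>univ := B\<rparr>) \<and>
     (\<forall>\<phi>\<in>formulas L. \<forall>e. (\<forall>v\<in>fv \<phi>. e v \<in> elts (M\<lparr>univ := B\<rparr>) (snd v)) \<longrightarrow>
        (sat (M\<lparr>univ := B\<rparr>) e \<phi> \<longleftrightarrow> sat M e \<phi>))"

section \<open>Formulas with parameters, definable sets and types\<close>

text \<open>A formula over \<open>B\<close> in the free variables \<open>(x\<^sub>i)\<close>, \<open>i \<in> I\<close>, with \<open>x\<^sub>i\<close> of sort \<open>ss i\<close>,
  is given as a formula \<open>\<phi>\<close> together with a map \<open>\<rho>\<close> replacing each free variable of \<open>\<phi>\<close> either
  by some \<open>x\<^sub>i\<close> (\<open>Inl i\<close>) or by a parameter from \<open>B\<close> (\<open>Inr b\<close>), respecting sorts.\<close>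

type_synonym ('s, 'f, 'r, 'a, 'i) pfm = "('s, 'f, 'r) fm \<times> ('s var \<Rightarrow> 'i + 'a)"

definition pformulas ::
  "('s, 'f, 'r) signature \<Rightarrow> ('s, 'f, 'r, 'a) struct \<Rightarrow> 'i set \<Rightarrow> ('i \<Rightarrow> 's) \<Rightarrow> 'a set
   \<Rightarrow> ('s, 'f, 'r, 'a, 'i) pfm set" where
  "pformulas L M I ss B =
     {(\<phi>, \<rho>). \<phi> \<in> formulas L \<and>
        (\<forall>v\<in>fv \<phi>. case \<rho> v of Inl i \<Rightarrow> i \<in> I \<and> ss i = snd v | Inr b \<Rightarrow> b \<in> B \<and> srt M b = snd v)}"

definition psat ::
  "('s, 'f, 'r, 'a) struct \<Rightarrow> ('i \<Rightarrow> 'a) \<Rightarrow> ('s, 'f, 'r, 'a, 'i) pfm \<Rightarrow> bool" where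
  "psat M a p = (case p of (\<phi>, \<rho>) \<Rightarrow> sat M (\<lambda>v. case \<rho> v of Inl i \<Rightarrow> a i | Inr b \<Rightarrow> b) \<phi>)"

text \<open>\<open>tp L M I a B\<close> is the complete type over \<open>B\<close> of the tuple \<open>(a i)\<close>, \<open>i \<in> I\<close>.\<close>

definition tp ::
  "('s, 'f, 'r) signature \<Rightarrow> ('s, 'f, 'r, 'a) struct \<Rightarrow> 'i set \<Rightarrow> ('i \<Rightarrow> 'a) \<Rightarrow> 'a set
   \<Rightarrow> ('s, 'f, 'r, 'a, 'i) pfm set" where
  "tp L M I a B = {p \<in> pformulas L M I (\<lambda>i. srt M (a i)) B. psat M a p}"

definition type_definable ::
  "('s, 'f, 'r) signature \<Rightarrow> ('s, 'f, 'r, 'a) struct \<Rightarrow> 'a set \<Rightarrow> 's list \<Rightarrow> 'a list set \<Rightarrow> bool"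
  where
  "type_definable L M B ss D \<longleftrightarrow>
     (\<exists>\<Sigma> \<subseteq> pformulas L M {..<length ss} ((!) ss) B.
        D = {xs \<in> tuples M ss. \<forall>p\<in>\<Sigma>. psat M ((!) xs) p})"

definition definable ::
  "('s, 'f, 'r) signature \<Rightarrow> ('s, 'f, 'r, 'a) struct \<Rightarrow> 'a set \<Rightarrow> 's list \<Rightarrow> 'a list set \<Rightarrow> bool"
  where
  "definable L M B ss D \<longleftrightarrow>
     (\<exists>p \<in> pformulas L M {..<length ss} ((!) ss) B. D = {xs \<in> tuples M ss. psat M ((!) xs) p})"

section \<open>Monster models\<close>

definition auts ::
  "('s, 'f, 'r) signature \<Rightarrow> ('s, 'f, 'r, 'a) struct \<Rightarrow> 'a set \<Rightarrow> ('a \<Rightarrow> 'a) set" where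
  "auts L M A =
     {g. bij_betw g (univ M) (univ M) \<and> (\<forall>x\<in>univ M. srt M (g x) = srt M x) \<and>
         (\<forall>f\<in>Funs L. \<forall>xs\<in>tuples M (fun_dom L f). g (fn M f xs) = fn M f (map g xs)) \<and>
         (\<forall>r\<in>Rels L. \<forall>xs\<in>tuples M (rel_dom L r). rl M r (map g xs) \<longleftrightarrow> rl M r xs) \<and>
         (\<forall>a\<in>A. g a = a)}"

definition saturated ::
  "('s, 'f, 'r) signature \<Rightarrow> 'k rel \<Rightarrow> ('s, 'f, 'r, 'a) struct \<Rightarrow> bool" where
  "saturated L \<kappa> M \<longleftrightarrow>
     (\<forall>B \<subseteq> univ M. |B| <o \<kappa> \<longrightarrow>
        (\<forall>s\<in>Sorts L. \<forall>\<Sigma> \<subseteq> pformulas L M (UNIV :: unit set) (\<lambda>_. s) B.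
           (\<forall>\<Sigma>' \<subseteq> \<Sigma>. finite \<Sigma>' \<longrightarrow> (\<exists>x\<in>elts M s. \<forall>p\<in>\<Sigma>'. psat M (\<lambda>_. x) p)) \<longrightarrow>
           (\<exists>x\<in>elts M s. \<forall>p\<in>\<Sigma>. psat M (\<lambda>_. x) p)))"

text \<open>The equality of types says that \<open>f\<close> is an elementary map on \<open>B\<close>.\<close>

definition strongly_homogeneous ::
  "('s, 'f, 'r) signature \<Rightarrow> 'k rel \<Rightarrow> ('s, 'f, 'r, 'a) struct \<Rightarrow> bool" where
  "strongly_homogeneous L \<kappa> M \<longleftrightarrow>
     (\<forall>B \<subseteq> univ M. |B| <o \<kappa> \<longrightarrow>
        (\<forall>f. f ` B \<subseteq> univ M \<and> tp L M B f {} = tp L M B (\<lambda>b. b) {} \<longrightarrow>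
           (\<exists>g\<in>auts L M {}. \<forall>b\<in>B. g b = f b)))"

text \<open>As usual \<open>|T|\<close> is the number of formulas, and the bound \<open>2\<close> to the \<open>|T| + |B|\<close> is the one
  in the definition of the connected components. When \<open>\<kappa>\<close> is a strong limit above \<open>|T|\<close>, as is
  often required of a monster model, \<open>small\<close> means cardinality less than \<open>\<kappa>\<close>. Strong limits
  are not required, since no uncountable one provably exists in HOL.\<close>

abbreviation small_bound :: "('s, 'f, 'r) signature \<Rightarrow> 'b set \<Rightarrow> (('s, 'f, 'r) fm + 'b \<Rightarrow> bool) rel"
  where "small_bound L B \<equiv> ctwo ^c ( |formulas L| +c |B| )"

definition small :: "('s, 'f, 'r) signature \<Rightarrow> 'k rel \<Rightarrow> 'b set \<Rightarrow> bool" where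
  "small L \<kappa> B \<longleftrightarrow> small_bound L B <o \<kappa>"

definition monster ::
  "('s, 'f, 'r) signature \<Rightarrow> ('s, 'f, 'r) fm set \<Rightarrow> 'k rel \<Rightarrow> ('s, 'f, 'r, 'a) struct \<Rightarrow> bool" where
  "monster L T \<kappa> C \<longleftrightarrow>
     Card_order \<kappa> \<and> ctwo ^c |formulas L| <o \<kappa> \<and>
     is_model L T C \<and> saturated L \<kappa> C \<and> strongly_homogeneous L \<kappa> C"

section \<open>Lascar distance and G-compactness\<close>

definition lascar_le ::
  "('s, 'f, 'r) signature \<Rightarrow> 'k rel \<Rightarrow> ('s, 'f, 'r, 'a) struct \<Rightarrow> 'i set
   \<Rightarrow> ('i \<Rightarrow> 'a) \<Rightarrow> ('i \<Rightarrow> 'a) \<Rightarrow> nat \<Rightarrow> bool" where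
  "lascar_le L \<kappa> C I a b n \<longleftrightarrow>
     (\<exists>c :: nat \<Rightarrow> 'i \<Rightarrow> 'a. \<exists>M :: nat \<Rightarrow> 'a set.
        (\<forall>j\<le>n. c j ` I \<subseteq> univ C) \<and> (\<forall>i\<in>I. c 0 i = a i) \<and> (\<forall>i\<in>I. c n i = b i) \<and>
        (\<forall>j\<in>{1..n}. small L \<kappa> (M j) \<and> elem_sub L (M j) C \<and>
           tp L C I (c (j - 1)) (M j) = tp L C I (c j) (M j)))"

definition lascar_dist ::
  "('s, 'f, 'r) signature \<Rightarrow> 'k rel \<Rightarrow> ('s, 'f, 'r, 'a) struct \<Rightarrow> 'i set
   \<Rightarrow> ('i \<Rightarrow> 'a) \<Rightarrow> ('i \<Rightarrow> 'a) \<Rightarrow> enat" where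
  "lascar_dist L \<kappa> C I a b = (INF n \<in> {n. lascar_le L \<kappa> C I a b n}. enat n)"

text \<open>HOL does not allow quantification over types, so the type \<open>'a\<close> serves as the universe in which
  the monster models, their saturation cardinals and the index sets of tuples are taken.\<close>

definition G_compact ::
  "'a itself \<Rightarrow> ('s, 'f, 'r) signature \<Rightarrow> ('s, 'f, 'r) fm set \<Rightarrow> bool" where
  "G_compact _ L T \<longleftrightarrow>
     (\<forall>(\<kappa> :: 'a rel) (C :: ('s, 'f, 'r, 'a) struct). monster L T \<kappa> C \<longrightarrow>
        (\<forall>(I :: 'a set) a. small L \<kappa> I \<and> a ` I \<subseteq> univ C \<longrightarrow>
           (\<exists>n :: nat. \<forall>b. b ` I \<subseteq> univ C \<and> lascar_dist L \<kappa> C I a b < \<infinity> \<longrightarrow>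
              lascar_dist L \<kappa> C I a b \<le> enat n)))"

text \<open>The sort \<open>t\<close> of \<open>N\<close> is identified, via \<open>h t\<close>, with the quotient of the definable set
  \<open>D t \<subseteq> tuples M (ar t)\<close> by the definable equivalence relation \<open>E t\<close>. Definability is with
  arbitrary parameters from \<open>M\<close>.\<close>

definition interprets ::
  "('s, 'f, 'r) signature \<Rightarrow> ('s, 'f, 'r, 'a) struct
   \<Rightarrow> ('t, 'g, 'q) signature \<Rightarrow> ('t, 'g, 'q, 'b) struct \<Rightarrow> bool" where
  "interprets L M L' N \<longleftrightarrow>
     (\<exists>(ar :: 't \<Rightarrow> 's list) (D :: 't \<Rightarrow> 'a list set) (E :: 't \<Rightarrow> 'a list rel)
       (h :: 't \<Rightarrow> 'a list set \<Rightarrow> 'b).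
        let q = \<lambda>t d. h t (E t `` {d}); def = definable L M (univ M) in
        (\<forall>t\<in>Sorts L'.
           set (ar t) \<subseteq> Sorts L \<and> def (ar t) (D t) \<and>
           equiv (D t) (E t) \<and> def (ar t @ ar t) {xs @ ys | xs ys. (xs, ys) \<in> E t} \<and>
           bij_betw (h t) (D t // E t) (elts N t)) \<and>
        (\<forall>r\<in>Rels L'. let ts = rel_dom L' r in
           def (concat (map ar ts))
             {concat ds | ds. ds \<in> listset (map D ts) \<and> rl N r (map2 q ts ds)}) \<and>
        (\<forall>f\<in>Funs L'. let ts = fun_dom L' f; t = fun_cod L' f in
           def (concat (map ar ts) @ ar t)
             {concat ds @ d | ds d. ds \<in> listset (map D ts) \<and> d \<in> D t \<and>
                fn N f (map2 q ts ds) = q t d}))"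

text \<open>Again the models \<open>M\<close> of \<open>T\<close>, the interpreted structures \<open>N\<close> and their languages are taken
  in the universe \<open>'a\<close>.\<close>

definition hereditarily_G_compact ::
  "'a itself \<Rightarrow> ('s, 'f, 'r) signature \<Rightarrow> ('s, 'f, 'r) fm set \<Rightarrow> bool" where
  "hereditarily_G_compact _ L T \<longleftrightarrow>
     (\<forall>(M :: ('s, 'f, 'r, 'a) struct) (L' :: ('a, 'a, 'a) signature) (N :: ('a, 'a, 'a, 'a) struct).
        is_model L T M \<and> wf_sig L' \<and> is_struct L' N \<and> interprets L M L' N \<longrightarrow>
        G_compact TYPE('a) L' (Th L' N))"

section \<open>NIP\<close>

text \<open>\<open>X\<close> is the set of object variables of the partitioned formula \<open>\<phi>\<close>; the remaining
  variables are its parameter variables.\<close>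

definition has_IP ::
  "('s, 'f, 'r) signature \<Rightarrow> ('s, 'f, 'r, 'a) struct \<Rightarrow> ('s, 'f, 'r) fm \<Rightarrow> 's var set \<Rightarrow> bool" where
  "has_IP L M \<phi> X \<longleftrightarrow>
     (\<exists>(a :: nat \<Rightarrow> 's var \<Rightarrow> 'a) (b :: nat set \<Rightarrow> 's var \<Rightarrow> 'a).
        (\<forall>i. \<forall>v\<in>fv \<phi> \<inter> X. a i v \<in> elts M (snd v)) \<and>
        (\<forall>S. \<forall>v\<in>fv \<phi> - X. b S v \<in> elts M (snd v)) \<and>
        (\<forall>i S. sat M (\<lambda>v. if v \<in> X then a i v else b S v) \<phi> \<longleftrightarrow> i \<in> S))"

definition NIP ::
  "'a itself \<Rightarrow> ('s, 'f, 'r) signature \<Rightarrow> ('s, 'f, 'r) fm set \<Rightarrow> bool" where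
  "NIP _ L T \<longleftrightarrow>
     (\<forall>M :: ('s, 'f, 'r, 'a) struct. is_model L T M \<longrightarrow>
        (\<forall>\<phi>\<in>formulas L. \<forall>X. \<not> has_IP L M \<phi> X))"

section \<open>Definable groups and connected components\<close>

definition definable_group ::
  "('s, 'f, 'r) signature \<Rightarrow> ('s, 'f, 'r, 'a) struct \<Rightarrow> 'a set \<Rightarrow> 's list \<Rightarrow> 'a list monoid \<Rightarrow> bool"
  where
  "definable_group L C A ss G \<longleftrightarrow>
     group G \<and> definable L C A ss (carrier G) \<and>
     definable L C A (ss @ ss @ ss)
       {x @ y @ (x \<otimes>\<^bsub>G\<^esub> y) | x y. x \<in> carrier G \<and> y \<in> carrier G}"

definition small_index ::
  "('s, 'f, 'r) signature \<Rightarrow> 'a set \<Rightarrow> 'a list monoid \<Rightarrow> 'a list set \<Rightarrow> bool" where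
  "small_index L A G H \<longleftrightarrow> |rcosets\<^bsub>G\<^esub> H| \<le>o small_bound L A"

definition invariant ::
  "('s, 'f, 'r) signature \<Rightarrow> ('s, 'f, 'r, 'a) struct \<Rightarrow> 'a set \<Rightarrow> 'a list set \<Rightarrow> bool" where
  "invariant L C A H \<longleftrightarrow> (\<forall>g\<in>auts L C A. map g ` H = H)"

definition is_least :: "'b set \<Rightarrow> ('b set \<Rightarrow> bool) \<Rightarrow> bool" where
  "is_least H P \<longleftrightarrow> P H \<and> (\<forall>K. P K \<longrightarrow> H \<subseteq> K)"

text \<open>\<open>is_G000_over L C A G H\<close> and \<open>is_G00_over L C A ss G H\<close> say that \<open>H\<close> is the component of
  \<open>G\<close> over \<open>A\<close>; \<open>is_G000\<close> and \<open>is_G00\<close> say that the component exists, independently of the small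
  set over which \<open>G\<close> is definable, and is \<open>H\<close>.\<close>

definition is_G000_over ::
  "('s, 'f, 'r) signature \<Rightarrow> ('s, 'f, 'r, 'a) struct \<Rightarrow> 'a set \<Rightarrow> 'a list monoid
   \<Rightarrow> 'a list set \<Rightarrow> bool" where
  "is_G000_over L C A G H \<longleftrightarrow>
     is_least H (\<lambda>K. subgroup K G \<and> invariant L C A K \<and> small_index L A G K)"

definition is_G00_over ::
  "('s, 'f, 'r) signature \<Rightarrow> ('s, 'f, 'r, 'a) struct \<Rightarrow> 'a set \<Rightarrow> 's list \<Rightarrow> 'a list monoid
   \<Rightarrow> 'a list set \<Rightarrow> bool" where
  "is_G00_over L C A ss G H \<longleftrightarrow>
     is_least H (\<lambda>K. subgroup K G \<and> type_definable L C A ss K \<and> small_index L A G K)"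

definition is_G000 ::
  "('s, 'f, 'r) signature \<Rightarrow> 'k rel \<Rightarrow> ('s, 'f, 'r, 'a) struct \<Rightarrow> 's list \<Rightarrow> 'a list monoid
   \<Rightarrow> 'a list set \<Rightarrow> bool" where
  "is_G000 L \<kappa> C ss G H \<longleftrightarrow>
     (\<forall>B \<subseteq> univ C. small L \<kappa> B \<and> definable_group L C B ss G \<longrightarrow> is_G000_over L C B G H)"

definition is_G00 ::
  "('s, 'f, 'r) signature \<Rightarrow> 'k rel \<Rightarrow> ('s, 'f, 'r, 'a) struct \<Rightarrow> 's list \<Rightarrow> 'a list monoid
   \<Rightarrow> 'a list set \<Rightarrow> bool" where
  "is_G00 L \<kappa> C ss G H \<longleftrightarrow>
     (\<forall>B \<subseteq> univ C. small L \<kappa> B \<and> definable_group L C B ss G \<longrightarrow> is_G00_over L C B ss G H)"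

end

theory Submission
  imports Defs "HOL-Library.Ramsey"
begin

text \<open>Forget the unit of \<open>G\<close> and keep only the \<open>A\<close>-definable relations that are invariant under left
  translations. This torsor is interpreted by the monster model, so its theory is G-compact. Left
  translations are automorphisms of it, and hence the elements at finite Lascar distance from \<open>1\<close>
  form a subgroup. Call an \<open>A\<close>-definable set \<open>D\<close> thick if every sufficiently long sequence in \<open>G\<close> has
  \<open>i < j\<close> with \<open>x\<^sub>i\<inverse> x\<^sub>j \<in> D\<close>. Equality of types over a model puts \<open>x\<inverse> y\<close> into \<open>D\<inverse> D\<close> for all thick \<open>D\<close>,
  because a maximal sequence avoiding \<open>D\<close> can be found inside the model. Conversely every invariant
  subgroup of small index contains the intersection of the thick sets. A uniform bound \<open>n\<close> on the
  Lascar distance therefore places the subgroup between the group generated by this intersection and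
  the intersection of the sets \<open>(D\<inverse> D)\<^sup>n\<close>, and by compactness the three coincide: the smallest
  invariant subgroup of small index is type-definable.

  Under NIP, suppose that a type-definable subgroup \<open>K\<close> of small index, over a larger set of
  parameters, misses a point \<open>g\<close> of the intersection of the \<open>A\<close>-definable thick sets. Then there is an
  infinite sequence whose quotients \<open>x\<^sub>i\<inverse> x\<^sub>j\<close>, \<open>i < j\<close>, are conjugate to \<open>g\<close> over \<open>A\<close>. By Ramsey's
  theorem a subsequence of these quotients lies in the conjugates of a small definable neighbourhood
  of \<open>K\<close>, except each in its own, and finite products of them shatter these conjugates.\<close>

section \<open>Cardinalities of lists\<close>

text \<open>The unit is forgotten because a named unit would be definable, and a definable point is
  alone in its Lascar class. In the torsor no point is distinguished, and every elementary map on a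
  small set is a left translation composed with an automorphism over \<open>A\<close>; homogeneity
  of the torsor rests on this. Thick sets are the bridge between models and subgroups: they mention
  no submodel, and Ramsey's theorem makes them closed under intersection. They need not be
  symmetric, and quotients follow the order of the sequence, which is why one Lascar step leads into
  D^-1 D and not into D. Cardinals have to be watched, since \<open>\<kappa>\<close> need not be a
  strong limit. The torsor may have at most |L| + |A| formulas, and its types over a small model
  then number at most 2^(|L| + |A|), exactly the bound in \<open>small_index\<close>. Under NIP the
  obstacle is that automorphisms over \<open>A\<close> may move \<open>K\<close>, and that
  \<open>G\<close> is not commutative: products are ordered, and the one bad factor is isolated as
  u^-1 w v^-1, which costs two extra roots of a neighbourhood.\<close>

lemma card_of_lists_length_le:
  assumes "Cinfinite r" and "|A| \<le>o r"
  shows "|{xs. set xs \<subseteq> A \<and> length xs = n}| \<le>o r"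
proof (induction n)
  case 0
  have "{xs. set xs \<subseteq> A \<and> length xs = 0} = {[]}" by auto
  moreover have "|{[]}| \<le>o r"
    using assms(1) by (intro ordLess_imp_ordLeq finite_ordLess_infinite)
      (auto simp: cinfinite_def card_of_well_order_on card_order_on_well_order_on Field_card_of)
  ultimately show ?case by simp
next
  case (Suc n)
  have "{xs. set xs \<subseteq> A \<and> length xs = Suc n}
      = (\<lambda>(x, xs). x # xs) ` (A \<times> {xs. set xs \<subseteq> A \<and> length xs = n})"
    by (auto simp: length_Suc_conv image_iff)
  moreover have "|A \<times> {xs. set xs \<subseteq> A \<and> length xs = n}| \<le>o r"
    using assms Suc by (intro card_of_Times_ordLeq_infinite_Field) (auto simp: cinfinite_def)
  ultimately show ?case
    by (metis (no_types, lifting) card_of_image ordLeq_transitive)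
qed

lemma card_of_lists_le:
  assumes "Cinfinite r" and "|A| \<le>o r"
  shows "|lists A| \<le>o r"
proof -
  have "|UNIV :: nat set| \<le>o r"
    using assms(1) by (meson card_of_nat natLeq_ordLeq_cinfinite ordIso_ordLeq_trans)
  then have "|\<Union>n. {xs. set xs \<subseteq> A \<and> length xs = n}| \<le>o r"
    by (rule UNION_Cinfinite_bound[OF _ _ assms(1)]) (simp add: card_of_lists_length_le[OF assms])
  moreover have "lists A = (\<Union>n. {xs. set xs \<subseteq> A \<and> length xs = n})" by auto
  ultimately show ?thesis by simp
qed

lemma card_of_le_trans_image:
  assumes "A \<subseteq> f ` B" and "|B| \<le>o r"
  shows "|A| \<le>o r"
  by (meson assms card_of_image card_of_mono1 ordLeq_transitive)

section \<open>Renaming of variables\<close>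

lemma finite_fv_tm [simp]: "finite (fv_tm t)"
  by (induction t) auto

lemma finite_fv [simp]: "finite (fv \<phi>)"
  by (induction \<phi>) auto

lemma val_cong: "(\<And>v. v \<in> fv_tm t \<Longrightarrow> e v = e' v) \<Longrightarrow> val M e t = val M e' t"
proof (induction t)
  case (App f ts)
  then have "map (val M e) ts = map (val M e') ts" by (auto intro!: App.IH)
  then show ?case by (simp only: val.simps)
qed simp

lemma sat_cong: "(\<And>v. v \<in> fv \<phi> \<Longrightarrow> e v = e' v) \<Longrightarrow> sat M e \<phi> \<longleftrightarrow> sat M e' \<phi>"
proof (induction \<phi> arbitrary: e e')
  case (Eq t u)
  then show ?case using val_cong[of t e e' M] val_cong[of u e e' M] by auto
next
  case (Rel r ts)
  then have "map (val M e) ts = map (val M e') ts" by (auto intro!: val_cong)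
  then show ?case by (simp only: sat.simps)
next
  case (Imp \<phi> \<psi>)
  have "sat M e \<phi> \<longleftrightarrow> sat M e' \<phi>" "sat M e \<psi> \<longleftrightarrow> sat M e' \<psi>"
    using Imp.prems by (auto intro!: Imp.IH)
  then show ?case by simp
next
  case (All v \<phi>)
  have "sat M (e(v := x)) \<phi> \<longleftrightarrow> sat M (e'(v := x)) \<phi>" for x
    using All.prems by (intro All.IH) auto
  then show ?case by simp
qed simp

fun ren_tm :: "('s var \<Rightarrow> 's var) \<Rightarrow> ('s, 'f) tm \<Rightarrow> ('s, 'f) tm" where
  "ren_tm f (Var v) = Var (f v)"
| "ren_tm f (App g ts) = App g (map (ren_tm f) ts)"

text \<open>Exceeds the indices of the images of all free variables of the body, the bound one
  included, so one index serves for every sort.\<close>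

definition fresh :: "('s var \<Rightarrow> 's var) \<Rightarrow> ('s, 'f, 'r) fm \<Rightarrow> nat" where
  "fresh f \<phi> = Suc (Max (insert 0 (fst ` f ` fv \<phi>)))"

lemma fresh: "v \<in> fv \<phi> \<Longrightarrow> f v \<noteq> (fresh f \<phi>, s)"
proof
  assume v: "v \<in> fv \<phi>" and "f v = (fresh f \<phi>, s)"
  then have "fst (f v) = fresh f \<phi>" by simp
  moreover have "fst (f v) \<le> Max (insert 0 (fst ` f ` fv \<phi>))"
    using v by (intro Max_ge) auto
  ultimately show False by (simp add: fresh_def)
qed

text \<open>\<open>f\<close> need not be injective: binders are renamed to a fresh index of the same
  sort, so no image of a free variable is captured.\<close>

fun ren :: "('s var \<Rightarrow> 's var) \<Rightarrow> ('s, 'f, 'r) fm \<Rightarrow> ('s, 'f, 'r) fm" where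
  "ren f Bot = Bot"
| "ren f (Eq t u) = Eq (ren_tm f t) (ren_tm f u)"
| "ren f (Rel r ts) = Rel r (map (ren_tm f) ts)"
| "ren f (Imp \<phi> \<psi>) = Imp (ren f \<phi>) (ren f \<psi>)"
| "ren f (All v \<phi>) = All (fresh f \<phi>, snd v) (ren (f(v := (fresh f \<phi>, snd v))) \<phi>)"

lemma val_ren_tm: "val M e (ren_tm f t) = val M (\<lambda>v. e (f v)) t"
proof (induction t)
  case (App g ts)
  then have "map (val M e \<circ> ren_tm f) ts = map (val M (\<lambda>v. e (f v))) ts" by simp
  then show ?case by (simp only: val.simps ren_tm.simps map_map)
qed simp

lemma sat_ren: "sat M e (ren f \<phi>) \<longleftrightarrow> sat M (\<lambda>v. e (f v)) \<phi>"
proof (induction \<phi> arbitrary: e f)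
  case (Eq t u)
  then show ?case by (simp add: val_ren_tm)
next
  case (Rel r ts)
  have "map (val M e) (map (ren_tm f) ts) = map (val M (\<lambda>v. e (f v))) ts"
    by (simp add: val_ren_tm)
  then show ?case by (simp only: sat.simps ren.simps)
next
  case (All v \<phi>)
  let ?w = "(fresh f \<phi>, snd v)"
  have "sat M (e(?w := x)) (ren (f(v := ?w)) \<phi>) \<longleftrightarrow> sat M ((\<lambda>v. e (f v))(v := x)) \<phi>" for x
    unfolding All.IH by (rule sat_cong) (simp add: fresh)
  then show ?case by simp
qed simp_all

lemma fv_ren_tm: "fv_tm (ren_tm f t) = f ` fv_tm t"
  by (induction t) auto

lemma fv_ren: "fv (ren f \<phi>) \<subseteq> f ` fv \<phi>"
proof (induction \<phi> arbitrary: f)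
  case (All v \<phi>)
  show ?case using All.IH[of "f(v := (fresh f \<phi>, snd v))"] by (fastforce split: if_splits)
qed (force simp: fv_ren_tm)+

lemma tm_sort_ren_tm: "(\<And>v. snd (f v) = snd v) \<Longrightarrow> tm_sort L (ren_tm f t) = tm_sort L t"
  by (cases t) auto

lemma wf_ren_tm: "(\<And>v. snd (f v) = snd v) \<Longrightarrow> wf_tm L t \<Longrightarrow> wf_tm L (ren_tm f t)"
proof (induction t)
  case (App g ts)
  have eq: "map (tm_sort L \<circ> ren_tm f) ts = map (tm_sort L) ts"
    by (simp add: tm_sort_ren_tm App.prems)
  show ?case using App by (auto simp del: map_eq_conv) (simp_all add: eq)
qed simp

lemma wf_ren: "(\<And>v. snd (f v) = snd v) \<Longrightarrow> wf_fm L \<phi> \<Longrightarrow> wf_fm L (ren f \<phi>)"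
proof (induction \<phi> arbitrary: f)
  case (Eq t u)
  then show ?case by (simp add: wf_ren_tm tm_sort_ren_tm)
next
  case (Rel r ts)
  have eq: "map (tm_sort L \<circ> ren_tm f) ts = map (tm_sort L) ts"
    by (simp add: tm_sort_ren_tm Rel.prems)
  show ?case using Rel by (auto simp: wf_ren_tm simp del: map_eq_conv) (simp_all add: eq)
qed simp_all

section \<open>Expressible conditions\<close>

definition admissible ::
  "('s, 'f, 'r, 'a) struct \<Rightarrow> 'i set \<Rightarrow> ('i \<Rightarrow> 's) \<Rightarrow> 'a set \<Rightarrow> 's \<Rightarrow> 'i + 'a \<Rightarrow> bool" where
  "admissible M I ss B s z \<longleftrightarrow>
     (case z of Inl i \<Rightarrow> i \<in> I \<and> ss i = s | Inr b \<Rightarrow> b \<in> B \<and> srt M b = s)"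

lemma admissible_simps [simp]:
  "admissible M I ss B s (Inl i) \<longleftrightarrow> i \<in> I \<and> ss i = s"
  "admissible M I ss B s (Inr b) \<longleftrightarrow> b \<in> B \<and> srt M b = s"
  by (simp_all add: admissible_def)

lemma pformulas_iff:
  "(\<phi>, \<rho>) \<in> pformulas L M I ss B \<longleftrightarrow>
     wf_fm L \<phi> \<and> (\<forall>v\<in>fv \<phi>. admissible M I ss B (snd v) (\<rho> v))"
  by (simp add: pformulas_def formulas_def admissible_def)

lemma psat_Pair: "psat M a (\<phi>, \<rho>) \<longleftrightarrow> sat M (\<lambda>v. case_sum a (\<lambda>b. b) (\<rho> v)) \<phi>"
  by (simp add: psat_def)

text \<open>The truth of the condition is required to agree with one formula in all structures at once,
  so that a condition can be moved between a structure and a substructure.\<close>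

definition expressible ::
  "('s, 'f, 'r) signature \<Rightarrow> ('s, 'f, 'r, 'a) struct \<Rightarrow> 'i set \<Rightarrow> ('i \<Rightarrow> 's) \<Rightarrow> 'a set
   \<Rightarrow> (('s, 'f, 'r, 'a) struct \<Rightarrow> ('i \<Rightarrow> 'a) \<Rightarrow> bool) \<Rightarrow> bool" where
  "expressible L M I ss B Q \<longleftrightarrow>
     (\<exists>p\<in>pformulas L M I ss B. \<forall>M' a. psat M' a p \<longleftrightarrow> Q M' a)"

lemma expressible_psat [intro]:
  "p \<in> pformulas L M I ss B \<Longrightarrow> expressible L M I ss B (\<lambda>M' a. psat M' a p)"
  by (auto simp: expressible_def)

text \<open>Each free variable is renamed to the code of what it stands for, keeping its sort.
  Decoding the index recovers the substitution, so formulas treated with the same \<open>enc\<close>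
  share the map \<open>\<rho>'\<close> and can be joined by connectives, even if they used one
  variable for different things before.\<close>

lemma normal_form:
  fixes M :: "('s, 'f, 'r, 'a) struct" and enc :: "'i + 'a \<Rightarrow> nat"
  assumes "(\<phi>, \<rho>) \<in> pformulas L M I ss B" and "\<rho> ` fv \<phi> \<subseteq> Z" and "inj_on enc Z"
  defines "\<phi>' \<equiv> ren (\<lambda>v. (enc (\<rho> v), snd v)) \<phi>" and "\<rho>' \<equiv> \<lambda>w :: 's var. inv_into Z enc (fst w)"
  shows "(\<phi>', \<rho>') \<in> pformulas L M I ss B"
    and "\<And>M' a. psat M' a (\<phi>', \<rho>') \<longleftrightarrow> psat M' a (\<phi>, \<rho>)"
    and "\<And>w. w \<in> fv \<phi>' \<Longrightarrow> \<exists>z\<in>\<rho> ` fv \<phi>. fst w = enc z \<and> admissible M I ss B (snd w) z"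
proof -
  have inv: "inv_into Z enc (enc (\<rho> v)) = \<rho> v" if "v \<in> fv \<phi>" for v
    using that assms(2,3) by (auto intro: inv_into_f_f)
  have wf: "wf_fm L \<phi>" and adm: "\<And>v. v \<in> fv \<phi> \<Longrightarrow> admissible M I ss B (snd v) (\<rho> v)"
    using assms(1) by (auto simp: pformulas_iff)
  show fv: "\<exists>z\<in>\<rho> ` fv \<phi>. fst w = enc z \<and> admissible M I ss B (snd w) z" if w: "w \<in> fv \<phi>'" for w
  proof -
    obtain v where "v \<in> fv \<phi>" "w = (enc (\<rho> v), snd v)"
      using w fv_ren[of "\<lambda>v. (enc (\<rho> v), snd v)" \<phi>] unfolding \<phi>'_def by blast
    then show ?thesis using adm by (intro bexI[of _ "\<rho> v"]) auto
  qed
  show "(\<phi>', \<rho>') \<in> pformulas L M I ss B"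
    unfolding pformulas_iff
  proof (intro conjI ballI)
    show "wf_fm L \<phi>'" unfolding \<phi>'_def using wf by (simp add: wf_ren)
    fix w assume "w \<in> fv \<phi>'"
    then obtain v where "v \<in> fv \<phi>" "fst w = enc (\<rho> v)" "admissible M I ss B (snd w) (\<rho> v)"
      using fv by blast
    then show "admissible M I ss B (snd w) (\<rho>' w)" using inv by (simp add: \<rho>'_def)
  qed
  show "psat M' a (\<phi>', \<rho>') \<longleftrightarrow> psat M' a (\<phi>, \<rho>)" for M' :: "('s, 'f, 'r, 'a) struct" and a
    unfolding psat_Pair \<phi>'_def sat_ren by (rule sat_cong) (simp add: \<rho>'_def inv)
qed

lemma ex_enc: "finite Z \<Longrightarrow> \<exists>enc :: 'b \<Rightarrow> nat. inj_on enc Z"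
  by (meson finite_imp_inj_to_nat_seg)

lemma expressible_False [intro]: "expressible L M I ss B (\<lambda>M' a. False)"
  unfolding expressible_def
  by (intro bexI[of _ "(Bot, \<lambda>_. undefined)"]) (auto simp: pformulas_iff psat_Pair)

lemma expressible_imp:
  fixes M :: "('s, 'f, 'r, 'a) struct" and I :: "'i set"
  assumes "expressible L M I ss B Q" and "expressible L M I ss B R"
  shows "expressible L M I ss B (\<lambda>M' a. Q M' a \<longrightarrow> R M' a)"
proof -
  obtain \<phi> \<rho> where 1: "(\<phi>, \<rho>) \<in> pformulas L M I ss B" "\<And>M' a. psat M' a (\<phi>, \<rho>) \<longleftrightarrow> Q M' a"
    using assms(1) unfolding expressible_def by (metis surj_pair)
  obtain \<psi> \<tau> where 2: "(\<psi>, \<tau>) \<in> pformulas L M I ss B" "\<And>M' a. psat M' a (\<psi>, \<tau>) \<longleftrightarrow> R M' a"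
    using assms(2) unfolding expressible_def by (metis surj_pair)
  define Z where "Z = \<rho> ` fv \<phi> \<union> \<tau> ` fv \<psi>"
  obtain enc :: "'i + 'a \<Rightarrow> nat" where enc: "inj_on enc Z" using ex_enc[of Z] by (auto simp: Z_def)
  note n1 = normal_form[OF 1(1) _ enc] and n2 = normal_form[OF 2(1) _ enc]
  let ?f = "ren (\<lambda>v. (enc (\<rho> v), snd v)) \<phi>" and ?g = "ren (\<lambda>v. (enc (\<tau> v), snd v)) \<psi>"
  let ?r = "\<lambda>w. inv_into Z enc (fst w)"
  have "(?f, ?r) \<in> pformulas L M I ss B" "(?g, ?r) \<in> pformulas L M I ss B"
    using n1(1) n2(1) by (auto simp: Z_def)
  then have "(Imp ?f ?g, ?r) \<in> pformulas L M I ss B"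
    unfolding pformulas_iff by auto
  moreover have "psat M' a (Imp ?f ?g, ?r) \<longleftrightarrow> (Q M' a \<longrightarrow> R M' a)" for M' a
    using n1(2) n2(2) 1(2) 2(2) unfolding psat_Pair Z_def by simp
  ultimately show ?thesis unfolding expressible_def by blast
qed

lemma expressible_all:
  fixes M :: "('s, 'f, 'r, 'a) struct" and I :: "'i set"
  assumes "expressible L M (insert i I) ss B Q" and "ss i \<in> Sorts L"
  shows "expressible L M I ss B (\<lambda>M' a. \<forall>x\<in>elts M' (ss i). Q M' (a(i := x)))"
proof -
  obtain \<phi> \<rho> where 1: "(\<phi>, \<rho>) \<in> pformulas L M (insert i I) ss B"
      "\<And>M' a. psat M' a (\<phi>, \<rho>) \<longleftrightarrow> Q M' a"
    using assms(1) unfolding expressible_def by (metis surj_pair)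
  \<comment> \<open>\<open>Inl i\<close> is put in even if no variable of the formula stands for it,
    so that the bound variable always has a code of its own.\<close>
  define Z where "Z = insert (Inl i) (\<rho> ` fv \<phi>)"
  obtain enc :: "'i + 'a \<Rightarrow> nat" where enc: "inj_on enc Z" using ex_enc[of Z] by (auto simp: Z_def)
  have Z: "\<rho> ` fv \<phi> \<subseteq> Z" by (auto simp: Z_def)
  note n = normal_form[OF 1(1) Z enc]
  let ?f = "ren (\<lambda>v. (enc (\<rho> v), snd v)) \<phi>"
  let ?r = "\<lambda>w. inv_into Z enc (fst w)"
  let ?w = "(enc (Inl i), ss i)"
  have fvf: "\<exists>z\<in>Z. fst w = enc z \<and> ?r w = z \<and> admissible M (insert i I) ss B (snd w) z"
    if w: "w \<in> fv ?f" for w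
    using n(3)[OF w] Z enc by (metis inv_into_f_f subsetD)
  have iw: "?r ?w = Inl i" using enc by (simp add: Z_def)
  have other: "?r w \<noteq> Inl i" if w: "w \<in> fv ?f" "w \<noteq> ?w" for w
  proof
    assume a: "?r w = Inl i"
    obtain z where z: "z \<in> Z" "fst w = enc z" "?r w = z" "admissible M (insert i I) ss B (snd w) z"
      using fvf[OF w(1)] by blast
    then have "z = Inl i" using a by simp
    with z have "w = ?w" by (cases w) simp
    with w(2) show False by simp
  qed
  have "(All ?w ?f, ?r) \<in> pformulas L M I ss B"
    unfolding pformulas_iff
  proof (intro conjI ballI)
    show "wf_fm L (All ?w ?f)" using n(1) assms(2) by (simp add: pformulas_iff)
    fix w assume w: "w \<in> fv (All ?w ?f)"
    then have "admissible M (insert i I) ss B (snd w) (?r w)" "?r w \<noteq> Inl i"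
      using fvf[of w] other[of w] by auto
    then show "admissible M I ss B (snd w) (?r w)" by (cases "?r w") auto
  qed
  moreover have "psat M' a (All ?w ?f, ?r) \<longleftrightarrow> (\<forall>x\<in>elts M' (ss i). Q M' (a(i := x)))" for M' a
  proof -
    have "sat M' ((\<lambda>v. case_sum a (\<lambda>b. b) (?r v))(?w := x)) ?f
        \<longleftrightarrow> sat M' (\<lambda>v. case_sum (a(i := x)) (\<lambda>b. b) (?r v)) ?f" for x
    proof (rule sat_cong)
      fix w assume w: "w \<in> fv ?f"
      show "((\<lambda>v. case_sum a (\<lambda>b. b) (?r v))(?w := x)) w = case_sum (a(i := x)) (\<lambda>b. b) (?r w)"
      proof (cases "w = ?w")
        case True
        then show ?thesis using iw by simp
      next
        case False
        with other[OF w] show ?thesis by (cases "?r w") auto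
      qed
    qed
    then show ?thesis using n(2) 1(2) unfolding psat_Pair by simp
  qed
  ultimately show ?thesis unfolding expressible_def by blast
qed

text \<open>Only the map from variables to indices and parameters changes, never the formula; hence
  nothing can be captured, and an index may also be replaced by a parameter.\<close>

lemma expressible_subst:
  assumes "expressible L M I ss B Q" and "B \<subseteq> B'"
    and "\<And>i. i \<in> I \<Longrightarrow> admissible M J ss' B' (ss i) (t i)"
  shows "expressible L M J ss' B' (\<lambda>M' a. Q M' (\<lambda>i. case_sum a (\<lambda>b. b) (t i)))"
proof -
  obtain \<phi> \<rho> where 1: "(\<phi>, \<rho>) \<in> pformulas L M I ss B" "\<And>M' a. psat M' a (\<phi>, \<rho>) \<longleftrightarrow> Q M' a"
    using assms(1) unfolding expressible_def by (metis surj_pair)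
  let ?r = "\<lambda>v. case \<rho> v of Inl i \<Rightarrow> t i | Inr b \<Rightarrow> Inr b"
  have "(\<phi>, ?r) \<in> pformulas L M J ss' B'"
    unfolding pformulas_iff
  proof (intro conjI ballI)
    show "wf_fm L \<phi>" using 1 by (simp add: pformulas_iff)
    fix v assume "v \<in> fv \<phi>"
    then have "admissible M I ss B (snd v) (\<rho> v)" using 1 by (simp add: pformulas_iff)
    then show "admissible M J ss' B' (snd v) (?r v)"
      using assms(2) assms(3)[of "projl (\<rho> v)"] by (cases "\<rho> v") auto
  qed
  moreover have "psat M' a (\<phi>, ?r) \<longleftrightarrow> Q M' (\<lambda>i. case_sum a (\<lambda>b. b) (t i))" for M' a
    unfolding 1(2)[symmetric] psat_Pair by (rule sat_cong) (simp split: sum.split)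
  ultimately show ?thesis unfolding expressible_def by blast
qed

lemma expressible_reindex:
  assumes "expressible L M I ss B Q" and "B \<subseteq> B'" and "\<And>i. i \<in> I \<Longrightarrow> f i \<in> J \<and> ss' (f i) = ss i"
  shows "expressible L M J ss' B' (\<lambda>M' a. Q M' (\<lambda>i. a (f i)))"
  using expressible_subst[OF assms(1,2), of J ss' "\<lambda>i. Inl (f i)"] assms(3) by simp

lemma expressible_mono:
  assumes "expressible L M I ss B Q" and "I \<subseteq> J" and "B \<subseteq> B'"
  shows "expressible L M J ss B' Q"
  using expressible_reindex[OF assms(1,3), of "\<lambda>i. i" J ss] assms(2) by auto

lemma expressible_not:
  "expressible L M I ss B Q \<Longrightarrow> expressible L M I ss B (\<lambda>M' a. \<not> Q M' a)"
  using expressible_imp[OF _ expressible_False] by fastforce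

lemma expressible_conj:
  assumes "expressible L M I ss B Q" and "expressible L M I ss B R"
  shows "expressible L M I ss B (\<lambda>M' a. Q M' a \<and> R M' a)"
  using expressible_not[OF expressible_imp[OF assms(1) expressible_not[OF assms(2)]]] by simp

lemma expressible_ball:
  assumes "finite F" and "\<And>x. x \<in> F \<Longrightarrow> expressible L M I ss B (Q x)"
  shows "expressible L M I ss B (\<lambda>M' a. \<forall>x\<in>F. Q x M' a)"
  using assms
proof (induction F)
  case empty
  then show ?case using expressible_not[OF expressible_False] by fastforce
next
  case (insert y F)
  then show ?case using expressible_conj[of L M I ss B "Q y"] by simp
qed

lemma expressible_ex:
  assumes "expressible L M (insert i I) ss B Q" and "ss i \<in> Sorts L"
  shows "expressible L M I ss B (\<lambda>M' a. \<exists>x\<in>elts M' (ss i). Q M' (a(i := x)))"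
  using expressible_not[OF expressible_all[OF expressible_not[OF assms(1)] assms(2)]] by simp

lemma expressible_eq:
  fixes M :: "('s, 'f, 'r, 'a) struct" and I :: "'i set"
  assumes "admissible M I ss B s y" and "admissible M I ss B s z" and "s \<in> Sorts L"
  shows "expressible L M I ss B
    (\<lambda>M' a. case_sum a (\<lambda>b. b) y = case_sum a (\<lambda>b. b) z)"
proof -
  let ?p = "(Eq (Var (0, s)) (Var (1, s)), \<lambda>v. if fst v = 0 then y else z)"
  have "?p \<in> pformulas L M I ss B" using assms by (simp add: pformulas_iff)
  moreover have "psat M' a ?p \<longleftrightarrow> case_sum a (\<lambda>b. b) y = case_sum a (\<lambda>b. b) z" for M' a
    by (simp add: psat_Pair)
  ultimately show ?thesis unfolding expressible_def by blast
qed

lemma expressible_eq_var: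
  assumes "i \<in> I" and "j \<in> I" and "ss i = ss j" and "ss i \<in> Sorts L"
  shows "expressible L M I ss B (\<lambda>M' a. a i = a j)"
  using expressible_eq[of M I ss B "ss i" "Inl i" "Inl j"] assms by simp

text \<open>A formula has finitely many free variables, so a condition on an infinite family reads
  only finitely many coordinates. Compactness over infinite index sets quantifies over this finite
  support.\<close>

lemma expressible_support:
  fixes M :: "('s, 'f, 'r, 'a) struct" and I :: "'i set"
  assumes "expressible L M I ss B Q"
  obtains F where "finite F" and "F \<subseteq> I" and "expressible L M F ss B Q"
    and "\<And>M' a b. (\<And>i. i \<in> F \<Longrightarrow> a i = b i) \<Longrightarrow> Q M' a \<longleftrightarrow> Q M' b"
proof -
  obtain \<phi> \<rho> where 1: "(\<phi>, \<rho>) \<in> pformulas L M I ss B" "\<And>M' a. psat M' a (\<phi>, \<rho>) \<longleftrightarrow> Q M' a"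
    using assms(1) unfolding expressible_def by (metis surj_pair)
  let ?F = "Inl -` (\<rho> ` fv \<phi>)"
  show ?thesis
  proof
    show "finite ?F" by (rule finite_vimageI) auto
    show "?F \<subseteq> I"
    proof
      fix x assume "x \<in> ?F"
      then obtain v where "v \<in> fv \<phi>" "\<rho> v = Inl x" by (metis imageE vimageE)
      then show "x \<in> I" using 1(1) by (auto simp: pformulas_iff)
    qed
    have "(\<phi>, \<rho>) \<in> pformulas L M ?F ss B"
      unfolding pformulas_iff
    proof (intro conjI ballI)
      show "wf_fm L \<phi>" using 1 by (simp add: pformulas_iff)
      fix v assume v: "v \<in> fv \<phi>"
      then have "admissible M I ss B (snd v) (\<rho> v)" using 1 by (simp add: pformulas_iff)
      then show "admissible M ?F ss B (snd v) (\<rho> v)"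
        using v by (cases "\<rho> v") (auto simp: image_iff intro!: bexI[of _ v])
    qed
    then show "expressible L M ?F ss B Q" using 1(2) unfolding expressible_def by blast
    fix M' and a b :: "'i \<Rightarrow> 'a" assume ab: "\<And>i. i \<in> ?F \<Longrightarrow> a i = b i"
    show "Q M' a \<longleftrightarrow> Q M' b" unfolding 1(2)[symmetric] psat_Pair
    proof (rule sat_cong)
      fix v assume "v \<in> fv \<phi>"
      then show "case_sum a (\<lambda>b. b) (\<rho> v) = case_sum b (\<lambda>b. b) (\<rho> v)"
        by (cases "\<rho> v") (auto simp: image_iff intro!: ab bexI[of _ v])
    qed
  qed
qed

text \<open>The same finiteness for parameters; it places a condition over an increasing union at
  some stage of the union.\<close>

lemma expressible_params:
  fixes M :: "('s, 'f, 'r, 'a) struct" and I :: "'i set"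
  assumes "expressible L M I ss B Q"
  obtains B0 where "finite B0" and "B0 \<subseteq> B" and "expressible L M I ss B0 Q"
proof -
  obtain \<phi> \<rho> where 1: "(\<phi>, \<rho>) \<in> pformulas L M I ss B" "\<And>M' a. psat M' a (\<phi>, \<rho>) \<longleftrightarrow> Q M' a"
    using assms(1) unfolding expressible_def by (metis surj_pair)
  let ?F = "Inr -` (\<rho> ` fv \<phi>)"
  show ?thesis
  proof
    show "finite ?F" by (rule finite_vimageI) auto
    show "?F \<subseteq> B"
    proof
      fix x assume "x \<in> ?F"
      then obtain v where "v \<in> fv \<phi>" "\<rho> v = Inr x" by (metis imageE vimageE)
      then show "x \<in> B" using 1(1) by (auto simp: pformulas_iff)
    qed
    have "(\<phi>, \<rho>) \<in> pformulas L M I ss ?F"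
      unfolding pformulas_iff
    proof (intro conjI ballI)
      show "wf_fm L \<phi>" using 1 by (simp add: pformulas_iff)
      fix v assume v: "v \<in> fv \<phi>"
      then have "admissible M I ss B (snd v) (\<rho> v)" using 1 by (simp add: pformulas_iff)
      then show "admissible M I ss ?F (snd v) (\<rho> v)"
        using v by (cases "\<rho> v") (auto simp: image_iff intro!: bexI[of _ v])
    qed
    then show "expressible L M I ss ?F Q" using 1(2) unfolding expressible_def by blast
  qed
qed

section \<open>Automorphisms\<close>

lemma val_in_elts:
  assumes "is_struct L M" and "wf_tm L t" and "\<And>v. v \<in> fv_tm t \<Longrightarrow> e v \<in> elts M (snd v)"
  shows "val M e t \<in> elts M (tm_sort L t)"
  using assms(2,3)
proof (induction t)
  case (App f ts)
  have *: "val M e t \<in> elts M (tm_sort L t)" if "t \<in> set ts" for t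
    using that App by auto
  then have "map (srt M) (map (val M e) ts) = map (tm_sort L) ts"
    by (auto simp: elts_def)
  then have "map (srt M) (map (val M e) ts) = fun_dom L f" using App.prems by (simp del: map_map)
  with * have "map (val M e) ts \<in> tuples M (fun_dom L f)"
    by (auto simp: tuples_def elts_def)
  then show ?case using assms(1) App.prems by (auto simp: is_struct_def)
qed simp

lemma map_val_in_tuples:
  assumes "is_struct L M" and "\<forall>t\<in>set ts. wf_tm L t"
    and "\<And>v. v \<in> (\<Union>t\<in>set ts. fv_tm t) \<Longrightarrow> e v \<in> elts M (snd v)"
  shows "map (val M e) ts \<in> tuples M (map (tm_sort L) ts)"
proof -
  have "val M e t \<in> elts M (tm_sort L t)" if "t \<in> set ts" for t
    using that assms by (intro val_in_elts) auto
  then show ?thesis by (auto simp: tuples_def elts_def)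
qed

lemma aut_elts:
  assumes "\<sigma> \<in> auts L M A"
  shows "\<sigma> ` elts M s = elts M s"
proof -
  have "bij_betw \<sigma> (univ M) (univ M)" "\<And>x. x \<in> univ M \<Longrightarrow> srt M (\<sigma> x) = srt M x"
    using assms by (auto simp: auts_def)
  then have *: "\<sigma> ` univ M = univ M" and srt: "\<And>x. x \<in> univ M \<Longrightarrow> srt M (\<sigma> x) = srt M x"
    by (simp_all add: bij_betw_def)
  show ?thesis
  proof (intro equalityI subsetI)
    fix y assume "y \<in> \<sigma> ` elts M s"
    then show "y \<in> elts M s" using * srt by (auto simp: elts_def)
  next
    fix y assume y: "y \<in> elts M s"
    then obtain x where "x \<in> univ M" "y = \<sigma> x" using * by (auto simp: elts_def)
    then show "y \<in> \<sigma> ` elts M s" using y srt by (auto simp: elts_def)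
  qed
qed

lemma aut_in_elts: "\<sigma> \<in> auts L M A \<Longrightarrow> x \<in> elts M s \<Longrightarrow> \<sigma> x \<in> elts M s"
  using aut_elts[of \<sigma> L M A s] by auto

lemma aut_inj: "\<sigma> \<in> auts L M A \<Longrightarrow> inj_on \<sigma> (univ M)"
  by (simp add: auts_def bij_betw_def)

lemma aut_fix: "\<sigma> \<in> auts L M A \<Longrightarrow> a \<in> A \<Longrightarrow> \<sigma> a = a"
  by (simp add: auts_def)

lemma aut_val:
  assumes "is_struct L M" and "\<sigma> \<in> auts L M A" and "wf_tm L t"
    and "\<And>v. v \<in> fv_tm t \<Longrightarrow> e v \<in> elts M (snd v)"
  shows "val M (\<lambda>v. \<sigma> (e v)) t = \<sigma> (val M e t)"
  using assms(3,4)
proof (induction t)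
  case (App f ts)
  have "map (val M (\<lambda>v. \<sigma> (e v))) ts = map \<sigma> (map (val M e) ts)"
    using App by auto
  moreover have "map (val M e) ts \<in> tuples M (fun_dom L f)"
    using map_val_in_tuples[OF assms(1), of ts e] App.prems by auto
  ultimately show ?case using App.prems assms(2) by (simp add: auts_def del: map_map)
qed simp

lemma aut_sat:
  assumes "is_struct L M" and "\<sigma> \<in> auts L M A" and "wf_fm L \<phi>"
    and "\<And>v. v \<in> fv \<phi> \<Longrightarrow> e v \<in> elts M (snd v)"
  shows "sat M (\<lambda>v. \<sigma> (e v)) \<phi> \<longleftrightarrow> sat M e \<phi>"
  using assms(3,4)
proof (induction \<phi> arbitrary: e)
  case (Eq t u)
  have "val M e t \<in> univ M" "val M e u \<in> univ M"
    using val_in_elts[OF assms(1), of t e] val_in_elts[OF assms(1), of u e] Eq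
    by (auto simp: elts_def)
  then show ?case
    using Eq aut_val[OF assms(1,2), of t e] aut_val[OF assms(1,2), of u e] aut_inj[OF assms(2)]
    by (auto simp: inj_on_eq_iff)
next
  case (Rel r ts)
  have "map (val M (\<lambda>v. \<sigma> (e v))) ts = map \<sigma> (map (val M e) ts)"
    using Rel by (auto intro!: aut_val[OF assms(1,2)])
  moreover have "map (val M e) ts \<in> tuples M (rel_dom L r)"
    using map_val_in_tuples[OF assms(1), of ts e] Rel.prems by auto
  ultimately show ?case using Rel.prems assms(2) by (simp add: auts_def del: map_map)
next
  case (Imp \<phi> \<psi>)
  then show ?case by simp
next
  case (All v \<phi>)
  have "sat M ((\<lambda>v. \<sigma> (e v))(v := \<sigma> x)) \<phi> \<longleftrightarrow> sat M (e(v := x)) \<phi>" if "x \<in> elts M (snd v)" for x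
  proof -
    have "(\<lambda>v. \<sigma> (e v))(v := \<sigma> x) = (\<lambda>w. \<sigma> ((e(v := x)) w))" by auto
    moreover have "sat M (\<lambda>w. \<sigma> ((e(v := x)) w)) \<phi> \<longleftrightarrow> sat M (e(v := x)) \<phi>"
      by (rule All.IH) (use All.prems that in auto)
    ultimately show ?thesis by simp
  qed
  moreover have "(\<forall>x\<in>elts M (snd v). P x) \<longleftrightarrow> (\<forall>x\<in>elts M (snd v). P (\<sigma> x))" for P :: "_ \<Rightarrow> bool"
    using aut_elts[OF assms(2), of "snd v"] by (metis (no_types, lifting) imageE imageI)
  note this[of "\<lambda>x. sat M ((\<lambda>v. \<sigma> (e v))(v := x)) \<phi>"]
  ultimately show ?case by (simp del: fun_upd_apply)
qed simp

text \<open>The automorphism is not assumed to fix the parameters; they move together with the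
  tuple. This form is needed for conjugates of sets defined over a larger set than the one that is
  fixed.\<close>

lemma aut_psat_move:
  assumes "is_struct L M" and "\<sigma> \<in> auts L M A" and "(\<phi>, \<rho>) \<in> pformulas L M I ss B"
    and "B \<subseteq> univ M" and "\<And>i. i \<in> I \<Longrightarrow> a i \<in> elts M (ss i)"
  shows "sat M (\<lambda>v. case_sum (\<lambda>i. \<sigma> (a i)) \<sigma> (\<rho> v)) \<phi> \<longleftrightarrow> psat M a (\<phi>, \<rho>)"
proof -
  have "case_sum a (\<lambda>b. b) (\<rho> v) \<in> elts M (snd v)" if "v \<in> fv \<phi>" for v
  proof -
    have "admissible M I ss B (snd v) (\<rho> v)" using assms(3) that by (simp add: pformulas_iff)
    then show ?thesis using assms(4,5) by (cases "\<rho> v") (auto simp: elts_def)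
  qed
  moreover have "wf_fm L \<phi>" using assms(3) by (simp add: pformulas_iff)
  ultimately have "sat M (\<lambda>v. \<sigma> (case_sum a (\<lambda>b. b) (\<rho> v))) \<phi> \<longleftrightarrow> psat M a (\<phi>, \<rho>)"
    unfolding psat_Pair by (intro aut_sat[OF assms(1,2)])
  moreover have "(\<lambda>v. \<sigma> (case_sum a (\<lambda>b. b) (\<rho> v))) = (\<lambda>v. case_sum (\<lambda>i. \<sigma> (a i)) \<sigma> (\<rho> v))"
    by (auto split: sum.split)
  ultimately show ?thesis by simp
qed

lemma aut_expressible:
  assumes "is_struct L M" and "\<sigma> \<in> auts L M B" and "expressible L M I ss B Q"
    and "B \<subseteq> univ M" and "\<And>i. i \<in> I \<Longrightarrow> a i \<in> elts M (ss i)"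
  shows "Q M (\<lambda>i. \<sigma> (a i)) \<longleftrightarrow> Q M a"
proof -
  obtain \<phi> \<rho> where 1: "(\<phi>, \<rho>) \<in> pformulas L M I ss B" "\<And>M' a. psat M' a (\<phi>, \<rho>) \<longleftrightarrow> Q M' a"
    using assms(3) unfolding expressible_def by (metis surj_pair)
  have "sat M (\<lambda>v. case_sum (\<lambda>i. \<sigma> (a i)) \<sigma> (\<rho> v)) \<phi> \<longleftrightarrow> psat M (\<lambda>i. \<sigma> (a i)) (\<phi>, \<rho>)"
    unfolding psat_Pair
  proof (rule sat_cong)
    fix v assume "v \<in> fv \<phi>"
    then have "admissible M I ss B (snd v) (\<rho> v)" using 1 by (simp add: pformulas_iff)
    then show "case_sum (\<lambda>i. \<sigma> (a i)) \<sigma> (\<rho> v) = case_sum (\<lambda>i. \<sigma> (a i)) (\<lambda>b. b) (\<rho> v)"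
      using aut_fix[OF assms(2)] by (cases "\<rho> v") auto
  qed
  then show ?thesis using aut_psat_move[OF assms(1,2) 1(1) assms(4,5)] 1(2) by simp
qed

lemma aut_inverse:
  assumes "is_struct L M" and "\<sigma> \<in> auts L M A" and "A \<subseteq> univ M"
  obtains \<tau> where "\<tau> \<in> auts L M A" and "\<And>x. x \<in> univ M \<Longrightarrow> \<tau> (\<sigma> x) = x"
    and "\<And>x. x \<in> univ M \<Longrightarrow> \<sigma> (\<tau> x) = x"
proof
  let ?t = "inv_into (univ M) \<sigma>"
  have bij: "bij_betw \<sigma> (univ M) (univ M)" and srt: "\<And>x. x \<in> univ M \<Longrightarrow> srt M (\<sigma> x) = srt M x"
    using assms(2) by (auto simp: auts_def)
  show ts: "?t (\<sigma> x) = x" if "x \<in> univ M" for x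
    using bij that by (simp add: bij_betw_inv_into_left)
  show st: "\<sigma> (?t x) = x" if "x \<in> univ M" for x
    using bij that by (simp add: bij_betw_inv_into_right)
  have tb: "bij_betw ?t (univ M) (univ M)" using bij by (rule bij_betw_inv_into)
  then have tu: "?t x \<in> univ M" if "x \<in> univ M" for x using that by (auto simp: bij_betw_def)
  have srt': "srt M (?t x) = srt M x" if "x \<in> univ M" for x
    using srt[OF tu[OF that]] st[OF that] by simp
  have tup: "map ?t xs \<in> tuples M ss" "map \<sigma> (map ?t xs) = xs" if "xs \<in> tuples M ss" for xs ss
    using that tu srt' st by (auto simp: tuples_def subset_iff intro!: map_idI)
  show "?t \<in> auts L M A"
    unfolding auts_def
  proof (intro CollectI conjI ballI tb)
    fix x assume "x \<in> univ M"
    then show "srt M (?t x) = srt M x" by (rule srt')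
  next
    fix f xs assume f: "f \<in> Funs L" and xs: "xs \<in> tuples M (fun_dom L f)"
    have "\<sigma> (fn M f (map ?t xs)) = fn M f (map \<sigma> (map ?t xs))"
      using assms(2) f tup(1)[OF xs] by (simp add: auts_def del: map_map)
    then have "fn M f xs = \<sigma> (fn M f (map ?t xs))" using tup(2)[OF xs] by simp
    moreover have "fn M f (map ?t xs) \<in> univ M"
      using assms(1) f tup(1)[OF xs] by (auto simp: is_struct_def elts_def)
    ultimately show "?t (fn M f xs) = fn M f (map ?t xs)" using ts by simp
  next
    fix r xs assume r: "r \<in> Rels L" and xs: "xs \<in> tuples M (rel_dom L r)"
    have "rl M r (map \<sigma> (map ?t xs)) \<longleftrightarrow> rl M r (map ?t xs)"
      using assms(2) r tup(1)[OF xs] by (simp add: auts_def del: map_map)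
    then show "rl M r (map ?t xs) \<longleftrightarrow> rl M r xs" using tup(2)[OF xs] by simp
  next
    fix a assume "a \<in> A"
    then show "?t a = a" using ts[of a] assms(2,3) by (auto simp: auts_def)
  qed
qed

section \<open>Saturation and homogeneity for many variables\<close>

text \<open>The witness is a whole family that agrees with \<open>a\<close> off \<open>F\<close>;
  where \<open>F\<close> meets \<open>I\<close> the old values are overwritten. No block of fresh
  indices has to be named.\<close>

lemma expressible_ex_finite:
  assumes "finite F" and "\<And>i. i \<in> F \<Longrightarrow> ss i \<in> Sorts L" and "expressible L M (F \<union> I) ss B Q"
  shows "expressible L M I ss B
    (\<lambda>M' a. \<exists>b. (\<forall>i\<in>F. b i \<in> elts M' (ss i)) \<and> (\<forall>i. i \<notin> F \<longrightarrow> b i = a i) \<and> Q M' b)"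
  using assms
proof (induction F arbitrary: Q)
  case empty
  have "(\<exists>b. (\<forall>i. b i = a i) \<and> Q M' b) \<longleftrightarrow> Q M' a" for M' a
    by (metis ext)
  then show ?case using empty by simp
next
  case (insert i F)
  have *: "expressible L M (F \<union> I) ss B (\<lambda>M' a. \<exists>x\<in>elts M' (ss i). Q M' (a(i := x)))"
    using insert.prems by (intro expressible_ex) auto
  have "(\<exists>b. (\<forall>j\<in>F. b j \<in> elts M' (ss j)) \<and> (\<forall>j. j \<notin> F \<longrightarrow> b j = a j) \<and>
          (\<exists>x\<in>elts M' (ss i). Q M' (b(i := x)))) \<longleftrightarrow>
        (\<exists>b. (\<forall>j\<in>insert i F. b j \<in> elts M' (ss j)) \<and> (\<forall>j. j \<notin> insert i F \<longrightarrow> b j = a j) \<and> Q M' b)"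
    (is "?l \<longleftrightarrow> ?r") for M' a
  proof
    assume ?l
    then obtain b x where "\<forall>j\<in>F. b j \<in> elts M' (ss j)" "\<forall>j. j \<notin> F \<longrightarrow> b j = a j"
      "x \<in> elts M' (ss i)" "Q M' (b(i := x))" by blast
    then show ?r by (intro exI[of _ "b(i := x)"]) auto
  next
    assume ?r
    then obtain b where "\<forall>j\<in>insert i F. b j \<in> elts M' (ss j)"
      "\<forall>j. j \<notin> insert i F \<longrightarrow> b j = a j" "Q M' b" by blast
    \<comment> \<open>Since \<open>i\<close> is not in \<open>F\<close>, the inner family still has
      to agree with \<open>a\<close> at \<open>i\<close>; the value \<open>b i\<close> enters only
      through the outer quantifier.\<close>
    then show ?l using insert.hyps by (intro exI[of _ "b(i := a i)"]) (auto intro!: bexI[of _ "b i"])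
  qed
  then show ?case using insert.IH[OF _ *] insert.prems(1) by (simp del: fun_upd_apply)
qed

text \<open>Iterated negations of \<open>Bot\<close> are formulas over every signature.\<close>

lemma infinite_formulas: "infinite (formulas L)"
proof -
  let ?f = "\<lambda>n. ((\<lambda>\<phi>. Imp \<phi> Bot) ^^ n) Bot :: ('a, 'b, 'c) fm"
  have "?f m = ?f n \<Longrightarrow> m = n" for m n
  proof (induction m arbitrary: n)
    case 0
    then show ?case by (cases n) auto
  next
    case (Suc m)
    then show ?case by (cases n) auto
  qed
  then have "inj ?f" by (simp add: inj_def)
  moreover have "wf_fm L (?f n)" for n by (induction n) auto
  then have "range ?f \<subseteq> formulas L" by (auto simp: formulas_def)
  ultimately show ?thesis by (meson infinite_UNIV_nat finite_imageD finite_subset)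
qed

lemma Cinfinite_formulas: "Cinfinite |formulas L|"
  using infinite_formulas by (simp add: cinfinite_def Field_card_of card_of_card_order_on)

locale monster_struct =
  fixes L :: "('s, 'f, 'r) signature" and \<kappa> :: "'k rel" and C :: "('s, 'f, 'r, 'a) struct"
  assumes Card_\<kappa>: "Card_order \<kappa>" and exp_formulas: "ctwo ^c |formulas L| <o \<kappa>"
    and is_struct: "is_struct L C" and saturated: "saturated L \<kappa> C"
    and homogeneous: "strongly_homogeneous L \<kappa> C"
begin

lemma Cinfinite_\<kappa>: "Cinfinite \<kappa>"
proof -
  have "|formulas L| <o ctwo ^c |formulas L|"
    by (intro ordLess_ctwo_cexp card_of_Card_order)
  then have "|formulas L| \<le>o \<kappa>" using exp_formulas by (metis ordLess_imp_ordLeq ordLess_transitive)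
  then show ?thesis using Card_\<kappa> Cinfinite_formulas cinfinite_mono by blast
qed

lemma small_imp_less: assumes "small L \<kappa> B" shows "|B| <o \<kappa>"
proof -
  have "|B| \<le>o |formulas L| +c |B|" by (simp add: ordLeq_csum2 card_of_Card_order)
  moreover have "|formulas L| +c |B| <o ctwo ^c ( |formulas L| +c |B| )"
    by (intro ordLess_ctwo_cexp Card_order_csum)
  ultimately show ?thesis using assms unfolding small_def
    by (meson ordLeq_ordLess_trans ordLess_transitive)
qed

lemma finite_less: "finite B \<Longrightarrow> |B| <o \<kappa>"
  using Cinfinite_\<kappa> finite_ordLess_infinite[of "|B|" \<kappa>] card_of_well_order_on[of B]
  by (simp add: cinfinite_def Field_card_of card_order_on_well_order_on)

lemma Un_less: "|A| <o \<kappa> \<Longrightarrow> |B| <o \<kappa> \<Longrightarrow> |A \<union> B| <o \<kappa>"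
  using Un_Cinfinite_bound_strict Cinfinite_\<kappa> by blast

lemma saturated_expressible:
  fixes \<Q> :: "(('s, 'f, 'r, 'a) struct \<Rightarrow> (unit \<Rightarrow> 'a) \<Rightarrow> bool) set"
  assumes "B \<subseteq> univ C" and "|B| <o \<kappa>" and "s \<in> Sorts L"
    and "\<And>Q. Q \<in> \<Q> \<Longrightarrow> expressible L C UNIV (\<lambda>_. s) B Q"
    and fip: "\<And>\<F>. \<F> \<subseteq> \<Q> \<Longrightarrow> finite \<F> \<Longrightarrow> \<exists>x\<in>elts C s. \<forall>Q\<in>\<F>. Q C (\<lambda>_. x)"
  shows "\<exists>x\<in>elts C s. \<forall>Q\<in>\<Q>. Q C (\<lambda>_. x)"
proof -
  \<comment> \<open>All formulas that represent a member of \<open>\<Q>\<close> are taken, which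
    spares choosing one for each.\<close>
  define \<Sigma> where "\<Sigma> = {p \<in> pformulas L C (UNIV :: unit set) (\<lambda>_. s) B.
     \<exists>Q\<in>\<Q>. \<forall>M' a. psat M' a p \<longleftrightarrow> Q M' a}"
  have "\<exists>x\<in>elts C s. \<forall>p\<in>\<Sigma>'. psat C (\<lambda>_. x) p" if \<Sigma>': "\<Sigma>' \<subseteq> \<Sigma>" "finite \<Sigma>'" for \<Sigma>'
  proof -
    have "\<forall>p\<in>\<Sigma>'. \<exists>Q\<in>\<Q>. \<forall>M' a. psat M' a p \<longleftrightarrow> Q M' a" using \<Sigma>' by (auto simp: \<Sigma>_def)
    then obtain q where q: "\<And>p. p \<in> \<Sigma>' \<Longrightarrow> q p \<in> \<Q> \<and> (\<forall>M' a. psat M' a p \<longleftrightarrow> q p M' a)"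
      by metis
    obtain x where x: "x \<in> elts C s" "\<forall>Q\<in>q ` \<Sigma>'. Q C (\<lambda>_. x)"
      using fip[of "q ` \<Sigma>'"] q \<Sigma>' by blast
    then have "psat C (\<lambda>_. x) p" if "p \<in> \<Sigma>'" for p using q[OF that] that by simp
    then show ?thesis using x(1) by blast
  qed
  moreover have "\<Sigma> \<subseteq> pformulas L C UNIV (\<lambda>_. s) B" by (auto simp: \<Sigma>_def)
  moreover have "\<forall>\<Sigma>\<subseteq>pformulas L C (UNIV :: unit set) (\<lambda>_. s) B.
      (\<forall>\<Sigma>'\<subseteq>\<Sigma>. finite \<Sigma>' \<longrightarrow> (\<exists>x\<in>elts C s. \<forall>p\<in>\<Sigma>'. psat C (\<lambda>_. x) p)) \<longrightarrow>
      (\<exists>x\<in>elts C s. \<forall>p\<in>\<Sigma>. psat C (\<lambda>_. x) p)"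
    using saturated assms(1-3) by (simp add: saturated_def)
  ultimately have "\<exists>x\<in>elts C s. \<forall>p\<in>\<Sigma>. psat C (\<lambda>_. x) p" by simp
  then obtain x where x: "x \<in> elts C s" "\<And>p. p \<in> \<Sigma> \<Longrightarrow> psat C (\<lambda>_. x) p" by blast
  have "Q C (\<lambda>_. x)" if Q: "Q \<in> \<Q>" for Q
  proof -
    obtain p where p: "p \<in> pformulas L C UNIV (\<lambda>_. s) B" "\<forall>M' a. psat M' a p \<longleftrightarrow> Q M' a"
      using assms(4)[OF Q] unfolding expressible_def by blast
    then have "p \<in> \<Sigma>" using Q by (auto simp: \<Sigma>_def)
    then show ?thesis using x(2) p(2) by blast
  qed
  then show ?thesis using x(1) by blast
qed

text \<open>Saturation speaks of one variable, whereas types of infinite tuples have to be realised.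
  Zorn's lemma gives a maximal partial assignment that stays finitely satisfiable with
  \<open>\<Q>\<close>; if it missed an index, one-variable saturation over the values chosen so far
  would extend it.\<close>

theorem saturated_many:
  fixes \<Q> :: "(('s, 'f, 'r, 'a) struct \<Rightarrow> ('i \<Rightarrow> 'a) \<Rightarrow> bool) set"
  assumes "B \<subseteq> univ C" and "|B| <o \<kappa>" and "|I| <o \<kappa>" and sorts: "\<And>i. i \<in> I \<Longrightarrow> ss i \<in> Sorts L"
    and expr: "\<And>Q. Q \<in> \<Q> \<Longrightarrow> expressible L C I ss B Q"
    and fip: "\<And>\<F>. \<F> \<subseteq> \<Q> \<Longrightarrow> finite \<F> \<Longrightarrow>
      \<exists>a. (\<forall>i\<in>I. a i \<in> elts C (ss i)) \<and> (\<forall>Q\<in>\<F>. Q C a)"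
  shows "\<exists>a. (\<forall>i\<in>I. a i \<in> elts C (ss i)) \<and> (\<forall>Q\<in>\<Q>. Q C a)"
proof -
  \<comment> \<open>\<open>Z\<close> is a partial assignment given by its graph. Two pairs with the
    same index and different values make \<open>real\<close> false, so membership in
    \<open>\<Z>\<close> forces the graph to be a function.\<close>
  define real where "real Z \<F> \<longleftrightarrow> (\<exists>a. (\<forall>i\<in>I. a i \<in> elts C (ss i)) \<and> (\<forall>(i, x)\<in>Z. a i = x) \<and>
      (\<forall>Q\<in>\<F>. Q C a))" for Z \<F>
  define \<Z> where "\<Z> = {Z. fst ` Z \<subseteq> I \<and>
      (\<forall>Z' \<F>. Z' \<subseteq> Z \<and> finite Z' \<and> \<F> \<subseteq> \<Q> \<and> finite \<F> \<longrightarrow> real Z' \<F>)}"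
  have "\<exists>Z\<in>\<Z>. \<forall>X\<in>\<Z>. Z \<subseteq> X \<longrightarrow> X = Z"
  proof (rule subset_Zorn_nonempty)
    have "{} \<in> \<Z>" using fip by (auto simp: \<Z>_def real_def)
    then show "\<Z> \<noteq> {}" by blast
    fix \<C> assume ch: "\<C> \<noteq> {}" "subset.chain \<Z> \<C>"
    then have sub: "\<C> \<subseteq> \<Z>" by (auto simp: subset.chain_def)
    have "real Z' \<F>" if Z': "Z' \<subseteq> \<Union>\<C>" "finite Z'" and "\<F> \<subseteq> \<Q>" "finite \<F>" for Z' \<F>
    proof -
      obtain Z where "Z \<in> \<C>" "Z' \<subseteq> Z"
        using finite_subset_Union_chain[OF Z'(2,1) ch] by blast
      then show ?thesis using sub that by (auto simp: \<Z>_def)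
    qed
    moreover have "fst ` \<Union>\<C> \<subseteq> I" using sub by (auto simp: \<Z>_def)
    ultimately show "\<Union>\<C> \<in> \<Z>" by (auto simp: \<Z>_def)
  qed
  then obtain Z where Z: "Z \<in> \<Z>" and max: "\<And>X. X \<in> \<Z> \<Longrightarrow> Z \<subseteq> X \<Longrightarrow> X = Z" by blast
  have ZI: "fst ` Z \<subseteq> I" and real: "\<And>Z' \<F>. Z' \<subseteq> Z \<Longrightarrow> finite Z' \<Longrightarrow> \<F> \<subseteq> \<Q> \<Longrightarrow> finite \<F> \<Longrightarrow> real Z' \<F>"
    using Z by (auto simp: \<Z>_def)
  have "inj_on fst Z"
  proof (rule inj_onI)
    fix u v assume uv: "u \<in> Z" "v \<in> Z" "fst u = fst v"
    then have "real {u, v} {}" by (intro real) auto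
    then show "u = v" using uv by (cases u; cases v) (auto simp: real_def)
  qed
  then have "|Z| \<le>o |I|" using ZI card_of_ordLeq by blast
  then have "|snd ` Z| <o \<kappa>" using assms(3) card_of_image ordLeq_ordLess_trans by metis
  moreover have Zu: "x \<in> elts C (ss i)" if "(i, x) \<in> Z" for i x
  proof -
    have "real {(i, x)} {}" using that by (intro real) auto
    moreover have "i \<in> I" using that ZI by force
    ultimately show ?thesis by (auto simp: real_def)
  qed
  then have "snd ` Z \<subseteq> univ C" by (fastforce simp: elts_def)
  ultimately have B': "B \<union> snd ` Z \<subseteq> univ C" "|B \<union> snd ` Z| <o \<kappa>"
    using assms(1,2) by (auto intro: Un_less)
  have "fst ` Z = I"
  proof (rule ccontr)
    assume "fst ` Z \<noteq> I"
    then obtain i where i: "i \<in> I" "i \<notin> fst ` Z" using ZI by blast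
    \<comment> \<open>\<open>P\<close> says that \<open>x\<close> is a possible value at
      \<open>i\<close> for one finite part of the requirements; the type to be realised consists of
      all of these.\<close>
    define P where "P Z' \<F> x \<longleftrightarrow> real (insert (i, x) Z') \<F>" for Z' \<F> x
    have "\<exists>R. expressible L C (UNIV :: unit set) (\<lambda>_. ss i) (B \<union> snd ` Z) R \<and> (\<forall>x\<in>elts C (ss i). R C (\<lambda>_. x) \<longleftrightarrow> P Z' \<F> x)"
      if Z': "Z' \<subseteq> Z" "finite Z'" and \<F>: "\<F> \<subseteq> \<Q>" "finite \<F>" for Z' \<F>
    proof -
      define S where "S M' a \<longleftrightarrow> (\<forall>Q\<in>\<F>. Q M' a)" for M' and a :: "'i \<Rightarrow> 'a"
      have "expressible L C I ss B S"
        unfolding S_def using \<F> expr by (intro expressible_ball) auto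
      then obtain F where F: "finite F" "F \<subseteq> I" "expressible L C F ss B S"
        and supp: "\<And>M' a b. (\<And>i. i \<in> F \<Longrightarrow> a i = b i) \<Longrightarrow> S M' a \<longleftrightarrow> S M' b"
        by (rule expressible_support) blast
      define J where "J = insert i (F \<union> fst ` Z')"
      have J: "finite J" "J \<subseteq> I" "i \<in> J" using F Z' ZI i by (auto simp: J_def)
      let ?so = "case_option (ss i) ss" and ?B = "B \<union> snd ` Z"
      \<comment> \<open>\<open>None\<close> carries the candidate value and \<open>Some j\<close>
        the coordinate \<open>j\<close>. Only the finite set \<open>J\<close>, which contains the
        support of the finitely many conditions, is then quantified away.\<close>
      define U where "U M' b \<longleftrightarrow> S M' (\<lambda>j. b (Some j)) \<and> (\<forall>(j, y)\<in>Z'. b (Some j) = y) \<and>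
         b (Some i) = b None" for M' and b :: "'i option \<Rightarrow> 'a"
      have eqs: "expressible L C (Some ` J \<union> {None}) ?so ?B (\<lambda>M' b. b (Some (fst u)) = snd u)"
        if "u \<in> Z'" for u
      proof -
        have "(fst u, snd u) \<in> Z" using that Z' by auto
        then have "srt C (snd u) = ss (fst u)" "ss (fst u) \<in> Sorts L"
          using Zu sorts ZI by (force simp: elts_def)+
        moreover have "fst u \<in> J" using that by (auto simp: J_def)
        moreover have "snd u \<in> ?B" using that Z' by auto
        ultimately show ?thesis
          using expressible_eq[of C "Some ` J \<union> {None}" ?so ?B "ss (fst u)" "Inl (Some (fst u))" "Inr (snd u)" L]
          by auto
      qed
      have "expressible L C (Some ` J \<union> {None}) ?so ?B U"
        unfolding U_def case_prod_beta
      proof (intro expressible_conj expressible_ball Z'(2) eqs)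
        show "expressible L C (Some ` J \<union> {None}) ?so ?B (\<lambda>M' b. S M' (\<lambda>j. b (Some j)))"
          by (rule expressible_reindex[OF F(3)]) (auto simp: J_def)
        show "expressible L C (Some ` J \<union> {None}) ?so ?B (\<lambda>M' b. b (Some i) = b None)"
          by (rule expressible_eq_var) (use J sorts in auto)
      qed
      then have "expressible L C {None} ?so ?B (\<lambda>M' a. \<exists>b. (\<forall>k\<in>Some ` J. b k \<in> elts M' (?so k)) \<and>
          (\<forall>k. k \<notin> Some ` J \<longrightarrow> b k = a k) \<and> U M' b)"
        using J sorts by (intro expressible_ex_finite) auto
      then have "expressible L C (UNIV :: unit set) (\<lambda>_. ss i) ?B
          (\<lambda>M' a. \<exists>b. (\<forall>k\<in>Some ` J. b k \<in> elts M' (?so k)) \<and>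
          (\<forall>k. k \<notin> Some ` J \<longrightarrow> b k = a ()) \<and> U M' b)" (is "expressible _ _ _ _ _ ?R")
        by (rule expressible_reindex) auto
      moreover have "?R C (\<lambda>_. x) \<longleftrightarrow> P Z' \<F> x" for x
      proof
        assume "?R C (\<lambda>_. x)"
        then obtain b where b: "\<forall>k\<in>Some ` J. b k \<in> elts C (?so k)" "\<forall>k. k \<notin> Some ` J \<longrightarrow> b k = x" "U C b"
          by blast
        have "\<exists>a0. \<forall>j\<in>I. a0 j \<in> elts C (ss j)"
          using real[of "{}" "{}"] by (auto simp: real_def)
        then obtain a0 where a0: "\<forall>j\<in>I. a0 j \<in> elts C (ss j)" by blast
        \<comment> \<open>Coordinates outside \<open>J\<close> are read by none of these conditions
          and only need the right sort.\<close>
        let ?a = "\<lambda>j. if j \<in> J then b (Some j) else a0 j"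
        have "S C ?a" using b(3) supp[of ?a "\<lambda>j. b (Some j)" C] by (auto simp: U_def J_def)
        moreover have "\<forall>(j, y)\<in>insert (i, x) Z'. ?a j = y"
        proof -
          have "b (Some i) = x" using b(2,3) by (auto simp: U_def)
          moreover have "\<forall>(j, y)\<in>Z'. b (Some j) = y" using b(3) by (simp add: U_def)
          moreover have "\<forall>(j, y)\<in>Z'. j \<in> J" by (force simp: J_def)
          ultimately show ?thesis using J(3) by auto
        qed
        moreover have "\<forall>j\<in>I. ?a j \<in> elts C (ss j)" using a0 b(1) by auto
        ultimately show "P Z' \<F> x" unfolding P_def real_def S_def by (intro exI[of _ ?a] conjI)
      next
        assume "P Z' \<F> x"
        then obtain a where a: "\<forall>j\<in>I. a j \<in> elts C (ss j)"
          "\<forall>(j, y)\<in>insert (i, x) Z'. a j = y" "S C a"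
          unfolding P_def real_def S_def by blast
        let ?b = "\<lambda>k. if k \<in> Some ` J then a (the k) else x"
        have "S C (\<lambda>j. ?b (Some j))" using a(3) supp[of "\<lambda>j. ?b (Some j)" a C] by (auto simp: J_def)
        moreover have "\<forall>(j, y)\<in>Z'. ?b (Some j) = y" using a(2) by (force simp: J_def)
        moreover have "?b (Some i) = ?b None" using a(2) J(3) by auto
        ultimately have "U C ?b" unfolding U_def by blast
        moreover have "\<forall>k\<in>Some ` J. ?b k \<in> elts C (?so k)" using a(1) J(2) by auto
        ultimately show "?R C (\<lambda>_. x)" by (intro exI[of _ ?b]) auto
      qed
      ultimately show ?thesis by blast
    qed
    then obtain R where R: "\<And>Z' \<F>. Z' \<subseteq> Z \<Longrightarrow> finite Z' \<Longrightarrow> \<F> \<subseteq> \<Q> \<Longrightarrow> finite \<F> \<Longrightarrow>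
        expressible L C (UNIV :: unit set) (\<lambda>_. ss i) (B \<union> snd ` Z) (R Z' \<F>) \<and>
        (\<forall>x\<in>elts C (ss i). R Z' \<F> C (\<lambda>_. x) \<longleftrightarrow> P Z' \<F> x)"
      by metis
    define idx where "idx = {k. fst k \<subseteq> Z \<and> finite (fst k) \<and> snd k \<subseteq> \<Q> \<and> finite (snd k)}"
    have Rk: "expressible L C (UNIV :: unit set) (\<lambda>_. ss i) (B \<union> snd ` Z) (R (fst k) (snd k))"
      "\<And>x. x \<in> elts C (ss i) \<Longrightarrow> R (fst k) (snd k) C (\<lambda>_. x) \<longleftrightarrow> P (fst k) (snd k) x" if "k \<in> idx" for k
      using R[of "fst k" "snd k"] that by (auto simp: idx_def)
    have "\<exists>x\<in>elts C (ss i). \<forall>Q\<in>(\<lambda>k. R (fst k) (snd k)) ` idx. Q C (\<lambda>_. x)"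
    proof (rule saturated_expressible[OF B' sorts[OF i(1)]])
      fix Q assume "Q \<in> (\<lambda>k. R (fst k) (snd k)) ` idx"
      then show "expressible L C UNIV (\<lambda>_. ss i) (B \<union> snd ` Z) Q" using Rk(1) by auto
    next
      fix \<G> assume "\<G> \<subseteq> (\<lambda>k. R (fst k) (snd k)) ` idx" "finite \<G>"
      then obtain K where K: "K \<subseteq> idx" "finite K" "\<G> = (\<lambda>k. R (fst k) (snd k)) ` K"
        by (meson finite_subset_image)
      have Kd: "fst k \<subseteq> Z" "finite (fst k)" "snd k \<subseteq> \<Q>" "finite (snd k)" if "k \<in> K" for k
        using K(1) that by (auto simp: idx_def)
      \<comment> \<open>One family realises the union of finitely many requirements, and its value
        at \<open>i\<close> satisfies all of them.\<close>
      have "real (\<Union>(fst ` K)) (\<Union>(snd ` K))"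
        using K(2) Kd by (intro real) (blast+)
      then obtain a where a: "\<forall>j\<in>I. a j \<in> elts C (ss j)" "\<forall>(j, y)\<in>\<Union>(fst ` K). a j = y"
        "\<forall>Q\<in>\<Union>(snd ` K). Q C a" unfolding real_def by blast
      have "P (fst k) (snd k) (a i)" if "k \<in> K" for k
        unfolding P_def real_def
      proof (intro exI[of _ a] conjI a(1))
        show "\<forall>(j, y)\<in>insert (i, a i) (fst k). a j = y" using a(2) that by auto
        show "\<forall>Q\<in>snd k. Q C a" using a(3) that by auto
      qed
      then have "\<forall>Q\<in>\<G>. Q C (\<lambda>_. a i)" using K(1,3) Rk(2) a(1) i(1) by auto
      then show "\<exists>x\<in>elts C (ss i). \<forall>Q\<in>\<G>. Q C (\<lambda>_. x)" using a(1) i(1) by auto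
    qed
    then obtain x where x1: "x \<in> elts C (ss i)" "\<forall>k\<in>idx. R (fst k) (snd k) C (\<lambda>_. x)" by auto
    then have x: "x \<in> elts C (ss i)" "\<And>k. k \<in> idx \<Longrightarrow> P (fst k) (snd k) x" using Rk(2) by simp_all
    have "insert (i, x) Z \<in> \<Z>"
      unfolding \<Z>_def
    proof (intro CollectI conjI allI impI)
      show "fst ` insert (i, x) Z \<subseteq> I" using ZI i by auto
      fix Z' \<F> assume *: "Z' \<subseteq> insert (i, x) Z \<and> finite Z' \<and> \<F> \<subseteq> \<Q> \<and> finite \<F>"
      then have "(Z' - {(i, x)}, \<F>) \<in> idx" unfolding idx_def by auto
      from x(2)[OF this] have "real (insert (i, x) (Z' - {(i, x)})) \<F>" by (simp add: P_def)
      then show "real Z' \<F>" unfolding real_def by auto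
    qed
    then have "(i, x) \<in> Z" using max[of "insert (i, x) Z"] by blast
    then show False using i(2) by (auto simp: image_iff)
  qed
  then have "\<forall>i\<in>I. \<exists>x. (i, x) \<in> Z" by force
  then obtain a where a: "\<And>i. i \<in> I \<Longrightarrow> (i, a i) \<in> Z" by metis
  have Qa: "Q C a" if Q: "Q \<in> \<Q>" for Q
  proof -
    obtain F where F: "finite F" "F \<subseteq> I"
      and supp: "\<And>M' a b. (\<And>i. i \<in> F \<Longrightarrow> a i = b i) \<Longrightarrow> Q M' a \<longleftrightarrow> Q M' b"
      using expr[OF Q] by (rule expressible_support) blast
    have "real ((\<lambda>i. (i, a i)) ` F) {Q}" using F a Q by (intro real) auto
    then obtain b where "\<forall>i\<in>F. b i = a i" "Q C b" unfolding real_def by auto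
    then show ?thesis using supp[of b a C] by simp
  qed
  show ?thesis
  proof (intro exI[of _ a] conjI ballI)
    show "a i \<in> elts C (ss i)" if "i \<in> I" for i using a[OF that] by (rule Zu)
    show "Q C a" if "Q \<in> \<Q>" for Q using that by (rule Qa)
  qed
qed

text \<open>Strong homogeneity concerns elementary maps on sets, over no parameters. A pair of
  tuples over \<open>A\<close> becomes such a map on the union of \<open>A\<close> with the entries
  of \<open>a\<close>, once each repeated entry is given one index; the equalities in the common
  type make this choice harmless.\<close>

lemma homogeneous_many:
  fixes a a' :: "'i \<Rightarrow> 'a"
  assumes "A \<subseteq> univ C" and "|A| <o \<kappa>" and "|I| <o \<kappa>" and sorts: "\<And>i. i \<in> I \<Longrightarrow> ss i \<in> Sorts L"
    and a: "\<And>i. i \<in> I \<Longrightarrow> a i \<in> elts C (ss i)" and a': "\<And>i. i \<in> I \<Longrightarrow> a' i \<in> elts C (ss i)"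
    and eq: "\<And>Q. expressible L C I ss A Q \<Longrightarrow> Q C a \<longleftrightarrow> Q C a'"
  shows "\<exists>\<sigma>\<in>auts L C A. \<forall>i\<in>I. \<sigma> (a i) = a' i"
proof -
  define B where "B = a ` I \<union> A"
  define t where "t b = (if b \<in> A then Inr b else Inl (inv_into I a b))" for b
  define f where "f b = case_sum a' (\<lambda>b. b) (t b)" for b
  have tb: "admissible C I ss A (srt C b) (t b)" "case_sum a (\<lambda>b. b) (t b) = b" if "b \<in> B" for b
    using that a[of "inv_into I a b"] f_inv_into_f[of b a I] inv_into_into[of b a I]
    by (auto simp: B_def t_def elts_def)
  have fb: "f b \<in> elts C (srt C b)" if "b \<in> B" for b
    using tb(1)[OF that] a' assms(1) by (cases "t b") (auto simp: f_def elts_def)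
  have "tp L C B f {} = tp L C B (\<lambda>b. b) {}"
  proof -
    have "pformulas L C B (\<lambda>i. srt C (f i)) {} = pformulas L C B (srt C) {}"
      using fb by (auto simp: pformulas_def elts_def split: sum.splits)
    moreover have "psat C f p \<longleftrightarrow> psat C (\<lambda>b. b) p" if p: "p \<in> pformulas L C B (srt C) {}" for p
    proof -
      have e: "expressible L C B (srt C) {} (\<lambda>M' a. psat M' a p)" using p by blast
      obtain F where F: "F \<subseteq> B" "\<And>M' a b. (\<And>i. i \<in> F \<Longrightarrow> a i = b i) \<Longrightarrow> psat M' a p \<longleftrightarrow> psat M' b p"
        using e by (rule expressible_support) blast
      have "expressible L C I ss A (\<lambda>M' a. psat M' (\<lambda>b. case_sum a (\<lambda>b. b) (t b)) p)"
        by (rule expressible_subst[OF e]) (auto intro: tb)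
      then have "psat C (\<lambda>b. case_sum a (\<lambda>b. b) (t b)) p \<longleftrightarrow> psat C f p"
        unfolding f_def by (rule eq)
      moreover have "psat C (\<lambda>b. case_sum a (\<lambda>b. b) (t b)) p \<longleftrightarrow> psat C (\<lambda>b. b) p"
        by (rule F(2)) (use F(1) tb in auto)
      ultimately show ?thesis by simp
    qed
    ultimately show ?thesis by (auto simp: tp_def)
  qed
  moreover have "B \<subseteq> univ C" using a assms(1) by (auto simp: B_def elts_def)
  moreover have "|a ` I| <o \<kappa>" using assms(3) card_of_image ordLeq_ordLess_trans by metis
  then have "|B| <o \<kappa>" unfolding B_def using assms(2) by (rule Un_less)
  moreover have "f ` B \<subseteq> univ C" using fb by (auto simp: elts_def)
  ultimately obtain g where g: "g \<in> auts L C {}" "\<forall>b\<in>B. g b = f b"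
    using homogeneous unfolding strongly_homogeneous_def by meson
  have "g \<in> auts L C A" using g by (auto simp: auts_def B_def f_def t_def)
  moreover have "g (a i) = a' i" if i: "i \<in> I" for i
  proof (cases "a i \<in> A")
    case True
    \<comment> \<open>An entry lying in \<open>A\<close> is named there, so its counterpart must be
      the same element.\<close>
    have "expressible L C I ss A (\<lambda>M' a'. a' i = a i)"
      using expressible_eq[of C I ss A "ss i" "Inl i" "Inr (a i)" L] True i a[OF i] sorts
      by (simp add: elts_def)
    then have "a' i = a i" using eq by blast
    then show ?thesis using g True i by (simp add: B_def f_def t_def)
  next
    case False
    let ?j = "inv_into I a (a i)"
    have j: "?j \<in> I" "a ?j = a i" using i by (auto intro: inv_into_into f_inv_into_f)
    then have "ss ?j = ss i" using a[OF j(1)] a[OF i] by (simp add: elts_def)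
    \<comment> \<open>\<open>f\<close> used the index \<open>?j\<close> for the element
      \<open>a i\<close>; the coincidence of two entries is part of the type and so carries over to
      \<open>a'\<close>.\<close>
    then have "expressible L C I ss A (\<lambda>M' a. a ?j = a i)"
      using i j sorts by (intro expressible_eq_var) auto
    then have "a' ?j = a' i" using eq j by blast
    then show ?thesis using g False i by (simp add: B_def f_def t_def)
  qed
  ultimately show ?thesis by blast
qed

end

section \<open>Few formulas suffice\<close>

text \<open>A substitution map is a total function with arbitrary values off the free variables, so
  the pairs themselves are too many to count. Keeping one pair for each formula and each list of
  values on its free variables loses no condition.\<close>

lemma pformulas_representatives:
  fixes r :: "'k rel"
  assumes r: "Cinfinite r" and "|formulas L| \<le>o r" and "|I| \<le>o r" and "|B| \<le>o r"
  obtains P where "P \<subseteq> pformulas L M I ss B" and "|P| \<le>o r"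
    and "\<And>p. p \<in> pformulas L M I ss B \<Longrightarrow> \<exists>q\<in>P. \<forall>M' a. psat M' a q \<longleftrightarrow> psat M' a p"
proof -
  have "\<forall>\<phi> :: ('a, 'b, 'c) fm. \<exists>l. set l = fv \<phi>" using finite_list[OF finite_fv] by blast
  then obtain vs where vs: "\<And>\<phi> :: ('a, 'b, 'c) fm. set (vs \<phi>) = fv \<phi>" by metis
  define pack where "pack k = (fst k, \<lambda>v. the (map_of (zip (vs (fst k)) (snd k)) v))"
    for k :: "('a, 'b, 'c) fm \<times> ('d + 'e) list"
  let ?K = "formulas L \<times> lists (Inl ` I \<union> Inr ` B)"
  define P where "P = pack ` ?K \<inter> pformulas L M I ss B"
  have "|Inl ` I \<union> Inr ` B :: ('d + 'e) set| \<le>o r"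
    by (intro Un_Cinfinite_bound r card_of_le_trans_image[OF order_refl] assms(3,4))
  then have "|lists (Inl ` I \<union> Inr ` B :: ('d + 'e) set)| \<le>o r" by (rule card_of_lists_le[OF r])
  then have "|?K| \<le>o r"
    using r assms(2) by (intro card_of_Times_ordLeq_infinite_Field) (auto simp: cinfinite_def)
  then have "|P| \<le>o r" by (intro card_of_le_trans_image[of P pack ?K]) (auto simp: P_def)
  moreover have "\<exists>q\<in>P. \<forall>M' a. psat M' a q \<longleftrightarrow> psat M' a p" if p: "p \<in> pformulas L M I ss B" for p
  proof -
    obtain \<phi> \<rho> where p_eq: "p = (\<phi>, \<rho>)" by (cases p)
    let ?q = "pack (\<phi>, map \<rho> (vs \<phi>))"
    have q: "fst ?q = \<phi>" "snd ?q v = \<rho> v" if "v \<in> fv \<phi>" for v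
      using that by (auto simp: pack_def map_of_zip_map vs)
    have q1: "fst ?q = \<phi>" by (simp add: pack_def)
    have adm: "admissible M I ss B (snd v) (\<rho> v)" if "v \<in> fv \<phi>" for v
      using p that by (simp add: p_eq pformulas_iff)
    have "\<rho> v \<in> Inl ` I \<union> Inr ` B" if "v \<in> fv \<phi>" for v
      using adm[OF that] by (cases "\<rho> v") auto
    then have "set (map \<rho> (vs \<phi>)) \<subseteq> Inl ` I \<union> Inr ` B" by (auto simp only: set_map vs)
    moreover have "\<phi> \<in> formulas L" using p by (simp add: p_eq pformulas_def)
    ultimately have "(\<phi>, map \<rho> (vs \<phi>)) \<in> ?K" by (simp add: in_lists_conv_set subset_iff)
    then have "?q \<in> pack ` ?K" by (rule imageI)
    moreover have "?q \<in> pformulas L M I ss B"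
      using p q adm q1 by (cases ?q) (auto simp: p_eq pformulas_iff)
    ultimately have "?q \<in> P" by (simp add: P_def)
    moreover have "psat M' a ?q \<longleftrightarrow> psat M' a p" for M' :: "('a, 'b, 'c, 'e) struct" and a
    proof -
      have "psat M' a (fst ?q, snd ?q) \<longleftrightarrow> psat M' a (\<phi>, \<rho>)"
        unfolding psat_Pair q1 by (rule sat_cong) (simp add: q(2))
      then show ?thesis by (simp add: p_eq)
    qed
    ultimately show ?thesis by blast
  qed
  ultimately show ?thesis using that[of P] by (auto simp: P_def)
qed

lemma card_of_Sorts: "|Sorts L| \<le>o |formulas L|"
proof -
  have "inj_on (\<lambda>s. Eq (Var (0, s)) (Var (0, s))) (Sorts L)" by (auto simp: inj_on_def)
  moreover have "(\<lambda>s. Eq (Var (0, s)) (Var (0, s))) ` Sorts L \<subseteq> formulas L"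
    by (auto simp: formulas_def)
  ultimately show ?thesis using card_of_ordLeq by blast
qed

text \<open>A type is a set of such pairs and cannot be counted directly. A point is coded instead
  by the set of representatives it satisfies, a subset of \<open>P\<close>.\<close>

lemma types_bound:
  fixes i :: 'i and N :: "('s, 'f, 'r, 'a) struct"
  assumes r: "Cinfinite r" and "|formulas L| \<le>o r" and "|B| \<le>o r"
  obtains P :: "('s, 'f, 'r, 'a, 'i) pfm set" and F where "|P| \<le>o r" and "\<And>x. F x \<subseteq> P"
    and "\<And>x y. x \<in> elts N s \<Longrightarrow> y \<in> elts N s \<Longrightarrow> F x = F y
      \<Longrightarrow> tp L N {i} (\<lambda>_. x) B = tp L N {i} (\<lambda>_. y) B"
proof -
  have "|{i}| \<le>o r" using r by (intro ordLess_imp_ordLeq finite_ordLess_infinite)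
      (auto simp: cinfinite_def card_of_well_order_on card_order_on_well_order_on Field_card_of)
  then obtain P where P: "P \<subseteq> pformulas L N {i} (\<lambda>_. s) B" "|P| \<le>o r"
    "\<And>p. p \<in> pformulas L N {i} (\<lambda>_. s) B \<Longrightarrow> \<exists>q\<in>P. \<forall>M' a. psat M' a q \<longleftrightarrow> psat M' a p"
    using pformulas_representatives[OF r assms(2) _ assms(3), of "{i}"] by metis
  show ?thesis
  proof (rule that[of P "\<lambda>x. {q \<in> P. psat N (\<lambda>_. x) q}"])
    fix x y assume xy: "x \<in> elts N s" "y \<in> elts N s"
      and eq: "{q \<in> P. psat N (\<lambda>_. x) q} = {q \<in> P. psat N (\<lambda>_. y) q}"
    have "psat N (\<lambda>_. x) p \<longleftrightarrow> psat N (\<lambda>_. y) p" if p: "p \<in> pformulas L N {i} (\<lambda>_. s) B" for p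
    proof -
      obtain q where "q \<in> P" "\<forall>M' a. psat M' a q \<longleftrightarrow> psat M' a p" using P(3)[OF p] by blast
      then show ?thesis using eq by blast
    qed
    then show "tp L N {i} (\<lambda>_. x) B = tp L N {i} (\<lambda>_. y) B"
      using xy by (auto simp: tp_def elts_def)
  qed (use P(2) in auto)
qed

section \<open>Elementary substructures\<close>

lemma elts_restrict [simp]: "elts (M\<lparr>univ := B\<rparr>) s = {x \<in> B. srt M x = s}"
  by (simp add: elts_def)

lemma val_restrict [simp]: "val (M\<lparr>univ := B\<rparr>) e t = val M e t"
proof (induction t)
  case (App f ts)
  then have "map (val (M\<lparr>univ := B\<rparr>) e) ts = map (val M e) ts" by simp
  then show ?case by (simp only: val.simps) simp
qed simp

lemma elem_sub_expressible:
  assumes "elem_sub L B N" and "expressible L N I ss B Q"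
    and "\<And>i. i \<in> I \<Longrightarrow> a i \<in> B \<and> srt N (a i) = ss i"
  shows "Q (N\<lparr>univ := B\<rparr>) a \<longleftrightarrow> Q N a"
proof -
  obtain \<phi> \<rho> where 1: "(\<phi>, \<rho>) \<in> pformulas L N I ss B" "\<And>M' a. psat M' a (\<phi>, \<rho>) \<longleftrightarrow> Q M' a"
    using assms(2) unfolding expressible_def by (metis surj_pair)
  have "case_sum a (\<lambda>b. b) (\<rho> v) \<in> elts (N\<lparr>univ := B\<rparr>) (snd v)" if "v \<in> fv \<phi>" for v
  proof -
    have "admissible N I ss B (snd v) (\<rho> v)" using 1 that by (simp add: pformulas_iff)
    then show ?thesis using assms(3) by (cases "\<rho> v") auto
  qed
  moreover have "\<phi> \<in> formulas L" using 1 by (simp add: pformulas_def)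
  ultimately have "psat (N\<lparr>univ := B\<rparr>) a (\<phi>, \<rho>) \<longleftrightarrow> psat N a (\<phi>, \<rho>)"
    using assms(1) unfolding elem_sub_def psat_Pair by simp
  then show ?thesis using 1(2) by simp
qed

text \<open>The existence of a witness is a condition without free indices, hence has the same truth
  value in the substructure; as one formula expresses the condition in all structures, the witness
  found there also works in \<open>N\<close>.\<close>

lemma elem_sub_witness:
  assumes "elem_sub L B N" and "s \<in> Sorts L" and "expressible L N (UNIV :: unit set) (\<lambda>_. s) B Q"
    and "\<exists>x\<in>elts N s. Q N (\<lambda>_. x)"
  shows "\<exists>x\<in>B. x \<in> elts N s \<and> Q N (\<lambda>_. x)"
proof -
  have u: "insert () {} = (UNIV :: unit set)" "a(() := x) = (\<lambda>_. x)" for a :: "unit \<Rightarrow> 'd" and x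
    by auto
  have "expressible L N {} (\<lambda>_. s) B (\<lambda>M' a. \<exists>x\<in>elts M' s. Q M' (a(() := x)))"
    using assms(2,3) by (intro expressible_ex) (simp_all add: u)
  from elem_sub_expressible[OF assms(1) this, of undefined]
  have "(\<exists>x\<in>elts (N\<lparr>univ := B\<rparr>) s. Q (N\<lparr>univ := B\<rparr>) (\<lambda>_. x)) \<longleftrightarrow> (\<exists>x\<in>elts N s. Q N (\<lambda>_. x))"
    by (simp add: u)
  then obtain x where x: "x \<in> B" "srt N x = s" "Q (N\<lparr>univ := B\<rparr>) (\<lambda>_. x)"
    using assms(4) by auto
  then have "Q N (\<lambda>_. x)"
    using elem_sub_expressible[OF assms(1,3), of "\<lambda>_. x"] by simp
  moreover have "x \<in> univ N" using x(1) assms(1) by (auto simp: elem_sub_def)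
  ultimately show ?thesis using x by (auto simp: elts_def)
qed

text \<open>With no function symbols there is no closure to check, and the witness property alone
  yields a substructure with nonempty sorts.\<close>

lemma tarski_vaught:
  fixes N :: "('s, 'f, 'r, 'a) struct"
  assumes "is_struct L N" and "Funs L = {}" and B: "B \<subseteq> univ N"
    and wit: "\<And>s Q. s \<in> Sorts L \<Longrightarrow> expressible L N (UNIV :: unit set) (\<lambda>_. s) B Q
      \<Longrightarrow> \<exists>x\<in>elts N s. Q N (\<lambda>_. x) \<Longrightarrow> \<exists>x\<in>B. x \<in> elts N s \<and> Q N (\<lambda>_. x)"
  shows "elem_sub L B N"
proof -
  have "sat (N\<lparr>univ := B\<rparr>) e \<phi> \<longleftrightarrow> sat N e \<phi>"
    if "wf_fm L \<phi>" "\<And>v. v \<in> fv \<phi> \<Longrightarrow> e v \<in> B \<and> e v \<in> elts N (snd v)" for \<phi> e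
    using that
  proof (induction \<phi> arbitrary: e)
    case (Rel r ts)
    have "map (val (N\<lparr>univ := B\<rparr>) e) ts = map (val N e) ts" by simp
    then show ?case by (simp only: sat.simps) simp
  next
    case (Imp \<phi> \<psi>)
    then show ?case by simp
  next
    case (All v \<phi>)
    \<comment> \<open>The assignment supplies parameters for all variables but the quantified one,
      which turns the negated body into a condition on one element.\<close>
    let ?\<rho> = "\<lambda>w. if w = v then Inl () else Inr (e w)"
    have eq: "sat (N\<lparr>univ := B\<rparr>) (e(v := x)) \<phi> \<longleftrightarrow> sat N (e(v := x)) \<phi>"
      if "x \<in> B" "x \<in> elts N (snd v)" for x
      by (rule All.IH) (use All.prems that in auto)
    have ps: "psat M' (\<lambda>_. x) (Neg \<phi>, ?\<rho>) \<longleftrightarrow> \<not> sat M' (e(v := x)) \<phi>" for M' and x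
    proof -
      have "(\<lambda>w. case_sum (\<lambda>_. x) (\<lambda>b. b) (?\<rho> w)) = e(v := x)" by auto
      then show ?thesis by (simp add: psat_Pair del: fun_upd_apply)
    qed
    have "(Neg \<phi>, ?\<rho>) \<in> pformulas L N UNIV (\<lambda>_. snd v) B"
      using All.prems by (auto simp: pformulas_iff elts_def)
    then have "expressible L N UNIV (\<lambda>_. snd v) B (\<lambda>M' a. psat M' a (Neg \<phi>, ?\<rho>))" by blast
    from wit[OF _ this] have "\<exists>x\<in>elts N (snd v). \<not> sat N (e(v := x)) \<phi>
        \<Longrightarrow> \<exists>x\<in>B. x \<in> elts N (snd v) \<and> \<not> sat N (e(v := x)) \<phi>"
      using All.prems(1) unfolding ps by simp
    then have "(\<forall>x\<in>elts N (snd v). sat N (e(v := x)) \<phi>)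
        \<longleftrightarrow> (\<forall>x\<in>B. x \<in> elts N (snd v) \<longrightarrow> sat N (e(v := x)) \<phi>)" by blast
    moreover have "elts (N\<lparr>univ := B\<rparr>) (snd v) = {x \<in> B. x \<in> elts N (snd v)}"
      using B by (auto simp: elts_def)
    ultimately show ?case using eq by (simp del: elts_restrict fun_upd_apply) blast
  qed simp_all
  moreover have "is_struct L (N\<lparr>univ := B\<rparr>)"
  proof -
    have "s \<in> srt N ` B" if s: "s \<in> Sorts L" for s
    proof -
      have "\<exists>x. x \<in> elts N s" using assms(1) s by (force simp: is_struct_def elts_def)
      \<comment> \<open>The trivially true condition yields a point of each sort in
        \<open>B\<close>.\<close>
      moreover have "expressible L N (UNIV :: unit set) (\<lambda>_. s) B (\<lambda>M' a. \<not> False)"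
        by (intro expressible_not expressible_False)
      ultimately have "\<exists>x\<in>B. x \<in> elts N s" using wit[OF s] by blast
      then show ?thesis by (auto simp: elts_def)
    qed
    moreover have "srt N ` B \<subseteq> Sorts L" using B assms(1) by (auto simp: is_struct_def)
    ultimately show ?thesis using assms(2) by (auto simp: is_struct_def)
  qed
  ultimately show ?thesis using B unfolding elem_sub_def formulas_def
    by (auto simp: elts_def subset_iff)
qed

text \<open>Witnesses are added only for representatives of conditions, so no stage has more
  elements than there are formulas; countably many stages suffice because a condition has finitely
  many parameters.\<close>

theorem lowenheim_skolem:
  fixes N :: "('s, 'f, 'r, 'a) struct"
  assumes "is_struct L N" and "Funs L = {}"
  obtains B where "elem_sub L B N" and "|B| \<le>o |formulas L|"
proof -
  let ?r = "|formulas L|"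
  have r: "Cinfinite ?r" by (rule Cinfinite_formulas)
  have r1: "|UNIV :: unit set| \<le>o ?r" using r by (intro ordLess_imp_ordLeq finite_ordLess_infinite)
      (auto simp: cinfinite_def card_of_well_order_on card_order_on_well_order_on Field_card_of)
  define good where "good s B P \<longleftrightarrow> P \<subseteq> pformulas L N (UNIV :: unit set) (\<lambda>_. s) B \<and> |P| \<le>o ?r \<and>
     (\<forall>p\<in>pformulas L N (UNIV :: unit set) (\<lambda>_. s) B. \<exists>q\<in>P. \<forall>M' a. psat M' a q \<longleftrightarrow> psat M' a p)"
    for s B P
  define reps where "reps s B = (SOME P. good s B P)" for s B
  have reps: "good s B (reps s B)" if "|B| \<le>o ?r" for s B
  proof -
    have "|formulas L| \<le>o ?r" by (simp add: ordLeq_refl card_of_Card_order)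
    from pformulas_representatives[OF r this r1 that, of N "\<lambda>_. s"]
    have "\<exists>P. good s B P" unfolding good_def by metis
    then show ?thesis unfolding reps_def by (rule someI_ex)
  qed
  define wit where "wit s p = (SOME x. x \<in> elts N s \<and> psat N (\<lambda>_. x) p)"
    for s and p :: "('s, 'f, 'r, 'a, unit) pfm"
  have wit: "wit s p \<in> elts N s \<and> psat N (\<lambda>_. wit s p) p"
    if "\<exists>x\<in>elts N s. psat N (\<lambda>_. x) p" for s p
    using someI_ex[of "\<lambda>x. x \<in> elts N s \<and> psat N (\<lambda>_. x) p"] that unfolding wit_def by blast
  define W where "W B s = wit s ` {p \<in> reps s B. \<exists>x\<in>elts N s. psat N (\<lambda>_. x) p}" for B s
  define step where "step B = B \<union> (\<Union>s\<in>Sorts L. W B s)" for B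
  define Bn where "Bn n = (step ^^ n) {}" for n
  have Suc: "Bn (Suc n) = step (Bn n)" for n by (simp add: Bn_def)
  have card: "|Bn n| \<le>o ?r" for n
  proof (induction n)
    case 0
    then show ?case by (simp add: Bn_def card_of_empty)
  next
    case (Suc n)
    have "|W (Bn n) s| \<le>o ?r" for s
    proof -
      have "|reps s (Bn n)| \<le>o ?r" using reps[OF Suc] by (simp add: good_def)
      then show ?thesis unfolding W_def
        by (rule card_of_le_trans_image[rotated]) auto
    qed
    then have "|\<Union>s\<in>Sorts L. W (Bn n) s| \<le>o ?r"
      using UNION_Cinfinite_bound[OF card_of_Sorts _ r] by blast
    then show ?case unfolding \<open>Bn (Suc n) = step (Bn n)\<close> step_def
      using Suc r by (intro Un_Cinfinite_bound)
  qed
  have mono: "m \<le> n \<Longrightarrow> Bn m \<subseteq> Bn n" for m n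
    by (rule lift_Suc_mono_le[of Bn]) (auto simp: Suc step_def)
  have sub: "Bn n \<subseteq> univ N" for n
  proof (induction n)
    case 0
    then show ?case by (simp add: Bn_def)
  next
    case (Suc n)
    have "W (Bn n) s \<subseteq> univ N" for s using wit by (auto simp: W_def elts_def)
    then show ?case using Suc unfolding \<open>Bn (Suc n) = step (Bn n)\<close> step_def by blast
  qed
  let ?B = "\<Union>n. Bn n"
  have "elem_sub L ?B N"
  proof (rule tarski_vaught[OF assms])
    show "?B \<subseteq> univ N" using sub by blast
    fix s Q assume s: "s \<in> Sorts L" and Q: "expressible L N (UNIV :: unit set) (\<lambda>_. s) ?B Q"
      and ex: "\<exists>x\<in>elts N s. Q N (\<lambda>_. x)"
    obtain B0 where B0: "finite B0" "B0 \<subseteq> ?B" "expressible L N (UNIV :: unit set) (\<lambda>_. s) B0 Q"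
      using Q by (rule expressible_params)
    have "\<exists>n. B0 \<subseteq> Bn n" using B0(1,2)
    proof (induction B0)
      case (insert b F)
      then obtain m n where "F \<subseteq> Bn n" "b \<in> Bn m" by auto
      then show ?case using mono[of n "max m n"] mono[of m "max m n"] by auto
    qed simp
    then obtain n where n: "B0 \<subseteq> Bn n" by blast
    have "expressible L N (UNIV :: unit set) (\<lambda>_. s) (Bn n) Q"
      using B0(3) _ n by (rule expressible_mono) simp
    then obtain p where p: "p \<in> pformulas L N (UNIV :: unit set) (\<lambda>_. s) (Bn n)"
      "\<And>M' a. psat M' a p \<longleftrightarrow> Q M' a" unfolding expressible_def by blast
    obtain q where q: "q \<in> reps s (Bn n)" "\<And>M' a. psat M' a q \<longleftrightarrow> psat M' a p"
      using reps[OF card[of n], of s] p(1) unfolding good_def by blast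
    have exq: "\<exists>x\<in>elts N s. psat N (\<lambda>_. x) q" using ex q(2) p(2) by simp
    then have "wit s q \<in> W (Bn n) s" using q(1) by (auto simp: W_def)
    then have "wit s q \<in> Bn (Suc n)" using s by (auto simp: Suc step_def)
    moreover have "wit s q \<in> elts N s" "Q N (\<lambda>_. wit s q)" using wit[OF exq] p(2) q(2) by auto
    ultimately show "\<exists>x\<in>?B. x \<in> elts N s \<and> Q N (\<lambda>_. x)" by blast
  qed
  moreover have "|?B| \<le>o ?r"
  proof (rule UNION_Cinfinite_bound[OF _ _ r])
    show "|UNIV :: nat set| \<le>o ?r"
      using r by (meson card_of_nat natLeq_ordLeq_cinfinite ordIso_ordLeq_trans)
  qed (simp add: card)
  ultimately show ?thesis by (rule that)
qed

section \<open>Conditions on elements of a definable group\<close>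

lemma finite_less_Cinfinite:
  assumes "Cinfinite r" and "finite B"
  shows "|B| <o r"
  using assms finite_ordLess_infinite[of "|B|" r] card_of_well_order_on[of B]
  by (simp add: cinfinite_def Field_card_of card_order_on_well_order_on)

lemma card_of_Times_finite:
  assumes "Cinfinite r" and "|K| <o r" and "finite F"
  shows "|K \<times> F| <o r"
proof (cases "finite K")
  case True
  then show ?thesis using assms by (intro finite_less_Cinfinite) auto
next
  case False
  then have "Cinfinite |K|" by (simp add: cinfinite_def Field_card_of card_of_card_order_on)
  then have "|F| \<le>o |K|" using assms(3) by (intro ordLess_imp_ordLeq finite_less_Cinfinite)
  then have "|K \<times> F| \<le>o |K|" using False
    by (intro card_of_Times_ordLeq_infinite_Field) (auto simp: Field_card_of card_of_Card_order ordLeq_refl card_of_card_order_on)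
  then show ?thesis using assms(2) by (rule ordLeq_ordLess_trans)
qed

lemma expressible_cong_valuation:
  assumes "expressible L M I ss B Q" and "\<And>i. i \<in> I \<Longrightarrow> a i = b i"
  shows "Q M' a \<longleftrightarrow> Q M' b"
proof -
  obtain F where "F \<subseteq> I" "\<And>M' a b. (\<And>i. i \<in> F \<Longrightarrow> a i = b i) \<Longrightarrow> Q M' a \<longleftrightarrow> Q M' b"
    using assms(1) by (rule expressible_support) blast
  then show ?thesis using assms(2) by blast
qed

text \<open>Here \<open>A\<close> is only assumed to have fewer than \<open>\<kappa>\<close>
  elements; the exponential bound in \<open>small\<close> enters with the torsor. The locale is used
  a second time over a larger parameter set.\<close>

locale definable_group_struct = monster_struct L \<kappa> C
  for L :: "('s, 'f, 'r) signature" and \<kappa> :: "'k rel" and C :: "('s, 'f, 'r, 'a) struct" +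
  fixes A :: "'a set" and ss :: "'s list" and G :: "'a list monoid" (structure)
  assumes A_univ: "A \<subseteq> univ C" and A_less: "|A| <o \<kappa>" and dgroup: "definable_group L C A ss G"
begin

sublocale group G using dgroup by (simp add: definable_group_def)

abbreviation "len \<equiv> length ss"

abbreviation coords :: "('i \<Rightarrow> 'a list) \<Rightarrow> 'i \<times> nat \<Rightarrow> 'a" where
  "coords x \<equiv> \<lambda>k. x (fst k) ! snd k"

lemma carrier_tuples: "carrier G \<subseteq> tuples C ss"
  using dgroup by (auto simp: definable_group_def definable_def)

lemma carrier_nth:
  assumes "x \<in> carrier G"
  shows "length x = len" and "i < len \<Longrightarrow> x ! i \<in> elts C (ss ! i)" and "set x \<subseteq> univ C"
proof -
  have *: "set x \<subseteq> univ C" "map (srt C) x = ss" using carrier_tuples assms by (auto simp: tuples_def)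
  then show "length x = len" "set x \<subseteq> univ C" by auto
  show "x ! i \<in> elts C (ss ! i)" if "i < len"
  proof -
    have i: "i < length x" using that *(2) by auto
    then have "srt C (x ! i) = ss ! i" using *(2) by (metis nth_map)
    then show ?thesis using *(1) nth_mem[OF i] by (auto simp: elts_def)
  qed
qed

lemma sort_nth: "i < len \<Longrightarrow> ss ! i \<in> Sorts L"
  using carrier_nth(2)[OF one_closed, of i] is_struct
  by (simp add: elts_def is_struct_def) (metis imageI)

text \<open>The formula has to agree with \<open>Q\<close> only on families from \<open>G\<close>.
  Hence \<open>Q\<close> may use products and inverses freely, and the formula of the carrier
  appears only where elements are quantified, realised or collected into a definable set.\<close>

definition gpred :: "'a set \<Rightarrow> 'i set \<Rightarrow> (('i \<Rightarrow> 'a list) \<Rightarrow> bool) \<Rightarrow> bool" where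
  "gpred B K Q \<longleftrightarrow> (\<exists>R. expressible L C (K \<times> {..<len}) (\<lambda>k. ss ! snd k) B R \<and>
     (\<forall>x. (\<forall>k\<in>K. x k \<in> carrier G) \<longrightarrow> (R C (coords x) \<longleftrightarrow> Q x)))"

lemma gpredI:
  assumes "expressible L C (K \<times> {..<len}) (\<lambda>k. ss ! snd k) B R"
    and "\<And>x. \<forall>k\<in>K. x k \<in> carrier G \<Longrightarrow> R C (coords x) \<longleftrightarrow> Q x"
  shows "gpred B K Q"
  unfolding gpred_def using assms by blast

lemma gpredE:
  assumes "gpred B K Q"
  obtains R where "expressible L C (K \<times> {..<len}) (\<lambda>k. ss ! snd k) B R"
    and "\<And>x. \<forall>k\<in>K. x k \<in> carrier G \<Longrightarrow> R C (coords x) \<longleftrightarrow> Q x"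
  using assms unfolding gpred_def by blast

lemma gpred_cong:
  assumes "gpred B K Q" and "\<And>x. \<forall>k\<in>K. x k \<in> carrier G \<Longrightarrow> Q x \<longleftrightarrow> Q' x"
  shows "gpred B K Q'"
  using assms unfolding gpred_def by meson

lemma gpred_imp:
  assumes "gpred B K Q" and "gpred B K Q'"
  shows "gpred B K (\<lambda>x. Q x \<longrightarrow> Q' x)"
proof -
  obtain R R' where
    "expressible L C (K \<times> {..<len}) (\<lambda>k. ss ! snd k) B R"
    "expressible L C (K \<times> {..<len}) (\<lambda>k. ss ! snd k) B R'"
    "\<And>x. \<forall>k\<in>K. x k \<in> carrier G \<Longrightarrow> (R C (coords x) \<longleftrightarrow> Q x) \<and> (R' C (coords x) \<longleftrightarrow> Q' x)"
    using assms by (elim gpredE) blast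
  then show ?thesis by (intro gpredI[OF expressible_imp[of L C _ _ B R R']]) simp_all
qed

lemma gpred_False: "gpred B K (\<lambda>x. False)"
  by (rule gpredI[OF expressible_False]) simp

lemma gpred_not: "gpred B K Q \<Longrightarrow> gpred B K (\<lambda>x. \<not> Q x)"
  using gpred_imp[OF _ gpred_False] by simp

lemma gpred_conj: "gpred B K Q \<Longrightarrow> gpred B K Q' \<Longrightarrow> gpred B K (\<lambda>x. Q x \<and> Q' x)"
  using gpred_not[OF gpred_imp[OF _ gpred_not]] by simp

lemma gpred_ball:
  assumes "finite F" and "\<And>j. j \<in> F \<Longrightarrow> gpred B K (Q j)"
  shows "gpred B K (\<lambda>x. \<forall>j\<in>F. Q j x)"
  using assms
proof (induction F)
  case empty
  then show ?case using gpred_not[OF gpred_False] by simp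
next
  case (insert j F)
  then show ?case using gpred_conj[of B K "Q j"] by simp
qed

lemma gpred_subst:
  assumes "gpred B K Q" and "B \<subseteq> B'"
    and t: "\<And>k. k \<in> K \<Longrightarrow> case t k of Inl j \<Rightarrow> j \<in> J | Inr g \<Rightarrow> g \<in> carrier G \<and> set g \<subseteq> B'"
  shows "gpred B' J (\<lambda>x. Q (\<lambda>k. case_sum x (\<lambda>g. g) (t k)))"
proof -
  obtain R where R: "expressible L C (K \<times> {..<len}) (\<lambda>k. ss ! snd k) B R"
    "\<And>x. \<forall>k\<in>K. x k \<in> carrier G \<Longrightarrow> R C (coords x) \<longleftrightarrow> Q x"
    using assms(1) unfolding gpred_def by blast
  let ?t = "\<lambda>k. case t (fst k) of Inl j \<Rightarrow> Inl (j, snd k) | Inr g \<Rightarrow> Inr (g ! snd k)"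
  have "expressible L C (J \<times> {..<len}) (\<lambda>k. ss ! snd k) B'
      (\<lambda>M' a. R M' (\<lambda>k. case_sum a (\<lambda>b. b) (?t k)))"
  proof (rule expressible_subst[OF R(1) assms(2)])
    fix k assume k: "k \<in> K \<times> {..<len}"
    then have "case t (fst k) of Inl j \<Rightarrow> j \<in> J | Inr g \<Rightarrow> g \<in> carrier G \<and> set g \<subseteq> B'"
      using t by auto
    then show "admissible C (J \<times> {..<len}) (\<lambda>k. ss ! snd k) B' (ss ! snd k) (?t k)"
      using k carrier_nth by (cases "t (fst k)") (auto simp: elts_def subset_iff)
  qed
  then show ?thesis
  proof (rule gpredI)
    fix x assume x: "\<forall>j\<in>J. x j \<in> carrier G"
    let ?y = "\<lambda>k. case_sum x (\<lambda>g. g) (t k)"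
    have "(\<lambda>k. case_sum (coords x) (\<lambda>b. b) (?t k)) = coords ?y"
      by (auto split: sum.split)
    moreover have "?y k \<in> carrier G" if "k \<in> K" for k
      using t[OF that] x by (cases "t k") auto
    ultimately show "R C (\<lambda>k. case_sum (coords x) (\<lambda>b. b) (?t k)) \<longleftrightarrow> Q ?y"
      using R(2)[of ?y] by simp
  qed
qed

lemma gpred_reindex:
  assumes "gpred B K Q" and "B \<subseteq> B'" and "\<And>k. k \<in> K \<Longrightarrow> h k \<in> J"
  shows "gpred B' J (\<lambda>x. Q (\<lambda>k. x (h k)))"
  using gpred_subst[OF assms(1,2), where t = "\<lambda>k. Inl (h k)" and J = J] assms(3) by simp

lemma gpred_mono:
  assumes "gpred B K Q" and "B \<subseteq> B'" and "K \<subseteq> J"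
  shows "gpred B' J Q"
  using gpred_reindex[OF assms(1,2), of "\<lambda>k. k" J] assms(3) by auto

lemma gpred_definable:
  assumes "definable L C B ss D" and "k \<in> K"
  shows "gpred B K (\<lambda>x. x k \<in> D)"
proof -
  obtain p where p: "p \<in> pformulas L C {..<len} ((!) ss) B" "D = {xs \<in> tuples C ss. psat C ((!) xs) p}"
    using assms(1) by (auto simp: definable_def)
  have "expressible L C (K \<times> {..<len}) (\<lambda>k. ss ! snd k) B (\<lambda>M' a. psat M' (\<lambda>i. a (k, i)) p)"
    using assms(2) by (intro expressible_reindex[OF expressible_psat[OF p(1)], where f = "\<lambda>i. (k, i)"]) auto
  then show ?thesis
  proof (rule gpredI)
    fix x assume "\<forall>k\<in>K. x k \<in> carrier G"
    then have "x k \<in> tuples C ss" using assms(2) carrier_tuples by blast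
    then show "psat C (\<lambda>i. coords x (k, i)) p \<longleftrightarrow> x k \<in> D" using p(2) by simp
  qed
qed

lemma carrier_definable: "definable L C A ss (carrier G)"
  using dgroup by (simp add: definable_group_def)

lemma gpred_mult:
  assumes "A \<subseteq> B" and "k \<in> K" and "l \<in> K" and "m \<in> K"
  shows "gpred B K (\<lambda>x. x k \<otimes> x l = x m)"
proof -
  let ?S = "{x @ y @ (x \<otimes> y) | x y. x \<in> carrier G \<and> y \<in> carrier G}"
  let ?s = "ss @ ss @ ss"
  have "definable L C A ?s ?S" using dgroup by (simp add: definable_group_def)
  then obtain p where p: "p \<in> pformulas L C {..<length ?s} ((!) ?s) A"
    "?S = {xs \<in> tuples C ?s. psat C ((!) xs) p}"
    unfolding definable_def by auto
  \<comment> \<open>Decodes a position in the concatenation of three tuples into a group variable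
    and a coordinate.\<close>
  define f where "f i = (if i < len then (k, i) else if i < 2 * len then (l, i - len) else (m, i - 2 * len))" for i
  have e: "expressible L C {..<length ?s} ((!) ?s) A (\<lambda>M' a. psat M' a p)" using p(1) by blast
  have "expressible L C (K \<times> {..<len}) (\<lambda>k. ss ! snd k) B (\<lambda>M' a. psat M' (\<lambda>i. a (f i)) p)"
    by (rule expressible_reindex[OF e assms(1)]) (use assms in \<open>auto simp: f_def nth_append mult_2\<close>)
  then show ?thesis
  proof (rule gpredI)
    fix x assume x: "\<forall>k\<in>K. x k \<in> carrier G"
    let ?xs = "x k @ x l @ x m"
    have G: "x k \<in> carrier G" "x l \<in> carrier G" "x m \<in> carrier G" using x assms by auto
    note len = carrier_nth(1)[OF G(1)] carrier_nth(1)[OF G(2)] carrier_nth(1)[OF G(3)]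
    have "psat C (\<lambda>i. coords x (f i)) p \<longleftrightarrow> psat C ((!) ?xs) p"
      by (rule expressible_cong_valuation[OF e]) (auto simp: f_def nth_append len mult_2)
    also have "\<dots> \<longleftrightarrow> ?xs \<in> ?S"
    proof -
      have "u \<in> tuples C ss" if "u \<in> carrier G" for u using carrier_tuples that by blast
      then have "?xs \<in> tuples C ?s" using G by (simp add: tuples_def)
      then show ?thesis unfolding p(2) by simp
    qed
    also have "\<dots> \<longleftrightarrow> x k \<otimes> x l = x m"
    proof
      assume "?xs \<in> ?S"
      then obtain u v where uv: "?xs = u @ v @ (u \<otimes> v)" "u \<in> carrier G" "v \<in> carrier G" by blast
      then have "x k = u \<and> x l = v \<and> x m = u \<otimes> v"
        using len carrier_nth(1)[OF uv(2)] carrier_nth(1)[OF uv(3)] by simp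
      then show "x k \<otimes> x l = x m" by simp
    next
      assume "x k \<otimes> x l = x m"
      then have "?xs = x k @ x l @ (x k \<otimes> x l)" by simp
      then show "?xs \<in> ?S" using G by blast
    qed
    finally show "psat C (\<lambda>i. coords x (f i)) p \<longleftrightarrow> x k \<otimes> x l = x m" .
  qed
qed

text \<open>A quantifier over \<open>G\<close> becomes a block of quantifiers over coordinates,
  together with the formula of the carrier, which makes the block a tuple in
  \<open>G\<close>.\<close>

lemma gpred_ex_finite:
  assumes "finite F" and "A \<subseteq> B" and "gpred B (F \<union> K) Q"
  shows "gpred B K (\<lambda>x. \<exists>y. (\<forall>k\<in>F. y k \<in> carrier G) \<and> (\<forall>k. k \<notin> F \<longrightarrow> y k = x k) \<and> Q y)"
proof -
  obtain R where R: "expressible L C ((F \<union> K) \<times> {..<len}) (\<lambda>k. ss ! snd k) B R"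
    "\<And>x. \<forall>k\<in>F \<union> K. x k \<in> carrier G \<Longrightarrow> R C (coords x) \<longleftrightarrow> Q x"
    using assms(3) unfolding gpred_def by blast
  obtain p where p: "p \<in> pformulas L C {..<len} ((!) ss) A"
    "carrier G = {xs \<in> tuples C ss. psat C ((!) xs) p}"
    using carrier_definable by (auto simp: definable_def)
  have ep: "expressible L C {..<len} ((!) ss) A (\<lambda>M' a. psat M' a p)" using p(1) by blast
  define S where "S M' b \<longleftrightarrow> R M' b \<and> (\<forall>k\<in>F. psat M' (\<lambda>i. b (k, i)) p)" for M' and b
  have 1: "expressible L C ((F \<union> K) \<times> {..<len}) (\<lambda>k. ss ! snd k) B (\<lambda>M' b. psat M' (\<lambda>i. b (k, i)) p)"
    if "k \<in> F" for k
    by (rule expressible_reindex[OF ep assms(2)]) (use that in auto)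
  have "expressible L C ((F \<union> K) \<times> {..<len}) (\<lambda>k. ss ! snd k) B S"
    unfolding S_def by (intro expressible_conj R(1) expressible_ball assms(1) 1)
  then have "expressible L C (F \<times> {..<len} \<union> K \<times> {..<len}) (\<lambda>k. ss ! snd k) B S"
    by (simp only: Sigma_Un_distrib1)
  then have "expressible L C (K \<times> {..<len}) (\<lambda>k. ss ! snd k) B
     (\<lambda>M' a. \<exists>b. (\<forall>k\<in>F \<times> {..<len}. b k \<in> elts M' (ss ! snd k)) \<and>
        (\<forall>k. k \<notin> F \<times> {..<len} \<longrightarrow> b k = a k) \<and> S M' b)"
    by (rule expressible_ex_finite[rotated 2]) (use assms(1) sort_nth in auto)
  then show ?thesis
  proof (rule gpredI)
    fix x assume x: "\<forall>k\<in>K. x k \<in> carrier G"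
    show "(\<exists>b. (\<forall>k\<in>F \<times> {..<len}. b k \<in> elts C (ss ! snd k)) \<and>
        (\<forall>k. k \<notin> F \<times> {..<len} \<longrightarrow> b k = coords x k) \<and> S C b) \<longleftrightarrow>
      (\<exists>y. (\<forall>k\<in>F. y k \<in> carrier G) \<and> (\<forall>k. k \<notin> F \<longrightarrow> y k = x k) \<and> Q y)" (is "?l \<longleftrightarrow> ?r")
    proof
      assume ?l
      then obtain b where b: "\<forall>k\<in>F \<times> {..<len}. b k \<in> elts C (ss ! snd k)"
        "\<forall>k. k \<notin> F \<times> {..<len} \<longrightarrow> b k = coords x k" "S C b" by blast
      define y where "y k = (if k \<in> F then map (\<lambda>i. b (k, i)) [0..<len] else x k)" for k
      have yF: "y k \<in> carrier G" if k: "k \<in> F" for k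
      proof -
        have "psat C (\<lambda>i. b (k, i)) p" using b(3) k by (simp add: S_def)
        then have "psat C ((!) (y k)) p"
          using expressible_cong_valuation[OF ep, of "(!) (y k)" "\<lambda>i. b (k, i)" C] k by (simp add: y_def)
        moreover have "y k \<in> tuples C ss"
          using b(1) k by (auto simp: tuples_def y_def elts_def intro!: nth_equalityI)
        ultimately show ?thesis using p(2) by blast
      qed
      have "R C (coords y) \<longleftrightarrow> R C b"
      proof (rule expressible_cong_valuation[OF R(1)])
        fix k assume "k \<in> (F \<union> K) \<times> {..<len}"
        then show "coords y k = b k" using b(2) by (cases k) (auto simp: y_def)
      qed
      moreover have "R C b" using b(3) by (simp add: S_def)
      moreover have "y k \<in> carrier G" if "k \<in> F \<union> K" for k
        using that yF x by (cases "k \<in> F") (auto simp: y_def)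
      ultimately have "Q y" using R(2)[of y] by blast
      then show ?r using yF by (intro exI[of _ y]) (auto simp: y_def)
    next
      assume ?r
      then obtain y where y: "\<forall>k\<in>F. y k \<in> carrier G" "\<forall>k. k \<notin> F \<longrightarrow> y k = x k" "Q y" by blast
      define b where "b k = (if k \<in> F \<times> {..<len} then coords y k else coords x k)" for k
      have "y k \<in> carrier G" if "k \<in> F \<union> K" for k using that y x by (cases "k \<in> F") auto
      then have "R C (coords y)" using R(2)[of y] y(3) by blast
      moreover have "R C (coords y) \<longleftrightarrow> R C b"
      proof (rule expressible_cong_valuation[OF R(1)])
        fix k assume "k \<in> (F \<union> K) \<times> {..<len}"
        then show "coords y k = b k" using y(2) by (cases k) (auto simp: b_def)
      qed
      moreover have "psat C (\<lambda>i. b (k, i)) p" if k: "k \<in> F" for k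
      proof -
        have "psat C ((!) (y k)) p" using y(1) k p(2) by blast
        then show ?thesis
          using expressible_cong_valuation[OF ep, of "\<lambda>i. b (k, i)" "(!) (y k)" C] k by (simp add: b_def)
      qed
      ultimately have "S C b" by (simp add: S_def)
      moreover have "\<forall>k\<in>F \<times> {..<len}. b k \<in> elts C (ss ! snd k)"
        using y(1) carrier_nth(2) by (auto simp: b_def)
      ultimately show ?l by (intro exI[of _ b]) (auto simp: b_def)
    qed
  qed
qed

lemma gpred_ex:
  assumes "A \<subseteq> B" and "gpred B (insert None (Some ` K)) Q"
  shows "gpred B K (\<lambda>x. \<exists>z\<in>carrier G. Q (case_option z x))"
proof -
  have "gpred B (Some ` K) (\<lambda>x. \<exists>y. (\<forall>k\<in>{None}. y k \<in> carrier G) \<and> (\<forall>k. k \<notin> {None} \<longrightarrow> y k = x k) \<and> Q y)"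
    using assms by (intro gpred_ex_finite) auto
  then have "gpred B K (\<lambda>x. \<exists>y. (\<forall>k\<in>{None}. y k \<in> carrier G) \<and> (\<forall>k. k \<notin> {None} \<longrightarrow> y k = x (the k)) \<and> Q y)"
    by (rule gpred_reindex) auto
  moreover have "(\<exists>y. (\<forall>k\<in>{None}. y k \<in> carrier G) \<and> (\<forall>k. k \<notin> {None} \<longrightarrow> y k = x (the k)) \<and> Q y)
      \<longleftrightarrow> (\<exists>z\<in>carrier G. Q (case_option z x))" for x
  proof
    assume "\<exists>y. (\<forall>k\<in>{None}. y k \<in> carrier G) \<and> (\<forall>k. k \<notin> {None} \<longrightarrow> y k = x (the k)) \<and> Q y"
    then obtain y where y: "y None \<in> carrier G" "\<And>k. k \<noteq> None \<Longrightarrow> y k = x (the k)" "Q y" by auto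
    then have "y = case_option (y None) x" by (auto split: option.split)
    then show "\<exists>z\<in>carrier G. Q (case_option z x)" using y by metis
  next
    assume "\<exists>z\<in>carrier G. Q (case_option z x)"
    then obtain z where "z \<in> carrier G" "Q (case_option z x)" by blast
    then show "\<exists>y. (\<forall>k\<in>{None}. y k \<in> carrier G) \<and> (\<forall>k. k \<notin> {None} \<longrightarrow> y k = x (the k)) \<and> Q y"
      by (intro exI[of _ "case_option z x"]) auto
  qed
  ultimately show ?thesis by simp
qed

text \<open>Off the carrier \<open>Q\<close> is arbitrary, so it cannot simply be said to depend on
  \<open>K0\<close>. Filling up with the unit gives a condition that reads the family on
  \<open>K0\<close> alone by its very form.\<close>

lemma gpred_support:
  assumes "gpred B K Q"
  obtains K0 where "finite K0" and "K0 \<subseteq> K" and "gpred B K0 (\<lambda>x. Q (\<lambda>k. if k \<in> K0 then x k else \<one>))"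
    and "\<And>x. \<forall>k\<in>K. x k \<in> carrier G \<Longrightarrow> Q x \<longleftrightarrow> Q (\<lambda>k. if k \<in> K0 then x k else \<one>)"
proof -
  obtain R where R: "expressible L C (K \<times> {..<len}) (\<lambda>k. ss ! snd k) B R"
    "\<And>x. \<forall>k\<in>K. x k \<in> carrier G \<Longrightarrow> R C (coords x) \<longleftrightarrow> Q x"
    using assms unfolding gpred_def by blast
  obtain F where F: "finite F" "F \<subseteq> K \<times> {..<len}" "expressible L C F (\<lambda>k. ss ! snd k) B R"
    using R(1) by (rule expressible_support) blast
  let ?K = "fst ` F"
  have Q: "Q x \<longleftrightarrow> Q (\<lambda>k. if k \<in> ?K then x k else \<one>)" if x: "\<forall>k\<in>K. x k \<in> carrier G" for x
  proof -
    have "R C (coords x) \<longleftrightarrow> R C (coords (\<lambda>k. if k \<in> ?K then x k else \<one>))"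
      by (rule expressible_cong_valuation[OF F(3)]) auto
    then show ?thesis using R(2)[of x] R(2)[of "\<lambda>k. if k \<in> ?K then x k else \<one>"] x by simp
  qed
  have "gpred B ?K (\<lambda>x. Q (\<lambda>k. if k \<in> ?K then x k else \<one>))"
  proof (rule gpredI[of ?K B R])
    show "expressible L C (?K \<times> {..<len}) (\<lambda>k. ss ! snd k) B R"
      by (rule expressible_mono[OF F(3)]) (use F(2) in force)+
    fix x assume x: "\<forall>k\<in>?K. x k \<in> carrier G"
    have "R C (coords x) \<longleftrightarrow> R C (coords (\<lambda>k. if k \<in> ?K then x k else \<one>))"
      by (rule expressible_cong_valuation[OF F(3)]) auto
    then show "R C (coords x) \<longleftrightarrow> Q (\<lambda>k. if k \<in> ?K then x k else \<one>)"
      using R(2)[of "\<lambda>k. if k \<in> ?K then x k else \<one>"] x by simp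
  qed
  moreover have "?K \<subseteq> K" using F(2) by auto
  ultimately show ?thesis using that[of ?K] F(1) Q by blast
qed

text \<open>Multiplication is the operation given by a formula. A quotient is introduced as the
  solution \<open>y\<close> of \<open>x j \<otimes> y = x (h k)\<close> and quantified away.
  Conditions of this shape are left invariant, and they supply relations of the torsor.\<close>

lemma gpred_translate:
  assumes "A \<subseteq> B" and "gpred B K Q" and "finite K" and "j \<in> J" and "\<And>k. k \<in> K \<Longrightarrow> h k \<in> J"
    and dep: "\<And>x y. (\<And>k. k \<in> K \<Longrightarrow> x k = y k) \<Longrightarrow> Q x \<longleftrightarrow> Q y"
  shows "gpred B J (\<lambda>x. Q (\<lambda>k. inv (x j) \<otimes> x (h k)))"
proof -
  let ?S = "\<lambda>x. (\<forall>k\<in>K. x (Inr j) \<otimes> x (Inl k) = x (Inr (h k))) \<and> Q (\<lambda>k. x (Inl k))"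
  have "gpred B (Inl ` K \<union> Inr ` J) ?S"
  proof (intro gpred_conj gpred_ball assms(3))
    show "gpred B (Inl ` K \<union> Inr ` J) (\<lambda>x. x (Inr j) \<otimes> x (Inl k) = x (Inr (h k)))" if "k \<in> K" for k
      using assms that by (intro gpred_mult) auto
    show "gpred B (Inl ` K \<union> Inr ` J) (\<lambda>x. Q (\<lambda>k. x (Inl k)))"
      using assms(2) by (rule gpred_reindex) auto
  qed
  then have "gpred B (Inr ` J) (\<lambda>x. \<exists>y. (\<forall>k\<in>Inl ` K. y k \<in> carrier G) \<and>
      (\<forall>k. k \<notin> Inl ` K \<longrightarrow> y k = x k) \<and> ?S y)"
    using assms(1,3) by (intro gpred_ex_finite) auto
  then have "gpred B J (\<lambda>x. \<exists>y. (\<forall>k\<in>Inl ` K. y k \<in> carrier G) \<and>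
      (\<forall>k. k \<notin> Inl ` K \<longrightarrow> y k = x (projr k)) \<and> ?S y)"
    by (rule gpred_reindex) auto
  then show ?thesis
  proof (rule gpred_cong)
    fix x assume x: "\<forall>k\<in>J. x k \<in> carrier G"
    show "(\<exists>y. (\<forall>k\<in>Inl ` K. y k \<in> carrier G) \<and> (\<forall>k. k \<notin> Inl ` K \<longrightarrow> y k = x (projr k)) \<and> ?S y)
      \<longleftrightarrow> Q (\<lambda>k. inv (x j) \<otimes> x (h k))" (is "?l \<longleftrightarrow> ?r")
    proof
      assume ?l
      then obtain y where y0: "\<forall>k\<in>Inl ` K. y k \<in> carrier G" "\<forall>k. k \<notin> Inl ` K \<longrightarrow> y k = x (projr k)"
        "?S y" by blast
      then have yr: "y (Inr j) = x j" for j by auto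
      have y: "\<And>k. k \<in> K \<Longrightarrow> y (Inl k) \<in> carrier G"
        "\<And>k. k \<in> K \<Longrightarrow> x j \<otimes> y (Inl k) = x (h k)" "Q (\<lambda>k. y (Inl k))"
        using y0 by (auto simp: yr)
      have "y (Inl k) = inv (x j) \<otimes> x (h k)" if "k \<in> K" for k
        using inv_solve_left[of "y (Inl k)" "x j" "x (h k)"] y(1,2)[OF that] x assms(4,5) that by auto
      then show ?r using y(3) dep[of "\<lambda>k. y (Inl k)" "\<lambda>k. inv (x j) \<otimes> x (h k)"] by simp
    next
      assume ?r
      define y where "y k = (case k of Inl k' \<Rightarrow> if k' \<in> K then inv (x j) \<otimes> x (h k') else x (projr k)
          | Inr i \<Rightarrow> x i)" for k
      have "Q (\<lambda>k. y (Inl k))"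
        using \<open>?r\<close> dep[of "\<lambda>k. y (Inl k)" "\<lambda>k. inv (x j) \<otimes> x (h k)"] by (simp add: y_def)
      moreover have "x j \<otimes> (inv (x j) \<otimes> x (h k)) = x (h k)" if "k \<in> K" for k
        using x assms(4,5) that by (simp add: m_assoc[symmetric])
      ultimately show ?l using x assms(4,5)
        by (intro exI[of _ y]) (auto simp: y_def split: sum.split)
    qed
  qed
qed

end

text \<open>Chains depend on the order of their terms, so the homogeneous set is returned as an
  increasing enumeration \<open>h\<close>.\<close>

lemma ramsey_ordered:
  fixes m r :: nat
  shows "\<exists>N. \<forall>c :: nat set \<Rightarrow> bool. \<exists>h t. strict_mono_on {..<m} h \<and> h ` {..<m} \<subseteq> {..<N} \<and>
     (\<forall>S. S \<subseteq> {..<m} \<and> card S = r \<longrightarrow> c (h ` S) = t)"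
proof -
  obtain N :: nat where N: "partn_lst {..<N} [m, m] r" using ramsey_full[of "[m, m]" r] ..
  have "\<exists>h t. strict_mono_on {..<m} h \<and> h ` {..<m} \<subseteq> {..<N} \<and>
     (\<forall>S. S \<subseteq> {..<m} \<and> card S = r \<longrightarrow> c (h ` S) = t)" for c :: "nat set \<Rightarrow> bool"
  proof -
    let ?f = "\<lambda>S. if c S then 0 else 1 :: nat"
    have "?f \<in> nsets {..<N} r \<rightarrow> {..<length [m, m]}" by auto
    from bspec[OF N[unfolded partn_lst_def] this]
    obtain i where i: "i < length [m, m]" "monochromatic {..<N} ([m, m] ! i) r ?f i" by blast
    then obtain H where "H \<in> nsets {..<N} ([m, m] ! i)" "?f ` nsets H r \<subseteq> {i}"
      unfolding monochromatic_def by blast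
    with i(1) have iH: "i < 2" "H \<in> nsets {..<N} ([m, m] ! i)" "?f ` nsets H r \<subseteq> {i}"
      by (simp_all only: list.size)
    have "[m, m] ! i = m" using iH(1) by (cases i) auto
    then have H: "H \<subseteq> {..<N}" "finite H" "card H = m" using iH(2) by (auto simp: nsets_def)
    let ?l = "sorted_list_of_set H"
    have l: "length ?l = m" "set ?l = H" "strict_sorted ?l" using H by auto
    have mono: "strict_mono_on {..<m} ((!) ?l)"
      using l by (auto intro!: strict_mono_onI simp: strict_sorted_iff sorted_wrt_nth_less)
    have img: "(!) ?l ` {..<m} = H" using l by (auto simp: set_conv_nth)
    have "c ((!) ?l ` S) = (i = 0)" if S: "S \<subseteq> {..<m}" "card S = r" for S
    proof -
      have "inj_on ((!) ?l) S"
        using strict_mono_on_imp_inj_on[OF mono] S(1) by (rule inj_on_subset)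
      then have "(!) ?l ` S \<in> nsets H r"
        using S img finite_subset[OF S(1)] by (auto simp: nsets_def card_image)
      then have "?f ((!) ?l ` S) = i" using iH(3) by blast
      then show ?thesis by (auto split: if_splits)
    qed
    then show ?thesis using mono img H(1)
      by (intro exI[of _ "(!) ?l"] exI[of _ "i = 0"] conjI allI impI) simp_all
  qed
  then show ?thesis by (intro exI[of _ N] allI)
qed

context definable_group_struct
begin

section \<open>Definable subsets of the group\<close>

definition gdef :: "'a set \<Rightarrow> 'a list set \<Rightarrow> bool" where
  "gdef B D \<longleftrightarrow> D \<subseteq> carrier G \<and> gpred B (UNIV :: unit set) (\<lambda>x. x () \<in> D)"

lemma gdefI:
  assumes "gpred B (UNIV :: unit set) Q"
  shows "gdef B {g \<in> carrier G. Q (\<lambda>_. g)}"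
proof -
  have "(\<lambda>_. x ()) = x" for x :: "unit \<Rightarrow> 'a list" by auto
  then show ?thesis unfolding gdef_def using assms by (auto intro: gpred_cong)
qed

lemma gdef_carrier_subset: "gdef B D \<Longrightarrow> D \<subseteq> carrier G"
  by (simp add: gdef_def)

lemma gdef_gpred:
  assumes "gdef B D" and "B \<subseteq> B'" and "k \<in> K"
  shows "gpred B' K (\<lambda>x. x k \<in> D)"
  using gpred_reindex[of B UNIV "\<lambda>x. x () \<in> D" B' "\<lambda>_. k" K] assms by (simp add: gdef_def)

lemma gdef_mono: "gdef B D \<Longrightarrow> B \<subseteq> B' \<Longrightarrow> gdef B' D"
  unfolding gdef_def by (auto intro: gpred_mono[OF _ _ order_refl])

lemma definable_imp_gdef: "definable L C B ss D \<Longrightarrow> D \<subseteq> carrier G \<Longrightarrow> gdef B D"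
  by (simp add: gdef_def gpred_definable)

lemma carrier_condition:
  obtains p where "p \<in> pformulas L C {..<len} ((!) ss) A"
    and "carrier G = {xs \<in> tuples C ss. psat C ((!) xs) p}"
  using carrier_definable by (auto simp: definable_def)

lemma gdef_imp_definable:
  assumes "gdef B D" and "A \<subseteq> B"
  shows "definable L C B ss D"
proof -
  obtain R where R: "expressible L C ((UNIV :: unit set) \<times> {..<len}) (\<lambda>k. ss ! snd k) B R"
    "\<And>x. \<forall>k\<in>UNIV. x k \<in> carrier G \<Longrightarrow> R C (coords x) \<longleftrightarrow> x () \<in> D"
    using assms(1) unfolding gdef_def gpred_def by blast
  obtain p where p: "p \<in> pformulas L C {..<len} ((!) ss) A"
    "carrier G = {xs \<in> tuples C ss. psat C ((!) xs) p}" by (rule carrier_condition)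
  have "expressible L C {..<len} ((!) ss) B (\<lambda>M' a. R M' (\<lambda>k. a (snd k)))"
    by (rule expressible_reindex[OF R(1)]) auto
  \<comment> \<open>The formula of a group condition says nothing off \<open>G\<close>, so the
    formula of the carrier is conjoined.\<close>
  moreover have "expressible L C {..<len} ((!) ss) B (\<lambda>M' a. psat M' a p)"
    by (rule expressible_mono[OF expressible_psat[OF p(1)] order_refl assms(2)])
  ultimately have "expressible L C {..<len} ((!) ss) B (\<lambda>M' a. R M' (\<lambda>k. a (snd k)) \<and> psat M' a p)"
    by (rule expressible_conj)
  then obtain q where q: "q \<in> pformulas L C {..<len} ((!) ss) B"
    "\<And>a. psat C a q \<longleftrightarrow> R C (\<lambda>k. a (snd k)) \<and> psat C a p" unfolding expressible_def by blast
  have "D = {xs \<in> tuples C ss. psat C ((!) xs) q}"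
  proof (intro equalityI subsetI)
    fix x assume x: "x \<in> D"
    then have "x \<in> carrier G" using assms(1) by (auto simp: gdef_def)
    then show "x \<in> {xs \<in> tuples C ss. psat C ((!) xs) q}"
      using p(2) q(2) R(2)[of "\<lambda>_. x"] x by auto
  next
    fix x assume x: "x \<in> {xs \<in> tuples C ss. psat C ((!) xs) q}"
    then have "x \<in> carrier G" using p(2) q(2) by auto
    then show "x \<in> D" using x q(2) R(2)[of "\<lambda>_. x"] by auto
  qed
  then show ?thesis using q(1) by (auto simp: definable_def)
qed

lemma gdef_carrier: "A \<subseteq> B \<Longrightarrow> gdef B (carrier G)"
  by (rule gdef_mono[OF definable_imp_gdef[OF carrier_definable order_refl]])

lemma gdef_Int:
  assumes "gdef B D" and "gdef B E"
  shows "gdef B (D \<inter> E)"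
proof -
  have "{g \<in> carrier G. g \<in> D \<and> g \<in> E} = D \<inter> E" using assms by (auto simp: gdef_def)
  then show ?thesis
    using gdefI[OF gpred_conj[OF gdef_gpred[OF assms(1)] gdef_gpred[OF assms(2)]], of B "()" "()"] by simp
qed

lemma gdef_Diff:
  assumes "gdef B D"
  shows "gdef B (carrier G - D)"
proof -
  have "{g \<in> carrier G. \<not> g \<in> D} = carrier G - D" by auto
  then show ?thesis using gdefI[OF gpred_not[OF gdef_gpred[OF assms]], of B "()"] by simp
qed

lemma gpred_quotient:
  assumes "gdef B D" and "A \<subseteq> B'" and "B \<subseteq> B'" and "k \<in> K" and "l \<in> K"
  shows "gpred B' K (\<lambda>x. inv (x k) \<otimes> x l \<in> D)"
proof -
  have "gpred B' (UNIV :: unit set) (\<lambda>x. x () \<in> D)" by (rule gdef_gpred[OF assms(1,3)]) simp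
  from gpred_translate[OF assms(2) this, of k K "\<lambda>_. l"] assms(4,5) show ?thesis by simp
qed

theorem saturated_gdef:
  assumes "A \<subseteq> B" and "B \<subseteq> univ C" and "|B| <o \<kappa>" and "\<And>D. D \<in> \<D> \<Longrightarrow> gdef B D"
    and fip: "\<And>\<F>. \<F> \<subseteq> \<D> \<Longrightarrow> finite \<F> \<Longrightarrow> \<exists>g\<in>carrier G. \<forall>D\<in>\<F>. g \<in> D"
  shows "\<exists>g\<in>carrier G. \<forall>D\<in>\<D>. g \<in> D"
proof -
  let ?I = "(UNIV :: unit set) \<times> {..<len}" and ?s = "\<lambda>k :: unit \<times> nat. ss ! snd k"
  obtain p where p: "p \<in> pformulas L C {..<len} ((!) ss) A"
    "carrier G = {xs \<in> tuples C ss. psat C ((!) xs) p}" by (rule carrier_condition)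
  have "\<forall>D\<in>\<D>. \<exists>R. expressible L C ?I ?s B R \<and> (\<forall>x\<in>carrier G. R C (coords (\<lambda>_. x)) \<longleftrightarrow> x \<in> D)"
  proof
    fix D assume "D \<in> \<D>"
    then obtain R where "expressible L C ?I ?s B R"
      "\<forall>x. (\<forall>k\<in>UNIV. x k \<in> carrier G) \<longrightarrow> (R C (coords x) \<longleftrightarrow> x () \<in> D)"
      using assms(4) unfolding gdef_def gpred_def by blast
    then show "\<exists>R. expressible L C ?I ?s B R \<and> (\<forall>x\<in>carrier G. R C (coords (\<lambda>_. x)) \<longleftrightarrow> x \<in> D)"
      by (intro exI[of _ R]) auto
  qed
  then obtain R where R: "\<And>D. D \<in> \<D> \<Longrightarrow> expressible L C ?I ?s B (R D)"
    "\<And>D x. D \<in> \<D> \<Longrightarrow> x \<in> carrier G \<Longrightarrow> R D C (coords (\<lambda>_. x)) \<longleftrightarrow> x \<in> D" by metis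
  \<comment> \<open>This condition forces the realised tuple into \<open>G\<close>. A finite part of
    the type may or may not contain it, hence the split at \<open>\<F> - {P}\<close> below.\<close>
  define P where "P M' a \<longleftrightarrow> psat M' (\<lambda>i. a ((), i)) p" for M' and a :: "unit \<times> nat \<Rightarrow> 'a"
  have eP: "expressible L C ?I ?s B P"
    unfolding P_def by (rule expressible_reindex[OF expressible_psat[OF p(1)] assms(1)]) auto
  have PG: "P C (coords (\<lambda>_. x))" if "x \<in> carrier G" for x using that p(2) by (simp add: P_def)
  have "\<exists>a. (\<forall>i\<in>?I. a i \<in> elts C (?s i)) \<and> (\<forall>Q\<in>insert P (R ` \<D>). Q C a)"
  proof (rule saturated_many[OF assms(2,3)])
    show "|?I| <o \<kappa>" by (intro finite_less) auto
    show "?s i \<in> Sorts L" if "i \<in> ?I" for i using that sort_nth by auto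
    show "expressible L C ?I ?s B Q" if "Q \<in> insert P (R ` \<D>)" for Q using that R(1) eP by auto
    fix \<F> assume F: "\<F> \<subseteq> insert P (R ` \<D>)" "finite \<F>"
    then have "finite (\<F> - {P})" "\<F> - {P} \<subseteq> R ` \<D>" by auto
    then obtain \<E> where E: "\<E> \<subseteq> \<D>" "finite \<E>" "\<F> - {P} = R ` \<E>" by (meson finite_subset_image)
    obtain g where g: "g \<in> carrier G" "\<forall>D\<in>\<E>. g \<in> D" using fip[OF E(1,2)] by blast
    have "\<forall>Q\<in>\<F> - {P}. Q C (coords (\<lambda>_. g))" unfolding E(3) using R(2) E(1) g by auto
    then have "Q C (coords (\<lambda>_. g))" if "Q \<in> \<F>" for Q
      using PG[OF g(1)] that by (cases "Q = P") auto
    then show "\<exists>a. (\<forall>i\<in>?I. a i \<in> elts C (?s i)) \<and> (\<forall>Q\<in>\<F>. Q C a)"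
      using carrier_nth(2)[OF g(1)] by (intro exI[of _ "coords (\<lambda>_. g)"]) auto
  qed
  then obtain a where a: "\<forall>i\<in>?I. a i \<in> elts C (?s i)" "\<forall>Q\<in>insert P (R ` \<D>). Q C a" by blast
  define g where "g = map (\<lambda>i. a ((), i)) [0..<len]"
  have ag: "coords (\<lambda>_. g) i = a i" if "i \<in> ?I" for i using that by (auto simp: g_def)
  have "P C (coords (\<lambda>_. g))"
    using expressible_cong_valuation[OF eP ag, where M' = C] a(2) by simp
  moreover have "g \<in> tuples C ss"
    using a(1) by (auto simp: g_def tuples_def elts_def intro!: nth_equalityI)
  ultimately have g: "g \<in> carrier G" using p(2) by (simp add: P_def)
  have "g \<in> D" if D: "D \<in> \<D>" for D
    using expressible_cong_valuation[OF R(1)[OF D] ag, where M' = C] a(2) R(2)[OF D g] D by simp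
  then show ?thesis using g by blast
qed

section \<open>Automorphisms acting on the group\<close>

text \<open>\<open>B\<close> need not contain \<open>A\<close>, so \<open>\<sigma>\<close> may fail
  to preserve \<open>G\<close>; that the images stay in \<open>G\<close> is therefore a
  hypothesis.\<close>

lemma gpred_aut:
  assumes \<sigma>: "\<sigma> \<in> auts L C B" and "B \<subseteq> univ C" and "gpred B K Q"
    and x: "\<And>k. k \<in> K \<Longrightarrow> x k \<in> carrier G" and sx: "\<And>k. k \<in> K \<Longrightarrow> map \<sigma> (x k) \<in> carrier G"
  shows "Q (\<lambda>k. map \<sigma> (x k)) \<longleftrightarrow> Q x"
proof -
  obtain R where R: "expressible L C (K \<times> {..<len}) (\<lambda>k. ss ! snd k) B R"
    "\<And>x. \<forall>k\<in>K. x k \<in> carrier G \<Longrightarrow> R C (coords x) \<longleftrightarrow> Q x"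
    using assms(3) unfolding gpred_def by blast
  have "R C (coords (\<lambda>k. map \<sigma> (x k))) \<longleftrightarrow> R C (\<lambda>k. \<sigma> (coords x k))"
    by (rule expressible_cong_valuation[OF R(1)]) (use x carrier_nth(1) in auto)
  also have "\<dots> \<longleftrightarrow> R C (coords x)"
    by (rule aut_expressible[OF is_struct \<sigma> R(1) assms(2)]) (use x carrier_nth(2) in auto)
  finally show ?thesis using R(2)[of x] R(2)[of "\<lambda>k. map \<sigma> (x k)"] x sx by simp
qed

lemma aut_carrier:
  assumes "\<sigma> \<in> auts L C A" and "x \<in> carrier G"
  shows "map \<sigma> x \<in> carrier G"
proof -
  obtain p where p: "p \<in> pformulas L C {..<len} ((!) ss) A"
    "carrier G = {xs \<in> tuples C ss. psat C ((!) xs) p}" by (rule carrier_condition)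
  have ep: "expressible L C {..<len} ((!) ss) A (\<lambda>M' a. psat M' a p)" using p(1) by blast
  have "psat C ((!) (map \<sigma> x)) p \<longleftrightarrow> psat C (\<lambda>i. \<sigma> (x ! i)) p"
    by (rule expressible_cong_valuation[OF ep]) (simp add: carrier_nth(1)[OF assms(2)])
  also have "\<dots> \<longleftrightarrow> psat C ((!) x) p"
    by (rule aut_expressible[OF is_struct assms(1) ep A_univ]) (use carrier_nth(2)[OF assms(2)] in auto)
  finally have "psat C ((!) (map \<sigma> x)) p" using assms(2) p(2) by blast
  moreover have "x \<in> tuples C ss" using assms(2) carrier_tuples by blast
  then have "map \<sigma> x \<in> tuples C ss"
    using assms(1) by (auto simp: tuples_def auts_def bij_betw_def subset_iff)
  ultimately show ?thesis using p(2) by blast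
qed

lemma aut_mult:
  assumes "\<sigma> \<in> auts L C A" and "x \<in> carrier G" and "y \<in> carrier G"
  shows "map \<sigma> (x \<otimes> y) = map \<sigma> x \<otimes> map \<sigma> y"
proof -
  define z :: "nat \<Rightarrow> 'a list" where "z i = (if i = 0 then x else if i = 1 then y else x \<otimes> y)" for i
  have z: "z i \<in> carrier G" for i using assms(2,3) by (simp add: z_def)
  have "gpred A (UNIV :: nat set) (\<lambda>x. x 0 \<otimes> x 1 = x 2)" by (intro gpred_mult) auto
  from gpred_aut[OF assms(1) A_univ this, of z] show ?thesis
    using aut_carrier[OF assms(1) z] z by (simp add: z_def)
qed

lemma aut_hom: "\<sigma> \<in> auts L C A \<Longrightarrow> group_hom G G (map \<sigma>)"
  by unfold_locales (auto simp: hom_def aut_carrier aut_mult)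

lemma aut_quotient:
  assumes "\<sigma> \<in> auts L C A" and "x \<in> carrier G" and "y \<in> carrier G"
  shows "map \<sigma> (inv x \<otimes> y) = inv (map \<sigma> x) \<otimes> map \<sigma> y"
  using assms aut_mult[OF assms(1), of "inv x" y] group_hom.hom_inv[OF aut_hom[OF assms(1)], of x] by simp

lemma homogeneous_group:
  assumes "|K| <o \<kappa>" and x: "\<And>k. k \<in> K \<Longrightarrow> x k \<in> carrier G" and y: "\<And>k. k \<in> K \<Longrightarrow> y k \<in> carrier G"
    and eq: "\<And>Q. gpred A K Q \<Longrightarrow> Q x \<longleftrightarrow> Q y"
  shows "\<exists>\<sigma>\<in>auts L C A. \<forall>k\<in>K. map \<sigma> (x k) = y k"
proof -
  have "\<exists>\<sigma>\<in>auts L C A. \<forall>i\<in>K \<times> {..<len}. \<sigma> (coords x i) = coords y i"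
  proof (rule homogeneous_many[OF A_univ A_less])
    show "|K \<times> {..<len}| <o \<kappa>" using assms(1) by (intro card_of_Times_finite Cinfinite_\<kappa>) auto
    show "ss ! snd i \<in> Sorts L" if "i \<in> K \<times> {..<len}" for i using that sort_nth by auto
    show "coords x i \<in> elts C (ss ! snd i)" if "i \<in> K \<times> {..<len}" for i
      using that x carrier_nth(2) by auto
    show "coords y i \<in> elts C (ss ! snd i)" if "i \<in> K \<times> {..<len}" for i
      using that y carrier_nth(2) by auto
    fix Q assume "expressible L C (K \<times> {..<len}) (\<lambda>k. ss ! snd k) A Q"
    then have "gpred A K (\<lambda>x. Q C (coords x))" by (rule gpredI) simp
    then show "Q C (coords x) \<longleftrightarrow> Q C (coords y)" by (rule eq)
  qed
  then obtain \<sigma> where \<sigma>: "\<sigma> \<in> auts L C A" "\<forall>i\<in>K \<times> {..<len}. \<sigma> (coords x i) = coords y i" by blast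
  have "map \<sigma> (x k) = y k" if k: "k \<in> K" for k
    using \<sigma>(2) k carrier_nth(1)[OF x[OF k]] carrier_nth(1)[OF y[OF k]]
    by (intro nth_equalityI) auto
  then show ?thesis using \<sigma>(1) by blast
qed

text \<open>One implication between the types suffices because complements in \<open>G\<close> of
  \<open>A\<close>-definable sets are \<open>A\<close>-definable.\<close>

lemma homogeneous_element:
  assumes "g \<in> carrier G" and "h \<in> carrier G" and "\<And>D. gdef A D \<Longrightarrow> g \<in> D \<Longrightarrow> h \<in> D"
  shows "\<exists>\<sigma>\<in>auts L C A. map \<sigma> g = h"
proof -
  have "\<exists>\<sigma>\<in>auts L C A. \<forall>k\<in>(UNIV :: unit set). map \<sigma> g = h"
  proof (rule homogeneous_group)
    show "|UNIV :: unit set| <o \<kappa>" by (rule finite_less) simp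
    fix Q assume Q: "gpred A (UNIV :: unit set) Q"
    have "gdef A {g \<in> carrier G. Q (\<lambda>_. g)}" using Q by (rule gdefI)
    moreover have "gdef A {g \<in> carrier G. \<not> Q (\<lambda>_. g)}" using gpred_not[OF Q] by (rule gdefI)
    ultimately show "Q (\<lambda>_. g) \<longleftrightarrow> Q (\<lambda>_. h)" using assms by blast
  qed (use assms in auto)
  then show ?thesis by simp
qed

section \<open>Thick sets\<close>

definition chain :: "'a list set \<Rightarrow> nat \<Rightarrow> (nat \<Rightarrow> 'a list) \<Rightarrow> bool" where
  "chain D n x \<longleftrightarrow> (\<forall>i<n. x i \<in> carrier G) \<and> (\<forall>i j. i < j \<longrightarrow> j < n \<longrightarrow> inv (x i) \<otimes> x j \<in> D)"

text \<open>A one-sided version of thick formulas: antichains of the relation x^-1 y \<in> D have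
  bounded length. No symmetry is demanded, so the order of the terms matters.\<close>

definition thick :: "'a list set \<Rightarrow> bool" where
  "thick D \<longleftrightarrow> (\<exists>n. \<forall>x. \<not> chain (carrier G - D) n x)"

lemma chain_mono:
  assumes "chain D n x" and "D \<subseteq> E" and "m \<le> n"
  shows "chain E m x"
  unfolding chain_def
proof (intro conjI allI impI)
  show "x i \<in> carrier G" if "i < m" for i using assms that by (simp add: chain_def)
  show "inv (x i) \<otimes> x j \<in> E" if "i < j" "j < m" for i j
    using assms(1,3) that by (intro subsetD[OF assms(2)]) (simp add: chain_def)
qed

lemma thick_carrier: "thick (carrier G)"
proof -
  have "\<not> chain {} 2 x" for x
  proof
    assume "chain {} 2 x"
    then have "(0::nat) < 1 \<longrightarrow> 1 < (2::nat) \<longrightarrow> inv (x 0) \<otimes> x 1 \<in> {}" unfolding chain_def by blast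
    then show False by simp
  qed
  then show ?thesis unfolding thick_def by (intro exI[of _ 2]) simp
qed

lemma chain_reindex:
  assumes "chain D N x" and "strict_mono_on {..<m} h" and "h ` {..<m} \<subseteq> {..<N}"
    and "\<And>i j. i < j \<Longrightarrow> j < m \<Longrightarrow> inv (x (h i)) \<otimes> x (h j) \<in> D \<Longrightarrow> inv (x (h i)) \<otimes> x (h j) \<in> E"
  shows "chain E m (\<lambda>i. x (h i))"
proof -
  have "h i < N" if "i < m" for i using assms(3) that by auto
  moreover have "h i < h j" if "i < j" "j < m" for i j
    using strict_mono_onD[OF assms(2), of i j] that by auto
  ultimately show ?thesis using assms(1,4) by (simp add: chain_def)
qed

text \<open>Colour a pair in a sequence avoiding the intersection by whether its quotient lies in
  \<open>D\<close>. A homogeneous subsequence avoids \<open>E\<close> or avoids \<open>D\<close>,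
  and its length \<open>max m n\<close> is too large for either.\<close>

lemma thick_Int:
  assumes "thick D" and "thick E"
  shows "thick (D \<inter> E)"
proof -
  obtain m n where m: "\<And>x. \<not> chain (carrier G - D) m x" and n: "\<And>x. \<not> chain (carrier G - E) n x"
    using assms by (auto simp: thick_def)
  obtain N where N: "\<forall>c :: nat set \<Rightarrow> bool. \<exists>h t. strict_mono_on {..<max m n} h \<and>
      h ` {..<max m n} \<subseteq> {..<N} \<and> (\<forall>S. S \<subseteq> {..<max m n} \<and> card S = 2 \<longrightarrow> c (h ` S) = t)"
    using ramsey_ordered[of "max m n" 2] ..
  have "\<not> chain (carrier G - D \<inter> E) N x" for x
  proof
    assume x: "chain (carrier G - D \<inter> E) N x"
    \<comment> \<open>\<open>Min\<close> and \<open>Max\<close> recover the ordered pair from its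
      underlying set.\<close>
    obtain h t where "strict_mono_on {..<max m n} h \<and> h ` {..<max m n} \<subseteq> {..<N} \<and>
      (\<forall>S. S \<subseteq> {..<max m n} \<and> card S = 2 \<longrightarrow> (inv (x (Min (h ` S))) \<otimes> x (Max (h ` S)) \<in> D) = t)"
      using spec[OF N, of "\<lambda>S. inv (x (Min S)) \<otimes> x (Max S) \<in> D"] by (elim exE) (rule that)
    then have h: "strict_mono_on {..<max m n} h" "h ` {..<max m n} \<subseteq> {..<N}"
      "\<And>S. S \<subseteq> {..<max m n} \<Longrightarrow> card S = 2 \<Longrightarrow> (inv (x (Min (h ` S))) \<otimes> x (Max (h ` S)) \<in> D) = t"
      by simp_all
    have t: "(inv (x (h i)) \<otimes> x (h j) \<in> D) = t" if ij: "i < j" "j < max m n" for i j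
    proof -
      have "h i < h j" using strict_mono_onD[OF h(1), of i j] ij by auto
      then have "Min (h ` {i, j}) = h i" "Max (h ` {i, j}) = h j" by auto
      then show ?thesis using h(3)[of "{i, j}"] ij by simp
    qed
    show False
    proof (cases t)
      case True
      have "chain (carrier G - E) (max m n) (\<lambda>i. x (h i))"
        by (rule chain_reindex[OF x h(1,2)]) (use t True in auto)
      then have "chain (carrier G - E) n (\<lambda>i. x (h i))" by (rule chain_mono) auto
      then show False using n by blast
    next
      case False
      have "chain (carrier G - D) (max m n) (\<lambda>i. x (h i))"
        by (rule chain_reindex[OF x h(1,2)]) (use t False in auto)
      then have "chain (carrier G - D) m (\<lambda>i. x (h i))" by (rule chain_mono) auto
      then show False using m by blast
    qed
  qed
  then show ?thesis unfolding thick_def by blast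
qed

text \<open>Relations inside \<open>Z\<close> are not recorded, only the possibility of continuing
  every finite part of \<open>Z\<close> by arbitrarily long chains. This property is of finite
  character and passes to increasing unions.\<close>

definition extendable :: "'a list set set \<Rightarrow> 'a list set \<Rightarrow> bool" where
  "extendable \<D> Z \<longleftrightarrow> Z \<subseteq> carrier G \<and> (\<forall>F D n. F \<subseteq> Z \<longrightarrow> finite F \<longrightarrow> D \<in> \<D> \<longrightarrow>
     (\<exists>x. chain D n x \<and> (\<forall>f\<in>F. \<forall>j<n. inv f \<otimes> x j \<in> D)))"

lemma gdef_extension:
  assumes "gdef A D" and "finite F" and "F \<subseteq> carrier G"
  shows "gdef (A \<union> (\<Union>f\<in>F. set f)) {z \<in> carrier G. \<exists>x. x 0 = z \<and> chain D (Suc n) x \<and>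
    (\<forall>f\<in>F. \<forall>j<Suc n. inv f \<otimes> x j \<in> D)}"
proof -
  \<comment> \<open>\<open>Inl f\<close> will be replaced by the parameter \<open>f\<close>, and
    \<open>Inr j\<close> is the \<open>j\<close>-th term; term 0 stays free while the others are
    quantified.\<close>
  let ?K = "Inl ` F \<union> Inr ` {..n} :: ('a list + nat) set"
  define Q where "Q x \<longleftrightarrow> (\<forall>f\<in>F. \<forall>j\<in>{..n}. inv (x (Inl f)) \<otimes> x (Inr j) \<in> D) \<and>
      (\<forall>j\<in>{..n}. \<forall>i\<in>{..<j}. inv (x (Inr i)) \<otimes> x (Inr j) \<in> D)" for x :: "'a list + nat \<Rightarrow> 'a list"
  have "gpred A ?K Q" unfolding Q_def
    by (intro gpred_conj gpred_ball gpred_quotient[OF assms(1)] assms(2)) auto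
  moreover have "?K = Inr ` {1..n} \<union> (Inl ` F \<union> {Inr 0})"
  proof -
    have "{..n} = insert 0 {1..n}" by auto
    then show ?thesis by auto
  qed
  ultimately have "gpred A (Inr ` {1..n} \<union> (Inl ` F \<union> {Inr 0})) Q" by simp
  then have "gpred A (Inl ` F \<union> {Inr 0}) (\<lambda>x. \<exists>y. (\<forall>k\<in>Inr ` {1..n}. y k \<in> carrier G) \<and>
      (\<forall>k. k \<notin> Inr ` {1..n} \<longrightarrow> y k = x k) \<and> Q y)"
    by (intro gpred_ex_finite) auto
  then have "gpred (A \<union> (\<Union>f\<in>F. set f)) (UNIV :: unit set) (\<lambda>x. \<exists>y. (\<forall>k\<in>Inr ` {1..n}. y k \<in> carrier G) \<and>
      (\<forall>k. k \<notin> Inr ` {1..n} \<longrightarrow> y k = case_sum x (\<lambda>g. g) (case k of Inl f \<Rightarrow> Inr f | Inr i \<Rightarrow> Inl ())) \<and> Q y)"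
    by (rule gpred_subst) (use assms(3) in auto)
  then have "gdef (A \<union> (\<Union>f\<in>F. set f)) {g \<in> carrier G. \<exists>y. (\<forall>k\<in>Inr ` {1..n}. y k \<in> carrier G) \<and>
      (\<forall>k. k \<notin> Inr ` {1..n} \<longrightarrow> y k = case_sum (\<lambda>_. g) (\<lambda>g. g) (case k of Inl f \<Rightarrow> Inr f | Inr i \<Rightarrow> Inl ())) \<and> Q y}"
    (is "gdef _ ?W") by (rule gdefI)
  moreover have "?W = {z \<in> carrier G. \<exists>x. x 0 = z \<and> chain D (Suc n) x \<and>
    (\<forall>f\<in>F. \<forall>j<Suc n. inv f \<otimes> x j \<in> D)}"
  proof (intro Collect_cong conj_cong refl iffI)
    fix g assume g: "g \<in> carrier G"
    assume "\<exists>y. (\<forall>k\<in>Inr ` {1..n}. y k \<in> carrier G) \<and>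
      (\<forall>k. k \<notin> Inr ` {1..n} \<longrightarrow> y k = case_sum (\<lambda>_. g) (\<lambda>g. g) (case k of Inl f \<Rightarrow> Inr f | Inr i \<Rightarrow> Inl ())) \<and> Q y"
    then obtain y where y: "\<forall>k\<in>Inr ` {1..n}. y k \<in> carrier G" "\<And>k. k \<notin> Inr ` {1..n} \<Longrightarrow>
        y k = case_sum (\<lambda>_. g) (\<lambda>g. g) (case k of Inl f \<Rightarrow> Inr f | Inr i \<Rightarrow> Inl ())" "Q y" by blast
    have y0: "y (Inr 0) = g" and yl: "\<And>f. y (Inl f) = f" by (subst y(2); auto)+
    have yG: "y (Inr j) \<in> carrier G" if "j < Suc n" for j
      using y(1) y0 g that by (cases "j = 0") auto
    have "chain D (Suc n) (\<lambda>j. y (Inr j))"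
      using y(3) yG by (auto simp: chain_def Q_def)
    moreover have "\<forall>f\<in>F. \<forall>j<Suc n. inv f \<otimes> y (Inr j) \<in> D" using y(3) by (auto simp: Q_def yl)
    ultimately show "\<exists>x. x 0 = g \<and> chain D (Suc n) x \<and> (\<forall>f\<in>F. \<forall>j<Suc n. inv f \<otimes> x j \<in> D)"
      using y0 by (intro exI[of _ "\<lambda>j. y (Inr j)"]) auto
  next
    fix g assume "\<exists>x. x 0 = g \<and> chain D (Suc n) x \<and> (\<forall>f\<in>F. \<forall>j<Suc n. inv f \<otimes> x j \<in> D)"
    then obtain x where x: "x 0 = g" "chain D (Suc n) x" "\<forall>f\<in>F. \<forall>j<Suc n. inv f \<otimes> x j \<in> D" by blast
    define y where "y k = (case k of Inl f \<Rightarrow> f | Inr i \<Rightarrow> if i \<le> n then x i else g)" for k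
    have "Q y" using x(2,3) by (auto simp: Q_def y_def chain_def)
    moreover have "\<forall>k\<in>Inr ` {1..n}. y k \<in> carrier G" using x(2) by (auto simp: y_def chain_def)
    moreover have "y k = case_sum (\<lambda>_. g) (\<lambda>g. g) (case k of Inl f \<Rightarrow> Inr f | Inr i \<Rightarrow> Inl ())"
      if "k \<notin> Inr ` {1..n}" for k
      using that x(1) by (cases k) (auto simp: y_def image_iff Suc_le_eq)
    ultimately show "\<exists>y. (\<forall>k\<in>Inr ` {1..n}. y k \<in> carrier G) \<and>
      (\<forall>k. k \<notin> Inr ` {1..n} \<longrightarrow> y k = case_sum (\<lambda>_. g) (\<lambda>g. g) (case k of Inl f \<Rightarrow> Inr f | Inr i \<Rightarrow> Inl ())) \<and> Q y"
      by (intro exI[of _ y]) simp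
  qed
  ultimately show ?thesis by simp
qed

lemma params_less:
  assumes "Z \<subseteq> carrier G" and "|Z| <o \<kappa>"
  shows "|A \<union> (\<Union>f\<in>Z. set f)| <o \<kappa>" and "A \<union> (\<Union>f\<in>Z. set f) \<subseteq> univ C"
proof -
  have "(\<Union>f\<in>Z. set f) \<subseteq> (\<lambda>(f, i). f ! i) ` (Z \<times> {..<len})"
  proof
    fix b assume "b \<in> (\<Union>f\<in>Z. set f)"
    then obtain f i where "f \<in> Z" "i < length f" "b = f ! i" by (auto simp: in_set_conv_nth)
    then show "b \<in> (\<lambda>(f, i). f ! i) ` (Z \<times> {..<len})"
      using carrier_nth(1)[of f] assms(1) by (intro image_eqI[of _ _ "(f, i)"]) auto
  qed
  then have "|\<Union>f\<in>Z. set f| \<le>o |Z \<times> {..<len}|"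
    by (rule card_of_le_trans_image) (simp add: ordLeq_refl card_of_Card_order)
  moreover have "|Z \<times> {..<len}| <o \<kappa>" using assms(2) by (intro card_of_Times_finite Cinfinite_\<kappa>) auto
  ultimately show "|A \<union> (\<Union>f\<in>Z. set f)| <o \<kappa>" by (intro Un_less A_less) (rule ordLeq_ordLess_trans)
  show "A \<union> (\<Union>f\<in>Z. set f) \<subseteq> univ C" using A_univ assms(1) carrier_nth(3) by blast
qed

text \<open>The new point \<open>z\<close> is required to begin chains of all finite lengths
  following each finite part of \<open>Z\<close>. These requirements are definable and finitely
  satisfiable, and a chain that starts with \<open>z\<close> has a tail that follows
  \<open>z\<close> as well.\<close>

lemma extend:
  assumes ne: "\<D> \<noteq> {}" and dir: "\<And>D E. D \<in> \<D> \<Longrightarrow> E \<in> \<D> \<Longrightarrow> D \<inter> E \<in> \<D>"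
    and gd: "\<And>D. D \<in> \<D> \<Longrightarrow> gdef A D" and "|Z| <o \<kappa>" and Z: "extendable \<D> Z"
  shows "\<exists>z\<in>carrier G. extendable \<D> (insert z Z) \<and> (\<forall>f\<in>Z. \<forall>D\<in>\<D>. inv f \<otimes> z \<in> D)"
proof -
  have ZG: "Z \<subseteq> carrier G" using Z by (simp add: extendable_def)
  let ?B = "A \<union> (\<Union>f\<in>Z. set f)"
  have "|?B| <o \<kappa>" "?B \<subseteq> univ C" using params_less[OF ZG assms(4)] by blast+
  define W where "W k = {z \<in> carrier G. \<exists>x. x 0 = z \<and> chain (fst (snd k)) (Suc (snd (snd k))) x \<and>
      (\<forall>f\<in>fst k. \<forall>j<Suc (snd (snd k)). inv f \<otimes> x j \<in> fst (snd k))}"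
    for k :: "'a list set \<times> 'a list set \<times> nat"
  define J :: "('a list set \<times> 'a list set \<times> nat) set"
    where "J = {k. fst k \<subseteq> Z \<and> finite (fst k) \<and> fst (snd k) \<in> \<D>}"
  have "\<exists>g\<in>carrier G. \<forall>D\<in>W ` J. g \<in> D"
  proof (rule saturated_gdef)
    show "A \<subseteq> ?B" by blast
    show "?B \<subseteq> univ C" "|?B| <o \<kappa>" by fact+
    fix D assume "D \<in> W ` J"
    then obtain k where k: "k \<in> J" "D = W k" by blast
    have "gdef (A \<union> (\<Union>f\<in>fst k. set f)) D"
      unfolding k(2) W_def using k(1) ZG gd by (intro gdef_extension) (auto simp: J_def)
    then show "gdef ?B D" by (rule gdef_mono) (use k(1) in \<open>auto simp: J_def\<close>)
  next
    fix \<F> assume "\<F> \<subseteq> W ` J" "finite \<F>"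
    then obtain H where H: "H \<subseteq> J" "finite H" "\<F> = W ` H" by (meson finite_subset_image)
    have "\<exists>D\<in>\<D>. \<forall>k\<in>H. D \<subseteq> fst (snd k)" using H(2,1)
    proof (induction H)
      case empty
      then show ?case using ne by auto
    next
      case (insert k H)
      then obtain D where "D \<in> \<D>" "\<forall>k\<in>H. D \<subseteq> fst (snd k)" by auto
      moreover have "fst (snd k) \<in> \<D>" using insert.prems by (simp add: J_def)
      ultimately show ?case using dir by (intro bexI[of _ "D \<inter> fst (snd k)"]) auto
    qed
    then obtain D where D: "D \<in> \<D>" "\<And>k. k \<in> H \<Longrightarrow> D \<subseteq> fst (snd k)" by blast
    define n where "n = Max (insert 0 ((\<lambda>k. snd (snd k)) ` H))"
    have n: "snd (snd k) \<le> n" if "k \<in> H" for k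
      unfolding n_def using H(2) that by (intro Max_ge) auto
    have "finite (\<Union>k\<in>H. fst k)" "(\<Union>k\<in>H. fst k) \<subseteq> Z" using H by (auto simp: J_def)
    then obtain x where x: "chain D (Suc n) x" "\<forall>f\<in>(\<Union>k\<in>H. fst k). \<forall>j<Suc n. inv f \<otimes> x j \<in> D"
      using Z D(1) unfolding extendable_def by meson
    have "x 0 \<in> carrier G" using x(1) by (simp add: chain_def)
    moreover have "x 0 \<in> W k" if k: "k \<in> H" for k
      unfolding W_def
    proof (intro CollectI conjI exI[of _ x] refl ballI allI impI)
      show "x 0 \<in> carrier G" by fact
      show "chain (fst (snd k)) (Suc (snd (snd k))) x"
        using x(1) D(2)[OF k] n[OF k] by (auto intro: chain_mono)
      show "inv f \<otimes> x j \<in> fst (snd k)" if "f \<in> fst k" "j < Suc (snd (snd k))" for f j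
      proof -
        have "f \<in> (\<Union>k\<in>H. fst k)" "j < Suc n" using k n[OF k] that by auto
        then show ?thesis using x(2) D(2)[OF k] by blast
      qed
    qed
    ultimately show "\<exists>g\<in>carrier G. \<forall>D\<in>\<F>. g \<in> D" unfolding H(3) by (intro bexI[of _ "x 0"]) blast+
  qed
  then obtain z where z: "z \<in> carrier G" "\<And>k. k \<in> J \<Longrightarrow> z \<in> W k" by auto
  have wz: "\<exists>x. x 0 = z \<and> chain D (Suc n) x \<and> (\<forall>f\<in>F. \<forall>j<Suc n. inv f \<otimes> x j \<in> D)"
    if "F \<subseteq> Z" "finite F" "D \<in> \<D>" for F D n
    using z(2)[of "(F, D, n)"] that by (simp add: J_def W_def)
  have "extendable \<D> (insert z Z)"
    unfolding extendable_def
  proof (intro conjI allI impI)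
    show "insert z Z \<subseteq> carrier G" using z(1) ZG by simp
    fix F D n assume F: "F \<subseteq> insert z Z" "finite F" "D \<in> \<D>"
    then have "F - {z} \<subseteq> Z" "finite (F - {z})" by auto
    then obtain x where x: "x 0 = z" "chain D (Suc n) x" "\<forall>f\<in>F - {z}. \<forall>j<Suc n. inv f \<otimes> x j \<in> D"
      using wz F(3) by blast
    \<comment> \<open>Length \<open>Suc n\<close> was asked for so that \<open>n\<close> terms
      remain after \<open>z\<close> is dropped.\<close>
    show "\<exists>x. chain D n x \<and> (\<forall>f\<in>F. \<forall>j<n. inv f \<otimes> x j \<in> D)"
    proof (intro exI[of _ "\<lambda>i. x (Suc i)"] conjI ballI allI impI)
      show "chain D n (\<lambda>i. x (Suc i))" using x(2) by (simp add: chain_def)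
      fix f j assume "f \<in> F" "j < n"
      then show "inv f \<otimes> x (Suc j) \<in> D"
        using x by (cases "f = z") (auto simp: chain_def)
    qed
  qed
  moreover have "inv f \<otimes> z \<in> D" if "f \<in> Z" "D \<in> \<D>" for f D
    using wz[of "{f}" D 0] that by auto
  ultimately show ?thesis using z(1) by blast
qed

end

section \<open>Subgroups of small index and the kernel\<close>

context definable_group_struct
begin

text \<open>\<open>rcosets\<close> counts right cosets, whereas the quotients f^-1 g of a chain
  concern left cosets. Passing to inverses matches the two.\<close>

lemma rcos_eq_imp_quotient:
  assumes "subgroup K G" and "f \<in> carrier G" and "g \<in> carrier G" and "K #> inv f = K #> inv g"
  shows "inv f \<otimes> g \<in> K"
proof -
  have "inv f \<in> K #> inv g" using rcos_self[of "inv f" K] assms by simp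
  then obtain k where k: "k \<in> K" "inv f = k \<otimes> inv g" by (auto simp: r_coset_def)
  then have "inv f \<otimes> g = k" using assms subgroup.mem_carrier[OF assms(1) k(1)] by (simp add: m_assoc)
  then show ?thesis using k(1) by simp
qed

text \<open>A maximal extendable set of pairwise inequivalent elements would have to be too large.\<close>

theorem bounded_index:
  assumes K: "subgroup K G" and index: "|rcosets K| <o \<kappa>"
    and ne: "\<D> \<noteq> {}" and dir: "\<And>D E. D \<in> \<D> \<Longrightarrow> E \<in> \<D> \<Longrightarrow> D \<inter> E \<in> \<D>"
    and gd: "\<And>D. D \<in> \<D> \<Longrightarrow> gdef A D" and chains: "\<And>D n. D \<in> \<D> \<Longrightarrow> \<exists>x. chain D n x"
  shows "\<exists>g\<in>K. \<forall>D\<in>\<D>. g \<in> D"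
proof -
  \<comment> \<open>The elements of a member of \<open>\<Z>\<close> lie in distinct left cosets of
    \<open>K\<close>, so the index bounds its size.\<close>
  define \<Z> where "\<Z> = {Z. extendable \<D> Z \<and> (\<forall>f\<in>Z. \<forall>g\<in>Z. f \<noteq> g \<longrightarrow> inv f \<otimes> g \<notin> K)}"
  have "\<exists>Z\<in>\<Z>. \<forall>X\<in>\<Z>. Z \<subseteq> X \<longrightarrow> X = Z"
  proof (rule subset_Zorn_nonempty)
    have "{} \<in> \<Z>" using chains by (auto simp: \<Z>_def extendable_def)
    then show "\<Z> \<noteq> {}" by blast
    fix \<C> assume ch: "\<C> \<noteq> {}" "subset.chain \<Z> \<C>"
    then have sub: "\<And>Z. Z \<in> \<C> \<Longrightarrow> Z \<in> \<Z>" by (auto simp: subset.chain_def)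
    have fin: "\<exists>Z\<in>\<C>. F \<subseteq> Z" if "finite F" "F \<subseteq> \<Union>\<C>" for F
      using finite_subset_Union_chain[OF that ch] by blast
    have "extendable \<D> (\<Union>\<C>)"
      unfolding extendable_def
    proof (intro conjI allI impI)
      show "\<Union>\<C> \<subseteq> carrier G"
      proof (rule Union_least)
        show "Z \<subseteq> carrier G" if "Z \<in> \<C>" for Z using sub[OF that] by (simp add: \<Z>_def extendable_def)
      qed
      fix F D n assume F: "F \<subseteq> \<Union>\<C>" "finite F" "D \<in> \<D>"
      then obtain Z where "Z \<in> \<C>" "F \<subseteq> Z" using fin by blast
      then show "\<exists>x. chain D n x \<and> (\<forall>f\<in>F. \<forall>j<n. inv f \<otimes> x j \<in> D)"
        using sub[of Z] F(2,3) by (auto simp: \<Z>_def extendable_def)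
    qed
    moreover have "inv f \<otimes> g \<notin> K" if fg: "f \<in> \<Union>\<C>" "g \<in> \<Union>\<C>" "f \<noteq> g" for f g
    proof -
      obtain Z where "Z \<in> \<C>" "{f, g} \<subseteq> Z" using fin[of "{f, g}"] fg by auto
      then show ?thesis using sub[of Z] fg(3) by (auto simp: \<Z>_def)
    qed
    ultimately show "\<Union>\<C> \<in> \<Z>" by (auto simp: \<Z>_def)
  qed
  then obtain Z where Z: "Z \<in> \<Z>" and max: "\<And>X. X \<in> \<Z> \<Longrightarrow> Z \<subseteq> X \<Longrightarrow> X = Z" by blast
  have ext: "extendable \<D> Z" and pw: "\<And>f g. f \<in> Z \<Longrightarrow> g \<in> Z \<Longrightarrow> f \<noteq> g \<Longrightarrow> inv f \<otimes> g \<notin> K"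
    using Z by (auto simp: \<Z>_def)
  have ZG: "\<And>f. f \<in> Z \<Longrightarrow> f \<in> carrier G" using ext by (auto simp: extendable_def)
  have "inj_on (\<lambda>f. K #> inv f) Z"
  proof (rule inj_onI)
    fix f g assume "f \<in> Z" "g \<in> Z" "K #> inv f = K #> inv g"
    then show "f = g" using rcos_eq_imp_quotient[OF K, of f g] pw ZG by blast
  qed
  moreover have "(\<lambda>f. K #> inv f) ` Z \<subseteq> rcosets K" using ZG by (auto simp: RCOSETS_def)
  ultimately have "|Z| \<le>o |rcosets K|" using card_of_ordLeq by blast
  then have "|Z| <o \<kappa>" using index by (rule ordLeq_ordLess_trans)
  then have "\<exists>z\<in>carrier G. extendable \<D> (insert z Z) \<and> (\<forall>f\<in>Z. \<forall>D\<in>\<D>. inv f \<otimes> z \<in> D)"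
    using ne dir gd ext by (intro extend) simp_all
  then obtain z where z: "z \<in> carrier G" "extendable \<D> (insert z Z)"
    "\<And>f D. f \<in> Z \<Longrightarrow> D \<in> \<D> \<Longrightarrow> inv f \<otimes> z \<in> D" by auto
  \<comment> \<open>Either \<open>z\<close> shares a left coset with some \<open>f\<close> in
    \<open>Z\<close>, and f^-1 z is the required element, or \<open>z\<close> may be added. Then
    maximality puts \<open>z\<close> into \<open>Z\<close>, which is absurd because z^-1 z is the
    unit.\<close>
  show ?thesis
  proof (cases "\<exists>f\<in>Z. inv f \<otimes> z \<in> K")
    case True
    then show ?thesis using z(3) by blast
  next
    case False
    have "inv z \<otimes> f \<notin> K" if f: "f \<in> Z" for f
    proof
      assume "inv z \<otimes> f \<in> K"
      then have "inv (inv z \<otimes> f) \<in> K" by (rule subgroup.m_inv_closed[OF K])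
      then show False using False f z(1) ZG[OF f] by (auto simp: inv_mult_group)
    qed
    then have "insert z Z \<in> \<Z>" using False z(2) pw by (auto simp: \<Z>_def)
    then have "z \<in> Z" using max[of "insert z Z"] by blast
    then have "inv z \<otimes> z \<notin> K" using False by blast
    then show ?thesis using z(1) subgroup.one_closed[OF K] by simp
  qed
qed

text \<open>Otherwise the complement of \<open>D\<close> carries chains of every length, and
  smallness of the index produces an element of \<open>K\<close> in that complement.\<close>

lemma thick_superset:
  assumes K: "subgroup K G" and index: "|rcosets K| <o \<kappa>" and "gdef A D" and "K \<subseteq> D"
  shows "thick D"
proof (rule ccontr)
  assume "\<not> thick D"
  then have "\<exists>x. chain (carrier G - D) n x" for n by (auto simp: thick_def)
  then have "\<exists>g\<in>K. \<forall>E\<in>{carrier G - D}. g \<in> E"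
    using gdef_Diff[OF assms(3)] by (intro bounded_index[OF K index]) auto
  then show False using assms(4) by auto
qed

text \<open>By passing to complements, a point of \<open>G\<close> lies here iff every
  \<open>A\<close>-definable set containing it carries chains of all lengths. The set is not itself
  claimed to be a subgroup.\<close>

definition kernel :: "'a list set" where
  "kernel = \<Inter>{D. gdef A D \<and> thick D}"

lemma kernel_carrier: "kernel \<subseteq> carrier G"
  using gdef_carrier[OF order_refl] thick_carrier by (auto simp: kernel_def)

text \<open>Invariance is used through types: some \<open>h\<close> in \<open>K\<close> lies in all
  \<open>A\<close>-definable sets containing \<open>g\<close>, an automorphism over \<open>A\<close>
  takes \<open>g\<close> to \<open>h\<close>, and it maps \<open>K\<close> onto itself.\<close>

theorem kernel_subset:
  assumes K: "subgroup K G" and "invariant L C A K" and index: "|rcosets K| <o \<kappa>"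
  shows "kernel \<subseteq> K"
proof
  fix g assume g: "g \<in> kernel"
  then have gG: "g \<in> carrier G" using kernel_carrier by blast
  let ?D = "{D. gdef A D \<and> g \<in> D}"
  have "\<exists>h\<in>K. \<forall>D\<in>?D. h \<in> D"
  proof (rule bounded_index[OF K index])
    show "?D \<noteq> {}" using gdef_carrier[OF order_refl] gG by blast
    show "D \<inter> E \<in> ?D" if "D \<in> ?D" "E \<in> ?D" for D E using that gdef_Int by auto
    show "gdef A D" if "D \<in> ?D" for D using that by simp
    show "\<exists>x. chain D n x" if D: "D \<in> ?D" for D n
    proof -
      have "\<not> thick (carrier G - D)" using g D gdef_Diff[of A D] by (auto simp: kernel_def)
      moreover have "carrier G - (carrier G - D) = D" using D gdef_carrier_subset by auto
      ultimately show ?thesis by (auto simp: thick_def)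
    qed
  qed
  then obtain h where h: "h \<in> K" "\<And>D. gdef A D \<Longrightarrow> g \<in> D \<Longrightarrow> h \<in> D" by auto
  have "h \<in> carrier G" using h(1) subgroup.mem_carrier[OF K] by blast
  then obtain \<sigma> where \<sigma>: "\<sigma> \<in> auts L C A" "map \<sigma> g = h"
    using homogeneous_element[OF gG _ h(2)] by blast
  have "map \<sigma> ` K = K" using assms(2) \<sigma>(1) by (simp add: invariant_def)
  then obtain k where k: "k \<in> K" "h = map \<sigma> k" using h(1) by blast
  have "inj_on \<sigma> (univ C)" using \<sigma>(1) by (rule aut_inj)
  moreover have "set g \<subseteq> univ C" "set k \<subseteq> univ C"
    using carrier_nth(3) gG subgroup.mem_carrier[OF K k(1)] by blast+
  ultimately have "g = k" using \<sigma>(2) k(2)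
    by (metis (no_types, lifting) inj_on_map_eq_map inj_on_subset Un_subset_iff)
  then show "g \<in> K" using k(1) by simp
qed

section \<open>Products of definable sets\<close>

lemma gdef_set_mult:
  assumes "gdef B U" and "gdef B V" and "A \<subseteq> B"
  shows "gdef B (U <#> V)"
proof -
  define Q :: "(unit option \<Rightarrow> 'a list) \<Rightarrow> bool"
    where "Q y \<longleftrightarrow> y None \<in> U \<and> inv (y None) \<otimes> y (Some ()) \<in> V" for y
  have "gpred B (insert None (Some ` (UNIV :: unit set))) Q"
    unfolding Q_def using assms
    by (intro gpred_conj gdef_gpred[OF assms(1)] gpred_quotient[OF assms(2)]) auto
  from gdefI[OF gpred_ex[OF assms(3) this]]
  have "gdef B {g \<in> carrier G. \<exists>z\<in>carrier G. z \<in> U \<and> inv z \<otimes> g \<in> V}" by (simp add: Q_def)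
  moreover have "{g \<in> carrier G. \<exists>z\<in>carrier G. z \<in> U \<and> inv z \<otimes> g \<in> V} = U <#> V"
  proof (intro equalityI subsetI)
    fix g assume "g \<in> {g \<in> carrier G. \<exists>z\<in>carrier G. z \<in> U \<and> inv z \<otimes> g \<in> V}"
    then obtain z where z: "g \<in> carrier G" "z \<in> carrier G" "z \<in> U" "inv z \<otimes> g \<in> V" by blast
    then have "g = z \<otimes> (inv z \<otimes> g)" by (simp add: m_assoc[symmetric])
    then show "g \<in> U <#> V" using z by (auto simp: set_mult_def)
  next
    fix g assume "g \<in> U <#> V"
    then obtain u v where uv: "u \<in> U" "v \<in> V" "g = u \<otimes> v" by (auto simp: set_mult_def)
    then have G: "u \<in> carrier G" "v \<in> carrier G" using assms gdef_carrier_subset by blast+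
    then have "inv u \<otimes> g = v" using uv by (simp add: m_assoc[symmetric])
    then show "g \<in> {g \<in> carrier G. \<exists>z\<in>carrier G. z \<in> U \<and> inv z \<otimes> g \<in> V}" using uv G by auto
  qed
  ultimately show ?thesis by simp
qed

lemma gdef_one:
  assumes "A \<subseteq> B"
  shows "gdef B {\<one>}"
proof -
  have "gdef B {g \<in> carrier G. g \<otimes> g = g}"
    using gdefI[OF gpred_mult[OF assms, of "()" UNIV "()" "()"]] by simp
  moreover have "{g \<in> carrier G. g \<otimes> g = g} = {\<one>}"
    by (auto simp: r_cancel_one')
  ultimately show ?thesis by simp
qed

definition inverses :: "'a list set \<Rightarrow> 'a list set" where
  "inverses D = {g \<in> carrier G. inv g \<in> D}"

lemma gdef_inverses:
  assumes "gdef B D" and "A \<subseteq> B"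
  shows "gdef B (inverses D)"
proof -
  define Q :: "(unit option \<Rightarrow> 'a list) \<Rightarrow> bool"
    where "Q y \<longleftrightarrow> y None \<in> {\<one>} \<and> inv (y (Some ())) \<otimes> y None \<in> D" for y
  have "gpred B (insert None (Some ` (UNIV :: unit set))) Q"
    unfolding Q_def using assms
    by (intro gpred_conj gdef_gpred[OF gdef_one[OF assms(2)]] gpred_quotient[OF assms(1)]) auto
  from gdefI[OF gpred_ex[OF assms(2) this]]
  have "gdef B {g \<in> carrier G. \<exists>z\<in>carrier G. z = \<one> \<and> inv g \<otimes> z \<in> D}" by (simp add: Q_def)
  moreover have "{g \<in> carrier G. \<exists>z\<in>carrier G. z = \<one> \<and> inv g \<otimes> z \<in> D} = inverses D"
    by (auto simp: inverses_def)
  ultimately show ?thesis by simp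
qed

lemma gdef_quotient_param:
  assumes "gdef A V" and "g \<in> carrier G"
  shows "gdef (A \<union> set g) {u \<in> carrier G. inv u \<otimes> g \<in> V}"
proof -
  have "gpred A (UNIV :: bool set) (\<lambda>x. inv (x True) \<otimes> x False \<in> V)"
    by (intro gpred_quotient[OF assms(1)]) auto
  then have "gpred (A \<union> set g) (UNIV :: unit set)
      (\<lambda>x. inv (case_sum x (\<lambda>g. g) (if True then Inl () else Inr g)) \<otimes>
        case_sum x (\<lambda>g. g) (if False then Inl () else Inr g) \<in> V)"
    by (rule gpred_subst[where t = "\<lambda>b. if b then Inl () else Inr g"]) (use assms(2) in auto)
  from gdefI[OF this] show ?thesis by simp
qed

lemma finite_lower_bound:
  assumes "\<D> \<noteq> {}" and "\<And>D E. D \<in> \<D> \<Longrightarrow> E \<in> \<D> \<Longrightarrow> D \<inter> E \<in> \<D>" and "finite F" and "F \<subseteq> \<D>"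
  shows "\<exists>D\<in>\<D>. \<forall>E\<in>F. D \<subseteq> E"
  using assms(3,4)
proof (induction F)
  case empty
  then show ?case using assms(1) by auto
next
  case (insert E F)
  then obtain D where "D \<in> \<D>" "\<forall>E\<in>F. D \<subseteq> E" by auto
  then show ?case using assms(2)[of D E] insert.prems by (intro bexI[of _ "D \<inter> E"]) auto
qed

text \<open>An intersection of products is a product of intersections: the left factor is realised
  over the extra parameter \<open>g\<close>, and monotonicity lets one small \<open>D\<close> serve
  finitely many requirements.\<close>

lemma set_mult_compactness:
  assumes ne: "\<D> \<noteq> {}" and dir: "\<And>D E. D \<in> \<D> \<Longrightarrow> E \<in> \<D> \<Longrightarrow> D \<inter> E \<in> \<D>"
    and U: "\<And>D. D \<in> \<D> \<Longrightarrow> gdef A (U D)" and V: "\<And>D. D \<in> \<D> \<Longrightarrow> gdef A (V D)"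
    and mono: "\<And>D E. D \<subseteq> E \<Longrightarrow> U D \<subseteq> U E \<and> V D \<subseteq> V E"
    and g: "g \<in> carrier G" "\<And>D. D \<in> \<D> \<Longrightarrow> g \<in> U D <#> V D"
  shows "\<exists>u v. g = u \<otimes> v \<and> u \<in> carrier G \<and> v \<in> carrier G \<and> (\<forall>D\<in>\<D>. u \<in> U D \<and> v \<in> V D)"
proof -
  let ?W = "\<lambda>D. U D \<inter> {u \<in> carrier G. inv u \<otimes> g \<in> V D}"
  have "\<exists>u\<in>carrier G. \<forall>W\<in>?W ` \<D>. u \<in> W"
  proof (rule saturated_gdef)
    show "A \<subseteq> A \<union> set g" by blast
    show "A \<union> set g \<subseteq> univ C" using A_univ carrier_nth(3)[OF g(1)] by blast
    show "|A \<union> set g| <o \<kappa>" by (intro Un_less A_less finite_less) simp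
    fix W assume "W \<in> ?W ` \<D>"
    then obtain D where D: "D \<in> \<D>" "W = ?W D" by blast
    have "gdef (A \<union> set g) (U D)" by (rule gdef_mono[OF U[OF D(1)]]) simp
    then show "gdef (A \<union> set g) W" unfolding D(2)
      by (rule gdef_Int) (rule gdef_quotient_param[OF V[OF D(1)] g(1)])
  next
    fix \<F> assume "\<F> \<subseteq> ?W ` \<D>" "finite \<F>"
    then obtain F where F: "F \<subseteq> \<D>" "finite F" "\<F> = ?W ` F" by (meson finite_subset_image)
    obtain D where D: "D \<in> \<D>" "\<forall>E\<in>F. D \<subseteq> E" using finite_lower_bound[OF ne dir F(2,1)] by blast
    obtain u v where uv: "u \<in> U D" "v \<in> V D" "g = u \<otimes> v"
      using g(2)[OF D(1)] by (auto simp: set_mult_def)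
    have G: "u \<in> carrier G" "v \<in> carrier G"
      using uv U[OF D(1)] V[OF D(1)] gdef_carrier_subset by blast+
    then have "inv u \<otimes> g = v" using uv by (simp add: m_assoc[symmetric])
    then have "u \<in> ?W E" if "E \<in> F" for E using uv mono[of D E] D(2) that G by auto
    then show "\<exists>u\<in>carrier G. \<forall>W\<in>\<F>. u \<in> W" unfolding F(3) using G by (intro bexI[of _ u]) auto
  qed
  then obtain u where u: "u \<in> carrier G" "\<And>D. D \<in> \<D> \<Longrightarrow> u \<in> U D \<and> inv u \<otimes> g \<in> V D" by auto
  then have "g = u \<otimes> (inv u \<otimes> g)" using g(1) by (simp add: m_assoc[symmetric])
  then show ?thesis using u g(1) by (intro exI[of _ u] exI[of _ "inv u \<otimes> g"]) simp
qed

text \<open>The n-th power of D^-1 D. For thick \<open>A\<close>-definable \<open>D\<close> it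
  contains whatever \<open>n\<close> Lascar steps from the unit can reach.\<close>

primrec qpow :: "'a list set \<Rightarrow> nat \<Rightarrow> 'a list set" where
  "qpow D 0 = {\<one>}"
| "qpow D (Suc n) = qpow D n <#> (inverses D <#> D)"

lemma qpow_mono: "D \<subseteq> E \<Longrightarrow> qpow D n \<subseteq> qpow E n"
proof (induction n)
  case (Suc n)
  then show ?case by (auto simp: set_mult_def inverses_def) blast
qed simp

lemma qpow_carrier: "D \<subseteq> carrier G \<Longrightarrow> qpow D n \<subseteq> carrier G"
proof (induction n)
  case (Suc n)
  then show ?case by (auto simp: set_mult_def inverses_def subset_iff)
qed simp

lemma gdef_qpow: "gdef B D \<Longrightarrow> A \<subseteq> B \<Longrightarrow> gdef B (qpow D n)"
  by (induction n) (simp_all add: gdef_one gdef_set_mult gdef_inverses)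

text \<open>If d lies in \<open>D\<close>, the unit d^-1 d lies in D^-1 D and can be appended as a
  factor.\<close>

lemma qpow_le:
  assumes "D \<subseteq> carrier G" and "D \<noteq> {}" and "m \<le> n"
  shows "qpow D m \<subseteq> qpow D n"
  using assms(3)
proof (induction rule: dec_induct)
  case (step k)
  obtain d where d: "d \<in> D" "d \<in> carrier G" using assms(1,2) by blast
  have "inv d \<in> inverses D" using d by (simp add: inverses_def)
  then have "inv d \<otimes> d \<in> inverses D <#> D" using d(1) by (auto simp: set_mult_def)
  then have 1: "\<one> \<in> inverses D <#> D" using d by simp
  have "g \<in> qpow D (Suc k)" if g: "g \<in> qpow D k" for g
  proof -
    have "g \<otimes> \<one> \<in> qpow D (Suc k)" 
      unfolding qpow.simps set_mult_def[of _ "qpow D k"] using g 1 by blast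
    then show ?thesis using subsetD[OF qpow_carrier[OF assms(1)] g] by (simp del: qpow.simps)
  qed
  then show ?case using step.IH by blast
qed simp

lemma thick_nonempty: "thick D \<Longrightarrow> D \<noteq> {}"
proof
  assume "thick D" "D = {}"
  then obtain n where "\<And>x. \<not> chain (carrier G) n x" by (auto simp: thick_def)
  then have "\<not> chain (carrier G) n (\<lambda>_. \<one>)" .
  then show False by (simp add: chain_def)
qed

text \<open>By compactness a point in all these powers splits into factors taken from the
  intersection of all thick sets and from its inverse. Closure of thick sets under intersection
  provides the directedness needed here.\<close>

theorem qpow_kernel:
  assumes K: "subgroup K G" and "kernel \<subseteq> K"
    and "g \<in> carrier G" and "\<And>D. gdef A D \<Longrightarrow> thick D \<Longrightarrow> g \<in> qpow D n"
  shows "g \<in> K"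
  using assms(3,4)
proof (induction n arbitrary: g)
  case 0
  then have "g \<in> qpow (carrier G) 0" using gdef_carrier[OF order_refl] thick_carrier by blast
  then show ?case using subgroup.one_closed[OF K] by simp
next
  case (Suc n)
  let ?D = "{D. gdef A D \<and> thick D}"
  have ne: "?D \<noteq> {}" using gdef_carrier[OF order_refl] thick_carrier by blast
  have dir: "D \<inter> E \<in> ?D" if "D \<in> ?D" "E \<in> ?D" for D E using that gdef_Int thick_Int by auto
  have im: "D \<subseteq> E \<Longrightarrow> inverses D \<subseteq> inverses E" for D E by (auto simp: inverses_def)
  have "\<exists>u v. g = u \<otimes> v \<and> u \<in> carrier G \<and> v \<in> carrier G \<and>
      (\<forall>D\<in>?D. u \<in> qpow D n \<and> v \<in> inverses D <#> D)"
  proof (rule set_mult_compactness[OF ne dir])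
    show "gdef A (qpow D n)" "gdef A (inverses D <#> D)" if "D \<in> ?D" for D
      using that by (auto intro: gdef_qpow gdef_set_mult gdef_inverses)
    show "qpow D n \<subseteq> qpow E n \<and> inverses D <#> D \<subseteq> inverses E <#> E" if "D \<subseteq> E" for D E
      using that qpow_mono mono_set_mult[OF im[OF that] that] by blast
    show "g \<in> carrier G" by fact
    show "g \<in> qpow D n <#> (inverses D <#> D)" if "D \<in> ?D" for D using Suc.prems(2) that by simp
  qed
  then obtain u v where uv: "g = u \<otimes> v" "u \<in> carrier G" "v \<in> carrier G"
    "\<And>D. D \<in> ?D \<Longrightarrow> u \<in> qpow D n" "\<And>D. D \<in> ?D \<Longrightarrow> v \<in> inverses D <#> D" by blast
  have "u \<in> K" using Suc.IH[OF uv(2)] uv(4) by simp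
  \<comment> \<open>A second splitting separates the factor in D^-1 from the factor in
    \<open>D\<close>, uniformly in \<open>D\<close>.\<close>
  have "\<exists>s t. v = s \<otimes> t \<and> s \<in> carrier G \<and> t \<in> carrier G \<and> (\<forall>D\<in>?D. s \<in> inverses D \<and> t \<in> D)"
  proof (rule set_mult_compactness[OF ne dir])
    show "gdef A (inverses D)" "gdef A D" if "D \<in> ?D" for D
      using that by (auto intro: gdef_inverses)
    show "inverses D \<subseteq> inverses E \<and> D \<subseteq> E" if "D \<subseteq> E" for D E using that im by blast
  qed (use uv in auto)
  then obtain s t where st: "v = s \<otimes> t" "s \<in> carrier G"
    "\<And>D. D \<in> ?D \<Longrightarrow> s \<in> inverses D" "\<And>D. D \<in> ?D \<Longrightarrow> t \<in> D" by blast
  have "inv s \<in> kernel" "t \<in> kernel" using st(3,4) by (auto simp: kernel_def inverses_def)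
  then have "inv s \<in> K" "t \<in> K" using assms(2) by auto
  then have "v \<in> K" using st(1,2) subgroup.m_inv_closed[OF K, of "inv s"] subgroup.m_closed[OF K] by simp
  with \<open>u \<in> K\<close> show ?case unfolding uv(1) by (rule subgroup.m_closed[OF K])
qed

end

section \<open>The principal homogeneous space as an interpreted structure\<close>

text \<open>Without function symbols every term is a variable, so the formulas can be counted by
  their size.\<close>

lemma card_of_relational_formulas:
  fixes L :: "('s, 'f, 'r) signature" and r :: "'k rel"
  assumes rel: "Funs L = {}" and r: "Cinfinite r" and "|Sorts L| \<le>o r" and "|Rels L| \<le>o r"
  shows "|formulas L| \<le>o r"
proof -
  have inf: "infinite (Field r)" "Card_order r" using r by (auto simp: cinfinite_def)
  have nat: "|UNIV :: nat set| \<le>o r"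
    using r by (meson card_of_nat natLeq_ordLeq_cinfinite ordIso_ordLeq_trans)
  define V where "V = (UNIV :: nat set) \<times> Sorts L"
  define T where "T = {t. wf_tm L t}"
  define F where "F n = {\<phi> \<in> formulas L. size \<phi> < n}" for n
  have V: "|V| \<le>o r" unfolding V_def using inf nat assms(3) by (intro card_of_Times_ordLeq_infinite_Field)
  have "T \<subseteq> Var ` V"
  proof
    fix t assume "t \<in> T"
    then show "t \<in> Var ` V" using rel by (cases t) (auto simp: T_def V_def)
  qed
  then have T: "|T| \<le>o r" using V by (rule card_of_le_trans_image)
  have Tl: "|lists T| \<le>o r" by (rule card_of_lists_le[OF r T])
  have "|F n| \<le>o r" for n
  proof (induction n)
    case 0
    have "F 0 = {}" by (simp add: F_def)
    then show ?case by (simp add: card_of_empty1 inf(2) card_of_empty)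
  next
    case (Suc n)
    have sub: "F (Suc n) \<subseteq> {Bot} \<union> (\<lambda>(t, u). Eq t u) ` (T \<times> T) \<union> (\<lambda>(r, ts). Rel r ts) ` (Rels L \<times> lists T)
        \<union> (\<lambda>(\<phi>, \<psi>). Imp \<phi> \<psi>) ` (F n \<times> F n) \<union> (\<lambda>(v, \<phi>). All v \<phi>) ` (V \<times> F n)" (is "_ \<subseteq> ?U")
    proof
      fix \<phi> assume \<phi>: "\<phi> \<in> F (Suc n)"
      show "\<phi> \<in> ?U"
      proof (cases \<phi>)
        case (Eq t u)
        then have "(t, u) \<in> T \<times> T" using \<phi> by (auto simp: F_def T_def formulas_def)
        then show ?thesis using Eq by (intro UnI1 UnI2 image_eqI[of _ _ "(t, u)"]) auto
      next
        case (Rel q ts)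
        then have "(q, ts) \<in> Rels L \<times> lists T" using \<phi> by (auto simp: F_def T_def formulas_def in_lists_conv_set)
        then show ?thesis using Rel by (intro UnI1 UnI2 image_eqI[of _ _ "(q, ts)"]) auto
      next
        case (Imp \<psi> \<chi>)
        then have "(\<psi>, \<chi>) \<in> F n \<times> F n" using \<phi> by (auto simp: F_def formulas_def)
        then show ?thesis using Imp by (intro UnI1 UnI2 image_eqI[of _ _ "(\<psi>, \<chi>)"]) auto
      next
        case (All v \<psi>)
        then have "(v, \<psi>) \<in> V \<times> F n" using \<phi> by (cases v) (auto simp: F_def V_def formulas_def)
        then show ?thesis using All by (intro UnI2 image_eqI[of _ _ "(v, \<psi>)"]) auto
      qed simp
    qed
    have "|{Bot} :: ('s, 'f, 'r) fm set| \<le>o r"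
      by (intro ordLess_imp_ordLeq finite_less_Cinfinite r) simp
    then have "|?U| \<le>o r"
      using inf assms(4) T Tl V Suc r
      by (intro Un_Cinfinite_bound card_of_le_trans_image[OF order_refl] card_of_Times_ordLeq_infinite_Field)
    then show ?case using card_of_mono1[OF sub] ordLeq_transitive by blast
  qed
  then have "|\<Union>n. F n| \<le>o r" by (intro UNION_Cinfinite_bound[OF nat _ r]) simp
  moreover have "formulas L = (\<Union>n. F n)" by (auto simp: F_def)
  ultimately show ?thesis by simp
qed

lemma nth_concat_uniform:
  assumes "\<And>d. d \<in> set ds \<Longrightarrow> length d = m" and "k < length ds" and "i < m"
  shows "concat ds ! (k * m + i) = ds ! k ! i"
  using assms
proof (induction ds arbitrary: k)
  case (Cons d ds)
  then have d: "length d = m" by simp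
  show ?case
  proof (cases k)
    case 0
    then show ?thesis using Cons.prems(3) d by (simp add: nth_append)
  next
    case (Suc k')
    then have "concat ds ! (k' * m + i) = ds ! k' ! i" using Cons by simp
    then show ?thesis using Suc d by (simp add: nth_append add.assoc)
  qed
qed simp

lemma length_concat_uniform:
  "(\<And>d. d \<in> set ds \<Longrightarrow> length d = m) \<Longrightarrow> length (concat ds) = length ds * m"
  by (induction ds) auto

lemma listset_replicate: "listset (replicate n S) = {ds. length ds = n \<and> set ds \<subseteq> S}"
proof (induction n)
  case (Suc n)
  then show ?case by (auto simp: set_Cons_def length_Suc_conv)
qed auto

section \<open>Left invariant definable relations\<close>

context definable_group_struct
begin

lemma gpred_eq:
  assumes "k \<in> K" and "l \<in> K"
  shows "gpred B K (\<lambda>x. x k = x l)"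
proof (rule gpredI)
  show "expressible L C (K \<times> {..<len}) (\<lambda>k. ss ! snd k) B (\<lambda>M' a. \<forall>i\<in>{..<len}. a (k, i) = a (l, i))"
    using assms sort_nth by (intro expressible_ball expressible_eq_var) auto
  fix x assume "\<forall>k\<in>K. x k \<in> carrier G"
  then have "length (x k) = len" "length (x l) = len" using assms carrier_nth(1) by auto
  then show "(\<forall>i\<in>{..<len}. coords x (k, i) = coords x (l, i)) \<longleftrightarrow> x k = x l"
    by (auto intro: nth_equalityI)
qed

text \<open>An interpretation describes an n-ary relation as a set of concatenated tuples;
  coordinate \<open>i\<close> of the group variable \<open>k\<close> sits at position
  \<open>k * len + i\<close>.\<close>

lemma gpred_definable_concat:
  assumes "gpred B {..<n} Q" and "A \<subseteq> B"
    and dep: "\<And>x y. (\<And>k. k < n \<Longrightarrow> x k = y k) \<Longrightarrow> Q x \<longleftrightarrow> Q y"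
  shows "definable L C B (concat (replicate n ss))
    {concat ds | ds. length ds = n \<and> set ds \<subseteq> carrier G \<and> Q ((!) ds)}" (is "definable _ _ _ ?s ?S")
proof -
  have sl: "length ?s = n * len" by (induction n) simp_all
  have sn: "?s ! (k * len + i) = ss ! i" if "k < n" "i < len" for k i
    using that nth_concat_uniform[of "replicate n ss" len k i] by simp
  have idx: "k * len + i < n * len" if "k < n" "i < len" for k i
  proof -
    have "k * len + i < Suc k * len" using that by simp
    also have "\<dots> \<le> n * len" using that by (intro mult_le_mono1) simp
    finally show ?thesis .
  qed
  obtain R where R: "expressible L C ({..<n} \<times> {..<len}) (\<lambda>k. ss ! snd k) B R"
    "\<And>x. \<forall>k\<in>{..<n}. x k \<in> carrier G \<Longrightarrow> R C (coords x) \<longleftrightarrow> Q x"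
    using assms(1) unfolding gpred_def by blast
  obtain p where p: "p \<in> pformulas L C {..<len} ((!) ss) A"
    "carrier G = {xs \<in> tuples C ss. psat C ((!) xs) p}" by (rule carrier_condition)
  have ep: "expressible L C {..<len} ((!) ss) A (\<lambda>M' a. psat M' a p)" using p(1) by blast
  have "expressible L C {..<length ?s} ((!) ?s) B (\<lambda>M' a. R M' (\<lambda>k. a (fst k * len + snd k)))"
    by (rule expressible_reindex[OF R(1) order_refl]) (use idx sn in \<open>auto simp: sl\<close>)
  moreover have "expressible L C {..<length ?s} ((!) ?s) B (\<lambda>M' a. psat M' (\<lambda>i. a (k * len + i)) p)"
    if "k < n" for k
    by (rule expressible_reindex[OF ep assms(2)]) (use that idx sn in \<open>auto simp: sl\<close>)
  ultimately have "expressible L C {..<length ?s} ((!) ?s) B (\<lambda>M' a. R M' (\<lambda>k. a (fst k * len + snd k)) \<and>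
      (\<forall>k\<in>{..<n}. psat M' (\<lambda>i. a (k * len + i)) p))"
    by (intro expressible_conj expressible_ball) simp_all
  then obtain q where q: "q \<in> pformulas L C {..<length ?s} ((!) ?s) B"
    "\<And>a. psat C a q \<longleftrightarrow> R C (\<lambda>k. a (fst k * len + snd k)) \<and> (\<forall>k\<in>{..<n}. psat C (\<lambda>i. a (k * len + i)) p)"
    unfolding expressible_def by blast
  have "?S = {xs \<in> tuples C ?s. psat C ((!) xs) q}"
  proof (intro equalityI subsetI)
    fix xs assume "xs \<in> ?S"
    then obtain ds where ds: "xs = concat ds" "length ds = n" "set ds \<subseteq> carrier G" "Q ((!) ds)" by blast
    have dl: "length d = len" if "d \<in> set ds" for d using ds(3) that carrier_nth(1) by blast
    have nth: "xs ! (k * len + i) = ds ! k ! i" if "k < n" "i < len" for k i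
      using nth_concat_uniform[OF dl, where k = k and i = i] that ds(1,2) by simp
    have dG: "ds ! k \<in> carrier G" if "k < n" for k using ds(2,3) that by auto
    have "R C (\<lambda>k. xs ! (fst k * len + snd k)) \<longleftrightarrow> R C (coords ((!) ds))"
      by (rule expressible_cong_valuation[OF R(1)]) (auto simp: nth)
    moreover have "R C (coords ((!) ds))" using R(2)[of "(!) ds"] ds(4) dG by simp
    moreover have "psat C (\<lambda>i. xs ! (k * len + i)) p" if k: "k < n" for k
    proof -
      have "psat C (\<lambda>i. xs ! (k * len + i)) p \<longleftrightarrow> psat C ((!) (ds ! k)) p"
        by (rule expressible_cong_valuation[OF ep]) (simp add: nth k)
      then show ?thesis using dG[OF k] p(2) by blast
    qed
    moreover have "xs \<in> tuples C ?s"
    proof -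
      have "map (srt C) d = ss" "set d \<subseteq> univ C" if "d \<in> set ds" for d
        using carrier_tuples ds(3) that by (auto simp: tuples_def)
      then have "map (map (srt C)) ds = replicate n ss" using ds(2)
        by (intro nth_equalityI) auto
      then show ?thesis using \<open>\<And>d. d \<in> set ds \<Longrightarrow> set d \<subseteq> univ C\<close>
        by (auto simp: tuples_def ds(1) map_concat)
    qed
    ultimately show "xs \<in> {xs \<in> tuples C ?s. psat C ((!) xs) q}" by (simp add: q(2))
  next
    fix xs assume "xs \<in> {xs \<in> tuples C ?s. psat C ((!) xs) q}"
    then have xs: "xs \<in> tuples C ?s" "R C (\<lambda>k. xs ! (fst k * len + snd k))"
      "\<And>k. k < n \<Longrightarrow> psat C (\<lambda>i. xs ! (k * len + i)) p" using q(2) by auto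
    have "map (srt C) xs = ?s" using xs(1) by (simp add: tuples_def)
    from arg_cong[OF this, of length] have xl: "length xs = n * len" using sl by simp
    define ds where "ds = map (\<lambda>k. map (\<lambda>i. xs ! (k * len + i)) [0..<len]) [0..<n]"
    have ds_nth: "ds ! k ! i = xs ! (k * len + i)" if "k < n" "i < len" for k i
      using that by (simp add: ds_def)
    have dl: "length d = len" if "d \<in> set ds" for d using that by (auto simp: ds_def)
    have cl: "length (concat ds) = n * len"
    proof -
      have "length (concat ds) = length ds * len" by (rule length_concat_uniform) (rule dl)
      then show ?thesis by (simp add: ds_def)
    qed
    have cat: "concat ds = xs"
    proof (rule nth_equalityI)
      show "length (concat ds) = length xs" by (simp add: cl xl)
      fix j assume j: "j < length (concat ds)"
      \<comment> \<open>If the sort tuple is empty, so is the concatenation, and there is no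
        position \<open>j\<close>.\<close>
      then have "len > 0" using cl by (cases "len = 0") auto
      then have jj: "j div len < n" "j mod len < len" "j = j div len * len + j mod len"
        using j cl by (auto simp: less_mult_imp_div_less)
      have "concat ds ! (j div len * len + j mod len) = ds ! (j div len) ! (j mod len)"
        by (rule nth_concat_uniform[OF dl _ jj(2)]) (simp_all add: ds_def jj(1))
      then show "concat ds ! j = xs ! j" using ds_nth[OF jj(1,2)] jj(3) by simp
    qed
    have dG: "ds ! k \<in> carrier G" if k: "k < n" for k
    proof -
      have "psat C ((!) (ds ! k)) p \<longleftrightarrow> psat C (\<lambda>i. xs ! (k * len + i)) p"
        by (rule expressible_cong_valuation[OF ep]) (simp add: ds_nth k)
      moreover have "ds ! k \<in> tuples C ss"
      proof -
        have *: "xs ! (k * len + i) \<in> univ C" "srt C (xs ! (k * len + i)) = ss ! i" if i: "i < len" for i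
        proof -
          have m: "k * len + i < length xs" using idx[OF k i] xl by simp
          then show "xs ! (k * len + i) \<in> univ C" using xs(1) nth_mem[OF m] by (auto simp: tuples_def)
          have "map (srt C) xs ! (k * len + i) = ss ! i" using xs(1) sn[OF k i] by (simp add: tuples_def)
          then show "srt C (xs ! (k * len + i)) = ss ! i" using m by simp
        qed
        have "ds ! k = map (\<lambda>i. xs ! (k * len + i)) [0..<len]" using k by (simp add: ds_def)
        then show ?thesis using * by (auto simp: tuples_def intro!: nth_equalityI)
      qed
      ultimately show ?thesis using xs(3)[OF k] p(2) by blast
    qed
    have "R C (\<lambda>k. xs ! (fst k * len + snd k)) \<longleftrightarrow> R C (coords ((!) ds))"
      by (rule expressible_cong_valuation[OF R(1)]) (auto simp: ds_nth)
    then have "Q ((!) ds)" using R(2)[of "(!) ds"] xs(2) dG by simp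
    moreover have "set ds \<subseteq> carrier G" using dG by (auto simp: in_set_conv_nth ds_def)
    ultimately show "xs \<in> ?S" using cat by (auto simp: ds_def intro!: exI[of _ ds])
  qed
  then show ?thesis using q(1) by (auto simp: definable_def)
qed

text \<open>Each relation is its own symbol. The arity is recorded because the empty set is a
  relation of every arity. Invariance is an inclusion here; applied to inverses it becomes an
  equivalence.\<close>

definition relations :: "(nat \<times> 'a list list set) set" where
  "relations = {(n, R). R \<subseteq> {ds. length ds = n \<and> set ds \<subseteq> carrier G} \<and>
     gpred A {..<n} (\<lambda>x. map x [0..<n] \<in> R) \<and> (\<forall>g\<in>carrier G. \<forall>ds\<in>R. map ((\<otimes>) g) ds \<in> R)}"

text \<open>The torsor has to be a monster model for the same \<open>\<kappa>\<close>, so its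
  language may not exceed |L| + |A|. A relation is determined by its arity and a condition over
  \<open>A\<close>, and conditions have few representatives.\<close>

lemma card_of_relations: "|relations| \<le>o |formulas L| +c |A|"
proof -
  let ?r = "|formulas L| +c |A|"
  have r: "Cinfinite ?r" by (rule Cinfinite_csum1[OF Cinfinite_formulas])
  have f: "|formulas L| \<le>o ?r" "|A| \<le>o ?r" by (simp_all add: ordLeq_csum1 ordLeq_csum2 card_of_Card_order)
  have nat: "|UNIV :: nat set| \<le>o ?r"
    using r by (meson card_of_nat natLeq_ordLeq_cinfinite ordIso_ordLeq_trans)
  define good where "good n P \<longleftrightarrow> P \<subseteq> pformulas L C ({..<n} \<times> {..<len}) (\<lambda>k. ss ! snd k) A \<and> |P| \<le>o ?r \<and>
      (\<forall>p\<in>pformulas L C ({..<n} \<times> {..<len}) (\<lambda>k. ss ! snd k) A. \<exists>q\<in>P. \<forall>M' a. psat M' a q \<longleftrightarrow> psat M' a p)"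
    for n :: nat and P
  have "\<exists>P. good n P" for n
  proof -
    have I: "|{..<n} \<times> {..<len}| \<le>o ?r" by (intro ordLess_imp_ordLeq finite_less_Cinfinite r) auto
    obtain P where P: "P \<subseteq> pformulas L C ({..<n} \<times> {..<len}) (\<lambda>k. ss ! snd k) A" "|P| \<le>o ?r"
      "\<And>p. p \<in> pformulas L C ({..<n} \<times> {..<len}) (\<lambda>k. ss ! snd k) A \<Longrightarrow> \<exists>q\<in>P. \<forall>M' a. psat M' a q \<longleftrightarrow> psat M' a p"
      by (rule pformulas_representatives[OF r f(1) I f(2), of C "\<lambda>k. ss ! snd k"]) (rule that; assumption)
    then have "good n P" unfolding good_def by simp
    then show ?thesis ..
  qed
  then obtain P where "\<And>n. good n (P n)" by metis
  then have P: "\<And>n. P n \<subseteq> pformulas L C ({..<n} \<times> {..<len}) (\<lambda>k. ss ! snd k) A"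
    "\<And>n. |P n| \<le>o ?r"
    "\<And>n p. p \<in> pformulas L C ({..<n} \<times> {..<len}) (\<lambda>k. ss ! snd k) A \<Longrightarrow>
      \<exists>q\<in>P n. \<forall>M' a. psat M' a q \<longleftrightarrow> psat M' a p" by (simp_all add: good_def)
  define S where "S n = (\<lambda>p. (n, {ds. length ds = n \<and> set ds \<subseteq> carrier G \<and> psat C (coords ((!) ds)) p})) ` P n"
    for n
  have "relations \<subseteq> (\<Union>n. S n)"
  proof
    fix u assume u: "u \<in> relations"
    obtain n R where nR: "u = (n, R)" by (cases u)
    have R: "R \<subseteq> {ds. length ds = n \<and> set ds \<subseteq> carrier G}" "gpred A {..<n} (\<lambda>x. map x [0..<n] \<in> R)"
      using u by (auto simp: relations_def nR)
    obtain Q where Q: "expressible L C ({..<n} \<times> {..<len}) (\<lambda>k. ss ! snd k) A Q"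
      "\<And>x. \<forall>k\<in>{..<n}. x k \<in> carrier G \<Longrightarrow> Q C (coords x) \<longleftrightarrow> map x [0..<n] \<in> R"
      using R(2) unfolding gpred_def by blast
    obtain p where p: "p \<in> pformulas L C ({..<n} \<times> {..<len}) (\<lambda>k. ss ! snd k) A"
      "\<And>M' a. psat M' a p \<longleftrightarrow> Q M' a" using Q(1) unfolding expressible_def by blast
    obtain q where q: "q \<in> P n" "\<And>M' a. psat M' a q \<longleftrightarrow> Q M' a" using P(3)[OF p(1)] p(2) by blast
    have "ds \<in> R \<longleftrightarrow> psat C (coords ((!) ds)) q" if ds: "length ds = n" "set ds \<subseteq> carrier G" for ds
    proof -
      have "map ((!) ds) [0..<n] = ds" using ds(1) by (intro nth_equalityI) auto
      moreover have "\<forall>k\<in>{..<n}. ds ! k \<in> carrier G" using ds by auto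
      ultimately show ?thesis using Q(2)[of "(!) ds"] q(2) by simp
    qed
    then have "R = {ds. length ds = n \<and> set ds \<subseteq> carrier G \<and> psat C (coords ((!) ds)) q}"
      using R(1) by blast
    then have "u \<in> S n" unfolding S_def nR using q(1) by (intro image_eqI[of _ _ q]) simp_all
    then show "u \<in> (\<Union>n. S n)" by blast
  qed
  moreover have "|S n| \<le>o ?r" for n
    unfolding S_def by (rule card_of_le_trans_image[OF order_refl P(2)])
  then have "|\<Union>n. S n| \<le>o ?r" by (intro UNION_Cinfinite_bound[OF nat _ r]) simp
  ultimately show ?thesis using card_of_mono1 ordLeq_transitive by blast
qed

lemma relations_left:
  assumes "(n, R) \<in> relations" and "c \<in> carrier G" and "set ds \<subseteq> carrier G"
  shows "map ((\<otimes>) c) ds \<in> R \<longleftrightarrow> ds \<in> R"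
proof -
  have R: "map ((\<otimes>) g) es \<in> R" if "g \<in> carrier G" "es \<in> R" for g es
    using assms(1) that by (auto simp: relations_def)
  have "map ((\<otimes>) (inv c)) (map ((\<otimes>) c) ds) = ds"
    using assms(2,3) by (auto simp: m_assoc[symmetric] subset_iff intro!: map_idI)
  then show ?thesis using R[of c ds] R[of "inv c" "map ((\<otimes>) c) ds"] assms(2) by auto
qed

lemma relations_aut:
  assumes "(n, R) \<in> relations" and \<sigma>: "\<sigma> \<in> auts L C A" and "length ds = n" and "set ds \<subseteq> carrier G"
  shows "map (map \<sigma>) ds \<in> R \<longleftrightarrow> ds \<in> R"
proof -
  have "gpred A {..<n} (\<lambda>x. map x [0..<n] \<in> R)" using assms(1) by (simp add: relations_def)
  note 1 = gpred_aut[OF \<sigma> A_univ this, of "(!) ds"]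
  have dG: "ds ! k \<in> carrier G" if "k \<in> {..<n}" for k using assms(3,4) that by auto
  from 1
  have "map (\<lambda>k. map \<sigma> (ds ! k)) [0..<n] \<in> R \<longleftrightarrow> map ((!) ds) [0..<n] \<in> R"
    using aut_carrier[OF \<sigma>] dG by simp
  moreover have "map (\<lambda>k. map \<sigma> (ds ! k)) [0..<n] = map (map \<sigma>) ds" "map ((!) ds) [0..<n] = ds"
    using assms(3) by (auto intro: nth_equalityI)
  ultimately show ?thesis by simp
qed

end

text \<open>One fixed element names the only sort, fills the components that no function symbol
  uses, and later indexes one-element tuples.\<close>

abbreviation pt :: 'a where "pt \<equiv> undefined"

text \<open>The torsor has one sort, and its relations are the \<open>A\<close>-definable left invariant relations
  on \<open>G\<close>. Elements and relation symbols are moved to \<open>'a\<close> by the injections \<open>\<iota>\<close> and \<open>nm\<close>.\<close>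

locale torsor = definable_group_struct L \<kappa> C A ss G
  for L :: "('s, 'f, 'r) signature" and \<kappa> :: "'a rel" and C :: "('s, 'f, 'r, 'a) struct"
    and A ss and G (structure) +
  fixes \<iota> :: "'a list \<Rightarrow> 'a" and nm :: "nat \<times> 'a list list set \<Rightarrow> 'a"
  assumes small_A: "small L \<kappa> A" and inj_\<iota>: "inj \<iota>" and inj_nm: "inj_on nm relations"
begin

definition sig :: "('a, 'a, 'a) signature" where
  "sig = \<lparr>Sorts = {pt}, Funs = {}, Rels = nm ` relations, fun_dom = \<lambda>_. [], fun_cod = \<lambda>_. pt,
     rel_dom = \<lambda>r. replicate (fst (inv_into relations nm r)) pt\<rparr>"

abbreviation un :: "'a \<Rightarrow> 'a list" where "un \<equiv> inv_into UNIV \<iota>"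

definition tor :: "('a, 'a, 'a, 'a) struct" where
  "tor = \<lparr>univ = \<iota> ` carrier G, srt = \<lambda>_. pt, fn = \<lambda>_ _. pt,
     rl = \<lambda>r xs. map un xs \<in> snd (inv_into relations nm r)\<rparr>"

lemma un_\<iota> [simp]: "un (\<iota> x) = x"
  using inj_\<iota> by simp

lemma sig_simps [simp]:
  "Sorts sig = {pt}" "Funs sig = {}" "Rels sig = nm ` relations"
  by (simp_all add: sig_def)

lemma tor_simps [simp]:
  "univ tor = \<iota> ` carrier G" "srt tor x = pt" "elts tor s = (if s = pt then \<iota> ` carrier G else {})"
  by (auto simp: tor_def elts_def)

lemma rel_simps [simp]:
  assumes "(n, R) \<in> relations"
  shows "rel_dom sig (nm (n, R)) = replicate n pt" "rl tor (nm (n, R)) xs \<longleftrightarrow> map un xs \<in> R"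
  using assms inj_nm by (simp_all add: sig_def tor_def)

lemma is_struct_tor: "is_struct sig tor"
  using one_closed by (auto simp: is_struct_def)

lemma wf_sig_sig: "wf_sig sig"
  by (auto simp: wf_sig_def sig_def)

lemma card_of_sig: "|formulas sig| \<le>o |formulas L| +c |A|"
proof (rule card_of_relational_formulas)
  show r: "Cinfinite ( |formulas L| +c |A| )" by (rule Cinfinite_csum1[OF Cinfinite_formulas])
  show "|Sorts sig| \<le>o |formulas L| +c |A|" by (intro ordLess_imp_ordLeq finite_less_Cinfinite r) simp
  show "|Rels sig| \<le>o |formulas L| +c |A|"
    using card_of_le_trans_image[OF _ card_of_relations, of "Rels sig" nm] by simp
qed simp

text \<open>Formulas of the torsor translate into \<open>A\<close>-definable conditions in
  \<open>C\<close>, which reduces saturation of the torsor to that of \<open>C\<close>. Homogeneity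
  is not obtained in this way, since less is definable in the torsor.\<close>

lemma gpred_sat:
  assumes "wf_fm sig \<phi>"
  shows "gpred A (fv \<phi>) (\<lambda>x. sat tor (\<lambda>v. \<iota> (x v)) \<phi>)"
  using assms
proof (induction \<phi>)
  case Bot
  then show ?case using gpred_False by simp
next
  case (Eq t u)
  then obtain v w where "t = Var v" "u = Var w" by (cases t; cases u) auto
  moreover from this have "gpred A (fv (Eq t u :: ('a, 'a, 'a) fm)) (\<lambda>x. x v = x w)" by (intro gpred_eq) auto
  ultimately show ?case using inj_\<iota> by (simp add: inj_eq)
next
  case (Rel r ts)
  then obtain n R where nR: "(n, R) \<in> relations" "r = nm (n, R)" by auto
  have ts: "\<exists>v. t = Var v" if "t \<in> set ts" for t
  proof -
    have "wf_tm sig t" using that Rel.prems by simp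
    then show ?thesis by (cases t) auto
  qed
  define vs where "vs = map (\<lambda>t. SOME v. t = Var v) ts"
  have ts_vs: "ts = map Var vs"
  proof -
    have "Var (SOME v. t = Var v) = t" if "t \<in> set ts" for t
      using someI_ex[OF ts[OF that]] by simp
    then show ?thesis by (simp add: vs_def map_idI)
  qed
  have len: "length vs = n"
  proof -
    have "map (tm_sort sig) ts = replicate n pt" using Rel nR by simp
    from arg_cong[OF this, of length] show ?thesis by (simp add: vs_def)
  qed
  have "gpred A {..<n} (\<lambda>x. map x [0..<n] \<in> R)" using nR(1) by (simp add: relations_def)
  then have "gpred A (set vs) (\<lambda>x. map (\<lambda>i. x (vs ! i)) [0..<n] \<in> R)"
    by (rule gpred_reindex) (use len in auto)
  moreover have "map (\<lambda>i. x (vs ! i)) [0..<n] = map x vs" for x :: "'a var \<Rightarrow> 'a list"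
    using len by (auto intro: nth_equalityI)
  moreover have "fv (Rel r ts) = set vs" by (auto simp: ts_vs)
  moreover have "sat tor (\<lambda>v. \<iota> (x v)) (Rel r ts) \<longleftrightarrow> map x vs \<in> R" for x
    using nR by (simp add: ts_vs comp_def)
  ultimately show ?case by simp
next
  case (Imp \<phi> \<psi>)
  have "gpred A (fv \<phi> \<union> fv \<psi>) (\<lambda>x. sat tor (\<lambda>v. \<iota> (x v)) \<phi>)"
    by (rule gpred_mono[of A "fv \<phi>"]) (use Imp in auto)
  moreover have "gpred A (fv \<phi> \<union> fv \<psi>) (\<lambda>x. sat tor (\<lambda>v. \<iota> (x v)) \<psi>)"
    by (rule gpred_mono[of A "fv \<psi>"]) (use Imp in auto)
  ultimately show ?case using gpred_imp by fastforce
next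
  case (All v \<phi>)
  let ?Q = "\<lambda>x. sat tor (\<lambda>v. \<iota> (x v)) \<phi>"
  have "gpred A (fv \<phi>) ?Q" using All by simp
  then have "gpred A ({v} \<union> (fv \<phi> - {v})) ?Q" by (rule gpred_mono) auto
  then have "gpred A ({v} \<union> (fv \<phi> - {v})) (\<lambda>x. \<not> ?Q x)" by (rule gpred_not)
  then have "gpred A (fv \<phi> - {v}) (\<lambda>x. \<exists>y. (\<forall>k\<in>{v}. y k \<in> carrier G) \<and>
      (\<forall>k. k \<notin> {v} \<longrightarrow> y k = x k) \<and> \<not> ?Q y)" by (intro gpred_ex_finite) auto
  then have "gpred A (fv \<phi> - {v}) (\<lambda>x. \<not> (\<exists>y. (\<forall>k\<in>{v}. y k \<in> carrier G) \<and>
      (\<forall>k. k \<notin> {v} \<longrightarrow> y k = x k) \<and> \<not> ?Q y))" by (rule gpred_not)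
  moreover have "(\<not> (\<exists>y. (\<forall>k\<in>{v}. y k \<in> carrier G) \<and> (\<forall>k. k \<notin> {v} \<longrightarrow> y k = x k) \<and> \<not> ?Q y))
      \<longleftrightarrow> sat tor (\<lambda>v. \<iota> (x v)) (All v \<phi>)" for x
  proof -
    have v: "snd v = pt" using All.prems by simp
    have "(\<lambda>w. \<iota> ((x(v := g)) w)) = (\<lambda>w. \<iota> (x w))(v := \<iota> g)" for g by auto
    then have "sat tor (\<lambda>v. \<iota> (x v)) (All v \<phi>) \<longleftrightarrow> (\<forall>g\<in>carrier G. ?Q (x(v := g)))"
      using v by (simp del: fun_upd_apply)
    also have "\<dots> \<longleftrightarrow> (\<forall>y. y v \<in> carrier G \<and> (\<forall>k. k \<noteq> v \<longrightarrow> y k = x k) \<longrightarrow> ?Q y)"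
    proof (intro iffI allI impI ballI)
      fix y assume *: "\<forall>g\<in>carrier G. ?Q (x(v := g))" "y v \<in> carrier G \<and> (\<forall>k. k \<noteq> v \<longrightarrow> y k = x k)"
      then have "x(v := y v) = y" by auto
      then show "?Q y" using * by metis
    next
      fix g assume *: "\<forall>y. y v \<in> carrier G \<and> (\<forall>k. k \<noteq> v \<longrightarrow> y k = x k) \<longrightarrow> ?Q y" "g \<in> carrier G"
      show "?Q (x(v := g))" by (rule *(1)[rule_format]) (use *(2) in auto)
    qed
    finally have *: "sat tor (\<lambda>v. \<iota> (x v)) (All v \<phi>) \<longleftrightarrow>
        (\<forall>y. y v \<in> carrier G \<and> (\<forall>k. k \<noteq> v \<longrightarrow> y k = x k) \<longrightarrow> ?Q y)" .
    show ?thesis unfolding * by blast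
  qed
  ultimately show ?case by (simp only: fv.simps)
qed

lemma gdef_psat:
  assumes "p \<in> pformulas sig tor (UNIV :: unit set) (\<lambda>_. s) (\<iota> ` Z)" and "Z \<subseteq> carrier G"
  shows "gdef (A \<union> (\<Union>f\<in>Z. set f)) {g \<in> carrier G. psat tor (\<lambda>_. \<iota> g) p}"
proof -
  obtain \<phi> \<rho> where p: "p = (\<phi>, \<rho>)" by (cases p)
  have wf: "wf_fm sig \<phi>" and adm: "\<And>v. v \<in> fv \<phi> \<Longrightarrow> admissible tor UNIV (\<lambda>_. s) (\<iota> ` Z) (snd v) (\<rho> v)"
    using assms(1) by (auto simp: p pformulas_iff)
  let ?t = "\<lambda>v. case \<rho> v of Inl u \<Rightarrow> Inl u | Inr b \<Rightarrow> Inr (un b)"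
  have "gpred (A \<union> (\<Union>f\<in>Z. set f)) (UNIV :: unit set)
      (\<lambda>x. sat tor (\<lambda>v. \<iota> (case_sum x (\<lambda>g. g) (?t v))) \<phi>)"
  proof (rule gpred_subst[OF gpred_sat[OF wf]])
    show "A \<subseteq> A \<union> (\<Union>f\<in>Z. set f)" by blast
    fix v assume "v \<in> fv \<phi>"
    from adm[OF this] show "case ?t v of Inl j \<Rightarrow> j \<in> UNIV
        | Inr g \<Rightarrow> g \<in> carrier G \<and> set g \<subseteq> A \<union> (\<Union>f\<in>Z. set f)"
      using assms(2) by (cases "\<rho> v") auto
  qed
  from gdefI[OF this]
  have "gdef (A \<union> (\<Union>f\<in>Z. set f)) {g \<in> carrier G. sat tor (\<lambda>v. \<iota> (case_sum (\<lambda>_. g) (\<lambda>g. g) (?t v))) \<phi>}" .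
  moreover have "sat tor (\<lambda>v. \<iota> (case_sum (\<lambda>_. g) (\<lambda>g. g) (?t v))) \<phi> \<longleftrightarrow> psat tor (\<lambda>_. \<iota> g) p" for g
    unfolding p psat_Pair
  proof (rule sat_cong)
    fix v assume "v \<in> fv \<phi>"
    from adm[OF this]
    show "\<iota> (case_sum (\<lambda>_. g) (\<lambda>g. g) (?t v)) = case_sum (\<lambda>_. \<iota> g) (\<lambda>b. b) (\<rho> v)"
      by (cases "\<rho> v") auto
  qed
  ultimately show ?thesis by simp
qed

lemma saturated_tor: "saturated sig \<kappa> tor"
  unfolding saturated_def
proof (intro allI impI ballI)
  fix B s and \<Sigma> :: "('a, 'a, 'a, 'a, unit) pfm set"
  assume B: "B \<subseteq> univ tor" "|B| <o \<kappa>" and s: "s \<in> Sorts sig"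
    and \<Sigma>: "\<Sigma> \<subseteq> pformulas sig tor UNIV (\<lambda>_. s) B"
    and fip: "\<forall>\<Sigma>'\<subseteq>\<Sigma>. finite \<Sigma>' \<longrightarrow> (\<exists>x\<in>elts tor s. \<forall>p\<in>\<Sigma>'. psat tor (\<lambda>_. x) p)"
  obtain Z where Z: "Z \<subseteq> carrier G" "B = \<iota> ` Z" using B(1) by (auto simp: subset_image_iff)
  have "|Z| =o |B|" using inj_\<iota> Z(2) by (metis card_of_ordIso bij_betw_imageI inj_on_subset top_greatest)
  then have Zk: "|Z| <o \<kappa>" using B(2) by (rule ordIso_ordLess_trans)
  let ?D = "\<lambda>p. {g \<in> carrier G. psat tor (\<lambda>_. \<iota> g) p}"
  have "\<exists>g\<in>carrier G. \<forall>D\<in>?D ` \<Sigma>. g \<in> D"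
  proof (rule saturated_gdef[OF _ params_less(2,1)[OF Z(1) Zk]])
    fix D assume "D \<in> ?D ` \<Sigma>"
    then show "gdef (A \<union> (\<Union>f\<in>Z. set f)) D" using gdef_psat[OF _ Z(1)] \<Sigma> Z(2) by auto
  next
    fix \<F> assume "\<F> \<subseteq> ?D ` \<Sigma>" "finite \<F>"
    then obtain F where F: "F \<subseteq> \<Sigma>" "finite F" "\<F> = ?D ` F" by (meson finite_subset_image)
    then obtain x where "x \<in> elts tor s" "\<forall>p\<in>F. psat tor (\<lambda>_. x) p" using fip by blast
    then show "\<exists>g\<in>carrier G. \<forall>D\<in>\<F>. g \<in> D" using s F(3) by auto
  qed blast
  then show "\<exists>x\<in>elts tor s. \<forall>p\<in>\<Sigma>. psat tor (\<lambda>_. x) p" using s by auto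
qed

text \<open>Choose a base point b0 in \<open>B\<close>. An \<open>A\<close>-definable condition on
  the quotients b0^-1 b, read as a relation between the points, is left invariant and so belongs to
  the language. Hence these quotients and those of the images have the same type over
  \<open>A\<close> in \<open>C\<close>, homogeneity of \<open>C\<close> provides
  \<open>\<sigma>\<close>, and a translation puts the base point right.\<close>

lemma elementary_map_tor:
  assumes B: "B \<subseteq> univ tor" "|B| <o \<kappa>" and fB: "f ` B \<subseteq> univ tor"
    and tp: "tp sig tor B f {} = tp sig tor B (\<lambda>b. b) {}"
  shows "\<exists>c\<in>carrier G. \<exists>\<sigma>\<in>auts L C A. \<forall>b\<in>B. f b = \<iota> (c \<otimes> map \<sigma> (un b))"
proof (cases "B = {}")
  case True
  have "id \<in> auts L C A" by (auto simp: auts_def)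
  then show ?thesis using True one_closed by blast
next
  case False
  then obtain b0 where b0: "b0 \<in> B" by blast
  have unB: "un b \<in> carrier G" "\<iota> (un b) = b" if "b \<in> B" for b using B(1) that by auto
  have unf: "un (f b) \<in> carrier G" "\<iota> (un (f b)) = f b" if "b \<in> B" for b using fB that by auto
  define x where "x b = inv (un b0) \<otimes> un b" for b
  define y where "y b = inv (un (f b0)) \<otimes> un (f b)" for b
  have xG: "x b \<in> carrier G" if "b \<in> B" for b using that b0 unB by (simp add: x_def)
  have yG: "y b \<in> carrier G" if "b \<in> B" for b using that b0 unf by (simp add: y_def)
  have "\<exists>\<sigma>\<in>auts L C A. \<forall>b\<in>B. map \<sigma> (x b) = y b"
  proof (rule homogeneous_group[OF B(2)])
    fix Q assume Q: "gpred A B Q"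
    obtain K0 where K0: "finite K0" "K0 \<subseteq> B" "gpred A K0 (\<lambda>x. Q (\<lambda>k. if k \<in> K0 then x k else \<one>))"
      and QK: "\<And>x. \<forall>k\<in>B. x k \<in> carrier G \<Longrightarrow> Q x \<longleftrightarrow> Q (\<lambda>k. if k \<in> K0 then x k else \<one>)"
      by (rule gpred_support[OF Q]) (rule that; assumption)
    \<comment> \<open>A relation symbol has finite arity, so the condition on the family over
      \<open>B\<close> is cut down to its finite support.\<close>
    define Q' where "Q' = (\<lambda>x. Q (\<lambda>k. if k \<in> K0 then x k else \<one>))"
    have dep: "Q' x \<longleftrightarrow> Q' y" if "\<And>k. k \<in> K0 \<Longrightarrow> x k = y k" for x y
    proof -
      have "(\<lambda>k. if k \<in> K0 then x k else \<one>) = (\<lambda>k. if k \<in> K0 then y k else \<one>)" using that by auto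
      then show ?thesis by (simp add: Q'_def)
    qed
    obtain ks where ks: "set ks = K0" using finite_list[OF K0(1)] by blast
    \<comment> \<open>Argument 0 is the base point, and \<open>Suc (idx k)\<close> is the place of
      \<open>k\<close> in the list of the support.\<close>
    define n where "n = Suc (length ks)"
    have "\<forall>k\<in>K0. \<exists>i. i < length ks \<and> ks ! i = k" using ks by (metis in_set_conv_nth)
    then obtain idx where idx: "\<And>k. k \<in> K0 \<Longrightarrow> idx k < length ks \<and> ks ! idx k = k" by metis
    define R where "R = {ds. length ds = n \<and> set ds \<subseteq> carrier G \<and>
        Q' (\<lambda>k. inv (ds ! 0) \<otimes> ds ! Suc (idx k))}"
    have "gpred A {..<n} (\<lambda>x. Q' (\<lambda>k. inv (x 0) \<otimes> x (Suc (idx k))))"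
    proof (rule gpred_translate[OF order_refl _ K0(1)])
      show "gpred A K0 Q'" using K0(3) by (simp add: Q'_def)
      show "0 \<in> {..<n}" by (simp add: n_def)
      show "Suc (idx k) \<in> {..<n}" if "k \<in> K0" for k using idx[OF that] by (simp add: n_def)
      show "Q' x \<longleftrightarrow> Q' y" if "\<And>k. k \<in> K0 \<Longrightarrow> x k = y k" for x y using that by (rule dep)
    qed
    then have "gpred A {..<n} (\<lambda>x. map x [0..<n] \<in> R)"
    proof (rule gpred_cong)
      fix x :: "nat \<Rightarrow> 'a list" assume "\<forall>k\<in>{..<n}. x k \<in> carrier G"
      moreover have "Q' (\<lambda>k. inv (x 0) \<otimes> x (Suc (idx k))) \<longleftrightarrow>
          Q' (\<lambda>k. inv (map x [0..<n] ! 0) \<otimes> map x [0..<n] ! Suc (idx k))"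
        using idx by (intro dep) (simp add: n_def del: upt_Suc)
      ultimately show "Q' (\<lambda>k. inv (x 0) \<otimes> x (Suc (idx k))) \<longleftrightarrow> map x [0..<n] \<in> R"
        by (auto simp: R_def simp del: upt_Suc)
    qed
    moreover have "map ((\<otimes>) g) ds \<in> R" if g: "g \<in> carrier G" and ds: "ds \<in> R" for g ds
    proof -
      have d: "length ds = n" "set ds \<subseteq> carrier G" using ds by (auto simp: R_def)
      have "Q' (\<lambda>k. inv (map ((\<otimes>) g) ds ! 0) \<otimes> map ((\<otimes>) g) ds ! Suc (idx k))
          \<longleftrightarrow> Q' (\<lambda>k. inv (ds ! 0) \<otimes> ds ! Suc (idx k))"
      proof (rule dep)
        fix k assume k: "k \<in> K0"
        have l: "0 < length ds" "Suc (idx k) < length ds" using idx[OF k] d(1) by (auto simp: n_def)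
        then have "ds ! 0 \<in> carrier G" "ds ! Suc (idx k) \<in> carrier G" using d(2) by auto
        then show "inv (map ((\<otimes>) g) ds ! 0) \<otimes> map ((\<otimes>) g) ds ! Suc (idx k)
            = inv (ds ! 0) \<otimes> ds ! Suc (idx k)"
          using g l by (simp add: inv_mult_group m_assoc inv_solve_left')
      qed
      then show ?thesis using ds g by (auto simp: R_def)
    qed
    ultimately have nR: "(n, R) \<in> relations" by (auto simp: relations_def R_def)
    let ?\<phi> = "Rel (nm (n, R)) (map (\<lambda>i. Var (i, pt)) [0..<n])"
    let ?\<rho> = "\<lambda>v :: 'a var. Inl ((b0 # ks) ! fst v) :: 'a + 'a"
    have mem: "(b0 # ks) ! i \<in> B" if "i < n" for i
      using that b0 ks K0(2) by (cases i) (auto simp: n_def)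
    have pf: "(?\<phi>, ?\<rho>) \<in> pformulas sig tor B (\<lambda>i. pt) {}"
    proof -
      have "wf_fm sig ?\<phi>" using nR by (auto simp: comp_def map_replicate_const simp del: upt_Suc)
      moreover have "admissible tor B (\<lambda>i. pt) {} (snd v) (?\<rho> v)" if "v \<in> fv ?\<phi>" for v
        using that mem by (auto simp del: upt_Suc)
      ultimately show ?thesis unfolding pformulas_iff by blast
    qed
    have ps: "psat tor h (?\<phi>, ?\<rho>) \<longleftrightarrow> Q' (\<lambda>k. inv (un (h b0)) \<otimes> un (h k))"
      if h: "\<And>b. b \<in> B \<Longrightarrow> un (h b) \<in> carrier G" for h
    proof -
      let ?ds = "map (\<lambda>i. un (h ((b0 # ks) ! i))) [0..<n]"
      have "psat tor h (?\<phi>, ?\<rho>) \<longleftrightarrow> ?ds \<in> R" using nR by (simp add: psat_Pair comp_def del: upt_Suc)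
      also have "\<dots> \<longleftrightarrow> Q' (\<lambda>k. inv (?ds ! 0) \<otimes> ?ds ! Suc (idx k))"
        using h mem by (auto simp: R_def simp del: upt_Suc)
      also have "\<dots> \<longleftrightarrow> Q' (\<lambda>k. inv (un (h b0)) \<otimes> un (h k))"
        using idx by (intro dep) (simp add: n_def del: upt_Suc)
      finally show ?thesis .
    qed
    have "(?\<phi>, ?\<rho>) \<in> tp sig tor B f {} \<longleftrightarrow> (?\<phi>, ?\<rho>) \<in> tp sig tor B (\<lambda>b. b) {}" using tp by simp
    then have "psat tor f (?\<phi>, ?\<rho>) \<longleftrightarrow> psat tor (\<lambda>b. b) (?\<phi>, ?\<rho>)"
      using pf by (simp add: tp_def)
    then have "Q' y \<longleftrightarrow> Q' x" using ps[of f] ps[of "\<lambda>b. b"] unf unB unfolding x_def y_def by simp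
    then show "Q x \<longleftrightarrow> Q y" using QK[of x] QK[of y] xG yG by (simp add: Q'_def)
  qed (use xG yG in auto)
  then obtain \<sigma> where \<sigma>: "\<sigma> \<in> auts L C A" "\<And>b. b \<in> B \<Longrightarrow> map \<sigma> (x b) = y b" by blast
  \<comment> \<open>Left multiplication by \<open>c\<close> sends the image of the base point under
    \<open>\<sigma>\<close> to \<open>f b0\<close>.\<close>
  define c where "c = un (f b0) \<otimes> inv (map \<sigma> (un b0))"
  have \<sigma>0: "map \<sigma> (un b0) \<in> carrier G" using aut_carrier[OF \<sigma>(1)] unB(1)[OF b0] .
  have "f b = \<iota> (c \<otimes> map \<sigma> (un b))" if b: "b \<in> B" for b
  proof -
    have \<sigma>b: "map \<sigma> (un b) \<in> carrier G" using aut_carrier[OF \<sigma>(1)] unB(1)[OF b] .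
    have "c \<otimes> map \<sigma> (un b) = un (f b0) \<otimes> (inv (map \<sigma> (un b0)) \<otimes> map \<sigma> (un b))"
      using \<sigma>0 \<sigma>b unf[OF b0] by (simp add: c_def m_assoc)
    also have "inv (map \<sigma> (un b0)) \<otimes> map \<sigma> (un b) = map \<sigma> (x b)"
      using aut_quotient[OF \<sigma>(1) unB(1)[OF b0] unB(1)[OF b]] by (simp add: x_def)
    also have "un (f b0) \<otimes> map \<sigma> (x b) = un (f b)"
      using \<sigma>(2)[OF b] unf[OF b0] unf[OF b] by (simp add: y_def m_assoc[symmetric])
    finally show ?thesis using unf(2)[OF b] by simp
  qed
  moreover have "c \<in> carrier G" using \<sigma>0 unf[OF b0] by (simp add: c_def)
  ultimately show ?thesis using \<sigma>(1) by blast
qed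

text \<open>Left translations preserve the relations because these are left invariant, automorphisms
  over \<open>A\<close> because they are \<open>A\<close>-definable. The first kind makes the Lascar
  class of the unit a subgroup, the second makes it invariant.\<close>

lemma tor_aut:
  assumes c: "c \<in> carrier G" and \<sigma>: "\<sigma> \<in> auts L C A"
  shows "(\<lambda>x. \<iota> (c \<otimes> map \<sigma> (un x))) \<in> auts sig tor {}" (is "?t \<in> _")
proof -
  have "bij_betw ?t (\<iota> ` carrier G) (\<iota> ` carrier G)"
  proof (rule bij_betw_imageI)
    show "inj_on ?t (\<iota> ` carrier G)"
    proof (rule inj_onI)
      fix u v assume "u \<in> \<iota> ` carrier G" "v \<in> \<iota> ` carrier G" "?t u = ?t v"
      then obtain g h where gh: "u = \<iota> g" "v = \<iota> h" "g \<in> carrier G" "h \<in> carrier G"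
        "c \<otimes> map \<sigma> g = c \<otimes> map \<sigma> h" using inj_\<iota> by (auto simp: inj_eq)
      then have "map \<sigma> g = map \<sigma> h" using c aut_carrier[OF \<sigma>] by simp
      moreover have "set g \<union> set h \<subseteq> univ C" using gh carrier_nth(3) by blast
      ultimately have "g = h"
        using inj_on_subset[OF aut_inj[OF \<sigma>]] inj_on_map_eq_map[of \<sigma> g h] by blast
      then show "u = v" using gh by simp
    qed
    show "?t ` (\<iota> ` carrier G) = \<iota> ` carrier G"
    proof (intro equalityI subsetI)
      fix u assume "u \<in> ?t ` (\<iota> ` carrier G)"
      then show "u \<in> \<iota> ` carrier G" using c aut_carrier[OF \<sigma>] by auto
    next
      fix u assume "u \<in> \<iota> ` carrier G"
      then obtain g where g: "u = \<iota> g" "g \<in> carrier G" by blast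
      obtain \<tau> where \<tau>: "\<tau> \<in> auts L C A" "\<And>x. x \<in> univ C \<Longrightarrow> \<sigma> (\<tau> x) = x"
        using aut_inverse[OF is_struct \<sigma> A_univ] by metis
      \<comment> \<open>The solution h of c sigma(h) = g, with \<open>\<tau>\<close> inverse to
        \<open>\<sigma>\<close>.\<close>
      let ?h = "map \<tau> (inv c \<otimes> g)"
      have cg: "inv c \<otimes> g \<in> carrier G" using c g by simp
      have h: "?h \<in> carrier G" using aut_carrier[OF \<tau>(1) cg] .
      have "map \<sigma> ?h = inv c \<otimes> g"
        using \<tau>(2) carrier_nth(3)[OF cg] by (auto intro!: map_idI)
      then have "?t (\<iota> ?h) = u" using c g by (simp add: m_assoc[symmetric] del: map_map)
      then show "u \<in> ?t ` (\<iota> ` carrier G)" using h by (metis imageI)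
    qed
  qed
  moreover have "rl tor r (map ?t xs) \<longleftrightarrow> rl tor r xs"
    if r: "r \<in> Rels sig" and xs: "xs \<in> tuples tor (rel_dom sig r)" for r xs
  proof -
    obtain n R where nR: "(n, R) \<in> relations" "r = nm (n, R)" using r by auto
    have xs': "set xs \<subseteq> \<iota> ` carrier G" "map (srt tor) xs = replicate n pt"
      using xs nR by (auto simp: tuples_def)
    have "length xs = n" using arg_cong[OF xs'(2), of length] by simp
    then have ds: "set (map un xs) \<subseteq> carrier G" "length (map un xs) = n" using xs'(1) by auto
    have ds': "set (map (map \<sigma>) (map un xs)) \<subseteq> carrier G" using ds(1) aut_carrier[OF \<sigma>] by auto
    have "map un (map ?t xs) = map ((\<otimes>) c) (map (map \<sigma>) (map un xs))" by simp
    then have "rl tor r (map ?t xs) \<longleftrightarrow> map un xs \<in> R"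
      using nR relations_left[OF nR(1) c ds'] relations_aut[OF nR(1) \<sigma> ds(2,1)] by (simp del: map_map)
    then show ?thesis using nR by simp
  qed
  ultimately show ?thesis by (simp add: auts_def)
qed

lemma homogeneous_tor: "strongly_homogeneous sig \<kappa> tor"
  unfolding strongly_homogeneous_def
proof (intro allI impI)
  fix B f assume "B \<subseteq> univ tor" "|B| <o \<kappa>" "f ` B \<subseteq> univ tor \<and> tp sig tor B f {} = tp sig tor B (\<lambda>b. b) {}"
  then obtain c \<sigma> where "c \<in> carrier G" "\<sigma> \<in> auts L C A" "\<forall>b\<in>B. f b = \<iota> (c \<otimes> map \<sigma> (un b))"
    using elementary_map_tor[of B f] by blast
  then show "\<exists>g\<in>auts sig tor {}. \<forall>b\<in>B. g b = f b"
    using tor_aut by (intro bexI[of _ "\<lambda>x. \<iota> (c \<otimes> map \<sigma> (un x))"]) auto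
qed

lemma exp_card_of_sig: "ctwo ^c |formulas sig| \<le>o small_bound L A"
  by (intro cexp_mono2_Cnotzero card_of_sig Card_order_ctwo Cinfinite_Cnotzero Cinfinite_formulas)

lemma monster_tor: "monster sig (Th sig tor) \<kappa> tor"
  unfolding monster_def is_model_def
  using Card_\<kappa> is_struct_tor saturated_tor homogeneous_tor ordLeq_ordLess_trans[OF exp_card_of_sig] small_A
  by (simp add: small_def)

text \<open>The only sort is the carrier modulo equality, so a class is a singleton and
  \<open>the_elem\<close> reads off its point. The parameters of the relations lie in
  \<open>A\<close>, inside \<open>univ C\<close>.\<close>

lemma interprets_tor: "interprets L C sig tor"
proof -
  let ?h = "\<lambda>(t :: 'a) X. \<iota> (the_elem X)"
  have q: "?h t (Id_on (carrier G) `` {d}) = \<iota> d" if "d \<in> carrier G" for t d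
  proof -
    have "Id_on (carrier G) `` {d} = {d}" using that by auto
    then show ?thesis by simp
  qed
  have def: "definable L C (univ C) ss (carrier G)"
    by (rule gdef_imp_definable[OF gdef_carrier[OF A_univ] A_univ])
  have sorts: "set ss \<subseteq> Sorts L" using sort_nth by (auto simp: in_set_conv_nth)
  have eq: "definable L C (univ C) (ss @ ss) {xs @ ys | xs ys. (xs, ys) \<in> Id_on (carrier G)}"
  proof -
    have "gpred (univ C) {..<2} (\<lambda>x. x 0 = x (1 :: nat))" by (intro gpred_eq) auto
    from gpred_definable_concat[OF this A_univ]
    have "definable L C (univ C) (concat (replicate 2 ss))
      {concat ds | ds. length ds = 2 \<and> set ds \<subseteq> carrier G \<and> ds ! 0 = ds ! 1}" by simp
    moreover have "{concat ds | ds. length ds = 2 \<and> set ds \<subseteq> carrier G \<and> ds ! 0 = ds ! 1}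
       = {xs @ ys | xs ys. (xs, ys) \<in> Id_on (carrier G)}"
    proof (intro equalityI subsetI)
      fix z assume "z \<in> {concat ds | ds. length ds = 2 \<and> set ds \<subseteq> carrier G \<and> ds ! 0 = ds ! 1}"
      then obtain x where "x \<in> carrier G" "z = x @ x" by (auto simp: numeral_2_eq_2 length_Suc_conv)
      then show "z \<in> {xs @ ys | xs ys. (xs, ys) \<in> Id_on (carrier G)}"
        by (intro CollectI exI[of _ x]) auto
    next
      fix z assume "z \<in> {xs @ ys | xs ys. (xs, ys) \<in> Id_on (carrier G)}"
      then obtain x where "x \<in> carrier G" "z = x @ x" by auto
      then show "z \<in> {concat ds | ds. length ds = 2 \<and> set ds \<subseteq> carrier G \<and> ds ! 0 = ds ! 1}"
        by (intro CollectI exI[of _ "[x, x]"]) auto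
    qed
    ultimately show ?thesis by (simp add: numeral_2_eq_2)
  qed
  have bij: "bij_betw (?h t) (carrier G // Id_on (carrier G)) (\<iota> ` carrier G)" for t :: 'a
  proof -
    have "carrier G // Id_on (carrier G) = (\<lambda>x. {x}) ` carrier G" by (auto simp: quotient_def)
    moreover have "bij_betw (?h t) ((\<lambda>x. {x}) ` carrier G) (\<iota> ` carrier G)"
    proof (rule bij_betw_imageI)
      show "inj_on (?h t) ((\<lambda>x. {x}) ` carrier G)"
        by (rule inj_onI) (auto dest: injD[OF inj_\<iota>])
    qed (simp add: image_image)
    ultimately show ?thesis by simp
  qed
  have rels: "definable L C (univ C) (concat (map (\<lambda>_. ss) (rel_dom sig r)))
     {concat ds | ds. ds \<in> listset (map (\<lambda>_. carrier G) (rel_dom sig r)) \<and>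
        rl tor r (map2 (\<lambda>t d. ?h t (Id_on (carrier G) `` {d})) (rel_dom sig r) ds)}"
    if r: "r \<in> Rels sig" for r
  proof -
    obtain n R where nR: "(n, R) \<in> relations" "r = nm (n, R)" using r by auto
    have "gpred (univ C) {..<n} (\<lambda>x. map x [0..<n] \<in> R)"
      using nR(1) A_univ by (auto simp: relations_def intro: gpred_mono)
    then have "definable L C (univ C) (concat (replicate n ss))
      {concat ds | ds. length ds = n \<and> set ds \<subseteq> carrier G \<and> map ((!) ds) [0..<n] \<in> R}"
    proof (rule gpred_definable_concat[OF _ A_univ])
      show "map x [0..<n] \<in> R \<longleftrightarrow> map y [0..<n] \<in> R" if "\<And>k. k < n \<Longrightarrow> x k = y k" for x y
      proof -
        have "map x [0..<n] = map y [0..<n]" using that by auto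
        then show ?thesis by (rule arg_cong[where f = "\<lambda>l. l \<in> R"])
      qed
    qed
    moreover have "rl tor r (map2 (\<lambda>t d. ?h t (Id_on (carrier G) `` {d})) (replicate n pt) ds) \<longleftrightarrow> map ((!) ds) [0..<n] \<in> R"
      if ds: "length ds = n" "set ds \<subseteq> carrier G" for ds
    proof -
      have "map2 (\<lambda>t d. ?h t (Id_on (carrier G) `` {d})) (replicate n pt) ds = map \<iota> ds"
      proof -
        have "carrier G \<inter> {ds ! i} = {ds ! i}" if "i < length ds" for i using ds that by auto
        then show ?thesis using ds(1) by (auto intro!: nth_equalityI)
      qed
      moreover have "map ((!) ds) [0..<n] = ds" using ds(1) by (intro nth_equalityI) auto
      ultimately show ?thesis using nR by (simp add: comp_def)
    qed
    then have "{concat ds | ds. length ds = n \<and> set ds \<subseteq> carrier G \<and> map ((!) ds) [0..<n] \<in> R} =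
      {concat ds | ds. ds \<in> listset (map (\<lambda>_. carrier G) (rel_dom sig r)) \<and>
        rl tor r (map2 (\<lambda>t d. ?h t (Id_on (carrier G) `` {d})) (rel_dom sig r) ds)}"
      using nR(1) unfolding nR(2) by (auto simp: map_replicate_const listset_replicate simp del: rel_simps(2))
    ultimately show ?thesis using nR by (simp add: map_replicate_const)
  qed
  show ?thesis
    unfolding interprets_def Let_def
    by (intro exI[of _ "\<lambda>_. ss"] exI[of _ "\<lambda>_. carrier G"] exI[of _ "\<lambda>_. Id_on (carrier G)"] exI[of _ ?h])
      (use sorts def eq bij rels in \<open>auto simp: equiv_def refl_on_def sym_def trans_def\<close>)
qed

end

section \<open>Lascar distance\<close>

text \<open>The edges of the graph in which Lascar distance is path length, for tuples with the
  single index \<open>i\<close>.\<close>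

definition lascar_step ::
  "('s, 'f, 'r) signature \<Rightarrow> 'k rel \<Rightarrow> ('s, 'f, 'r, 'a) struct \<Rightarrow> 'i \<Rightarrow> ('a \<times> 'a) set" where
  "lascar_step L \<kappa> C i = {(x, y). x \<in> univ C \<and> y \<in> univ C \<and>
     (\<exists>M. small L \<kappa> M \<and> elem_sub L M C \<and> tp L C {i} (\<lambda>_. x) M = tp L C {i} (\<lambda>_. y) M)}"

lemma lascar_step_univ: "(x, y) \<in> lascar_step L \<kappa> C i \<Longrightarrow> x \<in> univ C \<and> y \<in> univ C"
  by (simp add: lascar_step_def)

lemma lascar_stepI:
  assumes "x \<in> univ C" and "y \<in> univ C" and "small L \<kappa> M" and "elem_sub L M C"
    and "tp L C {i} (\<lambda>_. x) M = tp L C {i} (\<lambda>_. y) M"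
  shows "(x, y) \<in> lascar_step L \<kappa> C i"
  unfolding lascar_step_def mem_Collect_eq prod.case
  by (intro conjI exI[of _ M] assms)

lemma lascar_stepE:
  assumes "(x, y) \<in> lascar_step L \<kappa> C i"
  obtains M where "small L \<kappa> M" and "elem_sub L M C"
    and "tp L C {i} (\<lambda>_. x) M = tp L C {i} (\<lambda>_. y) M"
  using assms unfolding lascar_step_def mem_Collect_eq prod.case by (elim conjE exE)

lemma tp_cong:
  assumes "\<And>i. i \<in> I \<Longrightarrow> a i = b i"
  shows "tp L M I a B = tp L M I b B"
proof -
  have adm: "admissible M I (\<lambda>i. srt M (a i)) B s z \<longleftrightarrow> admissible M I (\<lambda>i. srt M (b i)) B s z" for s z
    using assms by (cases z) auto
  have "pformulas L M I (\<lambda>i. srt M (a i)) B = pformulas L M I (\<lambda>i. srt M (b i)) B"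
    by (intro equalityI subsetI; clarify; simp add: pformulas_iff adm)
  moreover have "psat M a p \<longleftrightarrow> psat M b p" if "p \<in> pformulas L M I (\<lambda>i. srt M (a i)) B" for p
    using expressible_cong_valuation[OF expressible_psat[OF that] assms] .
  ultimately show ?thesis by (auto simp: tp_def)
qed

text \<open>\<open>x \<in> univ C\<close> is stated separately because a path of length 0 has no
  edge that would imply it.\<close>

lemma lascar_le_iff:
  "lascar_le L \<kappa> C {i} (\<lambda>_. x) (\<lambda>_. y) n \<longleftrightarrow> x \<in> univ C \<and> (x, y) \<in> lascar_step L \<kappa> C i ^^ n"
proof
  assume "lascar_le L \<kappa> C {i} (\<lambda>_. x) (\<lambda>_. y) n"
  then obtain c M where cM: "\<forall>j\<le>n. c j ` {i} \<subseteq> univ C" "\<forall>k\<in>{i}. c 0 k = x" "\<forall>k\<in>{i}. c n k = y"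
    "\<forall>j\<in>{1..n}. small L \<kappa> (M j) \<and> elem_sub L (M j) C \<and>
      tp L C {i} (c (j - 1)) (M j) = tp L C {i} (c j) (M j)"
    unfolding lascar_le_def by blast
  then have c: "\<And>j. j \<le> n \<Longrightarrow> c j i \<in> univ C" "c 0 i = x" "c n i = y"
    and M: "\<And>j. j \<in> {1..n} \<Longrightarrow> small L \<kappa> (M j) \<and> elem_sub L (M j) C \<and>
      tp L C {i} (c (j - 1)) (M j) = tp L C {i} (c j) (M j)"
    by simp_all
  have steps: "(c j i, c (Suc j) i) \<in> lascar_step L \<kappa> C i" if j: "j < n" for j
  proof -
    have "Suc j \<in> {1..n}" using j by simp
    note Mj = M[OF this]
    have "tp L C {i} (\<lambda>_. c j i) (M (Suc j)) = tp L C {i} (c j) (M (Suc j))" by (rule tp_cong) simp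
    also have "\<dots> = tp L C {i} (c (Suc j)) (M (Suc j))"
      using Mj[THEN conjunct2, THEN conjunct2] by (simp only: diff_Suc_1)
    also have "\<dots> = tp L C {i} (\<lambda>_. c (Suc j) i) (M (Suc j))" by (rule tp_cong) simp
    finally have "tp L C {i} (\<lambda>_. c j i) (M (Suc j)) = tp L C {i} (\<lambda>_. c (Suc j) i) (M (Suc j))" .
    from lascar_stepI[OF c(1) c(1) Mj[THEN conjunct1] Mj[THEN conjunct2, THEN conjunct1] this]
    show ?thesis using j by simp
  qed
  have "(x, y) \<in> lascar_step L \<kappa> C i ^^ n"
    unfolding relpow_fun_conv
    by (intro exI[of _ "\<lambda>j. c j i"] conjI allI impI c(2,3) steps)
  moreover have "x \<in> univ C" using c(1)[OF le0] unfolding c(2) .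
  ultimately show "x \<in> univ C \<and> (x, y) \<in> lascar_step L \<kappa> C i ^^ n" by blast
next
  assume xy: "x \<in> univ C \<and> (x, y) \<in> lascar_step L \<kappa> C i ^^ n"
  from relpow_fun_conv[THEN iffD1, OF conjunct2[OF xy]]
  obtain f where "f 0 = x \<and> f n = y \<and> (\<forall>j<n. (f j, f (Suc j)) \<in> lascar_step L \<kappa> C i)"
    by (elim exE) (rule that)
  then have f: "x \<in> univ C" "f 0 = x" "f n = y"
    "\<And>j. j < n \<Longrightarrow> (f j, f (Suc j)) \<in> lascar_step L \<kappa> C i" using xy by simp_all
  have univ: "f j \<in> univ C" if "j \<le> n" for j
  proof (cases j)
    case 0
    then show ?thesis using f(1,2) by simp
  next
    case (Suc k)
    then show ?thesis using that lascar_step_univ[OF f(4)[of k]] by simp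
  qed
  have "\<exists>M. small L \<kappa> M \<and> elem_sub L M C \<and>
      tp L C {i} (\<lambda>_. f (j - 1)) M = tp L C {i} (\<lambda>_. f j) M" if "j \<in> {1..n}" for j
  proof -
    have "j - 1 < n" "Suc (j - 1) = j" using that by auto
    then have "(f (j - 1), f j) \<in> lascar_step L \<kappa> C i" using f(4)[of "j - 1"] by simp
    then show ?thesis by (rule lascar_stepE) blast
  qed
  then obtain M where "\<And>j. j \<in> {1..n} \<Longrightarrow> small L \<kappa> (M j) \<and> elem_sub L (M j) C \<and>
      tp L C {i} (\<lambda>_. f (j - 1)) (M j) = tp L C {i} (\<lambda>_. f j) (M j)" by metis
  then show "lascar_le L \<kappa> C {i} (\<lambda>_. x) (\<lambda>_. y) n"
    unfolding lascar_le_def using univ f(2,3)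
    by (intro exI[of _ "\<lambda>j _. f j"] exI[of _ M]) simp
qed

text \<open>The infimum of a set of naturals in \<open>enat\<close> is attained, and is infinite
  when the set is empty.\<close>

lemma lascar_dist_le_iff:
  "lascar_dist L \<kappa> C I a b \<le> enat n \<longleftrightarrow> (\<exists>m\<le>n. lascar_le L \<kappa> C I a b m)"
proof
  assume le: "lascar_dist L \<kappa> C I a b \<le> enat n"
  show "\<exists>m\<le>n. lascar_le L \<kappa> C I a b m"
  proof (rule ccontr)
    assume "\<not> ?thesis"
    then have "Suc n \<le> m" if "lascar_le L \<kappa> C I a b m" for m using that not_less_eq_eq by blast
    then have "enat (Suc n) \<le> lascar_dist L \<kappa> C I a b"
      unfolding lascar_dist_def by (intro INF_greatest) simp
    then show False using le order_trans by fastforce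
  qed
next
  assume "\<exists>m\<le>n. lascar_le L \<kappa> C I a b m"
  then obtain m where m: "m \<le> n" "lascar_le L \<kappa> C I a b m" by blast
  then have "lascar_dist L \<kappa> C I a b \<le> enat m" unfolding lascar_dist_def by (intro INF_lower) simp
  then show "lascar_dist L \<kappa> C I a b \<le> enat n" using m(1) by (meson enat_ord_simps(1) order_trans)
qed

text \<open>Applied to a tuple with one entry: finite distance means that a path exists, and the
  uniform bound on distances becomes a bound on path lengths.\<close>

lemma G_compact_bound:
  fixes \<kappa> :: "'a rel" and C :: "('s, 'f, 'r, 'a) struct" and i :: 'a
  assumes "G_compact TYPE('a) L T" and "monster L T \<kappa> C" and "small L \<kappa> {i}" and "x \<in> univ C"
  shows "\<exists>n. \<forall>y. (x, y) \<in> (lascar_step L \<kappa> C i)\<^sup>* \<longrightarrow> (\<exists>m\<le>n. (x, y) \<in> lascar_step L \<kappa> C i ^^ m)"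
proof -
  have "(\<lambda>_. x) ` {i} \<subseteq> univ C" using assms(4) by auto
  from assms(1)[unfolded G_compact_def, rule_format, OF assms(2) conjI[OF assms(3) this]]
  obtain n where n: "\<And>b. b ` {i} \<subseteq> univ C \<Longrightarrow> lascar_dist L \<kappa> C {i} (\<lambda>_. x) b < \<infinity> \<Longrightarrow>
      lascar_dist L \<kappa> C {i} (\<lambda>_. x) b \<le> enat n" by blast
  have "\<exists>m\<le>n. (x, y) \<in> lascar_step L \<kappa> C i ^^ m" if y: "(x, y) \<in> (lascar_step L \<kappa> C i)\<^sup>*" for y
  proof -
    obtain k where k: "(x, y) \<in> lascar_step L \<kappa> C i ^^ k" using y rtrancl_imp_relpow by blast
    have "y \<in> univ C" using y assms(4) by (induction rule: rtrancl_induct) (simp_all add: lascar_step_univ)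
    moreover have "lascar_dist L \<kappa> C {i} (\<lambda>_. x) (\<lambda>_. y) \<le> enat k"
      unfolding lascar_dist_le_iff lascar_le_iff using k assms(4) by blast
    then have "lascar_dist L \<kappa> C {i} (\<lambda>_. x) (\<lambda>_. y) < \<infinity>" by (rule le_less_trans) simp
    ultimately have "lascar_dist L \<kappa> C {i} (\<lambda>_. x) (\<lambda>_. y) \<le> enat n" using n[of "\<lambda>_. y"] by simp
    then show ?thesis unfolding lascar_dist_le_iff lascar_le_iff by blast
  qed
  then show ?thesis by blast
qed

text \<open>Parameters in the image of \<open>B\<close> are pulled back along the inverse
  automorphism while the formula is kept.\<close>

lemma aut_pullback:
  assumes "is_struct L C" and \<sigma>: "\<sigma> \<in> auts L C {}" and \<tau>: "\<And>x. x \<in> univ C \<Longrightarrow> \<tau> (\<sigma> x) = x"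
    and B: "B \<subseteq> univ C" and p: "(\<phi>, \<rho>) \<in> pformulas L C I ss (\<sigma> ` B)"
  shows "(\<phi>, \<lambda>v. map_sum (\<lambda>i. i) \<tau> (\<rho> v)) \<in> pformulas L C I ss B"
    and "\<And>a. (\<And>i. i \<in> I \<Longrightarrow> a i \<in> elts C (ss i)) \<Longrightarrow>
      psat C (\<lambda>i. \<sigma> (a i)) (\<phi>, \<rho>) \<longleftrightarrow> psat C a (\<phi>, \<lambda>v. map_sum (\<lambda>i. i) \<tau> (\<rho> v))"
proof -
  let ?r = "\<lambda>v. map_sum (\<lambda>i. i) \<tau> (\<rho> v)"
  have adm: "admissible C I ss (\<sigma> ` B) (snd v) (\<rho> v)" if "v \<in> fv \<phi>" for v
    using p that by (simp add: pformulas_iff)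
  have srt: "srt C (\<sigma> b) = srt C b" if "b \<in> B" for b using \<sigma> B that by (auto simp: auts_def)
  have adm': "admissible C I ss B (snd v) (?r v)" if "v \<in> fv \<phi>" for v
    using adm[OF that] \<tau> B srt by (cases "\<rho> v") auto
  show p': "(\<phi>, ?r) \<in> pformulas L C I ss B" using p adm' unfolding pformulas_iff by blast
  fix a assume a: "\<And>i. i \<in> I \<Longrightarrow> a i \<in> elts C (ss i)"
  have "psat C (\<lambda>i. \<sigma> (a i)) (\<phi>, \<rho>) \<longleftrightarrow> sat C (\<lambda>v. case_sum (\<lambda>i. \<sigma> (a i)) \<sigma> (?r v)) \<phi>"
    unfolding psat_Pair
  proof (rule sat_cong)
    fix v assume "v \<in> fv \<phi>"
    from adm[OF this]
    show "case_sum (\<lambda>i. \<sigma> (a i)) (\<lambda>b. b) (\<rho> v) = case_sum (\<lambda>i. \<sigma> (a i)) \<sigma> (?r v)"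
      using \<tau> B by (cases "\<rho> v") auto
  qed
  also have "\<dots> \<longleftrightarrow> psat C a (\<phi>, ?r)" by (rule aut_psat_move[OF assms(1) \<sigma> p' B]) (rule a)
  finally show "psat C (\<lambda>i. \<sigma> (a i)) (\<phi>, \<rho>) \<longleftrightarrow> psat C a (\<phi>, ?r)" .
qed

text \<open>Checked by the witness property: a condition over the image is pulled back, solved in
  \<open>M\<close>, and the solution is pushed forward.\<close>

lemma elem_sub_aut:
  assumes C: "is_struct L C" and "Funs L = {}" and \<sigma>: "\<sigma> \<in> auts L C {}" and M: "elem_sub L M C"
  shows "elem_sub L (\<sigma> ` M) C"
proof (rule tarski_vaught[OF C assms(2)])
  have MC: "M \<subseteq> univ C" using M by (simp add: elem_sub_def)
  have "\<sigma> ` univ C = univ C" using \<sigma> by (simp add: auts_def bij_betw_def)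
  then show "\<sigma> ` M \<subseteq> univ C" using image_mono[OF MC, of \<sigma>] by simp
  obtain \<tau> where \<tau>: "\<tau> \<in> auts L C {}" "\<And>x. x \<in> univ C \<Longrightarrow> \<tau> (\<sigma> x) = x" "\<And>x. x \<in> univ C \<Longrightarrow> \<sigma> (\<tau> x) = x"
    by (rule aut_inverse[OF C \<sigma> empty_subsetI]) (rule that; assumption)
  fix s Q assume s: "s \<in> Sorts L" and Q: "expressible L C (UNIV :: unit set) (\<lambda>_. s) (\<sigma> ` M) Q"
    and ex: "\<exists>x\<in>elts C s. Q C (\<lambda>_. x)"
  obtain x where x: "x \<in> elts C s" "Q C (\<lambda>_. x)" using ex by (elim bexE) (rule that)
  obtain \<phi> \<rho> where p: "(\<phi>, \<rho>) \<in> pformulas L C (UNIV :: unit set) (\<lambda>_. s) (\<sigma> ` M)"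
    "\<And>M' a. psat M' a (\<phi>, \<rho>) \<longleftrightarrow> Q M' a"
  proof -
    obtain q where q: "q \<in> pformulas L C (UNIV :: unit set) (\<lambda>_. s) (\<sigma> ` M)" "\<forall>M' a. psat M' a q \<longleftrightarrow> Q M' a"
      using Q unfolding expressible_def by (elim bexE) (rule that)
    obtain \<phi> \<rho> where q_eq: "q = (\<phi>, \<rho>)" by (cases q)
    show ?thesis by (rule that[of \<phi> \<rho>]) (use q in \<open>simp_all only: q_eq\<close>)
  qed
  note pb = aut_pullback[OF C \<sigma> \<tau>(2) MC p(1)]
  have pull: "psat C (\<lambda>_. z) (\<phi>, \<lambda>v. map_sum (\<lambda>i. i) \<tau> (\<rho> v)) \<longleftrightarrow> Q C (\<lambda>_. \<sigma> z)" if "z \<in> elts C s" for z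
    using pb(2)[of "\<lambda>_. z"] p(2) that by simp
  have "\<tau> x \<in> elts C s" using aut_in_elts[OF \<tau>(1) x(1)] .
  moreover have "\<sigma> (\<tau> x) = x" using \<tau>(3) x(1) by (simp add: elts_def)
  ultimately have "\<exists>z\<in>elts C s. psat C (\<lambda>_. z) (\<phi>, \<lambda>v. map_sum (\<lambda>i. i) \<tau> (\<rho> v))"
    using pull[of "\<tau> x"] x(2) by (intro bexI[of _ "\<tau> x"]) simp_all
  from elem_sub_witness[OF M s expressible_psat[OF pb(1)] this]
  obtain m where m: "m \<in> M" "m \<in> elts C s" "psat C (\<lambda>_. m) (\<phi>, \<lambda>v. map_sum (\<lambda>i. i) \<tau> (\<rho> v))"
    by blast
  have "Q C (\<lambda>_. \<sigma> m)" using m(3) unfolding pull[OF m(2)] .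
  then show "\<exists>x\<in>\<sigma> ` M. x \<in> elts C s \<and> Q C (\<lambda>_. x)"
    by (intro bexI[of _ "\<sigma> m"] conjI imageI m(1) aut_in_elts[OF \<sigma> m(2)])
qed

text \<open>The formula x = x records the sort of its variable. This matters because
  \<open>tp\<close> takes the sort from the element itself.\<close>

lemma tp_sort:
  assumes "is_struct L C" and "x \<in> univ C" and "tp L C {i} (\<lambda>_. x) M = tp L C {i} (\<lambda>_. y) M"
  shows "srt C y = srt C x"
proof -
  let ?p = "(Eq (Var (0, srt C x)) (Var (0, srt C x)), \<lambda>_. Inl i)"
  have "srt C x \<in> Sorts L" using assms(1,2) unfolding is_struct_def by blast
  then have "?p \<in> tp L C {i} (\<lambda>_. x) M" by (simp add: tp_def pformulas_iff psat_Pair)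
  then have "?p \<in> tp L C {i} (\<lambda>_. y) M" unfolding assms(3) .
  then show ?thesis by (simp add: tp_def pformulas_iff)
qed

text \<open>The model that witnesses the equality of types is moved along. For the torsor this makes
  Lascar distance invariant under left translations.\<close>

lemma lascar_step_aut:
  assumes C: "is_struct L C" and "Funs L = {}" and \<sigma>: "\<sigma> \<in> auts L C {}"
    and xy: "(x, y) \<in> lascar_step L \<kappa> C i"
  shows "(\<sigma> x, \<sigma> y) \<in> lascar_step L \<kappa> C i"
proof -
  obtain M where M: "small L \<kappa> M" "elem_sub L M C" "tp L C {i} (\<lambda>_. x) M = tp L C {i} (\<lambda>_. y) M"
    using xy by (rule lascar_stepE)
  have u: "x \<in> univ C" "y \<in> univ C" using lascar_step_univ[OF xy] by simp_all
  have MC: "M \<subseteq> univ C" using M(2) by (simp add: elem_sub_def)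
  have s: "srt C y = srt C x" by (rule tp_sort[OF C u(1) M(3)])
  have "\<sigma> ` univ C = univ C" using \<sigma> by (simp add: auts_def bij_betw_def)
  then have \<sigma>u: "\<sigma> z \<in> univ C \<and> srt C (\<sigma> z) = srt C z" if "z \<in> univ C" for z
    using \<sigma> that by (auto simp: auts_def)
  obtain \<tau> where \<tau>: "\<And>x. x \<in> univ C \<Longrightarrow> \<tau> (\<sigma> x) = x"
    by (rule aut_inverse[OF C \<sigma> empty_subsetI]) (rule that; assumption)
  have e: "x \<in> elts C (srt C x)" "y \<in> elts C (srt C x)" using u s by (simp_all add: elts_def)
  have "psat C (\<lambda>_. \<sigma> x) p \<longleftrightarrow> psat C (\<lambda>_. \<sigma> y) p"
    if p: "p \<in> pformulas L C {i} (\<lambda>_. srt C x) (\<sigma> ` M)" for p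
  proof -
    obtain \<phi> \<rho> where p_eq: "p = (\<phi>, \<rho>)" by (cases p)
    note pb = aut_pullback[OF C \<sigma> \<tau> MC p[unfolded p_eq]]
    let ?q = "(\<phi>, \<lambda>v. map_sum (\<lambda>i. i) \<tau> (\<rho> v))"
    have "?q \<in> tp L C {i} (\<lambda>_. x) M \<longleftrightarrow> ?q \<in> tp L C {i} (\<lambda>_. y) M" using M(3) by simp
    then have "psat C (\<lambda>_. x) ?q \<longleftrightarrow> psat C (\<lambda>_. y) ?q" using pb(1) s by (simp add: tp_def)
    moreover have "psat C (\<lambda>_. \<sigma> x) p \<longleftrightarrow> psat C (\<lambda>_. x) ?q"
      unfolding p_eq by (rule pb(2)[of "\<lambda>_. x"]) (simp_all add: e(1))
    moreover have "psat C (\<lambda>_. \<sigma> y) p \<longleftrightarrow> psat C (\<lambda>_. y) ?q"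
      unfolding p_eq by (rule pb(2)[of "\<lambda>_. y"]) (simp_all add: e(2))
    ultimately show ?thesis by simp
  qed
  then have "tp L C {i} (\<lambda>_. \<sigma> x) (\<sigma> ` M) = tp L C {i} (\<lambda>_. \<sigma> y) (\<sigma> ` M)"
    using \<sigma>u[OF u(1)] \<sigma>u[OF u(2)] s by (auto simp: tp_def)
  moreover have "small L \<kappa> (\<sigma> ` M)"
  proof -
    have "|\<sigma> ` M| \<le>o |M|" by (rule card_of_image)
    then have "|formulas L| +c |\<sigma> ` M| \<le>o |formulas L| +c |M|" by (rule csum_mono2)
    then have "small_bound L (\<sigma> ` M) \<le>o small_bound L M"
      by (intro cexp_mono2_Cnotzero Card_order_ctwo Cinfinite_Cnotzero Cinfinite_csum1[OF Cinfinite_formulas])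
    then show ?thesis using M(1) unfolding small_def by (rule ordLeq_ordLess_trans)
  qed
  ultimately show ?thesis
    using elem_sub_aut[OF C assms(2) \<sigma> M(2)] \<sigma>u[OF u(1)] \<sigma>u[OF u(2)] by (intro lascar_stepI) simp_all
qed

lemma sym_lascar_step: "sym (lascar_step L \<kappa> C i)"
proof (rule symI)
  fix x y assume xy: "(x, y) \<in> lascar_step L \<kappa> C i"
  then obtain M where "small L \<kappa> M" "elem_sub L M C" "tp L C {i} (\<lambda>_. x) M = tp L C {i} (\<lambda>_. y) M"
    by (rule lascar_stepE)
  then show "(y, x) \<in> lascar_step L \<kappa> C i"
    using lascar_step_univ[OF xy] by (intro lascar_stepI[of _ _ _ _ _ M]) simp_all
qed

lemma rtrancl_map_preserve:
  assumes "(x, y) \<in> R\<^sup>*" and "\<And>x y. (x, y) \<in> R \<Longrightarrow> (f x, f y) \<in> R"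
  shows "(f x, f y) \<in> R\<^sup>*"
  using assms(1)
proof (induction rule: rtrancl_induct)
  case (step y z)
  then show ?case using assms(2)[of y z] by (meson rtrancl.rtrancl_into_rtrancl)
qed simp

section \<open>Sets invariant under automorphisms\<close>

context definable_group_struct
begin

text \<open>Closure under all automorphisms over \<open>A\<close> already gives equality, because
  the inverse of such an automorphism is another one.\<close>

lemma invariantI:
  assumes "H \<subseteq> carrier G" and H: "\<And>\<sigma> h. \<sigma> \<in> auts L C A \<Longrightarrow> h \<in> H \<Longrightarrow> map \<sigma> h \<in> H"
  shows "invariant L C A H"
  unfolding invariant_def
proof (intro ballI equalityI subsetI)
  fix \<sigma> h assume \<sigma>: "\<sigma> \<in> auts L C A"
  show "h \<in> H" if "h \<in> map \<sigma> ` H" using that H[OF \<sigma>] by auto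
  assume h: "h \<in> H"
  obtain \<tau> where \<tau>: "\<tau> \<in> auts L C A" "\<And>x. x \<in> univ C \<Longrightarrow> \<sigma> (\<tau> x) = x"
    using aut_inverse[OF is_struct \<sigma> A_univ] by metis
  have "set h \<subseteq> univ C" using h assms(1) carrier_nth(3) by blast
  then have "map \<sigma> (map \<tau> h) = h" using \<tau>(2) by (auto intro!: map_idI)
  then show "h \<in> map \<sigma> ` H" using H[OF \<tau>(1) h] by (metis imageI)
qed

lemma set_multI: "x \<in> U \<Longrightarrow> y \<in> V \<Longrightarrow> x \<otimes> y \<in> U <#> V"
  by (auto simp: set_mult_def)

lemma type_definable_invariant:
  assumes "type_definable L C A ss K" and "K \<subseteq> carrier G"
  shows "invariant L C A K"
proof (rule invariantI[OF assms(2)])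
  fix \<sigma> h assume \<sigma>: "\<sigma> \<in> auts L C A" and h: "h \<in> K"
  obtain \<Sigma> where \<Sigma>: "\<Sigma> \<subseteq> pformulas L C {..<len} ((!) ss) A"
    "K = {xs \<in> tuples C ss. \<forall>p\<in>\<Sigma>. psat C ((!) xs) p}"
    using assms(1) by (auto simp: type_definable_def)
  have hG: "h \<in> carrier G" using h assms(2) by blast
  have "psat C ((!) (map \<sigma> h)) p" if p: "p \<in> \<Sigma>" for p
  proof -
    have ep: "expressible L C {..<len} ((!) ss) A (\<lambda>M' a. psat M' a p)" using p \<Sigma>(1) by blast
    have "psat C ((!) (map \<sigma> h)) p \<longleftrightarrow> psat C (\<lambda>i. \<sigma> (h ! i)) p"
      by (rule expressible_cong_valuation[OF ep]) (simp add: carrier_nth(1)[OF hG])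
    also have "\<dots> \<longleftrightarrow> psat C ((!) h) p"
      by (rule aut_expressible[OF is_struct \<sigma> ep A_univ]) (use carrier_nth(2)[OF hG] in auto)
    finally show ?thesis using h p \<Sigma>(2) by blast
  qed
  moreover have "map \<sigma> h \<in> tuples C ss" using aut_carrier[OF \<sigma> hG] carrier_tuples by blast
  ultimately show "map \<sigma> h \<in> K" using \<Sigma>(2) by blast
qed

end

section \<open>The Lascar class of the unit\<close>

context torsor
begin

definition step :: "('a \<times> 'a) set" where
  "step = lascar_step sig \<kappa> tor (pt :: 'a)"

abbreviation eqL :: "'a list \<Rightarrow> 'a list \<Rightarrow> bool" where
  "eqL g h \<equiv> (\<iota> g, \<iota> h) \<in> step\<^sup>*"

lemmas step_lemmas = lascar_step_univ[of _ _ sig \<kappa> tor "pt :: 'a", folded step_def]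
  lascar_stepE[of _ _ sig \<kappa> tor "pt :: 'a", folded step_def]

definition component :: "'a list set" where
  "component = {g \<in> carrier G. eqL \<one> g}"

text \<open>Smallness for the torsor refers to its own language, which has at most |L| + |A|
  formulas; sets of that size are therefore small along with \<open>A\<close>.\<close>

lemma small_sig:
  fixes M :: "'m set"
  assumes "|M| \<le>o |formulas L| +c |A|"
  shows "small sig \<kappa> M"
proof -
  have "|formulas sig| +c |M| \<le>o |formulas L| +c |A|"
    by (intro csum_cinfinite_bound card_of_sig assms card_of_Card_order Cinfinite_csum1[OF Cinfinite_formulas])
  then have "small_bound sig M \<le>o small_bound L A"
    by (intro cexp_mono2_Cnotzero Card_order_ctwo Cinfinite_Cnotzero Cinfinite_csum1[OF Cinfinite_formulas])
  then show ?thesis using small_A unfolding small_def by (rule ordLeq_ordLess_trans)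
qed

text \<open>A quotient x^-1 y does not change when both points are multiplied by g on the left, so
  its membership in \<open>D\<close> is a basic relation of the torsor and is visible in
  types.\<close>

lemma quotient_relation:
  assumes D: "gdef A D"
  obtains R where "(2, R) \<in> relations"
    and "\<And>a b. a \<in> carrier G \<Longrightarrow> b \<in> carrier G \<Longrightarrow> [a, b] \<in> R \<longleftrightarrow> inv a \<otimes> b \<in> D"
proof
  define R where "R = {ds. length ds = 2 \<and> set ds \<subseteq> carrier G \<and> inv (ds ! 0) \<otimes> ds ! 1 \<in> D}"
  have "gpred A {..<2} (\<lambda>x :: nat \<Rightarrow> 'a list. inv (x 0) \<otimes> x 1 \<in> D)"
    by (intro gpred_quotient[OF D]) auto
  then have gp: "gpred A {..<2} (\<lambda>x. map x [0..<2] \<in> R)"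
  proof (rule gpred_cong)
    fix x :: "nat \<Rightarrow> 'a list" assume "\<forall>k\<in>{..<2}. x k \<in> carrier G"
    then show "inv (x 0) \<otimes> x 1 \<in> D \<longleftrightarrow> map x [0..<2] \<in> R" by (auto simp: R_def numeral_2_eq_2)
  qed
  have "map ((\<otimes>) g) ds \<in> R" if g: "g \<in> carrier G" and ds: "ds \<in> R" for g ds
  proof -
    obtain a b where ab: "ds = [a, b]" "a \<in> carrier G" "b \<in> carrier G" "inv a \<otimes> b \<in> D"
      using ds by (auto simp: R_def numeral_2_eq_2 length_Suc_conv)
    have "inv (g \<otimes> a) \<otimes> (g \<otimes> b) = inv a \<otimes> b"
      using g ab by (simp add: inv_mult_group m_assoc inv_solve_left')
    then show ?thesis using g ab by (auto simp: R_def)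
  qed
  then show "(2, R) \<in> relations" using gp by (auto simp: relations_def R_def)
  show "[a, b] \<in> R \<longleftrightarrow> inv a \<otimes> b \<in> D" if "a \<in> carrier G" "b \<in> carrier G" for a b
    using that by (simp add: R_def)
qed

abbreviation binary :: "'a list list set \<Rightarrow> 'a \<Rightarrow> 'j \<Rightarrow> ('a, 'a, 'a, 'a, 'j) pfm" where
  "binary R m j \<equiv> (Rel (nm (2, R)) [Var (0, pt), Var (1, pt)], \<lambda>v. if fst v = 0 then Inr m else Inl j)"

lemma binary_pformula:
  "(2, R) \<in> relations \<Longrightarrow> m \<in> M \<Longrightarrow> binary R m j \<in> pformulas sig tor {j} (\<lambda>_. pt) M"
  by (auto simp: pformulas_iff numeral_2_eq_2)

lemma psat_binary: "(2, R) \<in> relations \<Longrightarrow> psat tor (\<lambda>_. z) (binary R m j) \<longleftrightarrow> [un m, un z] \<in> R"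
  by (simp add: psat_Pair)

text \<open>A maximal chain in the elementary substructure is maximal in the whole torsor.\<close>

lemma step_quotient:
  assumes "(x, y) \<in> step" and D: "gdef A D" "thick D"
  shows "inv (un x) \<otimes> un y \<in> inverses D <#> D"
proof -
  obtain M where M: "elem_sub sig M tor" "tp sig tor {pt :: 'a} (\<lambda>_. x) M = tp sig tor {pt :: 'a} (\<lambda>_. y) M"
    using assms(1) by (rule step_lemmas(2)) (rule that; assumption)
  have xy: "x \<in> univ tor" "y \<in> univ tor" using step_lemmas(1)[OF assms(1)] by simp_all
  have MG: "un m \<in> carrier G" "\<iota> (un m) = m" if "m \<in> M" for m
    using M(1) that by (auto simp: elem_sub_def)
  obtain R where nR: "(2, R) \<in> relations"
    and R: "\<And>a b. a \<in> carrier G \<Longrightarrow> b \<in> carrier G \<Longrightarrow> [a, b] \<in> R \<longleftrightarrow> inv a \<otimes> b \<in> D"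
    by (rule quotient_relation[OF D(1)]) (rule that; assumption)
  have ps: "psat tor (\<lambda>_. z) (binary R m j) \<longleftrightarrow> inv (un m) \<otimes> un z \<in> D"
    if "m \<in> M" "z \<in> univ tor" for m z and j :: unit
    unfolding psat_binary[OF nR] using R that MG by auto
  \<comment> \<open>The same fact for the index type of Lascar tuples; \<open>ps\<close> serves the
    witness property, which is stated for \<open>unit\<close>.\<close>
  have ps': "psat tor (\<lambda>_. z) (binary R m j) \<longleftrightarrow> inv (un m) \<otimes> un z \<in> D"
    if "m \<in> M" "z \<in> univ tor" for m z and j :: 'a
    unfolding psat_binary[OF nR] using R that MG by auto
  obtain n where n: "\<And>x. \<not> chain (carrier G - D) n x" using D(2) by (auto simp: thick_def)
  \<comment> \<open>Chains in \<open>M\<close> that avoid \<open>D\<close> have length at most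
    \<open>n\<close>, so there is a longest one.\<close>
  define good where "good k \<longleftrightarrow> (\<exists>x. chain (carrier G - D) k x \<and> (\<forall>i<k. \<iota> (x i) \<in> M))" for k
  have bound: "k \<le> n" if "good k" for k
  proof (rule ccontr)
    assume "\<not> k \<le> n"
    then have "\<exists>x. chain (carrier G - D) n x"
      using that chain_mono[of "carrier G - D" k _ "carrier G - D" n] by (auto simp: good_def)
    then show False using n by blast
  qed
  moreover have "good 0" by (auto simp: good_def chain_def)
  ultimately obtain k where k: "good k" "\<And>j. good j \<Longrightarrow> j \<le> k"
    using Greatest_le_nat[of good _ n] GreatestI_nat[of good 0 n] by metis
  obtain c where c: "chain (carrier G - D) k c" "\<And>i. i < k \<Longrightarrow> \<iota> (c i) \<in> M"
    using k(1) by (auto simp: good_def)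
  \<comment> \<open>If no quotient of some \<open>c i\<close> and \<open>z\<close> were in
    \<open>D\<close>, this condition, which is over \<open>M\<close>, would have a solution in
    \<open>M\<close>, and the chain could be prolonged there.\<close>
  have max: "\<exists>i<k. inv (c i) \<otimes> un z \<in> D" if z: "z \<in> univ tor" for z
  proof (rule ccontr)
    assume no: "\<not> ?thesis"
    define Q where "Q M' a \<longleftrightarrow> (\<forall>i\<in>{..<k}. \<not> psat M' a (binary R (\<iota> (c i)) ()))"
      for M' :: "('a, 'a, 'a, 'a) struct" and a :: "unit \<Rightarrow> 'a"
    have "expressible sig tor {()} (\<lambda>_. pt) M Q"
      unfolding Q_def by (intro expressible_ball expressible_not expressible_psat binary_pformula[OF nR] c(2)) auto
    moreover have "{()} = UNIV" by auto
    ultimately have "expressible sig tor UNIV (\<lambda>_. pt) M Q" by simp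
    moreover have "\<exists>z\<in>elts tor pt. Q tor (\<lambda>_. z)"
      using z no ps c(2) by (intro bexI[of _ z]) (auto simp: Q_def)
    ultimately obtain m where m: "m \<in> M" "Q tor (\<lambda>_. m)"
      using elem_sub_witness[OF M(1), of pt Q] by auto
    have m': "inv (c i) \<otimes> un m \<notin> D" if "i < k" for i
      using m ps[of "\<iota> (c i)" m] c(2)[OF that] that MG(1)[OF m(1)] MG(2)[OF m(1)]
      unfolding Q_def by (metis image_eqI lessThan_iff tor_simps(1) un_\<iota>)
    have "chain (carrier G - D) (Suc k) (c(k := un m))"
      unfolding chain_def
    proof (intro conjI allI impI)
      show "(c(k := un m)) i \<in> carrier G" if "i < Suc k" for i
        using that c(1) MG(1)[OF m(1)] by (auto simp: chain_def less_Suc_eq)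
      show "inv ((c(k := un m)) i) \<otimes> (c(k := un m)) j \<in> carrier G - D" if "i < j" "j < Suc k" for i j
        using that c(1) MG(1)[OF m(1)] m' by (cases "j = k") (auto simp: chain_def)
    qed
    moreover have "\<iota> ((c(k := un m)) i) \<in> M" if "i < Suc k" for i
      using that c(2) MG(2)[OF m(1)] m(1) by (auto simp: less_Suc_eq)
    ultimately have "good (Suc k)" unfolding good_def by blast
    then show False using k(2) by fastforce
  qed
  \<comment> \<open>The index found for \<open>x\<close> serves for \<open>y\<close> as well,
    because \<open>\<iota> (c i)\<close> lies in \<open>M\<close> and the types over
    \<open>M\<close> agree.\<close>
  obtain i where i: "i < k" "inv (c i) \<otimes> un x \<in> D" using max[OF xy(1)] by blast
  let ?p = "binary R (\<iota> (c i)) (pt :: 'a)"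
  have "?p \<in> tp sig tor {pt :: 'a} (\<lambda>_. x) M \<longleftrightarrow> ?p \<in> tp sig tor {pt :: 'a} (\<lambda>_. y) M" using M(2) by simp
  then have "psat tor (\<lambda>_. x) ?p \<longleftrightarrow> psat tor (\<lambda>_. y) ?p"
    using binary_pformula[OF nR c(2)[OF i(1)], of "pt :: 'a"] by (simp add: tp_def)
  then have iy: "inv (c i) \<otimes> un y \<in> D" using i(2) ps'[OF c(2)[OF i(1)]] xy by simp
  have G: "c i \<in> carrier G" "un x \<in> carrier G" "un y \<in> carrier G"
    using c(1) i(1) xy by (auto simp: chain_def)
  have "inv (inv (c i) \<otimes> un x) \<in> inverses D" using i(2) G by (simp add: inverses_def)
  moreover have "inv (un x) \<otimes> un y = inv (inv (c i) \<otimes> un x) \<otimes> (inv (c i) \<otimes> un y)"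
  proof -
    have "inv (inv (c i) \<otimes> un x) \<otimes> (inv (c i) \<otimes> un y) = inv (un x) \<otimes> (c i \<otimes> (inv (c i) \<otimes> un y))"
      using G by (simp add: inv_mult_group m_assoc)
    also have "c i \<otimes> (inv (c i) \<otimes> un y) = un y" using G by (simp add: m_assoc[symmetric])
    finally show ?thesis by simp
  qed
  ultimately show ?thesis using iy by (auto simp: set_mult_def)
qed

text \<open>The quotients along a path multiply to the quotient of its ends.\<close>

lemma relpow_quotient:
  assumes "x \<in> univ tor" and "(x, y) \<in> step ^^ n" and D: "gdef A D" "thick D"
  shows "inv (un x) \<otimes> un y \<in> qpow D n"
  using assms(2)
proof (induction n arbitrary: y)
  case 0
  then show ?case using assms(1) by auto
next
  case (Suc n)
  then obtain z where z: "(x, z) \<in> step ^^ n" "(z, y) \<in> step" by auto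
  have G: "un x \<in> carrier G" "un z \<in> carrier G" "un y \<in> carrier G"
    using assms(1) step_lemmas(1)[OF z(2)] by auto
  have "inv (un x) \<otimes> un y = (inv (un x) \<otimes> un z) \<otimes> (inv (un z) \<otimes> un y)"
  proof -
    have "(inv (un x) \<otimes> un z) \<otimes> (inv (un z) \<otimes> un y) = inv (un x) \<otimes> (un z \<otimes> (inv (un z) \<otimes> un y))"
      using G by (simp add: m_assoc)
    also have "un z \<otimes> (inv (un z) \<otimes> un y) = un y" using G by (simp add: m_assoc[symmetric])
    finally show ?thesis by simp
  qed
  then show ?case using set_multI[OF Suc.IH[OF z(1)] step_quotient[OF z(2) D]] by simp
qed

lemma eqL_aut:
  assumes "eqL g h" and "c \<in> carrier G" and "\<sigma> \<in> auts L C A"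
  shows "eqL (c \<otimes> map \<sigma> g) (c \<otimes> map \<sigma> h)"
proof -
  have "((\<lambda>x. \<iota> (c \<otimes> map \<sigma> (un x))) (\<iota> g), (\<lambda>x. \<iota> (c \<otimes> map \<sigma> (un x))) (\<iota> h)) \<in> step\<^sup>*"
    using assms(1)
    unfolding step_def
    by (rule rtrancl_map_preserve) (rule lascar_step_aut[OF is_struct_tor _ tor_aut[OF assms(2,3)]], simp_all)
  then show ?thesis by simp
qed

lemma eqL_left:
  assumes "eqL g h" and "c \<in> carrier G"
  shows "eqL (c \<otimes> g) (c \<otimes> h)"
  using eqL_aut[OF assms, of id] by (simp add: auts_def)

lemma eqL_sym: "eqL g h \<Longrightarrow> eqL h g"
  unfolding step_def by (rule symD[OF sym_rtrancl[OF sym_lascar_step]])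

text \<open>Translating the pair (1, h) by g puts g h into the class of g, which is the class of 1;
  translating (1, g) by g^-1 gives inverses.\<close>

lemma component_subgroup: "subgroup component G"
proof (rule subgroupI)
  show "component \<subseteq> carrier G" by (auto simp: component_def)
  show "component \<noteq> {}" by (auto simp: component_def)
  fix g assume g: "g \<in> component"
  then have "eqL (inv g \<otimes> \<one>) (inv g \<otimes> g)" by (intro eqL_left) (auto simp: component_def)
  then show "inv g \<in> component" using g eqL_sym by (simp add: component_def)
  fix h assume h: "h \<in> component"
  then have "eqL (g \<otimes> \<one>) (g \<otimes> h)" using g by (intro eqL_left) (auto simp: component_def)
  then have "eqL g (g \<otimes> h)" using g by (simp add: component_def)
  moreover have "eqL \<one> g" using g by (simp add: component_def)
  ultimately show "g \<otimes> h \<in> component" using g h rtrancl_trans[of "\<iota> \<one>" "\<iota> g"] by (simp add: component_def)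
qed

lemma component_invariant: "invariant L C A component"
proof (rule invariantI)
  show "component \<subseteq> carrier G" by (auto simp: component_def)
  fix \<sigma> h assume \<sigma>: "\<sigma> \<in> auts L C A" and h: "h \<in> component"
  have "eqL (\<one> \<otimes> map \<sigma> \<one>) (\<one> \<otimes> map \<sigma> h)" using h \<sigma> by (intro eqL_aut) (auto simp: component_def)
  moreover have "map \<sigma> \<one> = \<one>" using group_hom.hom_one[OF aut_hom[OF \<sigma>]] .
  ultimately show "map \<sigma> h \<in> component" using aut_carrier[OF \<sigma>, of h] h by (simp add: component_def)
qed

text \<open>Points with the same type over one elementary substructure of size at most |L| + |A| are
  a single Lascar step apart, and there are at most 2^(|L| + |A|) such types.\<close>

lemma component_small_index: "small_index L A G component"
proof -
  obtain M where M: "elem_sub sig M tor" "|M| \<le>o |formulas sig|"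
    using lowenheim_skolem[OF is_struct_tor] by auto
  let ?r = "|formulas L| +c |A|"
  have r: "Cinfinite ?r" by (rule Cinfinite_csum1[OF Cinfinite_formulas])
  have Mr: "|M| \<le>o ?r" using M(2) card_of_sig by (rule ordLeq_transitive)
  have "\<exists>(P :: ('a, 'a, 'a, 'a, 'a) pfm set) F. |P| \<le>o ?r \<and> (\<forall>x. F x \<subseteq> P) \<and>
      (\<forall>x y. x \<in> elts tor pt \<longrightarrow> y \<in> elts tor pt \<longrightarrow> F x = F y \<longrightarrow>
        tp sig tor {pt :: 'a} (\<lambda>_. x) M = tp sig tor {pt :: 'a} (\<lambda>_. y) M)"
  proof (rule types_bound[OF r card_of_sig Mr, of tor pt "pt :: 'a"])
    fix P :: "('a, 'a, 'a, 'a, 'a) pfm set" and F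
    assume 1: "|P| \<le>o ?r" and 2: "\<And>x. F x \<subseteq> P"
      and 3: "\<And>x y. x \<in> elts tor pt \<Longrightarrow> y \<in> elts tor pt \<Longrightarrow> F x = F y \<Longrightarrow>
        tp sig tor {pt :: 'a} (\<lambda>_. x) M = tp sig tor {pt :: 'a} (\<lambda>_. y) M"
    show ?thesis by (intro exI[of _ P] exI[of _ F] conjI allI impI 1 2 3)
  qed
  then obtain P :: "('a, 'a, 'a, 'a, 'a) pfm set" and F where PF: "|P| \<le>o ?r \<and> (\<forall>x. F x \<subseteq> P) \<and>
      (\<forall>x y. x \<in> elts tor pt \<longrightarrow> y \<in> elts tor pt \<longrightarrow> F x = F y \<longrightarrow>
        tp sig tor {pt :: 'a} (\<lambda>_. x) M = tp sig tor {pt :: 'a} (\<lambda>_. y) M)" by (elim exE) (rule that)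
  then have P0: "|P| \<le>o ?r" "\<And>x. F x \<subseteq> P"
    and F: "\<And>x y. x \<in> elts tor pt \<Longrightarrow> y \<in> elts tor pt \<Longrightarrow> F x = F y \<Longrightarrow>
        tp sig tor {pt :: 'a} (\<lambda>_. x) M = tp sig tor {pt :: 'a} (\<lambda>_. y) M" by blast+
  \<comment> \<open>A point is added so that the exponent is nonzero, as monotonicity of cardinal
    exponentiation requires.\<close>
  define P' where "P' = P \<union> {undefined}"
  have 1: "|{undefined} :: ('a, 'a, 'a, 'a, 'a) pfm set| \<le>o ?r"
    by (intro ordLess_imp_ordLeq finite_less_Cinfinite r) simp
  have P: "|P'| \<le>o ?r" "\<And>x. F x \<subseteq> P'" "P' \<noteq> {}"
    using Un_Cinfinite_bound[OF P0(1) 1 r] P0(2) unfolding P'_def by auto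
  have step: "eqL g h" if "g \<in> carrier G" "h \<in> carrier G" "F (\<iota> g) = F (\<iota> h)" for g h
  proof -
    have "(\<iota> g, \<iota> h) \<in> step"
      unfolding step_def using that by (intro lascar_stepI[OF _ _ small_sig[OF Mr] M(1)] F) simp_all
    then show ?thesis by blast
  qed
  define rep where "rep X = (SOME a. a \<in> carrier G \<and> X = component #> a)" for X
  have rep: "rep X \<in> carrier G \<and> X = component #> rep X" if "X \<in> rcosets component" for X
    unfolding rep_def by (rule someI_ex) (use that in \<open>auto simp: RCOSETS_def\<close>)
  \<comment> \<open>Translation invariance of the Lascar relation makes its classes left cosets; the
    inverses of representatives lead back to the right cosets counted by
    \<open>rcosets\<close>.\<close>
  have "inj_on (\<lambda>X. F (\<iota> (inv (rep X)))) (rcosets component)"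
  proof (rule inj_onI)
    fix X Y assume X: "X \<in> rcosets component" and Y: "Y \<in> rcosets component"
      and eq: "F (\<iota> (inv (rep X))) = F (\<iota> (inv (rep Y)))"
    let ?a = "rep X" and ?b = "rep Y"
    have ab: "?a \<in> carrier G" "?b \<in> carrier G" using rep X Y by auto
    have "eqL (inv ?a) (inv ?b)" by (rule step) (use ab eq in auto)
    then have "eqL (?a \<otimes> inv ?a) (?a \<otimes> inv ?b)" using ab(1) by (rule eqL_left)
    then have ab': "?a \<otimes> inv ?b \<in> component" using ab by (simp add: component_def)
    have "component #> ?a = component #> (?a \<otimes> inv ?b \<otimes> ?b)" using ab by (simp add: m_assoc)
    also have "\<dots> = component #> (?a \<otimes> inv ?b) #> ?b"
      using ab subgroup.subset[OF component_subgroup] by (simp add: coset_mult_assoc)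
    also have "component #> (?a \<otimes> inv ?b) = component"
      using ab' component_subgroup by (simp add: coset_join2 subgroup.mem_carrier)
    finally show "X = Y" using rep X Y by simp
  qed
  moreover have "(\<lambda>X. F (\<iota> (inv (rep X)))) ` (rcosets component) \<subseteq> Pow P'" using P(2) by blast
  ultimately have "|rcosets component| \<le>o |Pow P'|" using card_of_ordLeq by blast
  also have "|Pow P'| =o ctwo ^c |P'|"
    unfolding ctwo_def cexp_def Field_card_of by (rule card_of_Pow_Func)
  also have "ctwo ^c |P'| \<le>o ctwo ^c ?r"
    using P(1,3) by (intro cexp_mono2_Cnotzero Card_order_ctwo)
      (auto simp: card_of_Card_order card_of_ordIso_czero_iff_empty)
  finally show ?thesis by (simp add: small_index_def)
qed

lemma small_index_less: "small_index L A G K \<Longrightarrow> |rcosets K| <o \<kappa>"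
  by (rule ordLeq_ordLess_trans[OF _ small_A[unfolded small_def]]) (simp add: small_index_def)

text \<open>The third clause serves the comparison of parameters under NIP: a subgroup over a larger
  set that contains the kernel then contains the component over \<open>A\<close>.\<close>

theorem components_coincide:
  assumes "G_compact TYPE('a) sig (Th sig tor)"
  shows "is_G00_over L C A ss G component" and "is_G000_over L C A G component"
    and "subgroup K G \<Longrightarrow> kernel \<subseteq> K \<Longrightarrow> component \<subseteq> K"
proof -
  have "|{pt}| \<le>o |formulas L| +c |A|"
    by (intro ordLess_imp_ordLeq finite_less_Cinfinite Cinfinite_csum1[OF Cinfinite_formulas]) simp
  from G_compact_bound[OF assms monster_tor small_sig[OF this], of "\<iota> \<one>", folded step_def]
  obtain n where n: "\<And>y. (\<iota> \<one>, y) \<in> step\<^sup>* \<Longrightarrow> \<exists>m\<le>n. (\<iota> \<one>, y) \<in> step ^^ m" by auto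
  have sub: "g \<in> qpow D n" if g: "g \<in> component" and D: "gdef A D" "thick D" for g D
  proof -
    have gG: "g \<in> carrier G" using g by (simp add: component_def)
    obtain m where m: "m \<le> n" "(\<iota> \<one>, \<iota> g) \<in> step ^^ m" using g n by (auto simp: component_def)
    have "inv (un (\<iota> \<one>)) \<otimes> un (\<iota> g) \<in> qpow D m" by (rule relpow_quotient[OF _ m(2) D]) simp
    then have "g \<in> qpow D m" using gG by simp
    \<comment> \<open>The path may be shorter than \<open>n\<close>, and the powers increase with
      the exponent.\<close>
    then show ?thesis using qpow_le[OF gdef_carrier_subset[OF D(1)] thick_nonempty[OF D(2)] m(1)] by blast
  qed
  have le: "component \<subseteq> K" if "subgroup K G" "kernel \<subseteq> K" for K
  proof
    fix g assume g: "g \<in> component"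
    then have "g \<in> carrier G" by (simp add: component_def)
    then show "g \<in> K" by (rule qpow_kernel[OF that]) (rule sub[OF g])
  qed
  then show "subgroup K G \<Longrightarrow> kernel \<subseteq> K \<Longrightarrow> component \<subseteq> K" .
  have least: "component \<subseteq> K" if "subgroup K G" "invariant L C A K" "small_index L A G K" for K
    using le[OF that(1) kernel_subset[OF that(1,2) small_index_less[OF that(3)]]] .
  show "is_G000_over L C A G component"
    unfolding is_G000_over_def is_least_def
    using component_subgroup component_invariant component_small_index least by blast
  have ker: "kernel \<subseteq> component"
    by (rule kernel_subset[OF component_subgroup component_invariant small_index_less[OF component_small_index]])
  let ?D = "{D. gdef A D \<and> thick D}"
  \<comment> \<open>One inclusion is the Lascar bound and the other is compactness. With one fixed
    \<open>n\<close> this describes the class by \<open>A\<close>-definable sets.\<close>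
  have eq: "component = {g \<in> carrier G. \<forall>D\<in>?D. g \<in> qpow D n}"
    using sub qpow_kernel[OF component_subgroup ker, of _ n] by (auto simp: component_def)
  define \<Sigma> where "\<Sigma> = {p \<in> pformulas L C {..<len} ((!) ss) A.
      \<exists>D\<in>?D. qpow D n = {xs \<in> tuples C ss. psat C ((!) xs) p}}"
  have def: "\<exists>p\<in>\<Sigma>. qpow D n = {xs \<in> tuples C ss. psat C ((!) xs) p}" if D: "D \<in> ?D" for D
  proof -
    have "definable L C A ss (qpow D n)"
      using D by (intro gdef_imp_definable gdef_qpow) auto
    then show ?thesis using D unfolding definable_def \<Sigma>_def by blast
  qed
  have "component = {xs \<in> tuples C ss. \<forall>p\<in>\<Sigma>. psat C ((!) xs) p}"
  proof (intro equalityI subsetI)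
    fix g assume g: "g \<in> component"
    have "psat C ((!) g) p" if "p \<in> \<Sigma>" for p using that g eq by (auto simp: \<Sigma>_def)
    moreover have "g \<in> tuples C ss" using g carrier_tuples by (auto simp: component_def)
    ultimately show "g \<in> {xs \<in> tuples C ss. \<forall>p\<in>\<Sigma>. psat C ((!) xs) p}" by blast
  next
    fix g assume g: "g \<in> {xs \<in> tuples C ss. \<forall>p\<in>\<Sigma>. psat C ((!) xs) p}"
    have all: "g \<in> qpow D n" if "D \<in> ?D" for D using def[OF that] g by blast
    have "carrier G \<in> ?D" using gdef_carrier[OF order_refl] thick_carrier by simp
    then have "g \<in> carrier G" using all qpow_carrier[OF order_refl] by blast
    then show "g \<in> component" using all eq by blast
  qed
  then have td: "type_definable L C A ss component"
    unfolding type_definable_def by (intro exI[of _ \<Sigma>]) (auto simp: \<Sigma>_def)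
  have least': "component \<subseteq> K" if "subgroup K G" "type_definable L C A ss K" "small_index L A G K" for K
    using least[OF that(1) type_definable_invariant[OF that(2) subgroup.subset[OF that(1)]] that(3)] .
  show "is_G00_over L C A ss G component"
    unfolding is_G00_over_def is_least_def
    using component_subgroup td component_small_index least' by blast
qed

end

section \<open>NIP and independence of the parameters\<close>

lemma pformulas_mono: "B \<subseteq> B' \<Longrightarrow> pformulas L M I ss B \<subseteq> pformulas L M I ss B'"
  by (auto simp: pformulas_def split: sum.splits)

lemma definable_mono: "definable L M B ss D \<Longrightarrow> B \<subseteq> B' \<Longrightarrow> definable L M B' ss D"
  unfolding definable_def using pformulas_mono by blast

lemma type_definable_mono:
  assumes "type_definable L M B ss D" and "B \<subseteq> B'"
  shows "type_definable L M B' ss D"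
proof -
  obtain \<Sigma> where "\<Sigma> \<subseteq> pformulas L M {..<length ss} ((!) ss) B"
    "D = {xs \<in> tuples M ss. \<forall>p\<in>\<Sigma>. psat M ((!) xs) p}"
    using assms(1) by (auto simp: type_definable_def)
  then show ?thesis
    unfolding type_definable_def using pformulas_mono[OF assms(2), of L M "{..<length ss}" "(!) ss"]
    by (intro exI[of _ \<Sigma>]) auto
qed

lemma definable_group_mono: "definable_group L C A ss G \<Longrightarrow> A \<subseteq> E \<Longrightarrow> definable_group L C E ss G"
  unfolding definable_group_def by (blast intro: definable_mono)

text \<open>\<open>has_IP\<close> asks for parameters for every subset of the naturals, so continuum
  many variables have to be realised. As the language is infinite, the continuum is at most 2^|L|,
  which is below \<open>\<kappa>\<close>.\<close>

lemma (in monster_struct) nat_set_less: "|UNIV :: nat set set| <o \<kappa>"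
proof -
  have "|UNIV :: nat set| \<le>o |formulas L|"
    using infinite_formulas by (simp add: infinite_iff_card_of_nat)
  then have "ctwo ^c |UNIV :: nat set| \<le>o ctwo ^c |formulas L|"
    by (intro cexp_mono2_Cnotzero Card_order_ctwo) (auto simp: card_of_Card_order card_of_ordIso_czero_iff_empty)
  moreover have "|Pow (UNIV :: nat set)| =o ctwo ^c |UNIV :: nat set|"
    unfolding ctwo_def cexp_def Field_card_of by (rule card_of_Pow_Func)
  ultimately have "|Pow (UNIV :: nat set)| \<le>o ctwo ^c |formulas L|" by (rule ordIso_ordLeq_trans[rotated])
  then have "|Pow (UNIV :: nat set)| <o \<kappa>" using exp_formulas by (rule ordLeq_ordLess_trans)
  then show ?thesis by simp
qed

text \<open>The finite patterns cover all subsets \<open>S\<close> but only the numbers below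
  \<open>n\<close>. Each requirement concerns one number and one subset, so saturation in continuum
  many variables joins them into an infinite pattern.\<close>

theorem (in monster_struct) has_IP_compactness:
  assumes \<phi>: "\<phi> \<in> formulas L"
    and fin: "\<And>n :: nat. \<exists>a b.
       (\<forall>i :: nat. \<forall>v\<in>fv \<phi> \<inter> X. a i v \<in> elts C (snd v)) \<and>
       (\<forall>S :: nat set. \<forall>v\<in>fv \<phi> - X. b S v \<in> elts C (snd v)) \<and>
       (\<forall>i<n. \<forall>S. sat C (\<lambda>v. if v \<in> X then a i v else b S v) \<phi> \<longleftrightarrow> i \<in> S)"
  shows "has_IP L C \<phi> X"
proof -
  let ?I = "Inl ` ((UNIV :: nat set) \<times> (fv \<phi> \<inter> X)) \<union> Inr ` ((UNIV :: nat set set) \<times> (fv \<phi> - X))"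
  let ?s = "\<lambda>k :: (nat \<times> 's var) + (nat set \<times> 's var). case k of Inl u \<Rightarrow> snd (snd u) | Inr u \<Rightarrow> snd (snd u)"
  define asg where "asg k e = (\<lambda>v. if v \<in> X then e (Inl (fst k, v)) else e (Inr (snd k, v)))"
    for k :: "nat \<times> nat set" and e :: "(nat \<times> 's var) + (nat set \<times> 's var) \<Rightarrow> 'a"
  define Q where "Q k M' e \<longleftrightarrow> (sat M' (asg k e) \<phi> \<longleftrightarrow> fst k \<in> snd k)"
    for k and M' :: "('s, 'f, 'r, 'a) struct" and e
  have nat: "|UNIV :: nat set| <o \<kappa>"
  proof -
    \<comment> \<open>Each number is the minimum of its singleton.\<close>
    have "|UNIV :: nat set| \<le>o |UNIV :: nat set set|"
      by (rule card_of_le_trans_image[of _ "\<lambda>S. Min S" UNIV])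
        (auto simp: ordLeq_refl card_of_Card_order intro!: image_eqI[of _ _ "{_}"])
    then show ?thesis using nat_set_less by (rule ordLeq_ordLess_trans)
  qed
  have I: "|?I| <o \<kappa>"
  proof (rule Un_less)
    have "|(UNIV :: nat set) \<times> (fv \<phi> \<inter> X)| <o \<kappa>"
      by (rule card_of_Times_finite[OF Cinfinite_\<kappa> nat]) simp
    then show "|Inl ` ((UNIV :: nat set) \<times> (fv \<phi> \<inter> X)) :: ((nat \<times> 's var) + (nat set \<times> 's var)) set| <o \<kappa>"
      by (rule ordLeq_ordLess_trans[OF card_of_image])
    have "|(UNIV :: nat set set) \<times> (fv \<phi> - X)| <o \<kappa>"
      by (rule card_of_Times_finite[OF Cinfinite_\<kappa> nat_set_less]) simp
    then show "|Inr ` ((UNIV :: nat set set) \<times> (fv \<phi> - X)) :: ((nat \<times> 's var) + (nat set \<times> 's var)) set| <o \<kappa>"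
      by (rule ordLeq_ordLess_trans[OF card_of_image])
  qed
  have sorts: "snd v \<in> Sorts L" if v: "v \<in> fv \<phi>" for v
  proof -
    obtain a b where "\<forall>i :: nat. \<forall>v\<in>fv \<phi> \<inter> X. a i v \<in> elts C (snd v)"
      "\<forall>S :: nat set. \<forall>v\<in>fv \<phi> - X. b S v \<in> elts C (snd v)" using fin[of 0] by (elim exE conjE) (rule that)
    then have "(if v \<in> X then a 0 v else b {} v) \<in> elts C (snd v)" using v by simp
    then have "snd v \<in> srt C ` univ C" by (force simp: elts_def)
    then show ?thesis using is_struct by (simp add: is_struct_def)
  qed
  have "\<exists>e. (\<forall>i\<in>?I. e i \<in> elts C (?s i)) \<and> (\<forall>Q'\<in>range Q. Q' C e)"
  proof (rule saturated_many[of "{}"])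
    show "|{} :: 'a set| <o \<kappa>" by (rule finite_less) simp
    show "|?I| <o \<kappa>" by (rule I)
    show "?s i \<in> Sorts L" if "i \<in> ?I" for i using that sorts by auto
  next
    fix Q' assume "Q' \<in> range Q"
    then obtain k where k: "Q' = Q k" by blast
    let ?r = "\<lambda>v. Inl (if v \<in> X then Inl (fst k, v) else Inr (snd k, v))
      :: ((nat \<times> 's var) + (nat set \<times> 's var)) + 'a"
    have "(\<phi>, ?r) \<in> pformulas L C ?I ?s {}" using \<phi> by (auto simp: pformulas_iff formulas_def)
    then have e: "expressible L C ?I ?s {} (\<lambda>M' e. psat M' e (\<phi>, ?r))" by (rule expressible_psat)
    have *: "psat M' e (\<phi>, ?r) \<longleftrightarrow> sat M' (asg k e) \<phi>" for M' e
    proof -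
      have "(\<lambda>v. case_sum e (\<lambda>b. b) (?r v)) = asg k e" by (auto simp: asg_def)
      then show ?thesis by (simp add: psat_Pair)
    qed
    show "expressible L C ?I ?s {} Q'"
    proof (cases "fst k \<in> snd k")
      case True
      then have "Q' = (\<lambda>M' e. psat M' e (\<phi>, ?r))" unfolding k * by (intro ext) (simp add: Q_def)
      then show ?thesis using e by simp
    next
      case False
      then have "Q' = (\<lambda>M' e. \<not> psat M' e (\<phi>, ?r))" unfolding k * by (intro ext) (simp add: Q_def)
      then show ?thesis using expressible_not[OF e] by simp
    qed
  next
    fix \<F> assume "\<F> \<subseteq> range Q" "finite \<F>"
    then obtain J where J: "finite J" "\<F> = Q ` J" by (meson finite_subset_image)
    \<comment> \<open>Exceeds every number occurring in \<open>J\<close>, so one finite pattern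
      satisfies all conditions in \<open>\<F>\<close>.\<close>
    define n where "n = Suc (Max (insert 0 (fst ` J)))"
    have n: "fst k < n" if "k \<in> J" for k
    proof -
      have "fst k \<le> Max (insert 0 (fst ` J))" using J(1) that by (intro Max_ge) auto
      then show ?thesis by (simp add: n_def)
    qed
    obtain a b where ab: "\<forall>i. \<forall>v\<in>fv \<phi> \<inter> X. a i v \<in> elts C (snd v)"
      "\<forall>S. \<forall>v\<in>fv \<phi> - X. b S v \<in> elts C (snd v)"
      "\<forall>i<n. \<forall>S. sat C (\<lambda>v. if v \<in> X then a i v else b S v) \<phi> \<longleftrightarrow> i \<in> S" using fin[of n] by (elim exE conjE) (rule that)
    define e where "e k = (case k of Inl u \<Rightarrow> a (fst u) (snd u) | Inr u \<Rightarrow> b (fst u) (snd u))" for k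
    have "Q k C e" if k: "k \<in> J" for k
    proof -
      have "asg k e = (\<lambda>v. if v \<in> X then a (fst k) v else b (snd k) v)" by (auto simp: asg_def e_def)
      then show ?thesis using ab(3) n[OF k] by (simp add: Q_def)
    qed
    moreover have "\<forall>i\<in>?I. e i \<in> elts C (?s i)"
    proof
      fix i assume "i \<in> ?I"
      then consider (l) j v where "i = Inl (j, v)" "v \<in> fv \<phi> \<inter> X" | (r) S v where "i = Inr (S, v)" "v \<in> fv \<phi> - X"
        by blast
      then show "e i \<in> elts C (?s i)"
      proof cases
        case l
        then show ?thesis using ab(1)[rule_format, OF l(2), of j] by (simp add: e_def)
      next
        case r
        then show ?thesis using ab(2)[rule_format, OF r(2), of S] by (simp add: e_def)
      qed
    qed
    ultimately show "\<exists>e. (\<forall>i\<in>?I. e i \<in> elts C (?s i)) \<and> (\<forall>Q'\<in>\<F>. Q' C e)"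
      unfolding J(2) by (intro exI[of _ e]) simp
  qed simp
  then obtain e where e: "\<forall>i\<in>?I. e i \<in> elts C (?s i)" "\<forall>Q'\<in>range Q. Q' C e"
    by (elim exE conjE) (rule that)
  have "sat C (asg (i, S) e) \<phi> \<longleftrightarrow> i \<in> S" for i S
  proof -
    have "Q (i, S) C e" using e(2) by simp
    then show ?thesis by (simp add: Q_def)
  qed
  then have "sat C (\<lambda>v. if v \<in> X then e (Inl (i, v)) else e (Inr (S, v))) \<phi> \<longleftrightarrow> i \<in> S" for i S
    unfolding asg_def fst_conv snd_conv .
  moreover have "e (Inl (i, v)) \<in> elts C (snd v)" if "v \<in> fv \<phi> \<inter> X" for i v
    using bspec[OF e(1), of "Inl (i, v)"] that by simp
  moreover have "e (Inr (S, v)) \<in> elts C (snd v)" if "v \<in> fv \<phi> - X" for S v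
    using bspec[OF e(1), of "Inr (S, v)"] that by simp
  ultimately show ?thesis
    unfolding has_IP_def
    by (intro exI[of _ "\<lambda>i v. e (Inl (i, v))"] exI[of _ "\<lambda>S v. e (Inr (S, v))"]) simp
qed

section \<open>Chains and conjugates under NIP\<close>

context definable_group_struct
begin

text \<open>One-point extension is iterated along the naturals, so that a single sequence works for
  all members of \<open>\<D>\<close> at once.\<close>

lemma infinite_chain:
  assumes ne: "\<D> \<noteq> {}" and dir: "\<And>D E. D \<in> \<D> \<Longrightarrow> E \<in> \<D> \<Longrightarrow> D \<inter> E \<in> \<D>"
    and gd: "\<And>D. D \<in> \<D> \<Longrightarrow> gdef A D" and chains: "\<And>D n. D \<in> \<D> \<Longrightarrow> \<exists>x. chain D n x"
  obtains x :: "nat \<Rightarrow> 'a list" where "\<And>i. x i \<in> carrier G"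
    and "\<And>i j D. i < j \<Longrightarrow> D \<in> \<D> \<Longrightarrow> inv (x i) \<otimes> x j \<in> D"
proof -
  define ok where "ok Z z \<longleftrightarrow> z \<in> carrier G \<and> extendable \<D> (insert z Z) \<and> (\<forall>f\<in>Z. \<forall>D\<in>\<D>. inv f \<otimes> z \<in> D)" for Z z
  define pick where "pick Z = (SOME z. ok Z z)" for Z
  have pick: "ok Z (pick Z)" if "finite Z" "extendable \<D> Z" for Z
  proof -
    have "\<exists>z\<in>carrier G. extendable \<D> (insert z Z) \<and> (\<forall>f\<in>Z. \<forall>D\<in>\<D>. inv f \<otimes> z \<in> D)"
      using ne dir gd finite_less[OF that(1)] that(2) by (rule extend)
    then have "\<exists>z. ok Z z" by (auto simp: ok_def)
    then show ?thesis unfolding pick_def by (rule someI_ex)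
  qed
  define Zs where "Zs = rec_nat {} (\<lambda>_ Z. insert (pick Z) Z)"
  have Zs: "Zs 0 = {}" "\<And>n. Zs (Suc n) = insert (pick (Zs n)) (Zs n)" by (simp_all add: Zs_def)
  have "finite (Zs n) \<and> extendable \<D> (Zs n)" for n
  proof (induction n)
    case 0
    then show ?case using chains by (auto simp: Zs extendable_def)
  next
    case (Suc n)
    then show ?case using pick[of "Zs n"] by (simp add: Zs ok_def)
  qed
  then have ok: "ok (Zs n) (pick (Zs n))" for n using pick by blast
  have mem: "pick (Zs i) \<in> Zs j" if "i < j" for i j
    using that by (induction j) (auto simp: Zs less_Suc_eq)
  show ?thesis
  proof (rule that[of "\<lambda>n. pick (Zs n)"])
    show "pick (Zs i) \<in> carrier G" for i using ok[of i] by (simp add: ok_def)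
    show "inv (pick (Zs i)) \<otimes> pick (Zs j) \<in> D" if "i < j" "D \<in> \<D>" for i j D
      using ok[of j] mem[OF that(1)] that(2) by (simp add: ok_def)
  qed
qed

lemma aut_image_iff:
  assumes \<sigma>: "\<sigma> \<in> auts L C A" and "D \<subseteq> carrier G" and "g \<in> carrier G"
  shows "map \<sigma> g \<in> map \<sigma> ` D \<longleftrightarrow> g \<in> D"
proof
  assume "map \<sigma> g \<in> map \<sigma> ` D"
  then obtain d where d: "d \<in> D" "map \<sigma> g = map \<sigma> d" by blast
  have "set g \<union> set d \<subseteq> univ C" using assms(2,3) d(1) carrier_nth(3) by blast
  then have "g = d"
    using inj_on_map_eq_map[of \<sigma> g d] inj_on_subset[OF aut_inj[OF \<sigma>]] d(2) by blast
  then show "g \<in> D" using d(1) by simp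
qed simp

lemma aut_surj:
  assumes \<sigma>: "\<sigma> \<in> auts L C A" and "g \<in> carrier G"
  obtains h where "h \<in> carrier G" and "g = map \<sigma> h"
proof -
  obtain \<tau> where \<tau>: "\<tau> \<in> auts L C A" "\<And>x. x \<in> univ C \<Longrightarrow> \<sigma> (\<tau> x) = x"
    using aut_inverse[OF is_struct \<sigma> A_univ] by metis
  have "map \<sigma> (map \<tau> g) = g" using \<tau>(2) carrier_nth(3)[OF assms(2)] by (auto intro!: map_idI)
  then show ?thesis using that[OF aut_carrier[OF \<tau>(1) assms(2)]] by simp
qed

text \<open>A conjugate of a thick set is thick with the same bound \<open>N\<close>: the sequence
  is pulled back by the automorphism.\<close>

lemma thick_aut:
  assumes "\<And>x. \<not> chain (carrier G - D) N x" and "D \<subseteq> carrier G" and \<sigma>: "\<sigma> \<in> auts L C A"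
    and x: "\<And>i. x i \<in> carrier G"
  obtains i j where "i < j" and "j < N" and "inv (x i) \<otimes> x j \<in> map \<sigma> ` D"
proof -
  have "\<exists>y. y \<in> carrier G \<and> x i = map \<sigma> y" for i using aut_surj[OF \<sigma> x] by metis
  then obtain y where y: "\<And>i. y i \<in> carrier G" "\<And>i. x i = map \<sigma> (y i)" by metis
  have "\<not> chain (carrier G - D) N y" using assms(1) .
  then obtain i j where ij: "i < j" "j < N" "inv (y i) \<otimes> y j \<in> D"
    using y(1) by (auto simp: chain_def)
  have "inv (x i) \<otimes> x j = map \<sigma> (inv (y i) \<otimes> y j)" using aut_quotient[OF \<sigma> y(1) y(1)] y(2) by simp
  then show ?thesis using that[OF ij(1,2)] ij(3) by blast
qed

text \<open>Ramsey's theorem for quadruples makes the quotients \<open>x\<^sub>2\<^sub>m\<inverse> x\<^sub>2\<^sub>m\<^sub>+\<^sub>1\<close> lie in all conjugates of the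
  thick set except possibly their own.\<close>

lemma independent_conjugates:
  assumes x: "\<And>i. x i \<in> carrier G" and \<sigma>: "\<And>i j :: nat. i < j \<Longrightarrow> \<sigma> i j \<in> auts L C A"
    and V: "thick V" "V \<subseteq> carrier G"
  obtains e :: "nat \<Rightarrow> nat" where "strict_mono e"
    and "\<And>m k. m \<noteq> k \<Longrightarrow> inv (x (e (2 * m))) \<otimes> x (e (2 * m + 1)) \<in> map (\<sigma> (e (2 * k)) (e (2 * k + 1))) ` V"
proof -
  obtain N where N: "\<And>y. \<not> chain (carrier G - V) N y" using V(1) by (auto simp: thick_def)
  define P where "P i j k l \<longleftrightarrow> inv (x k) \<otimes> x l \<in> map (\<sigma> i j) ` V" for i j k l
  \<comment> \<open>The colour of an increasing quadruple has two bits: 2 if the quotient of the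
    later pair lies in the conjugate attached to the earlier pair, and 1 if the same holds with the
    pairs exchanged.\<close>
  define f where "f S = (let l = sorted_list_of_set S in
      (if P (l ! 0) (l ! 1) (l ! 2) (l ! 3) then 2 else 0) +
      (if P (l ! 2) (l ! 3) (l ! 0) (l ! 1) then 1 else 0 :: nat))" for S :: "nat set"
  have f4: "f {a, b, c, d} = (if P a b c d then 2 else 0) + (if P c d a b then 1 else 0)"
    if "a < b" "b < c" "c < d" for a b c d
  proof -
    have "sorted_list_of_set (set [a, b, c, d]) = [a, b, c, d]"
      using that by (intro sorted_list_of_set.idem_if_sorted_distinct) auto
    then have "sorted_list_of_set {a, b, c, d} = [a, b, c, d]" by simp
    then show ?thesis by (simp add: f_def Let_def numeral_2_eq_2 numeral_3_eq_3)
  qed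
  have "\<exists>Y t. Y \<subseteq> (UNIV :: nat set) \<and> infinite Y \<and> t < 4 \<and>
      (\<forall>X. X \<subseteq> Y \<and> finite X \<and> card X = 4 \<longrightarrow> f X = t)"
  proof (rule Ramsey)
    have "f X < 4" for X by (simp add: f_def Let_def)
    then show "\<forall>X. X \<subseteq> UNIV \<and> finite X \<and> card X = 4 \<longrightarrow> f X < 4" by simp
  qed simp
  then obtain Y t where Y0: "infinite Y" "\<forall>X. X \<subseteq> Y \<and> finite X \<and> card X = 4 \<longrightarrow> f X = t"
    by (elim exE conjE) (rule that)
  then have Y: "infinite Y" "\<And>X. X \<subseteq> Y \<Longrightarrow> finite X \<Longrightarrow> card X = 4 \<Longrightarrow> f X = t" by simp_all
  define e where "e = enumerate Y"
  have e: "strict_mono e" "\<And>i. e i \<in> Y"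
    using Y(1) by (simp_all add: e_def strict_mono_enumerate enumerate_in_set)
  have less: "e i < e j" if "i < j" for i j using e(1) that by (simp add: strict_mono_less)
  have ft: "f {e a, e b, e c, e d} = t" if "a < b" "b < c" "c < d" for a b c d
  proof (rule Y(2))
    have "e a < e b" "e b < e c" "e c < e d" using less that by blast+
    then show "card {e a, e b, e c, e d} = 4" by (simp add: card_insert_if)
  qed (use e(2) in auto)
  have eq: "(if P (e a) (e b) (e c) (e d) then 2 else 0) + (if P (e c) (e d) (e a) (e b) then 1 else 0) = t"
    if "a < b" "b < c" "c < d" for a b c d
    using ft[OF that] f4[OF less less less, OF that] by simp
  \<comment> \<open>Infinitely many terms follow \<open>e 0\<close> and \<open>e 1\<close>, so the
    thick conjugate attached to this pair catches some later quotient. By homogeneity the bit 2 is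
    then set for every quadruple.\<close>
  have t1: "t \<ge> 2"
  proof -
    obtain i j where ij: "i < j" "inv (x (e (i + 2))) \<otimes> x (e (j + 2)) \<in> map (\<sigma> (e 0) (e 1)) ` V"
      by (rule thick_aut[OF N V(2) \<sigma>[OF less[of 0 1]], of "\<lambda>i. x (e (i + 2))"]) (use x in auto)
    then have "P (e 0) (e 1) (e (i + 2)) (e (j + 2))" by (simp add: P_def)
    then show ?thesis using eq[of 0 1 "i + 2" "j + 2"] ij(1) by (auto split: if_splits)
  qed
  \<comment> \<open>The bound \<open>N\<close> does not depend on the automorphism, so the
    \<open>N\<close> terms before the pair \<open>e N\<close>, \<open>e (Suc N)\<close> already
    contain a quotient in the conjugate attached to it.\<close>
  have t2: "odd t"
  proof -
    obtain i j where ij: "i < j" "j < N" "inv (x (e i)) \<otimes> x (e j) \<in> map (\<sigma> (e N) (e (Suc N))) ` V"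
      by (rule thick_aut[OF N V(2) \<sigma>[OF less[of N "Suc N"]], of "\<lambda>i. x (e i)"]) (use x in auto)
    then have "P (e N) (e (Suc N)) (e i) (e j)" by (simp add: P_def)
    then show ?thesis using eq[of i j N "Suc N"] ij(1,2) by (auto split: if_splits)
  qed
  have P1: "P (e a) (e b) (e c) (e d)" "P (e c) (e d) (e a) (e b)" if "a < b" "b < c" "c < d" for a b c d
    using eq[OF that] t1 t2 by (auto split: if_splits)
  show ?thesis
  proof (rule that[OF e(1)])
    fix m k :: nat assume "m \<noteq> k"
    then consider "m < k" | "k < m" by linarith
    then have "P (e (2 * k)) (e (2 * k + 1)) (e (2 * m)) (e (2 * m + 1))"
    proof cases
      case 1
      then show ?thesis by (intro P1(2)) auto
    next
      case 2
      then show ?thesis by (intro P1(1)) auto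
    qed
    then show "inv (x (e (2 * m))) \<otimes> x (e (2 * m + 1)) \<in> map (\<sigma> (e (2 * k)) (e (2 * k + 1))) ` V"
      by (simp add: P_def)
  qed
qed

abbreviation lprod :: "'a list list \<Rightarrow> 'a list" where
  "lprod l \<equiv> foldr (\<otimes>) l \<one>"

lemma lprod_carrier: "set l \<subseteq> carrier G \<Longrightarrow> lprod l \<in> carrier G"
  by (induction l) auto

lemma lprod_append: "set l \<subseteq> carrier G \<Longrightarrow> set l' \<subseteq> carrier G \<Longrightarrow> lprod (l @ l') = lprod l \<otimes> lprod l'"
  by (induction l) (auto simp: m_assoc lprod_carrier)

lemma lprod_aut:
  assumes \<sigma>: "\<sigma> \<in> auts L C A" and "set l \<subseteq> carrier G"
  shows "lprod (map (map \<sigma>) l) = map \<sigma> (lprod l)"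
  using assms(2)
proof (induction l)
  case Nil
  then show ?case using group_hom.hom_one[OF aut_hom[OF \<sigma>]] by simp
next
  case (Cons g l)
  then show ?case using aut_mult[OF \<sigma>, of g "lprod l"] lprod_carrier by simp
qed

text \<open>With the product associated to the right, each multiplication costs one level: the first
  factor and the product of the others both lie in level \<open>Suc k\<close>.\<close>

lemma lprod_roots:
  assumes one: "\<And>k. \<one> \<in> V k" and dec: "\<And>k. V (Suc k) \<subseteq> V k"
    and roots: "\<And>k u v. u \<in> V (Suc k) \<Longrightarrow> v \<in> V (Suc k) \<Longrightarrow> u \<otimes> v \<in> V k"
    and l: "length l \<le> n" "set l \<subseteq> V (k + n)"
  shows "lprod l \<in> V k"
  using l
proof (induction l arbitrary: k n)
  case Nil
  then show ?case using one by simp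
next
  case (Cons g l)
  then obtain m where m: "n = Suc m" by (cases n) auto
  have base: "V (Suc k + m) \<subseteq> V (Suc k)"
  proof (induction m)
    case (Suc m)
    then show ?case using dec[of "Suc k + m"] by simp
  qed simp
  have l: "g \<in> V (Suc k + m)" "set l \<subseteq> V (Suc k + m)" using Cons.prems(2) m by simp_all
  have g: "g \<in> V (Suc k)" by (rule subsetD[OF base l(1)])
  have "length l \<le> m" using Cons.prems(1) m by simp
  then have "lprod l \<in> V (Suc k)" using l(2) by (rule Cons.IH)
  then show ?case using roots[OF g] by simp
qed

text \<open>The kernel is taken over \<open>A\<close> but \<open>K\<close> is defined over
  \<open>E\<close>, so automorphisms over \<open>A\<close> may move \<open>K\<close> and the
  argument for invariant subgroups breaks down. NIP replaces it by limiting how independent the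
  conjugates of a neighbourhood of \<open>K\<close> can be.\<close>

theorem NIP_kernel:
  assumes NIP: "\<And>\<phi> X. \<phi> \<in> formulas L \<Longrightarrow> \<not> has_IP L C \<phi> X"
    and AE: "A \<subseteq> E" and EC: "E \<subseteq> univ C" and Ek: "|E| <o \<kappa>"
    and K: "subgroup K G" and td: "type_definable L C E ss K" and index: "|rcosets K| <o \<kappa>"
  shows "kernel \<subseteq> K"
proof (rule subsetI, rule ccontr)
  fix g assume g: "g \<in> kernel" and gK: "g \<notin> K"
  interpret E: definable_group_struct L \<kappa> C E ss G
    by unfold_locales (use EC Ek definable_group_mono[OF dgroup AE] in auto)
  have gG: "g \<in> carrier G" using g kernel_carrier by blast
  have KG: "K \<subseteq> carrier G" using subgroup.subset[OF K] .
  \<comment> \<open>The \<open>E\<close>-definable neighbourhoods of \<open>K\<close>; by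
    type-definability they separate \<open>K\<close> from every other point of
    \<open>G\<close>.\<close>
  define \<V> where "\<V> = {D. gdef E D \<and> K \<subseteq> D}"
  have V_Int: "D \<inter> D' \<in> \<V>" if "D \<in> \<V>" "D' \<in> \<V>" for D D' using that gdef_Int by (auto simp: \<V>_def)
  have V_carrier: "carrier G \<in> \<V>" using gdef_carrier[OF AE] KG by (simp add: \<V>_def)
  have V_one: "\<one> \<in> D" if "D \<in> \<V>" for D using that subgroup.one_closed[OF K] by (auto simp: \<V>_def)
  have V_G: "D \<subseteq> carrier G" if "D \<in> \<V>" for D using that gdef_carrier_subset by (auto simp: \<V>_def)
  have sep: "\<exists>D\<in>\<V>. h \<notin> D" if h: "h \<in> carrier G" "h \<notin> K" for h
  proof -
    obtain \<Sigma> where \<Sigma>: "\<Sigma> \<subseteq> pformulas L C {..<len} ((!) ss) E"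
      "K = {xs \<in> tuples C ss. \<forall>p\<in>\<Sigma>. psat C ((!) xs) p}"
      using td by (auto simp: type_definable_def)
    then obtain p where p: "p \<in> \<Sigma>" "\<not> psat C ((!) h) p" using h carrier_tuples by blast
    have "definable L C E ss {xs \<in> tuples C ss. psat C ((!) xs) p}"
      using p(1) \<Sigma>(1) unfolding definable_def by blast
    from gdefI[OF gpred_definable[OF this, of "()" UNIV]]
    have "gdef E {x \<in> carrier G. x \<in> tuples C ss \<and> psat C ((!) x) p}" by simp
    moreover have "K \<subseteq> {x \<in> carrier G. x \<in> tuples C ss \<and> psat C ((!) x) p}" using KG \<Sigma>(2) p(1) by blast
    ultimately show ?thesis using p(2) by (intro bexI[of _ "{x \<in> carrier G. x \<in> tuples C ss \<and> psat C ((!) x) p}"])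
        (auto simp: \<V>_def)
  qed
  \<comment> \<open>If no product W W were contained in \<open>D\<close>, compactness would yield
    two points of \<open>K\<close> whose product is outside \<open>D\<close>. Intersecting with the
    inverses makes \<open>W\<close> symmetric.\<close>
  have root: "\<exists>W\<in>\<V>. (\<forall>u\<in>W. \<forall>v\<in>W. u \<otimes> v \<in> D) \<and> (\<forall>u\<in>W. inv u \<in> W)" if D: "D \<in> \<V>" for D
  proof -
    have "\<exists>W\<in>\<V>. W <#> W \<subseteq> D"
    proof (rule ccontr)
      assume no: "\<not> ?thesis"
      have "\<exists>h\<in>carrier G. \<forall>S\<in>(\<lambda>W. (W <#> W) \<inter> (carrier G - D)) ` \<V>. h \<in> S"
      proof (rule E.saturated_gdef[OF order_refl EC Ek])
        fix S assume "S \<in> (\<lambda>W. (W <#> W) \<inter> (carrier G - D)) ` \<V>"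
        then obtain W where "W \<in> \<V>" "S = (W <#> W) \<inter> (carrier G - D)" by blast
        then show "gdef E S" using D AE by (auto simp: \<V>_def intro: gdef_Int gdef_Diff gdef_set_mult)
      next
        fix \<F> assume "\<F> \<subseteq> (\<lambda>W. (W <#> W) \<inter> (carrier G - D)) ` \<V>" "finite \<F>"
        then obtain F where F: "F \<subseteq> \<V>" "finite F" "\<F> = (\<lambda>W. (W <#> W) \<inter> (carrier G - D)) ` F"
          by (meson finite_subset_image)
        obtain W where W: "W \<in> \<V>" "\<forall>W'\<in>F. W \<subseteq> W'"
        proof -
          have "\<V> \<noteq> {}" using V_carrier by blast
          then have "\<exists>D\<in>\<V>. \<forall>E\<in>F. D \<subseteq> E" using V_Int F(2,1) by (rule finite_lower_bound)
          then show ?thesis by (elim bexE) (rule that)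
        qed
        have "\<not> W <#> W \<subseteq> D" using no W(1) by simp
        then obtain h where h: "h \<in> W <#> W" "h \<notin> D" unfolding subset_iff by auto
        have hG: "h \<in> carrier G" by (rule subsetD[OF set_mult_closed[OF V_G[OF W(1)] V_G[OF W(1)]] h(1)])
        have "h \<in> W' <#> W'" if "W' \<in> F" for W'
          using h(1) mono_set_mult[of W W' W W' G] W(2) that by auto
        then show "\<exists>h\<in>carrier G. \<forall>S\<in>\<F>. h \<in> S" unfolding F(3) using h(2) hG by (intro bexI[of _ h]) simp_all
      qed
      then obtain h where h0: "h \<in> carrier G" "\<forall>W\<in>\<V>. h \<in> W <#> W \<and> h \<notin> D" by auto
      then have h: "h \<in> carrier G" "\<And>W. W \<in> \<V> \<Longrightarrow> h \<in> W <#> W \<and> h \<notin> D" by simp_all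
      have "\<exists>u v. h = u \<otimes> v \<and> u \<in> carrier G \<and> v \<in> carrier G \<and> (\<forall>D\<in>\<V>. u \<in> D \<and> v \<in> D)"
        by (rule E.set_mult_compactness[where U = "\<lambda>D. D" and V = "\<lambda>D. D"])
          (use V_carrier V_Int h in \<open>auto simp: \<V>_def\<close>)
      then obtain u v where uv: "h = u \<otimes> v" "u \<in> carrier G" "v \<in> carrier G" "\<forall>D\<in>\<V>. u \<in> D \<and> v \<in> D" by blast
      have "u \<in> K" "v \<in> K" using sep[OF uv(2)] sep[OF uv(3)] uv(4) by blast+
      then have "h \<in> D" using D subgroup.m_closed[OF K] uv(1) by (auto simp: \<V>_def)
      then show False using h(2)[OF V_carrier] by blast
    qed
    then obtain W where W: "W \<in> \<V>" "W <#> W \<subseteq> D" by blast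
    have "inverses W \<in> \<V>"
      using W(1) AE gdef_inverses KG subgroup.m_inv_closed[OF K] by (auto simp: \<V>_def inverses_def)
    then have "W \<inter> inverses W \<in> \<V>" using V_Int W(1) by blast
    moreover have "u \<otimes> v \<in> D" if "u \<in> W" "v \<in> W" for u v using set_multI[OF that] W(2) by blast
    moreover have "inv u \<in> W \<inter> inverses W" if "u \<in> W \<inter> inverses W" for u
      using that by (auto simp: inverses_def)
    ultimately show ?thesis by (intro bexI[of _ "W \<inter> inverses W"]) auto
  qed
  obtain D0 where D0: "D0 \<in> \<V>" "g \<notin> D0" using sep[OF gG gK] by blast
  define rt where "rt D = (SOME W. W \<in> \<V> \<and> (\<forall>u\<in>W. \<forall>v\<in>W. u \<otimes> v \<in> D) \<and> (\<forall>u\<in>W. inv u \<in> W))" for D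
  have rt: "rt D \<in> \<V> \<and> (\<forall>u\<in>rt D. \<forall>v\<in>rt D. u \<otimes> v \<in> D) \<and> (\<forall>u\<in>rt D. inv u \<in> rt D)" if "D \<in> \<V>" for D
    unfolding rt_def by (rule someI_ex) (use root[OF that] in blast)
  \<comment> \<open>Two roots are taken in advance, so that a product u^-1 w v^-1 with factors from
    \<open>V 0\<close> falls into \<open>D0\<close>.\<close>
  define V where "V k = (rt ^^ (k + 2)) D0" for k
  have V: "V k \<in> \<V>" for k
  proof -
    have "(rt ^^ k) D0 \<in> \<V>" for k using D0(1) rt by (induction k) auto
    then show ?thesis by (simp only: V_def)
  qed
  have VSuc: "V (Suc k) = rt (V k)" for k by (simp add: V_def)
  have roots: "u \<otimes> v \<in> V k" if "u \<in> V (Suc k)" "v \<in> V (Suc k)" for u v k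
    using rt[OF V[of k]] that by (simp add: VSuc)
  have dec: "V (Suc k) \<subseteq> V k" for k
  proof
    fix u assume u: "u \<in> V (Suc k)"
    then have "u \<in> carrier G" using V V_G by blast
    then show "u \<in> V k" using roots[OF u V_one[OF V]] by simp
  qed
  have cube: "inv u \<otimes> h \<otimes> inv v \<in> D0" if "u \<in> V 0" "v \<in> V 0" "h \<in> V 0" for u v h
  proof -
    have V0: "V 0 = rt (rt D0)" by (simp add: V_def numeral_2_eq_2)
    have r: "rt D0 \<in> \<V>" using rt[OF D0(1)] by simp
    have "inv u \<otimes> h \<in> rt D0" using rt[OF r] that by (simp add: V0)
    moreover have iv: "inv v \<in> V 0" using rt[OF r] that by (simp add: V0)
    then have "inv v \<otimes> \<one> \<in> rt D0" using rt[OF r] V_one[OF V, of 0] by (simp add: V0)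
    then have "inv v \<in> rt D0" using subsetD[OF V_G[OF V] iv] by simp
    ultimately show ?thesis using rt[OF D0(1)] by simp
  qed
  \<comment> \<open>As \<open>g\<close> is in the kernel, each of these sets carries chains of every
    length; an infinite chain for all of them has quotients with the type of \<open>g\<close> over
    \<open>A\<close>.\<close>
  let ?D = "{D. gdef A D \<and> g \<in> D}"
  obtain x :: "nat \<Rightarrow> 'a list" where x: "\<And>i. x i \<in> carrier G" "\<And>i j D. i < j \<Longrightarrow> D \<in> ?D \<Longrightarrow> inv (x i) \<otimes> x j \<in> D"
  proof (rule infinite_chain[of ?D])
    show "?D \<noteq> {}" using gdef_carrier[OF order_refl] gG by blast
    show "D \<inter> D' \<in> ?D" if "D \<in> ?D" "D' \<in> ?D" for D D' using that gdef_Int by auto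
    show "gdef A D" if "D \<in> ?D" for D using that by simp
    show "\<exists>x. chain D n x" if D: "D \<in> ?D" for D n
    proof -
      have "\<not> thick (carrier G - D)" using g D gdef_Diff[of A D] by (auto simp: kernel_def)
      moreover have "carrier G - (carrier G - D) = D" using D gdef_carrier_subset by auto
      ultimately show ?thesis by (auto simp: thick_def)
    qed
  qed (rule that; assumption)
  have "\<exists>\<tau>. i < j \<longrightarrow> \<tau> \<in> auts L C A \<and> map \<tau> g = inv (x i) \<otimes> x j" for i j
  proof (cases "i < j")
    case True
    then have "\<exists>\<tau>\<in>auts L C A. map \<tau> g = inv (x i) \<otimes> x j"
      using x gG by (intro homogeneous_element) auto
    then show ?thesis by blast
  qed simp
  then obtain \<sigma> where \<sigma>: "\<And>i j. i < j \<Longrightarrow> \<sigma> i j \<in> auts L C A"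
    "\<And>i j. i < j \<Longrightarrow> map (\<sigma> i j) g = inv (x i) \<otimes> x j" by metis
  have "definable L C E ss (V 0)" using V[of 0] by (intro E.gdef_imp_definable) (auto simp: \<V>_def)
  then obtain p where p0: "p \<in> pformulas L C {..<len} ((!) ss) E" "V 0 = {xs \<in> tuples C ss. psat C ((!) xs) p}"
    by (auto simp: definable_def)
  obtain \<phi> \<rho> where p_eq: "p = (\<phi>, \<rho>)" by (cases p)
  note p = p0[unfolded p_eq]
  \<comment> \<open>The variables of the formula that stand for parameters are the object variables
    of the independence pattern: conjugated parameters are indexed by numbers, products of quotients
    by subsets.\<close>
  define X where "X = {v. \<exists>b. \<rho> v = Inr b}"
  have adm: "admissible C {..<len} ((!) ss) E (snd v) (\<rho> v)" if "v \<in> fv \<phi>" for v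
    using p(1) that by (simp add: pformulas_iff)
  have conj: "sat C (\<lambda>v. if v \<in> X then \<tau> (projr (\<rho> v)) else h ! projl (\<rho> v)) \<phi> \<longleftrightarrow> h \<in> map \<tau> ` V 0"
    if \<tau>: "\<tau> \<in> auts L C A" and h: "h \<in> carrier G" for \<tau> h
  proof -
    obtain k where k: "k \<in> carrier G" "h = map \<tau> k" by (rule aut_surj[OF \<tau> h])
    have "sat C (\<lambda>v. if v \<in> X then \<tau> (projr (\<rho> v)) else h ! projl (\<rho> v)) \<phi> \<longleftrightarrow>
        sat C (\<lambda>v. case_sum (\<lambda>i. \<tau> (k ! i)) \<tau> (\<rho> v)) \<phi>"
    proof (rule sat_cong)
      fix v assume "v \<in> fv \<phi>"
      from adm[OF this] show "(if v \<in> X then \<tau> (projr (\<rho> v)) else h ! projl (\<rho> v)) = case_sum (\<lambda>i. \<tau> (k ! i)) \<tau> (\<rho> v)"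
        using carrier_nth(1)[OF k(1)] k(2) by (cases "\<rho> v") (auto simp: X_def)
    qed
    also have "\<dots> \<longleftrightarrow> psat C ((!) k) (\<phi>, \<rho>)"
      by (rule aut_psat_move[OF is_struct \<tau> p(1) EC]) (use carrier_nth(2)[OF k(1)] in simp)
    also have "\<dots> \<longleftrightarrow> k \<in> V 0" using p(2) k(1) carrier_tuples by auto
    also have "\<dots> \<longleftrightarrow> h \<in> map \<tau> ` V 0" using aut_image_iff[OF \<tau> V_G[OF V] k(1)] k(2) by simp
    finally show ?thesis .
  qed
  have "\<exists>a b. (\<forall>i :: nat. \<forall>v\<in>fv \<phi> \<inter> X. a i v \<in> elts C (snd v)) \<and>
       (\<forall>S :: nat set. \<forall>v\<in>fv \<phi> - X. b S v \<in> elts C (snd v)) \<and>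
       (\<forall>i<n. \<forall>S. sat C (\<lambda>v. if v \<in> X then a i v else b S v) \<phi> \<longleftrightarrow> i \<in> S)" for n :: nat
  proof -
    \<comment> \<open>The level \<open>n\<close> leaves room for products of up to \<open>n\<close>
      factors to stay in \<open>V 0\<close>; the set is thick because it contains
      \<open>K\<close>.\<close>
    have th: "thick (V n)" using V[of n] by (intro E.thick_superset[OF K index]) (auto simp: \<V>_def)
    obtain e :: "nat \<Rightarrow> nat" where e: "strict_mono e" "\<And>m k. m \<noteq> k \<Longrightarrow>
        inv (x (e (2 * m))) \<otimes> x (e (2 * m + 1)) \<in> map (\<sigma> (e (2 * k)) (e (2 * k + 1))) ` V n"
      by (rule independent_conjugates[OF x(1) \<sigma>(1) th V_G[OF V]]) (assumption | rule that)+
    define \<tau> where "\<tau> m = \<sigma> (e (2 * m)) (e (2 * m + 1))" for m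
    define y where "y m = inv (x (e (2 * m))) \<otimes> x (e (2 * m + 1))" for m
    have less: "e (2 * m) < e (2 * m + 1)" for m using e(1) by (simp add: strict_mono_less)
    have \<tau>: "\<tau> m \<in> auts L C A" "map (\<tau> m) g = y m" for m
      using \<sigma>[OF less] by (simp_all add: \<tau>_def y_def)
    have yG: "y m \<in> carrier G" for m using x(1) by (simp add: y_def)
    have yV: "y m \<in> map (\<tau> k) ` V n" if "m \<noteq> k" for m k using e(2)[OF that] by (simp add: \<tau>_def y_def)
    \<comment> \<open>\<open>y m\<close> is the image of \<open>g\<close> under
      \<open>\<tau> m\<close>, and \<open>g\<close> was kept out of \<open>D0\<close>.\<close>
    have yD: "y m \<notin> map (\<tau> m) ` D0" for m
      using aut_image_iff[OF \<tau>(1) V_G[OF D0(1)] gG] \<tau>(2) D0(2) by metis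
    have prod: "lprod (map y l) \<in> map (\<tau> k) ` V 0" if l: "length l \<le> n" "k \<notin> set l" for l k
    proof -
      have "\<forall>m\<in>set l. \<exists>v\<in>V n. y m = map (\<tau> k) v"
      proof
        fix m assume "m \<in> set l"
        then have "m \<noteq> k" using l(2) by blast
        from yV[OF this] show "\<exists>v\<in>V n. y m = map (\<tau> k) v" by blast
      qed
      then obtain v where v: "\<And>m. m \<in> set l \<Longrightarrow> v m \<in> V n \<and> y m = map (\<tau> k) (v m)" by metis
      have "map y l = map (map (\<tau> k)) (map v l)" using v by simp
      moreover have vV: "set (map v l) \<subseteq> V n" using v by auto
      then have "lprod (map (map (\<tau> k)) (map v l)) = map (\<tau> k) (lprod (map v l))"
        using V_G[OF V, of n] by (intro lprod_aut[OF \<tau>(1)]) blast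
      moreover have "lprod (map v l) \<in> V 0"
        by (rule lprod_roots[of V _ n, OF V_one[OF V] dec roots]) (use l(1) vV in auto)
      ultimately show ?thesis by (metis imageI)
    qed
    \<comment> \<open>The product runs over the complement of \<open>S\<close>: the factor
      \<open>y k\<close> destroys membership in the conjugate with number \<open>k\<close>, while
      the other factors preserve it. Sorting fixes the order.\<close>
    define L' where "L' S = sorted_list_of_set ({..<n} - S)" for S
    have L': "length (L' S) \<le> n" "set (L' S) = {..<n} - S" "distinct (L' S)" for S
    proof -
      have "length (L' S) = card ({..<n} - S)" by (simp add: L'_def)
      also have "\<dots> \<le> card {..<n}" by (intro card_mono) auto
      finally show "length (L' S) \<le> n" by simp
      show "set (L' S) = {..<n} - S" "distinct (L' S)" by (simp_all add: L'_def)
    qed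
    define h where "h S = lprod (map y (L' S))" for S
    have hG: "h S \<in> carrier G" for S unfolding h_def using yG by (intro lprod_carrier) auto
    have hin: "h S \<in> map (\<tau> k) ` V 0 \<longleftrightarrow> k \<in> S" if k: "k < n" for k S
    proof
      assume "k \<in> S"
      then show "h S \<in> map (\<tau> k) ` V 0" unfolding h_def using L'[of S] by (intro prod) auto
    next
      assume hV: "h S \<in> map (\<tau> k) ` V 0"
      show "k \<in> S"
      proof (rule ccontr)
        assume "k \<notin> S"
        then have "k \<in> set (L' S)" using k L'(2) by simp
        \<comment> \<open>The products before and after \<open>y k\<close> lie in the conjugate of
          \<open>V 0\<close>; cancelling them from \<open>h S\<close> would put \<open>y k\<close>
          into the conjugate of \<open>D0\<close>.\<close>
        then obtain l1 l2 where l: "L' S = l1 @ k # l2" by (meson split_list)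
        have d: "k \<notin> set l1" "k \<notin> set l2" "length l1 \<le> n" "length l2 \<le> n"
          using L'(1,3)[of S] by (auto simp: l)
        obtain u v w where uvw: "u \<in> V 0" "lprod (map y l1) = map (\<tau> k) u" "v \<in> V 0" "lprod (map y l2) = map (\<tau> k) v"
          "w \<in> V 0" "h S = map (\<tau> k) w" using prod[OF d(3,1)] prod[OF d(4,2)] hV by blast
        have G: "u \<in> carrier G" "v \<in> carrier G" "w \<in> carrier G" using uvw V_G[OF V] by blast+
        note hom = group_hom.hom_inv[OF aut_hom[OF \<tau>(1)[of k]]]
        have "h S = map (\<tau> k) u \<otimes> (y k \<otimes> map (\<tau> k) v)"
          using lprod_append[of "map y l1" "map y (k # l2)"] yG by (auto simp: h_def l uvw)
        then have "map (\<tau> k) w = map (\<tau> k) u \<otimes> (y k \<otimes> map (\<tau> k) v)" using uvw by simp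
        then have "y k = inv (map (\<tau> k) u) \<otimes> map (\<tau> k) w \<otimes> inv (map (\<tau> k) v)"
          using G yG[of k] aut_carrier[OF \<tau>(1)] by (simp add: m_assoc inv_solve_left inv_solve_right)
        also have "\<dots> = map (\<tau> k) (inv u \<otimes> w \<otimes> inv v)" using G hom aut_mult[OF \<tau>(1)] by simp
        finally have "y k \<in> map (\<tau> k) ` D0" using cube[OF uvw(1,3,5)] by blast
        then show False using yD by blast
      qed
    qed
    show ?thesis
    proof (intro exI conjI allI ballI impI)
      show "\<tau> i (projr (\<rho> v)) \<in> elts C (snd v)" if v: "v \<in> fv \<phi> \<inter> X" for i v
      proof -
        have "projr (\<rho> v) \<in> elts C (snd v)" using adm[of v] v EC by (auto simp: X_def elts_def)
        then show ?thesis by (rule aut_in_elts[OF \<tau>(1)])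
      qed
      show "h S ! projl (\<rho> v) \<in> elts C (snd v)" if v: "v \<in> fv \<phi> - X" for S v
      proof -
        obtain i where i: "\<rho> v = Inl i" using v by (cases "\<rho> v") (auto simp: X_def)
        then have "i < len" "ss ! i = snd v" using adm[of v] v by simp_all
        then show ?thesis using carrier_nth(2)[OF hG, of i S] i by simp
      qed
      show "sat C (\<lambda>v. if v \<in> X then \<tau> i (projr (\<rho> v)) else h S ! projl (\<rho> v)) \<phi> \<longleftrightarrow> i \<in> S"
        if "i < n" for i S
        using conj[OF \<tau>(1) hG] hin[OF that] by simp
    qed
  qed
  moreover have "\<phi> \<in> formulas L" using p(1) by (simp add: pformulas_def)
  ultimately have "has_IP L C \<phi> X" by (intro has_IP_compactness)
  then show False using NIP \<open>\<phi> \<in> formulas L\<close> by blast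
qed

end

section \<open>The theorem\<close>

text \<open>\<open>small\<close> bounds an exponential, so the union is compared with the larger of
  the two sets, up to the size of the language.\<close>

lemma small_Un:
  assumes "small L \<kappa> A" and "small L \<kappa> B"
  shows "small L \<kappa> (A \<union> B)"
proof -
  have *: "small L \<kappa> (A \<union> B)" if "|A| \<le>o |B|" "small L \<kappa> B" for A B :: "'x set"
  proof -
    let ?r = "|formulas L| +c |B|"
    have r: "Cinfinite ?r" by (rule Cinfinite_csum1[OF Cinfinite_formulas])
    have B: "|B| \<le>o ?r" by (simp add: ordLeq_csum2 card_of_Card_order)
    have "|A \<union> B| \<le>o ?r" by (intro Un_Cinfinite_bound r B ordLeq_transitive[OF that(1) B])
    then have "|formulas L| +c |A \<union> B| \<le>o ?r"
      by (intro csum_cinfinite_bound r card_of_Card_order) (simp_all add: ordLeq_csum1 card_of_Card_order)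
    then have "small_bound L (A \<union> B) \<le>o small_bound L B"
      by (intro cexp_mono2_Cnotzero Card_order_ctwo Cinfinite_Cnotzero Cinfinite_csum1[OF Cinfinite_formulas])
    then show ?thesis using that(2) unfolding small_def by (rule ordLeq_ordLess_trans)
  qed
  have "|A| \<le>o |B| \<or> |B| \<le>o |A|" by (intro ordLeq_total card_of_Well_order)
  then show ?thesis using *[of A B] *[of B A] assms by (auto simp: Un_commute)
qed

text \<open>The universe \<open>'a\<close> has room for the torsor: \<open>\<kappa>\<close> is an
  infinite cardinal on it, so lists over \<open>'a\<close> inject into \<open>'a\<close>, and the
  relations number at most |L| + |A|, which is below \<open>\<kappa>\<close>.\<close>

lemma monster_components:
  fixes \<kappa> :: "'a rel" and C :: "('s, 'f, 'r, 'a) struct"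
  assumes her: "hereditarily_G_compact TYPE('a) L T" and mon: "monster L T \<kappa> C"
    and A: "A \<subseteq> univ C" "small L \<kappa> A" and G: "definable_group L C A ss G"
  obtains H where "definable_group_struct L \<kappa> C A ss G"
    and "is_G00_over L C A ss G H" and "is_G000_over L C A G H"
    and "\<And>K. subgroup K G \<Longrightarrow> definable_group_struct.kernel L C A ss G \<subseteq> K \<Longrightarrow> H \<subseteq> K"
proof -
  interpret monster_struct L \<kappa> C
    using mon by unfold_locales (auto simp: monster_def is_model_def)
  interpret D: definable_group_struct L \<kappa> C A ss G
    by unfold_locales (use A G small_imp_less in auto)
  have inf: "infinite (Field \<kappa>)" using Cinfinite_\<kappa> by (simp add: cinfinite_def)
  then have infA: "infinite (UNIV :: 'a set)" 
    by (rule contrapos_nn) (rule finite_subset[OF subset_UNIV])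
  then have r: "Cinfinite |UNIV :: 'a set|" by (simp add: cinfinite_def Field_card_of card_of_card_order_on)
  have "|lists (UNIV :: 'a set)| \<le>o |UNIV :: 'a set|"
    by (intro card_of_lists_le r) (simp add: ordLeq_refl card_of_Card_order)
  then obtain \<iota> :: "'a list \<Rightarrow> 'a" where \<iota>: "inj \<iota>"
    by (auto simp: card_of_ordLeq[symmetric] lists_UNIV)
  have "|D.relations| \<le>o |formulas L| +c |A|" by (rule D.card_of_relations)
  moreover have "|formulas L| +c |A| <o small_bound L A" by (intro ordLess_ctwo_cexp Card_order_csum)
  moreover have "small_bound L A <o \<kappa>" using A(2) by (simp add: small_def)
  ultimately have "|D.relations| \<le>o \<kappa>"
    by (meson ordLeq_ordLess_trans ordLess_imp_ordLeq ordLess_transitive)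
  moreover have "\<kappa> \<le>o |UNIV :: 'a set|"
    by (meson Card_\<kappa> card_of_Field_ordIso card_of_mono1 ordIso_ordLeq_trans ordIso_symmetric subset_UNIV)
  ultimately have "|D.relations| \<le>o |UNIV :: 'a set|" by (rule ordLeq_transitive)
  then obtain nm :: "nat \<times> 'a list list set \<Rightarrow> 'a" where nm: "inj_on nm D.relations"
    by (auto simp: card_of_ordLeq[symmetric])
  interpret torsor L \<kappa> C A ss G \<iota> nm
    by unfold_locales (use A \<iota> nm in auto)
  have "is_model L T C" using mon by (simp add: monster_def)
  then have "G_compact TYPE('a) sig (Th sig tor)"
    using her wf_sig_sig is_struct_tor interprets_tor unfolding hereditarily_G_compact_def by blast
  note c = components_coincide[OF this]
  show ?thesis
  proof (rule that[of component])
    show "definable_group_struct L \<kappa> C A ss G" by (rule D.definable_group_struct_axioms)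
    show "component \<subseteq> K" if "subgroup K G" "D.kernel \<subseteq> K" for K using c(3) that by blast
  qed (use c in auto)
qed

text \<open>Enlarging the parameters can only shrink the component. Conversely, by NIP the component
  over \<open>E\<close> contains the kernel over \<open>A\<close>, hence also the component over
  \<open>A\<close>.\<close>

lemma NIP_component_eq:
  fixes \<kappa> :: "'a rel" and C :: "('s, 'f, 'r, 'a) struct"
  assumes her: "hereditarily_G_compact TYPE('a) L T" and mon: "monster L T \<kappa> C"
    and NIP: "NIP TYPE('a) L T" and AE: "A \<subseteq> E" and E: "E \<subseteq> univ C" "small L \<kappa> A" "small L \<kappa> E"
    and G: "definable_group L C A ss G"
    and HA: "is_G00_over L C A ss G H" and HE: "is_G00_over L C E ss G H'"
  shows "H = H'"
proof
  have A: "A \<subseteq> univ C" using AE E(1) by blast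
  obtain H0 where H0: "definable_group_struct L \<kappa> C A ss G" "is_G00_over L C A ss G H0"
    "\<And>K. subgroup K G \<Longrightarrow> definable_group_struct.kernel L C A ss G \<subseteq> K \<Longrightarrow> H0 \<subseteq> K"
    by (rule monster_components[OF her mon A E(2) G]) (rule that; assumption)
  interpret definable_group_struct L \<kappa> C A ss G by (rule H0(1))
  have "H0 = H" using HA H0(2) unfolding is_G00_over_def is_least_def by blast
  have H': "subgroup H' G" "type_definable L C E ss H'" "small_index L E G H'"
    and least: "\<And>K. subgroup K G \<Longrightarrow> type_definable L C E ss K \<Longrightarrow> small_index L E G K \<Longrightarrow> H' \<subseteq> K"
    using HE unfolding is_G00_over_def is_least_def by blast+
  have "kernel \<subseteq> H'"
  proof (rule NIP_kernel[OF _ AE E(1) small_imp_less[OF E(3)] H'(1,2)])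
    show "\<not> has_IP L C \<phi> X" if "\<phi> \<in> formulas L" for \<phi> X
      using NIP mon that unfolding NIP_def monster_def by blast
    show "|rcosets\<^bsub>G\<^esub> H'| <o \<kappa>"
      using H'(3) E(3) unfolding small_index_def small_def by (rule ordLeq_ordLess_trans)
  qed
  then show "H \<subseteq> H'" using H0(3)[OF H'(1)] \<open>H0 = H\<close> by simp
  have H: "subgroup H G" "type_definable L C A ss H" "small_index L A G H"
    using HA unfolding is_G00_over_def is_least_def by blast+
  have "small_bound L A \<le>o small_bound L E"
    by (intro cexp_mono2_Cnotzero Card_order_ctwo Cinfinite_Cnotzero Cinfinite_csum1[OF Cinfinite_formulas]
        csum_mono2 card_of_mono1 AE)
  then have "small_index L E G H" using H(3) unfolding small_index_def by (rule ordLeq_transitive[rotated])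
  then show "H' \<subseteq> H" using least[OF H(1) type_definable_mono[OF H(2) AE]] by blast
qed

theorem proposition2p12:
  fixes L :: "('s, 'f, 'r) signature" and T :: "('s, 'f, 'r) fm set"
    and \<kappa> :: "'a rel" and C :: "('s, 'f, 'r, 'a) struct"
    and A :: "'a set" and ss :: "'s list" and G :: "'a list monoid"
  assumes "wf_sig L" and "complete_theory L T"
    and "hereditarily_G_compact TYPE('a) L T"
    and "monster L T \<kappa> C"
    and "A \<subseteq> univ C" and "small L \<kappa> A"
    and "definable_group L C A ss G"
  shows "(\<exists>H. is_G00_over L C A ss G H \<and> is_G000_over L C A G H) \<and>
         (NIP TYPE('a) L T \<longrightarrow> (\<exists>H. is_G00 L \<kappa> C ss G H \<and> is_G000 L \<kappa> C ss G H))"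
proof -
  note components = monster_components[OF assms(3,4)]
  obtain H where H: "is_G00_over L C A ss G H" "is_G000_over L C A G H"
    by (rule components[OF assms(5-7)]) (rule that; assumption)
  have "is_G00_over L C B ss G H \<and> is_G000_over L C B G H"
    if NIP: "NIP TYPE('a) L T" and B: "B \<subseteq> univ C" "small L \<kappa> B" "definable_group L C B ss G" for B
  proof -
    obtain HB where HB: "is_G00_over L C B ss G HB" "is_G000_over L C B G HB"
      by (rule components[OF B]) (rule that; assumption)
    \<comment> \<open>Two parameter sets are compared through their union, over which
      \<open>G\<close> remains definable.\<close>
    let ?E = "A \<union> B"
    have E: "?E \<subseteq> univ C" "small L \<kappa> ?E" "definable_group L C ?E ss G"
      using assms(5) B small_Un[OF assms(6) B(2)] definable_group_mono[OF assms(7)] by auto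
    obtain HE where HE: "is_G00_over L C ?E ss G HE"
      by (rule components[OF E]) (rule that; assumption)
    have "H = HE"
      by (rule NIP_component_eq[OF assms(3,4) NIP _ E(1) assms(6) E(2) assms(7) H(1) HE]) simp
    moreover have "HB = HE"
      by (rule NIP_component_eq[OF assms(3,4) NIP _ E(1) B(2) E(2) B(3) HB(1) HE]) simp
    ultimately show ?thesis using HB by simp
  qed
  then show ?thesis using H unfolding is_G00_def is_G000_def by blast
qed

end
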